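(* Let $-1<\alpha<0$, $\Omega=\mathbb H^d_n(a)$, and $\delta(x)=|a+x\cdot n|$. Let $u\in H^1_{loc}(\Omega;\mathbb R^m)$ be a weak solution of the Neumann problem $\mathcal L(u)=\mathrm{div}(f)$ in $\Omega$, $\frac{\partial u}{\partial\nu}=-n\cdot f$ on $\partial\Omega$, and assume that for some $x_0\in\partial\Omega$, $R^\alpha\int_{B(x_0,R)\cap\Omega}|\nabla u|^2\to0$ as $R\to\infty$. Then $$\int_\Omega|\nabla u(x)|^2[\delta(x)]^\alpha dx\le C\int_\Omega|f(x)|^2[\delta(x)]^\alpha dx,$$ where $C$ depends only on $d,m,\mu,\alpha$ and $\|A\|_{C^\sigma(\mathbb T^d)}$.
   Context: $A=(a_{ij}^{\alpha\beta}(x))$ satisfies $\mu|\xi|^2\le a_{ij}^{\alpha\beta}\xi_i^\alpha\xi_j^\beta\le\mu^{-1}|\xi|^2$ for $\xi\in\mathbb R^{m\times d}$, is $\mathbb Z^d$-periodic, and $A\in C^\sigma(\mathbb T^d)$ for some $\sigma\in(0,1)$. $\mathcal L=-\mathrm{div}(A(x)\nabla)$, $(\partial u/\partial\nu)^\alpha=n_ia_{ij}^{\alpha\beta}\partial_ju^\beta$. $\mathbb H^d_n(a)=\{x:x\cdot n<-a\}$ with outward normal $n$. Weak sense: $\int_\Omega a_{ij}^{\alpha\beta}\partial_ju^\beta\partial_i\varphi^\alpha=-\int_\Omega f_i^\alpha\partial_i\varphi^\alpha$ for all $\varphi\in C_c^\infty(\mathbb R^d;\mathbb R^m)$. *)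

theory Defs
  imports "HOL-Analysis.Analysis"
begin

definition pd :: "'d::finite \<Rightarrow> (real^'d \<Rightarrow> real) \<Rightarrow> real^'d \<Rightarrow> real" where
  "pd i g x = frechet_derivative g (at x) (axis i 1)"

fun iter_pd :: "'d::finite list \<Rightarrow> (real^'d \<Rightarrow> real) \<Rightarrow> real^'d \<Rightarrow> real" where
  "iter_pd [] g = g"
| "iter_pd (i # is) g = pd i (iter_pd is g)"

definition smooth :: "(real^'d::finite \<Rightarrow> real) \<Rightarrow> bool" where
  "smooth g \<longleftrightarrow> (\<forall>is x. iter_pd is g differentiable (at x))"

definition test_fun :: "(real^'d::finite) set \<Rightarrow> (real^'d \<Rightarrow> real) \<Rightarrow> bool" where
  "test_fun S g \<longleftrightarrow> smooth g \<and> compact (closure {x. g x \<noteq> 0}) \<and> closure {x. g x \<noteq> 0} \<subseteq> S"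

definition grad :: "(real^'d::finite \<Rightarrow> real^'m::finite) \<Rightarrow> real^'d \<Rightarrow> real^'d^'m" where
  "grad \<phi> x = (\<chi> \<beta>. \<chi> i. pd i (\<lambda>y. \<phi> y $ \<beta>) x)"

definition halfspace :: "real^'d::finite \<Rightarrow> real \<Rightarrow> (real^'d) set" where
  "halfspace n a = {x. x \<bullet> n < - a}"

text \<open>Coefficients a i j alpha beta x = a_{ij}^{alpha beta}(x).\<close>
type_synonym ('d, 'm) coeff = "'d \<Rightarrow> 'd \<Rightarrow> 'm \<Rightarrow> 'm \<Rightarrow> real^'d \<Rightarrow> real"

definition bilin :: "('d::finite, 'm::finite) coeff \<Rightarrow> real^'d \<Rightarrow> real^'d^'m \<Rightarrow> real^'d^'m \<Rightarrow> real" where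
  "bilin A x \<xi> \<eta> = (\<Sum>i\<in>UNIV. \<Sum>j\<in>UNIV. \<Sum>\<alpha>\<in>UNIV. \<Sum>\<beta>\<in>UNIV. A i j \<alpha> \<beta> x * \<xi> $ \<beta> $ j * \<eta> $ \<alpha> $ i)"

definition elliptic :: "real \<Rightarrow> ('d::finite, 'm::finite) coeff \<Rightarrow> bool" where
  "elliptic \<mu> A \<longleftrightarrow> (\<forall>x \<xi>. \<mu> * (norm \<xi>)^2 \<le> bilin A x \<xi> \<xi> \<and> bilin A x \<xi> \<xi> \<le> (1/\<mu>) * (norm \<xi>)^2)"

definition periodic_coeff :: "('d::finite, 'm::finite) coeff \<Rightarrow> bool" where
  "periodic_coeff A \<longleftrightarrow> (\<forall>z x. (\<forall>k. z $ k \<in> \<int>) \<longrightarrow> (\<forall>i j \<alpha> \<beta>. A i j \<alpha> \<beta> (x + z) = A i j \<alpha> \<beta> x))"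

definition tnorm_diff :: "('d::finite, 'm::finite) coeff \<Rightarrow> real^'d \<Rightarrow> real^'d \<Rightarrow> real" where
  "tnorm_diff A x y = sqrt (\<Sum>i\<in>UNIV. \<Sum>j\<in>UNIV. \<Sum>\<alpha>\<in>UNIV. \<Sum>\<beta>\<in>UNIV. (A i j \<alpha> \<beta> x - A i j \<alpha> \<beta> y)^2)"

definition tnorm :: "('d::finite, 'm::finite) coeff \<Rightarrow> real^'d \<Rightarrow> real" where
  "tnorm A x = sqrt (\<Sum>i\<in>UNIV. \<Sum>j\<in>UNIV. \<Sum>\<alpha>\<in>UNIV. \<Sum>\<beta>\<in>UNIV. (A i j \<alpha> \<beta> x)^2)"

definition holder_norm :: "real \<Rightarrow> ('d::finite, 'm::finite) coeff \<Rightarrow> ereal" where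
  "holder_norm \<sigma> A = (SUP x. ereal (tnorm A x))
     + (SUP p\<in>{(x, y). x \<noteq> y}. ereal (tnorm_diff A (fst p) (snd p) / (dist (fst p) (snd p) powr \<sigma>)))"

definition H1_loc :: "(real^'d::finite) set \<Rightarrow> (real^'d \<Rightarrow> real^'m::finite) \<Rightarrow> (real^'d \<Rightarrow> real^'d^'m) \<Rightarrow> bool" where
  "H1_loc \<Omega> u Du \<longleftrightarrow> u \<in> borel_measurable lborel \<and> Du \<in> borel_measurable lborel \<and>
     (\<forall>K. compact K \<and> K \<subseteq> \<Omega> \<longrightarrow>
        set_integrable lborel K (\<lambda>x. (norm (u x))^2) \<and> set_integrable lborel K (\<lambda>x. (norm (Du x))^2)) \<and>
     (\<forall>\<phi> \<alpha> i. test_fun \<Omega> \<phi> \<longrightarrow>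
        (LINT x:\<Omega>|lborel. u x $ \<alpha> * pd i \<phi> x) = - (LINT x:\<Omega>|lborel. Du x $ \<alpha> $ i * \<phi> x))"

definition L2_loc_upto :: "(real^'d::finite) set \<Rightarrow> (real^'d \<Rightarrow> 'b::euclidean_space) \<Rightarrow> bool" where
  "L2_loc_upto \<Omega> g \<longleftrightarrow> g \<in> borel_measurable lborel \<and>
     (\<forall>K. compact K \<longrightarrow> set_integrable lborel (\<Omega> \<inter> K) (\<lambda>x. (norm (g x))^2))"

text \<open>Weak formulation of L u = div f in Omega, du/dnu = -n.f on the boundary.\<close>
definition weak_neumann :: "('d::finite, 'm::finite) coeff \<Rightarrow> (real^'d) set \<Rightarrow> (real^'d \<Rightarrow> real^'d^'m) \<Rightarrow> (real^'d \<Rightarrow> real^'d^'m) \<Rightarrow> bool" where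
  "weak_neumann A \<Omega> Du f \<longleftrightarrow>
     (\<forall>\<phi> :: real^'d \<Rightarrow> real^'m. (\<forall>\<beta>. test_fun UNIV (\<lambda>x. \<phi> x $ \<beta>)) \<longrightarrow>
        (LINT x:\<Omega>|lborel. bilin A x (Du x) (grad \<phi> x))
          = - (LINT x:\<Omega>|lborel. (\<Sum>i\<in>UNIV. \<Sum>\<alpha>\<in>UNIV. f x $ \<alpha> $ i * grad \<phi> x $ \<alpha> $ i)))"

end

theory Submission
  imports Defs "HOL-Analysis.Analysis"
begin

text \<open>
  Let t(x) = - a - x . n be the height above the boundary and let E(r,T) and F(r,T) denote the integrals of
  |grad u|^2 and |f|^2 over the points of height below r within distance T of x0.  No homogenization
  theory is needed.  The decisive inequality is, for every small h > 0,
    E(h R, T) <= E(2 h R, T + R) / 4 + C h E(R, T + K R) + C(h) F(R, T + K R),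
  valid for R <= r0(h) and for R >= R0(h).  Summed over dyadic R with weights R^alpha, the first two terms on
  the right are absorbed, because alpha > -1 makes C h * h^alpha small; the bounded range of scales between
  r0 and R0 is handled by monotonicity of E, and the growth hypothesis removes the top scales.

  To obtain the inequality one first tests the equation with the difference between u and an average of
  u over heights between r and 2r and over tangential balls of radius r.  This bounds E(r,T) by a small
  multiple of E(2r, .) plus increments u(x+y) - u(x), y tangential, in the layer r <= t <= 2r.  These increments are
  controlled by the Caccioppoli inequality for u(x+z) - u(x), where A(x+z) is close to A(x): for small R one takes
  z = y and uses Hoelder continuity, for large R one takes for z the lattice vector nearest to y and uses
  periodicity.  In the latter case z need not be tangential, and the error, supported in a boundary layer of
  bounded width, is small by hole filling.  All this is done for functions that are C^1 up to the
  boundary; u is approximated by mollified, evenly reflected functions v, which solve the same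
  equation with f replaced by f + A(grad u - grad v).
\<close>

text \<open>Evenness of the approximations is what permits translations that leave the half-space:
  the Caccioppoli estimate for \<open>v (x + z) - v x\<close> sees \<open>J\<close> on both sides of
  the boundary, and for even functions a two-sided slab carries at most twice the energy of the
  one-sided slab. Changing the right-hand side by A(grad u - grad v) is harmless because only its
  mean-square size enters any estimate. The factor h comes from thinness: up to a derivative term,
  the squared norm of a function over a layer of relative height h is of order h times that over the
  large slab, while the squared length of the translation cancels the division by the square of the
  averaging scale. The order of quantifiers carries the argument: the constant in front of h is
  fixed before h, whereas r0(h), R0(h) and C(h) are chosen after it. Absorption then rests on
  numbers: as \<alpha> > -1, neighbouring dyadic weights differ by a factor of at most 2, so the
  coefficient 1/4 becomes 1/2; h is taken so small that the other term has coefficient 1/4, and the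
  total 3/4 is below 1.\<close>

abbreviation nsq :: "'b::real_normed_vector => ennreal" where "nsq y \<equiv> ennreal ((norm y)^2)"

text \<open>Collapses an expression in \<open>ennreal\<close> that is built from nonnegative real
  constants into one \<open>ennreal\<close> of a real, so that the final numerical comparison of an
  estimate can be made over the reals.\<close>

lemmas ennreal_reals = ennreal_mult ennreal_plus ennreal_numeral mult_nonneg_nonneg add_nonneg_nonneg
 divide_nonneg_nonneg zero_le_power2 less_imp_le zero_le_one zero_le_numeral

section \<open>Continuously differentiable maps\<close>

text \<open>The Jacobian is carried as an explicit second argument, and both maps live on the whole
  space. Smoothness up to the boundary of the half-space is thus built in, and the calculus rules
  never have to mention a domain.\<close>

definition C1 :: "(real^'d::finite => real^'m::finite) => (real^'d => real^'d^'m) => bool" where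
 "C1 v J \<longleftrightarrow> (\<forall>x. (v has_derivative (\<lambda>h. J x *v h)) (at x)) \<and> continuous_on UNIV J"

definition C1s :: "(real^'d::finite => real) => (real^'d => real^'d) => bool" where
 "C1s f g \<longleftrightarrow> (\<forall>x. (f has_derivative (\<lambda>h. g x \<bullet> h)) (at x)) \<and> continuous_on UNIV g"

text \<open>The tensor product of \<open>p\<close> and \<open>q\<close>: the term that a scalar
  factor with gradient \<open>q\<close> contributes to the Jacobian of a product, see
  \<open>C1_scale\<close>.\<close>

definition outer :: "real^'m::finite => real^'d::finite => real^'d^'m" where
 "outer p q = (\<chi> \<beta>. p $ \<beta> *\<^sub>R q)"

lemma outer_mult_vec: "outer p q *v h = (q \<bullet> h) *\<^sub>R p"
 by (simp add: outer_def matrix_vector_mult_def vec_eq_iff inner_vec_def sum_distrib_left mult_ac)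

lemma norm_outer [simp]: "norm (outer p q) = norm p * norm q"
proof -
 have "norm (outer p q) ^ 2 = (norm p * norm q) ^ 2"
  by (simp add: outer_def norm_vec_def L2_set_def power_mult_distrib sum_nonneg sum_product)
 thus ?thesis by (simp add: power2_eq_iff_nonneg)
qed

text \<open>The norm of a matrix is the Euclidean norm of all its entries, so Cauchy-Schwarz in each
  row and summation of the squares suffice.\<close>

lemma norm_mult_vec_le: "norm ((J::real^'d::finite^'m::finite) *v h) <= norm J * norm h"
proof -
 have "norm (J *v h) ^ 2 <= (norm J * norm h) ^ 2"
 proof -
  have "norm (J *v h) ^ 2 = (\<Sum>\<beta>\<in>UNIV. ((J $ \<beta>) \<bullet> h)^2)"
   by (simp add: norm_vec_def L2_set_def sum_nonneg matrix_mult_dot)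
  also have "... <= (\<Sum>\<beta>\<in>UNIV. (norm (J $ \<beta>))^2 * (norm h)^2)"
   by (intro sum_mono) (metis Cauchy_Schwarz_ineq power2_norm_eq_inner)
  also have "... = (norm J * norm h) ^ 2"
   by (simp add: norm_vec_def L2_set_def sum_nonneg power_mult_distrib sum_distrib_right)
  finally show ?thesis .
 qed
 thus ?thesis by (rule power2_le_imp_le) simp
qed

lemma norm_matrix_le_columns: "norm (J::real^'d::finite^'m::finite) <= (\<Sum>i\<in>UNIV. norm (J *v axis i 1))"
proof -
 have "norm J ^ 2 = (\<Sum>\<beta>\<in>UNIV. \<Sum>i\<in>UNIV. (J $ \<beta> $ i)^2)"
  by (simp add: norm_vec_def L2_set_def sum_nonneg)
 also have "... = (\<Sum>i\<in>UNIV. \<Sum>\<beta>\<in>UNIV. (J $ \<beta> $ i)^2)" by (rule sum.swap)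
 also have "... = (\<Sum>i\<in>UNIV. (norm (J *v axis i 1))^2)"
  by (simp add: norm_vec_def L2_set_def sum_nonneg matrix_vector_mult_basis column_def)
 also have "... <= (\<Sum>i\<in>UNIV. norm (J *v axis i 1))^2"
 proof -
  have "(\<Sum>i\<in>A. (a i)^2) <= (\<Sum>i\<in>A. a i)^2" if "\<And>i. a i \<ge> 0" "finite A" for a :: "'d => real" and A
   using that(2)
  proof (induction A)
   case (insert x F)
   have "0 <= a x * sum a F" by (simp add: that(1) sum_nonneg)
   thus ?case using insert by (simp add: power2_sum)
  qed simp
  thus ?thesis by simp
 qed
 finally show ?thesis by (rule power2_le_imp_le) (simp add: sum_nonneg)
qed

lemma continuous_on_mult_vec [continuous_intros]:
 "continuous_on S J ==> continuous_on S h ==> continuous_on S (\<lambda>x. (J x :: real^'d::finite^'m::finite) *v h x)"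
 unfolding matrix_vector_mult_def
 by (intro continuous_intros continuous_on_vec_lambda)

lemma continuous_on_outer [continuous_intros]:
 "continuous_on S p ==> continuous_on S q ==> continuous_on S (\<lambda>x. outer (p x) (q x))"
 unfolding outer_def by (intro continuous_intros continuous_on_vec_lambda)

lemma bounded_linear_mult_vec_left: "bounded_linear (\<lambda>J::real^'d::finite^'m::finite. J *v h)"
 by (rule bounded_linear_intro[where K="norm h"])
  (auto simp: matrix_vector_mult_add_rdistrib scaleR_matrix_vector_assoc norm_mult_vec_le)

lemma C1_continuous: "C1 v J ==> continuous_on UNIV v"
 unfolding C1_def using has_derivative_continuous continuous_at_imp_continuous_on by blast

lemma C1_continuous_J: "C1 v J ==> continuous_on UNIV J"
 unfolding C1_def by blast

lemma C1_measurable: "C1 v J ==> v \<in> borel_measurable borel"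
 by (rule borel_measurable_continuous_onI[OF C1_continuous])

lemma C1_measurable_J: "C1 v J ==> J \<in> borel_measurable borel"
 by (rule borel_measurable_continuous_onI[OF C1_continuous_J])

lemma C1s_continuous: "C1s v J ==> continuous_on UNIV v"
 unfolding C1s_def using has_derivative_continuous continuous_at_imp_continuous_on by blast

lemma C1s_continuous_g: "C1s v J ==> continuous_on UNIV J"
 unfolding C1s_def by blast

lemma C1_diff: "C1 v J ==> C1 w K ==> C1 (\<lambda>x. v x - w x) (\<lambda>x. J x - K x)"
 unfolding C1_def
 by (auto intro!: has_derivative_eq_rhs[OF has_derivative_diff] continuous_intros
   simp: matrix_vector_mult_diff_rdistrib)

lemma C1_shift: "C1 v J ==> C1 (\<lambda>x. v (x + z)) (\<lambda>x. J (x + z))"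
 unfolding C1_def
proof safe
 fix x assume a: "\<forall>x. (v has_derivative (*v) (J x)) (at x)"
 have "((v \<circ> (\<lambda>x. x + z)) has_derivative ((*v) (J (x+z)) \<circ> (\<lambda>h. h))) (at x)"
  by (rule diff_chain_at) (use a in \<open>auto intro!: derivative_eq_intros\<close>)
 thus "((\<lambda>x. v (x + z)) has_derivative (*v) (J (x + z))) (at x)" by (simp add: o_def)
next
 assume "continuous_on UNIV J"
 thus "continuous_on UNIV (\<lambda>x. J (x + z))"
  by (rule continuous_on_compose2) (auto intro!: continuous_intros)
qed

lemma C1_scale: "C1s f g ==> C1 v J ==> C1 (\<lambda>x. f x *\<^sub>R v x) (\<lambda>x. f x *\<^sub>R J x + outer (v x) (g x))"
 using C1_continuous[of v J] C1s_continuous[of f g] unfolding C1_def C1s_def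
 by (auto intro!: has_derivative_eq_rhs[OF has_derivative_scaleR] continuous_intros
   simp: matrix_vector_mult_add_rdistrib scaleR_matrix_vector_assoc[symmetric] outer_mult_vec fun_eq_iff)

lemma C1s_mult: "C1s f g ==> C1s f' g' ==> C1s (\<lambda>x. f x * f' x) (\<lambda>x. f x *\<^sub>R g' x + f' x *\<^sub>R g x)"
 using C1s_continuous[of f g] C1s_continuous[of f' g'] unfolding C1s_def
 by (auto intro!: has_derivative_eq_rhs[OF has_derivative_mult] continuous_intros
   simp: inner_add_left fun_eq_iff algebra_simps)

lemma C1s_compose:
 assumes "\<And>s. (b has_real_derivative b' s) (at s)" "continuous_on UNIV b'" "C1s f g"
 shows "C1s (\<lambda>x. b (f x)) (\<lambda>x. b' (f x) *\<^sub>R g x)"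
 unfolding C1s_def
proof safe
 fix x
 have "(f has_derivative (\<lambda>h. g x \<bullet> h)) (at x)" using assms(3) unfolding C1s_def by blast
 moreover have "(b has_derivative (\<lambda>h. b' (f x) * h)) (at (f x))"
  using assms(1)[of "f x"] by (simp add: has_field_derivative_def)
 ultimately have "(b \<circ> f has_derivative (\<lambda>h. b' (f x) * h) \<circ> (\<lambda>h. g x \<bullet> h)) (at x)"
  by (rule diff_chain_at)
 thus "((\<lambda>x. b (f x)) has_derivative (\<lambda>h. (b' (f x) *\<^sub>R g x) \<bullet> h)) (at x)" by (simp add: o_def)
next
 show "continuous_on UNIV (\<lambda>x. b' (f x) *\<^sub>R g x)"
  using assms C1s_continuous[OF assms(3)] C1s_continuous_g[OF assms(3)]
  by (auto intro!: continuous_intros continuous_on_compose2[OF assms(2)])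
qed

lemma grad_C1: assumes "C1 v J" shows "grad v x = J x"
proof -
 have "pd i (\<lambda>y. v y $ \<beta>) x = J x $ \<beta> $ i" for i \<beta>
 proof -
  have "(v has_derivative (\<lambda>h. J x *v h)) (at x)" using assms unfolding C1_def by blast
  hence "((\<lambda>y. v y $ \<beta>) has_derivative (\<lambda>h. (J x *v h) $ \<beta>)) (at x)"
   by (rule bounded_linear.has_derivative[OF bounded_linear_vec_nth])
  hence "frechet_derivative (\<lambda>y. v y $ \<beta>) (at x) = (\<lambda>h. (J x *v h) $ \<beta>)"
   by (rule frechet_derivative_at[symmetric])
  thus ?thesis by (simp add: pd_def matrix_vector_mult_basis column_def)
 qed
 thus ?thesis by (simp add: grad_def vec_eq_iff)
qed

lemma nn_integral_shift:
 fixes f :: "'a::euclidean_space => ennreal"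
 assumes "f \<in> borel_measurable borel"
 shows "(\<integral>\<^sup>+x. f (x + c) \<partial>lborel) = (\<integral>\<^sup>+x. f x \<partial>lborel)"
proof -
 have "(\<integral>\<^sup>+x. f x \<partial>lborel) = (\<integral>\<^sup>+x. f x \<partial>(distr lborel borel ((+) c)))"
  by (simp add: lborel_distr_plus)
 also have "... = (\<integral>\<^sup>+x. f (c + x) \<partial>lborel)"
  using assms by (intro nn_integral_distr) auto
 finally show ?thesis by (simp add: add.commute)
qed

lemma integral_shift:
 fixes f :: "'a::euclidean_space => 'b::{banach, second_countable_topology}"
 assumes "f \<in> borel_measurable borel"
 shows "(LINT x|lborel. f (x + c)) = (LINT x|lborel. f x)"
proof -
 have "(LINT x|lborel. f x) = (LINT x|(distr lborel borel ((+) c)). f x)"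
  by (simp add: lborel_distr_plus)
 also have "... = (LINT x|lborel. f (c + x))"
  using assms by (intro integral_distr) auto
 finally show ?thesis by (simp add: add.commute)
qed

lemma integrable_shift:
 fixes f :: "'a::euclidean_space => 'b::{banach, second_countable_topology}"
 assumes "integrable lborel f"
 shows "integrable lborel (\<lambda>x. f (x + c))"
proof -
 have "integrable (distr lborel borel ((+) c)) f"
  using assms by (simp add: lborel_distr_plus)
 hence "integrable lborel (\<lambda>x. f (c + x))"
  by (rule integrable_distr[rotated]) auto
 thus ?thesis by (simp add: add.commute)
qed

text \<open>Cauchy-Schwarz against the constant 1 on \<open>S\<close>; the right-hand side may be
  infinite.\<close>

lemma sq_norm_set_integral_le:
 fixes f :: "'a => 'b::{banach, second_countable_topology}"
 assumes "set_integrable M S f" "S \<in> sets M"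
 shows "nsq (LINT x:S|M. f x) <= emeasure M S * (\<integral>\<^sup>+x\<in>S. nsq (f x) \<partial>M)"
proof -
 let ?f = "\<lambda>x. indicator S x *\<^sub>R f x"
 have m[measurable]: "?f \<in> borel_measurable M" using assms unfolding set_integrable_def by auto
 have [measurable]: "S \<in> sets M" by fact
 have "ennreal (norm (LINT x:S|M. f x)) <= (\<integral>\<^sup>+x. ennreal (norm (?f x)) \<partial>M)"
  using integral_norm_bound_ennreal[OF assms(1)[unfolded set_integrable_def]]
  unfolding set_lebesgue_integral_def by simp
 also have "... = (\<integral>\<^sup>+x. indicator S x * ennreal (norm (?f x)) \<partial>M)"
  by (intro nn_integral_cong) (auto split: split_indicator)
 finally have "nsq (LINT x:S|M. f x) <= (\<integral>\<^sup>+x. indicator S x * ennreal (norm (?f x)) \<partial>M)^2"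
  by (metis ennreal_power norm_ge_zero power_mono zero_le)
 also have "... <= (\<integral>\<^sup>+x. (indicator S x)^2 \<partial>M) * (\<integral>\<^sup>+x. (ennreal (norm (?f x)))^2 \<partial>M)"
  by (rule Cauchy_Schwarz_nn_integral) measurable
 also have "(\<integral>\<^sup>+x. (indicator S x)^2 \<partial>M) = (\<integral>\<^sup>+x. indicator S x \<partial>M)"
  by (intro nn_integral_cong) (auto split: split_indicator)
 also have "... = emeasure M S" by simp
 also have "(\<integral>\<^sup>+x. (ennreal (norm (?f x)))^2 \<partial>M) = (\<integral>\<^sup>+x\<in>S. nsq (f x) \<partial>M)"
  by (intro nn_integral_cong) (auto split: split_indicator simp: ennreal_power)
 finally show ?thesis .
qed

lemma C1_line:
 assumes "C1 v J"
 shows "((\<lambda>s. v (x + s *\<^sub>R z)) has_vector_derivative (J (x + s *\<^sub>R z) *v z)) (at s within S)"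
proof -
 have "(v has_derivative (\<lambda>h. J (x + s *\<^sub>R z) *v h)) (at (x + s *\<^sub>R z))" using assms unfolding C1_def by blast
 moreover have "((\<lambda>s. x + s *\<^sub>R z) has_derivative (\<lambda>h. h *\<^sub>R z)) (at s within S)"
  by (auto intro!: derivative_eq_intros)
 ultimately have "((\<lambda>s. v (x + s *\<^sub>R z)) has_derivative (\<lambda>h. J (x + s *\<^sub>R z) *v (h *\<^sub>R z))) (at s within S)"
  by (rule has_derivative_compose[rotated])
 thus ?thesis by (simp add: has_vector_derivative_def matrix_vector_mult_scaleR)
qed

lemma integral_FTC_set:
 fixes f :: "real => 'b::euclidean_space"
 assumes "a <= b" "\<And>x. x \<in> {a..b} ==> (f has_vector_derivative f' x) (at x within {a..b})" "continuous_on {a..b} f'"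
 shows "set_integrable lborel {a..b} f'" "(LINT x:{a..b}|lborel. f' x) = f b - f a"
proof -
 show i: "set_integrable lborel {a..b} f'"
  unfolding set_integrable_def by (rule borel_integrable_compact) (use assms in auto)
 have "(f' has_integral (f b - f a)) {a..b}" using assms by (intro fundamental_theorem_of_calculus) auto
 thus "(LINT x:{a..b}|lborel. f' x) = f b - f a"
  using set_borel_integral_eq_integral(2)[OF i] by (simp add: integral_unique)
qed

text \<open>The increment is the integral of \<open>J (x + s *\<^sub>R z) *v z\<close> along the
  segment, to which Cauchy-Schwarz is applied. The free length \<open>r\<close> serves both unit
  steps along a vector \<open>z\<close> and long steps along a unit normal.\<close>

lemma C1_increment_sq_le:
 assumes "C1 v J" "0 <= r"
 shows "nsq (v (x + r *\<^sub>R z) - v x)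
  <= ennreal (r * (norm z)^2) * (\<integral>\<^sup>+s\<in>{0..r}. nsq (J (x + s *\<^sub>R z)) \<partial>lborel)"
proof -
 let ?f = "\<lambda>s. J (x + s *\<^sub>R z) *v z"
 have cJ: "continuous_on {0..r} (\<lambda>s. J (x + s *\<^sub>R z))"
  by (rule continuous_on_compose2[OF C1_continuous_J[OF assms(1)]]) (auto intro!: continuous_intros)
 have c: "continuous_on {0..r} ?f" by (intro continuous_intros cJ)
 note F = integral_FTC_set[OF assms(2) C1_line[OF assms(1), of x z] c]
 have "nsq (v (x + r *\<^sub>R z) - v x) <= emeasure lborel {0..r} * (\<integral>\<^sup>+s\<in>{0..r}. nsq (?f s) \<partial>lborel)"
  using sq_norm_set_integral_le[OF F(1)] F(2) by simp
 also have "... <= emeasure lborel {0..r} * (\<integral>\<^sup>+s. nsq z * (nsq (J (x + s *\<^sub>R z)) * indicator {0..r} s) \<partial>lborel)"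
 proof (intro mult_left_mono nn_integral_mono)
  fix s
  have "(norm (?f s))^2 <= (norm z)^2 * (norm (J (x + s *\<^sub>R z)))^2"
   using norm_mult_vec_le[of "J (x + s *\<^sub>R z)" z] by (metis mult.commute norm_ge_zero power_mono power_mult_distrib)
  thus "nsq (?f s) * indicator {0..r} s <= nsq z * (nsq (J (x + s *\<^sub>R z)) * indicator {0..r} s)"
   by (auto split: split_indicator simp: ennreal_mult[symmetric] intro!: ennreal_leI)
 qed auto
 also have "... = ennreal r * (nsq z * (\<integral>\<^sup>+s\<in>{0..r}. nsq (J (x + s *\<^sub>R z)) \<partial>lborel))"
 proof -
  have "(\<lambda>s. nsq (J (x + s *\<^sub>R z))) \<in> borel_measurable lborel"
   using C1_measurable_J[OF assms(1)] by measurable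
  thus ?thesis using assms(2) by (subst nn_integral_cmult) auto
 qed
 finally show ?thesis using assms(2) by (simp add: ennreal_mult mult.assoc)
qed

lemma C1_components:
 "C1 v J \<longleftrightarrow> (\<forall>\<beta>. C1s (\<lambda>x. v x $ \<beta>) (\<lambda>x. J x $ \<beta>))"
proof -
 have "(v has_derivative (\<lambda>h. J x *v h)) (at x) \<longleftrightarrow> (\<forall>\<beta>. ((\<lambda>x. v x $ \<beta>) has_derivative (\<lambda>h. J x $ \<beta> \<bullet> h)) (at x))" for x
 proof -
  have "(v has_derivative (\<lambda>h. J x *v h)) (at x) \<longleftrightarrow>
   (\<forall>b\<in>Basis. ((\<lambda>x. v x \<bullet> b) has_derivative (\<lambda>h. (J x *v h) \<bullet> b)) (at x))"
   by (rule has_derivative_componentwise_within)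
  also have "... \<longleftrightarrow> (\<forall>\<beta>. ((\<lambda>x. v x $ \<beta>) has_derivative (\<lambda>h. J x $ \<beta> \<bullet> h)) (at x))"
   by (simp add: Basis_vec_def inner_axis matrix_mult_dot)
  finally show ?thesis .
 qed
 moreover have "continuous_on UNIV J \<longleftrightarrow> (\<forall>\<beta>. continuous_on UNIV (\<lambda>x. J x $ \<beta>))"
 proof
  assume "\<forall>\<beta>. continuous_on UNIV (\<lambda>x. J x $ \<beta>)"
  hence "continuous_on UNIV (\<lambda>x. \<chi> \<beta>. J x $ \<beta>)" by (intro continuous_on_vec_lambda) auto
  thus "continuous_on UNIV J" by simp
 qed (auto intro!: continuous_intros)
 ultimately show ?thesis unfolding C1_def C1s_def by blast
qed

section \<open>Differentiation under the integral sign\<close>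

lemma integrable_weight_continuous:
 fixes g :: "'p::euclidean_space => 'b::euclidean_space"
 assumes "compact S" "integrable lborel w" "\<And>p. p \<notin> S ==> w p = 0" "continuous_on S g"
 shows "integrable lborel (\<lambda>p. w p *\<^sub>R g p)"
proof -
 obtain B where B: "\<And>p. p \<in> S ==> norm (g p) <= B" "0 < B"
  using compact_imp_bounded[OF compact_continuous_image[OF assms(4,1)]] unfolding bounded_pos by auto
 have eq: "w p *\<^sub>R g p = w p *\<^sub>R (indicator S p *\<^sub>R g p)" for p using assms(3) by (auto split: split_indicator)
 have m1: "w \<in> borel_measurable lborel" using assms(2) by auto
 have m2: "(\<lambda>p. indicator S p *\<^sub>R g p) \<in> borel_measurable lborel"
  using borel_integrable_compact[OF assms(1,4)] by auto
 show ?thesis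
 proof (rule Bochner_Integration.integrable_bound)
  show "integrable lborel (\<lambda>p. B * w p)" using assms(2) by simp
  show "(\<lambda>p. w p *\<^sub>R g p) \<in> borel_measurable lborel"
   unfolding eq by (rule borel_measurable_scaleR[OF m1 m2])
  show "AE p in lborel. norm (w p *\<^sub>R g p) <= norm (B * w p)"
  proof (rule AE_I2)
   fix p
   show "norm (w p *\<^sub>R g p) <= norm (B * w p)"
   proof (cases "p \<in> S")
    case True
    hence "\<bar>w p\<bar> * norm (g p) <= \<bar>w p\<bar> * B" by (intro mult_left_mono B) auto
    thus ?thesis using B(2) by (simp add: abs_mult mult.commute)
   qed (simp add: assms(3))
  qed
 qed
qed

lemma continuous_on_slice:
 assumes "continuous_on (UNIV \<times> S) (\<lambda>(x,p). g x p)" shows "continuous_on S (g x)"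
proof -
 have "continuous_on S ((\<lambda>(x,p). g x p) \<circ> (\<lambda>p. (x,p)))"
  by (intro continuous_on_compose continuous_intros continuous_on_subset[OF assms]) auto
 thus ?thesis by (simp add: o_def)
qed

text \<open>Compactness of \<open>cball x 1 \<times> S\<close> gives uniform continuity, so the
  choice of \<open>d\<close> does not depend on the parameter; this takes the place of dominated
  convergence in the differentiation below.\<close>

lemma uniform_in_parameter:
 fixes g :: "'a::euclidean_space => 'p::euclidean_space => 'b::euclidean_space"
 assumes "compact S" "continuous_on (UNIV \<times> S) (\<lambda>(x,p). g x p)" "0 < e"
 obtains d where "0 < d" "\<And>y p. p \<in> S ==> norm (y - x) < d ==> norm (g y p - g x p) <= e"
proof -
 have "continuous_on (cball x 1 \<times> S) (\<lambda>(x,p). g x p)" by (rule continuous_on_subset[OF assms(2)]) auto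
 hence "uniformly_continuous_on (cball x 1 \<times> S) (\<lambda>(x,p). g x p)"
  by (rule compact_uniformly_continuous) (intro compact_Times compact_cball assms)
 then obtain d where d: "0 < d" "\<And>u v. u \<in> cball x 1 \<times> S ==> v \<in> cball x 1 \<times> S ==> dist v u < d
  ==> dist ((\<lambda>(x,p). g x p) v) ((\<lambda>(x,p). g x p) u) < e"
  unfolding uniformly_continuous_on_def using assms(3) by metis
 show ?thesis
 proof (rule that[of "min d 1"])
  fix y p assume "p \<in> S" "norm (y - x) < min d 1"
  thus "norm (g y p - g x p) <= e"
   using d(2)[of "(x,p)" "(y,p)"] by (auto simp: dist_norm norm_minus_commute dist_Pair_Pair)
 qed (use d in auto)
qed

lemma norm_weighted_integral_le:
 fixes g :: "'p => 'b::euclidean_space"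
 assumes "integrable M w" "integrable M (\<lambda>p. w p *\<^sub>R g p)" "\<And>p. p \<notin> S ==> w p = 0" "\<And>p. p \<in> S ==> norm (g p) <= e" "0 <= e"
 shows "norm (LINT p|M. w p *\<^sub>R g p) <= e * (LINT p|M. \<bar>w p\<bar>)"
proof -
 have "norm (LINT p|M. w p *\<^sub>R g p) <= (LINT p|M. e * \<bar>w p\<bar>)"
 proof (rule order_trans[OF integral_norm_bound integral_mono])
  show "norm (w p *\<^sub>R g p) <= e * \<bar>w p\<bar>" for p
   using assms(3,4)[of p] mult_left_mono[of "norm (g p)" e "\<bar>w p\<bar>"] by (cases "p \<in> S") (auto simp: mult.commute[of _ e])
  show "integrable M (\<lambda>p. norm (w p *\<^sub>R g p))" using assms(2) by (rule integrable_norm)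
  show "integrable M (\<lambda>p. e * \<bar>w p\<bar>)" using assms(1) by simp
 qed
 thus ?thesis by simp
qed

text \<open>The difference quotients converge uniformly in the parameter, by the mean value
  inequality and the uniform continuity of \<open>g'\<close>. The weight may be rough: it will be a
  mollifier, the indicator of an interval, or a component of a Sobolev function, so that one lemma
  covers averaging, the corrector and mollification.\<close>

lemma C1s_param_integral:
 fixes g :: "real^'d::finite => 'p::euclidean_space => real"
 assumes S: "compact S" and w: "integrable lborel w" "\<And>p. p \<notin> S ==> w p = 0"
  and g: "continuous_on (UNIV \<times> S) (\<lambda>(x,p). g x p)" and g': "continuous_on (UNIV \<times> S) (\<lambda>(x,p). g' x p)"
  and der: "\<And>x p. p \<in> S ==> ((\<lambda>x. g x p) has_derivative (\<lambda>h. g' x p \<bullet> h)) (at x)"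
 shows "C1s (\<lambda>x. LINT p|lborel. w p * g x p) (\<lambda>x. LINT p|lborel. w p *\<^sub>R g' x p)"
proof -
 have cg: "continuous_on S (g x)" for x
  by (rule continuous_on_slice[OF g])
 have cg': "continuous_on S (g' x)" for x
  by (rule continuous_on_slice[OF g'])
 have ig: "integrable lborel (\<lambda>p. w p * g x p)" for x
  using integrable_weight_continuous[OF S w cg] by simp
 have ig': "integrable lborel (\<lambda>p. w p *\<^sub>R g' x p)" for x
  by (rule integrable_weight_continuous[OF S w cg'])
 \<comment> \<open>The summand 1 keeps \<open>W\<close> positive when the weight vanishes, so that
   \<open>e / W\<close> can be used as tolerance.\<close>
 define W where "W = (LINT p|lborel. \<bar>w p\<bar>) + 1"
 have W0: "0 <= (LINT p|lborel. \<bar>w p\<bar>)" by simp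
 have W: "0 < W" "(LINT p|lborel. \<bar>w p\<bar>) <= W" unfolding W_def using W0 by linarith+
 have small: "\<exists>d>0. \<forall>y. norm (y - x) < d --> (\<forall>p\<in>S. norm (g' y p - g' x p) <= e / W)" if "0 < e" for x e
  using uniform_in_parameter[OF S g', of "e/W" x] that W(1) by (metis divide_pos_pos)
 show ?thesis unfolding C1s_def
 proof safe
  fix x
  show "((\<lambda>x. LINT p|lborel. w p * g x p) has_derivative (\<bullet>) (LINT p|lborel. w p *\<^sub>R g' x p)) (at x)"
   unfolding has_derivative_at_alt
  proof (intro conjI allI impI)
   fix e :: real assume e: "0 < e"
   obtain d where d: "d > 0" "\<And>y p. norm (y - x) < d ==> p \<in> S ==> norm (g' y p - g' x p) <= e / W"
    using small[OF e, of x] by blast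
   show "\<exists>d>0. \<forall>y. norm (y - x) < d --> norm ((LINT p|lborel. w p * g y p) - (LINT p|lborel. w p * g x p) - (LINT p|lborel. w p *\<^sub>R g' x p) \<bullet> (y - x)) <= e * norm (y - x)"
   proof (intro exI[of _ d] conjI allI impI d(1))
    fix y assume y: "norm (y - x) < d"
    have pt: "norm (g y p - g x p - g' x p \<bullet> (y - x)) <= norm (y - x) * (e / W)" if p: "p \<in> S" for p
    proof (rule differentiable_bound_linearization[where S="ball x d" and f'="\<lambda>x h. g' x p \<bullet> h"])
     show "x + t *\<^sub>R (y - x) \<in> ball x d" if "t \<in> {0..1}" for t
     proof -
      have "\<bar>t\<bar> * norm (y - x) <= 1 * norm (y - x)" using that by (intro mult_right_mono) auto
      thus ?thesis using y by (simp add: dist_norm)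
     qed
     show "((\<lambda>x. g x p) has_derivative (\<lambda>h. g' u p \<bullet> h)) (at u within ball x d)" for u
      by (rule has_derivative_at_withinI[OF der[OF p]])
     show "onorm ((\<lambda>h. g' u p \<bullet> h) - (\<lambda>h. g' x p \<bullet> h)) <= e / W" if u: "u \<in> ball x d" for u
      unfolding fun_diff_def
     proof (rule onorm_le)
      fix i
      have "norm (g' u p \<bullet> i - g' x p \<bullet> i) = \<bar>(g' u p - g' x p) \<bullet> i\<bar>" by (simp add: inner_diff_left)
      also have "... <= norm (g' u p - g' x p) * norm i" by (rule Cauchy_Schwarz_ineq2)
      also have "... <= e / W * norm i" using d(2)[of u p] u p by (intro mult_right_mono) (auto simp: dist_norm norm_minus_commute)
      finally show "norm (g' u p \<bullet> i - g' x p \<bullet> i) <= e / W * norm i" .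
     qed
    qed (use d in auto)
    have "(LINT p|lborel. w p * g y p) - (LINT p|lborel. w p * g x p) - (LINT p|lborel. w p *\<^sub>R g' x p) \<bullet> (y - x)
     = (LINT p|lborel. w p * g y p) - (LINT p|lborel. w p * g x p) - (LINT p|lborel. (w p *\<^sub>R g' x p) \<bullet> (y - x))"
     by (subst integral_inner_left[OF ig']) (rule refl)
    also have "... = (LINT p|lborel. w p *\<^sub>R (g y p - g x p - g' x p \<bullet> (y - x)))"
    proof -
     have i3: "integrable lborel (\<lambda>p. (w p *\<^sub>R g' x p) \<bullet> (y - x))" by (rule integrable_inner_left[OF ig'])
     show ?thesis using ig i3
      by (simp add: right_diff_distrib Bochner_Integration.integral_diff[symmetric] del: Bochner_Integration.integral_diff)
    qed
    finally have eq: "(LINT p|lborel. w p * g y p) - (LINT p|lborel. w p * g x p) - (LINT p|lborel. w p *\<^sub>R g' x p) \<bullet> (y - x)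
     = (LINT p|lborel. w p *\<^sub>R (g y p - g x p - g' x p \<bullet> (y - x)))" .
    have "norm (LINT p|lborel. w p *\<^sub>R (g y p - g x p - g' x p \<bullet> (y - x))) <= (norm (y - x) * (e / W)) * (LINT p|lborel. \<bar>w p\<bar>)"
    proof (rule norm_weighted_integral_le[where S=S])
     show "integrable lborel (\<lambda>p. w p *\<^sub>R (g y p - g x p - g' x p \<bullet> (y - x)))"
      by (rule integrable_weight_continuous[OF S w], assumption, intro continuous_intros cg cg')
    qed (use w pt e W in auto)
    also have "... <= (norm (y - x) * (e / W)) * W" using W e by (intro mult_left_mono) auto
    also have "... = e * norm (y - x)" using W by simp
    finally show "norm ((LINT p|lborel. w p * g y p) - (LINT p|lborel. w p * g x p) - (LINT p|lborel. w p *\<^sub>R g' x p) \<bullet> (y - x)) <= e * norm (y - x)"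
     unfolding eq .
   qed
  qed (rule bounded_linear_inner_right)
 next
  show "continuous_on UNIV (\<lambda>x. LINT p|lborel. w p *\<^sub>R g' x p)"
  proof (rule continuous_at_imp_continuous_on, rule ballI)
   fix x
   show "isCont (\<lambda>x. LINT p|lborel. w p *\<^sub>R g' x p) x"
    unfolding continuous_at_eps_delta
   proof (intro allI impI)
    fix e :: real assume e: "0 < e"
    obtain d where d: "d > 0" "\<And>y p. norm (y - x) < d ==> p \<in> S ==> norm (g' y p - g' x p) <= (e/2) / W"
     using small[of "e/2" x] e by auto
    show "\<exists>d>0. \<forall>y. dist y x < d --> dist (LINT p|lborel. w p *\<^sub>R g' y p) (LINT p|lborel. w p *\<^sub>R g' x p) < e"
    proof (intro exI[of _ d] conjI allI impI d(1))
     fix y assume "dist y x < d"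
     hence y: "norm (y - x) < d" by (simp add: dist_norm)
     have "norm (LINT p|lborel. w p *\<^sub>R (g' y p - g' x p)) <= ((e/2) / W) * (LINT p|lborel. \<bar>w p\<bar>)"
     proof (rule norm_weighted_integral_le[where S=S])
      show "integrable lborel (\<lambda>p. w p *\<^sub>R (g' y p - g' x p))"
       by (rule integrable_weight_continuous[OF S w], assumption, intro continuous_intros cg')
     qed (use w d(2)[OF y] e W in auto)
     also have "... <= ((e/2) / W) * W" using W e by (intro mult_left_mono) auto
     also have "... < e" using W e by simp
     finally show "dist (LINT p|lborel. w p *\<^sub>R g' y p) (LINT p|lborel. w p *\<^sub>R g' x p) < e"
      using ig' by (simp add: dist_norm scaleR_diff_right)
    qed
   qed
  qed
 qed
qed

lemma C1_param_integral:
 fixes g :: "real^'d::finite => 'p::euclidean_space => real^'m::finite"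
 assumes S: "compact S" and w: "integrable lborel w" "\<And>p. p \<notin> S ==> w p = 0"
  and g: "continuous_on (UNIV \<times> S) (\<lambda>(x,p). g x p)" and g': "continuous_on (UNIV \<times> S) (\<lambda>(x,p). g' x p)"
  and der: "\<And>x p. p \<in> S ==> ((\<lambda>x. g x p) has_derivative (\<lambda>h. g' x p *v h)) (at x)"
 shows "C1 (\<lambda>x. LINT p|lborel. w p *\<^sub>R g x p) (\<lambda>x. LINT p|lborel. w p *\<^sub>R g' x p)"
 unfolding C1_components
proof
 fix \<beta>
 have cg: "continuous_on S (g x)" for x
  by (rule continuous_on_slice[OF g])
 have cg': "continuous_on S (g' x)" for x
  by (rule continuous_on_slice[OF g'])
 have ig: "(LINT p|lborel. w p *\<^sub>R g x p) $ \<beta> = (LINT p|lborel. w p * g x p $ \<beta>)" for x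
  using integral_bounded_linear[OF bounded_linear_vec_nth integrable_weight_continuous[OF S w cg], of x \<beta>] by simp
 have ig': "(LINT p|lborel. w p *\<^sub>R g' x p) $ \<beta> = (LINT p|lborel. w p *\<^sub>R g' x p $ \<beta>)" for x
  using integral_bounded_linear[OF bounded_linear_vec_nth integrable_weight_continuous[OF S w cg'], of x \<beta>] by simp
 have c: "continuous_on (UNIV \<times> S) (\<lambda>(x,p). g x p $ \<beta>)" "continuous_on (UNIV \<times> S) (\<lambda>(x,p). g' x p $ \<beta>)"
  using g g' by (auto intro!: continuous_intros simp: case_prod_unfold)
 have "C1s (\<lambda>x. LINT p|lborel. w p * g x p $ \<beta>) (\<lambda>x. LINT p|lborel. w p *\<^sub>R g' x p $ \<beta>)"
 proof (rule C1s_param_integral[OF S w c])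
  fix x p assume "p \<in> S"
  from bounded_linear.has_derivative[OF bounded_linear_vec_nth der[OF this], of \<beta> x]
  show "((\<lambda>x. g x p $ \<beta>) has_derivative (\<bullet>) (g' x p $ \<beta>)) (at x)" by (simp add: matrix_mult_dot)
 qed
 thus "C1s (\<lambda>x. (LINT p|lborel. w p *\<^sub>R g x p) $ \<beta>) (\<lambda>x. (LINT p|lborel. w p *\<^sub>R g' x p) $ \<beta>)"
  by (simp add: ig ig')
qed

section \<open>Bump functions and mollification\<close>

text \<open>The family \<^term>\<open>hk k\<close> is closed under differentiation up to linear combinations, which gives smoothness of the bump function.\<close>
definition hk :: "nat => real => real" where
 "hk k s = (if s <= 0 then 0 else exp (- (1 / s)) / s ^ k)"

lemma hk_nonneg: "0 <= hk k s" by (simp add: hk_def)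

lemma power_le_fact_exp: "0 <= (y::real) ==> y ^ n <= fact n * exp y"
proof -
 assume y: "0 <= y"
 have sm: "summable (\<lambda>n. y^n /\<^sub>R fact n)" "(\<Sum>n. y^n /\<^sub>R fact n) = exp y"
  using exp_converges[of y] by (auto simp: sums_iff)
 have "sum (\<lambda>n. y^n /\<^sub>R fact n) {n} <= (\<Sum>n. y^n /\<^sub>R fact n)"
  by (rule sum_le_suminf[OF sm(1)]) (use y in auto)
 hence "inverse (fact n) * y^n <= exp y" unfolding sm(2) by simp
 hence "fact n * (inverse (fact n) * y^n) <= fact n * exp y" by (intro mult_left_mono) auto
 thus ?thesis by (simp add: mult.assoc[symmetric])
qed

text \<open>One term of the exponential series beats every power of \<open>1 / s\<close>. The
  quadratic decay at 0 is what makes the derivative at 0 exist in \<open>hk_deriv\<close>.\<close>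

lemma hk_le: "\<bar>hk k s\<bar> <= fact (k + 2) * s ^ 2"
proof (cases "s <= 0")
 case False
 hence s: "s > 0" by simp
 define F :: real where "F = fact (k + 2)"
 have "(inverse s) ^ (k+2) <= F * exp (inverse s)"
  unfolding F_def by (rule power_le_fact_exp) (use s in simp)
 hence "(inverse s) ^ (k+2) * (exp (- inverse s) * s^2) <= F * exp (inverse s) * (exp (- inverse s) * s^2)"
  by (rule mult_right_mono) simp
 also have "F * exp (inverse s) * (exp (- inverse s) * s^2) = F * s^2"
  by (simp add: exp_minus)
 also have "(inverse s) ^ (k+2) * (exp (- inverse s) * s^2) = exp (- inverse s) * inverse s ^ k"
 proof -
  have "inverse s ^ (k+2) * s^2 = inverse s ^ k" using s by (simp add: power_add power2_eq_square field_simps)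
  thus ?thesis by (metis mult.assoc mult.commute)
 qed
 finally show ?thesis using s by (simp add: hk_def divide_inverse power_inverse F_def)
qed (simp add: hk_def)

lemma hk_deriv: "(hk k has_real_derivative (- real k * hk (k+1) s + hk (k+2) s)) (at s)"
proof -
 consider "s > 0" | "s < 0" | "s = 0" by linarith
 thus ?thesis
 proof cases
  case 1
  have k: "real k * inverse s ^ (k - Suc 0) * (inverse s)^2 = real k * inverse s ^ (k+1)"
   by (cases k) (auto simp: power2_eq_square)
  have "((\<lambda>s. exp (- inverse s) * inverse s ^ k) has_real_derivative
   (exp (- inverse s) * (inverse s)^2) * inverse s ^ k - exp (- inverse s) * (real k * inverse s ^ (k - Suc 0) * (inverse s)^2)) (at s)"
   using 1 by (auto intro!: derivative_eq_intros simp: power2_eq_square)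
  moreover have "(exp (- inverse s) * (inverse s)^2) * inverse s ^ k - exp (- inverse s) * (real k * inverse s ^ (k - Suc 0) * (inverse s)^2)
   = - real k * hk (k+1) s + hk (k+2) s"
   unfolding k using 1 by (simp add: hk_def divide_inverse power_inverse power2_eq_square power_add mult_ac)
  ultimately have "((\<lambda>s. exp (- inverse s) * inverse s ^ k) has_real_derivative (- real k * hk (k+1) s + hk (k+2) s)) (at s)" by simp
  thus ?thesis
   by (rule has_field_derivative_transform_within_open[where S="{0<..}"]) (use 1 in \<open>auto simp: hk_def divide_inverse power_inverse\<close>)
 next
  case 2
  have "((\<lambda>s. 0) has_real_derivative (- real k * hk (k+1) s + hk (k+2) s)) (at s)"
   using 2 by (simp add: hk_def)
  thus ?thesis
   by (rule has_field_derivative_transform_within_open[where S="{..<0}"]) (use 2 in \<open>auto simp: hk_def\<close>)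
 next
  \<comment> \<open>At 0 the quadratic bound of \<open>hk_le\<close> forces the difference quotient
    to 0, which is also the claimed derivative there, since every \<open>hk\<close> vanishes at
    0.\<close>
  case 3
  let ?C = "fact (k+2) :: real"
  have "((\<lambda>h. hk k h / h) \<longlongrightarrow> 0) (at 0)"
  proof (rule Lim_null_comparison)
   show "\<forall>\<^sub>F h in at 0. norm (hk k h / h) <= ?C * \<bar>h\<bar>"
   proof (intro always_eventually allI)
    fix h :: real
    have "\<bar>hk k h\<bar> / \<bar>h\<bar> <= ?C * h^2 / \<bar>h\<bar>" by (rule divide_right_mono[OF hk_le]) simp
    also have "... = ?C * \<bar>h\<bar>" by (cases "h = 0") (auto simp: power2_eq_square field_simps abs_if)
    finally show "norm (hk k h / h) <= ?C * \<bar>h\<bar>" by simp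
   qed
   show "((\<lambda>h. ?C * \<bar>h\<bar>) \<longlongrightarrow> 0) (at 0)"
    by (auto intro!: tendsto_eq_intros)
  qed
  thus ?thesis using 3 by (simp add: has_field_derivative_iff hk_def)
 qed
qed

text \<open>An algebra of functions that is stable under partial derivatives: smoothness then
  follows by induction on the list of directions, without formulas for higher derivatives. The index
  \<open>k\<close> in the rule for bumps absorbs the chain rule.\<close>

inductive smooth_class :: "real => (real^'d::finite) => (real^'d => real) => bool" for r c where
 const: "smooth_class r c (\<lambda>x. k)"
| coord: "smooth_class r c (\<lambda>x. x $ i)"
| bump: "smooth_class r c (\<lambda>x. hk k (r^2 - (x - c) \<bullet> (x - c)))"
| add: "smooth_class r c f ==> smooth_class r c g ==> smooth_class r c (\<lambda>x. f x + g x)"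
| mult: "smooth_class r c f ==> smooth_class r c g ==> smooth_class r c (\<lambda>x. f x * g x)"

lemma continuous_on_gradI:
 assumes "\<And>x. (f has_derivative (\<lambda>h. g x \<bullet> h)) (at x)" "\<And>i. continuous_on UNIV (\<lambda>x. g x $ i)"
 shows "C1s f g"
proof -
 have "continuous_on UNIV (\<lambda>x. \<chi> i. g x $ i)" using assms(2) by (intro continuous_on_vec_lambda)
 thus ?thesis using assms(1) by (simp add: C1s_def)
qed

lemma smooth_class_deriv:
 assumes "smooth_class r c f"
 shows "\<exists>g. (\<forall>x. (f has_derivative (\<lambda>h. g x \<bullet> h)) (at x)) \<and> (\<forall>i. smooth_class r c (\<lambda>x. g x $ i))"
 using assms
proof induction
 case (const k)
 show ?case by (intro exI[of _ "\<lambda>x. 0"]) (auto intro: smooth_class.const)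
next
 case (coord i)
 show ?case
  by (intro exI[of _ "\<lambda>x. axis i 1"])
   (auto intro!: smooth_class.const bounded_linear_imp_has_derivative bounded_linear_vec_nth simp: inner_axis' )
next
 case (bump k)
 let ?q = "\<lambda>x. r^2 - (x - c) \<bullet> (x - c)"
 let ?g = "\<lambda>x. (- real k * hk (k+1) (?q x) + hk (k+2) (?q x)) *\<^sub>R ((-2) *\<^sub>R (x - c))"
 have "((\<lambda>x. hk k (?q x)) has_derivative (\<lambda>h. ?g x \<bullet> h)) (at x)" for x
 proof -
  have "(?q has_derivative (\<lambda>h. ((-2) *\<^sub>R (x - c)) \<bullet> h)) (at x)"
   by (auto intro!: derivative_eq_intros simp: inner_commute algebra_simps)
  from has_derivative_compose[OF this hk_deriv[of k "?q x", unfolded has_field_derivative_def]]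
  show ?thesis by (rule has_derivative_eq_rhs) (simp add: fun_eq_iff mult.assoc)
 qed
 moreover have "smooth_class r c (\<lambda>x. ?g x $ i)" for i
 proof -
  have "smooth_class r c (\<lambda>x. ((- real k) * hk (k+1) (?q x) + hk (k+2) (?q x)) * ((-2) * (x $ i + (- c $ i))))"
   by (intro smooth_class.intros)
  moreover have "?g x $ i = ((- real k) * hk (k+1) (?q x) + hk (k+2) (?q x)) * ((-2) * (x $ i + (- c $ i)))" for x
   by (simp only: vector_scaleR_component vector_minus_component real_scaleR_def) simp
  ultimately show ?thesis by simp
 qed
 ultimately show ?case by (intro exI[of _ ?g]) blast
next
 case (add f1 f2)
 then obtain g1 g2 where "\<forall>x. (f1 has_derivative (\<lambda>h. g1 x \<bullet> h)) (at x)" "\<forall>i. smooth_class r c (\<lambda>x. g1 x $ i)"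
  "\<forall>x. (f2 has_derivative (\<lambda>h. g2 x \<bullet> h)) (at x)" "\<forall>i. smooth_class r c (\<lambda>x. g2 x $ i)" by blast
 thus ?case
  by (intro exI[of _ "\<lambda>x. g1 x + g2 x"])
   (auto intro!: has_derivative_eq_rhs[OF has_derivative_add] smooth_class.add simp: inner_add_left)
next
 case (mult f1 f2)
 then obtain g1 g2 where "\<forall>x. (f1 has_derivative (\<lambda>h. g1 x \<bullet> h)) (at x)" "\<forall>i. smooth_class r c (\<lambda>x. g1 x $ i)"
  "\<forall>x. (f2 has_derivative (\<lambda>h. g2 x \<bullet> h)) (at x)" "\<forall>i. smooth_class r c (\<lambda>x. g2 x $ i)" by blast
 thus ?case using mult.hyps
  by (intro exI[of _ "\<lambda>x. f1 x *\<^sub>R g2 x + f2 x *\<^sub>R g1 x"])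
   (auto intro!: has_derivative_eq_rhs[OF has_derivative_mult] smooth_class.add smooth_class.mult simp: inner_add_left fun_eq_iff algebra_simps)
qed

lemma smooth_class_continuous: "smooth_class r c f ==> continuous_on UNIV f"
proof -
 assume "smooth_class r c f"
 then obtain g where "\<forall>x. (f has_derivative (\<lambda>h. g x \<bullet> h)) (at x)" using smooth_class_deriv by blast
 thus ?thesis by (intro continuous_at_imp_continuous_on ballI has_derivative_continuous) auto
qed

lemma C1s_pd: "C1s f g ==> pd i f x = g x $ i"
proof -
 assume "C1s f g"
 hence "(f has_derivative (\<lambda>h. g x \<bullet> h)) (at x)" unfolding C1s_def by blast
 from frechet_derivative_at[OF this] have "frechet_derivative f (at x) = (\<lambda>h. g x \<bullet> h)" by simp
 thus ?thesis by (simp add: pd_def inner_axis)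
qed

lemma smooth_class_C1s:
 assumes "smooth_class r c f"
 obtains g where "C1s f g" "\<And>i. smooth_class r c (\<lambda>x. g x $ i)" "\<And>i. pd i f = (\<lambda>x. g x $ i)"
proof -
 obtain g where g: "\<forall>x. (f has_derivative (\<lambda>h. g x \<bullet> h)) (at x)" "\<forall>i. smooth_class r c (\<lambda>x. g x $ i)"
  using smooth_class_deriv[OF assms] by blast
 have "C1s f g" by (rule continuous_on_gradI) (use g smooth_class_continuous in blast)+
 moreover have "pd i f = (\<lambda>x. g x $ i)" for i using C1s_pd[OF \<open>C1s f g\<close>] by auto
 ultimately show ?thesis using that g by blast
qed

lemma smooth_class_pd: "smooth_class r c f ==> smooth_class r c (pd i f)"
 by (erule smooth_class_C1s[where ?thesis="smooth_class r c (pd i f)"]) simp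

lemma smooth_class_iter_pd: "smooth_class r c f ==> smooth_class r c (iter_pd is f)"
 by (induction "is") (auto simp: smooth_class_pd)

lemma C1s_differentiable: "C1s f g ==> f differentiable (at x)"
 unfolding C1s_def differentiable_def by blast

lemma smooth_class_smooth: "smooth_class r c f ==> smooth f"
proof -
 assume a: "smooth_class r c f"
 show ?thesis unfolding smooth_def
 proof (intro allI)
  fix "is" x
  obtain g where "C1s (iter_pd is f) g" using smooth_class_C1s[OF smooth_class_iter_pd[OF a]] by blast
  thus "iter_pd is f differentiable (at x)" by (rule C1s_differentiable)
 qed
qed

definition bump :: "real => real^'d::finite => real^'d => real" where
 "bump r c x = hk 0 (r^2 - (x - c) \<bullet> (x - c))"

lemma bump_class: "smooth_class r c (bump r c)"
 unfolding bump_def[abs_def] by (rule smooth_class.bump)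

lemma bump_nonneg: "0 <= bump r c x" by (simp add: bump_def hk_nonneg)

lemma bump_pos: "0 < r ==> bump r c x \<noteq> 0 \<longleftrightarrow> dist x c < r"
proof -
 assume r: "0 < r"
 have "(x - c) \<bullet> (x - c) < r^2 \<longleftrightarrow> dist x c < r"
 proof -
  have "(x - c) \<bullet> (x - c) = (dist x c)^2" by (simp add: dist_norm power2_norm_eq_inner)
  moreover have "(dist x c)^2 < r^2 \<longleftrightarrow> dist x c < r"
   using r by (auto intro: power_strict_mono dest: power_less_imp_less_base)
  ultimately show ?thesis by simp
 qed
 thus ?thesis by (auto simp: bump_def hk_def)
qed

lemma bump_support: "0 < r ==> closure {x. bump r c x \<noteq> 0} \<subseteq> cball c r"
 by (rule closure_minimal) (auto simp: bump_pos dist_commute)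

lemma bump_test_fun:
 assumes "0 < r" "cball c r \<subseteq> S" shows "test_fun S (bump r c)"
 unfolding test_fun_def
proof (intro conjI)
 show "smooth (bump r c)" by (rule smooth_class_smooth[OF bump_class])
 show "compact (closure {x. bump r c x \<noteq> 0})"
  unfolding compact_eq_bounded_closed using bounded_subset[OF bounded_cball bump_support[OF assms(1)]] by simp
 show "closure {x. bump r c x \<noteq> 0} \<subseteq> S" using bump_support[OF assms(1)] assms(2) by blast
qed

lemma C1_zero_on_open:
 assumes "C1 \<phi> K" "open U" "\<And>x. x \<in> U ==> \<phi> x = 0" "x \<in> U"
 shows "K x = 0"
proof -
 have "(\<phi> has_derivative (\<lambda>h. K x *v h)) (at x)" using assms(1) unfolding C1_def by blast
 moreover have "(\<phi> has_derivative (\<lambda>h. 0)) (at x)"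
  by (rule has_derivative_transform_within_open[OF has_derivative_const assms(2,4)]) (simp add: assms(3))
 ultimately have "(\<lambda>h. K x *v h) = (\<lambda>h. 0)" by (rule has_derivative_unique)
 hence "K x *v h = 0 *v h" for h by (metis matrix_vector_mult_0)
 thus ?thesis by (metis matrix_eq)
qed

lemma integral_reflect:
 fixes f :: "'a::euclidean_space => 'b::{banach, second_countable_topology}"
 assumes "f \<in> borel_measurable borel"
 shows "(LINT y|lborel. f (c - y)) = (LINT y|lborel. f y)"
proof -
 have d: "distr lborel borel (\<lambda>x. c - x) = (lborel :: 'a measure)"
  using lborel_affine[of "-1" c] by (simp add: density_1)
 have "(LINT y|lborel. f y) = (LINT y|(distr lborel borel (\<lambda>x. c - x)). f y)" by (simp only: d)
 also have "... = (LINT y|lborel. f (c - y))" by (rule integral_distr) (use assms in auto)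
 finally show ?thesis by simp
qed

lemma bump_continuous: "continuous_on S (bump r c)"
 by (rule continuous_on_subset[OF smooth_class_continuous[OF bump_class]]) simp

lemma bump_eq_0: "0 < r ==> r <= dist x c ==> bump r c x = 0"
 using bump_pos[of r c x] by auto

lemma bump_integrable: assumes "0 < r" shows "integrable lborel (bump r c)"
proof -
 have "integrable lborel (\<lambda>x. indicator (cball c r) x *\<^sub>R bump r c x)"
  by (rule borel_integrable_compact) (auto intro: bump_continuous)
 moreover have "(\<lambda>x. indicator (cball c r) x *\<^sub>R bump r c x) = bump r c"
  using bump_eq_0[OF assms, of _ c] by (auto simp: fun_eq_iff dist_commute split: split_indicator)
 ultimately show ?thesis by simp
qed

definition molli :: "real => real^'d::finite => real" where
 "molli r x = bump r 0 x / (LINT y|lborel. bump r (0::real^'d) y)"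

text \<open>A vanishing integral would make the bump zero almost everywhere, whereas it is positive
  on an open ball, which is not negligible.\<close>

lemma bump_integral_pos: assumes "0 < r" shows "0 < (LINT y|lborel. bump r (0::real^'d::finite) y)"
proof -
 have "(LINT y|lborel. bump r (0::real^'d) y) \<noteq> 0"
 proof
  assume "(LINT y|lborel. bump r (0::real^'d) y) = 0"
  hence "AE y in lborel. bump r (0::real^'d) y = 0"
   using integral_nonneg_eq_0_iff_AE[OF bump_integrable[OF assms]] bump_nonneg by blast
  then obtain N where N: "N \<in> null_sets lborel" "{y. bump r (0::real^'d) y \<noteq> 0} \<subseteq> N"
   by (elim AE_E) (auto simp: null_sets_def)
  have "ball (0::real^'d) r \<subseteq> N" using N(2) bump_pos[OF assms, of "0::real^'d"] by (force simp: dist_commute)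
  moreover have "negligible N" using N(1) by (simp add: negligible_iff_null_sets null_sets_completionI)
  ultimately have "negligible (ball (0::real^'d) r)" using negligible_subset by blast
  thus False using open_not_negligible[of "ball (0::real^'d) r"] assms by auto
 qed
 moreover have "0 <= (LINT y|lborel. bump r (0::real^'d) y)" by (simp add: bump_nonneg)
 ultimately show ?thesis by simp
qed

lemma molli_class: "smooth_class r 0 (molli r)"
 using smooth_class.mult[OF bump_class smooth_class.const[of r 0 "1 / (LINT y|lborel. bump r (0::real^'d) y)"]]
 by (simp add: molli_def[abs_def])

lemma molli_props:
 fixes x :: "real^'d::finite"
 assumes "0 < r"
 shows molli_nonneg: "0 <= molli r x"
  and molli_integrable: "integrable lborel (molli r :: real^'d => real)"
  and molli_integral: "(LINT y|lborel. molli r (y::real^'d)) = 1"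
  and molli_eq_0: "x \<notin> cball 0 r ==> molli r x = 0"
  and molli_abs_integral: "(LINT y|lborel. \<bar>molli r (y::real^'d)\<bar>) = 1"
  and molli_continuous: "continuous_on S (molli r :: real^'d => real)"
proof -
 define N where "N = (LINT y|lborel. bump r (0::real^'d) y)"
 have N: "0 < N" unfolding N_def by (rule bump_integral_pos[OF assms])
 have m: "molli r = (\<lambda>x::real^'d. bump r 0 x / N)" by (simp add: molli_def N_def fun_eq_iff)
 have nn: "0 <= molli r x" for x :: "real^'d" using N bump_nonneg[of r 0 x] by (simp add: m)
 thus "0 <= molli r x" .
 show "integrable lborel (molli r :: real^'d => real)" unfolding m
  by (intro integrable_divide bump_integrable assms)
 show 1: "(LINT y|lborel. molli r (y::real^'d)) = 1" using N by (simp add: m N_def)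
 show "x \<notin> cball 0 r ==> molli r x = 0" using bump_eq_0[OF assms, of x 0] by (simp add: molli_def)
 show "(LINT y|lborel. \<bar>molli r (y::real^'d)\<bar>) = 1" using nn 1 by simp
 show "continuous_on S (molli r :: real^'d => real)"
  by (rule continuous_on_subset[OF smooth_class_continuous[OF molli_class]]) simp
qed

lemma cont_comp: "continuous_on UNIV f ==> continuous_on S h ==> continuous_on S (\<lambda>x. f (h x))"
 by (rule continuous_on_compose2) auto

text \<open>Every derivative falls on \<open>f\<close>, whose partial derivatives stay in
  \<open>smooth_class\<close>; no derivative ever reaches \<open>w\<close>.\<close>

lemma conv_smooth:
 assumes "compact S" "integrable lborel w" "\<And>p. p \<notin> S ==> w p = 0" "smooth_class r 0 f"
 shows "smooth (\<lambda>x. LINT p|lborel. w p * f (x - p))"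
proof -
 have C: "C1s (\<lambda>x. LINT p|lborel. w p * h (x - p)) (\<lambda>x. LINT p|lborel. w p *\<^sub>R g (x - p))"
  if hg: "C1s h g" for h g
 proof (rule C1s_param_integral[OF assms(1-3)])
  show "continuous_on (UNIV \<times> S) (\<lambda>(x, p). h (x - p))"
   unfolding case_prod_unfold by (intro cont_comp[OF C1s_continuous[OF hg]] continuous_intros)
  show "continuous_on (UNIV \<times> S) (\<lambda>(x, p). g (x - p))"
   unfolding case_prod_unfold by (intro cont_comp[OF C1s_continuous_g[OF hg]] continuous_intros)
  fix x p
  have 1: "(h has_derivative (\<lambda>k. g (x - p) \<bullet> k)) (at (x - p))" using hg unfolding C1s_def by blast
  have 2: "((\<lambda>x. x - p) has_derivative (\<lambda>k. k)) (at x)" by (auto intro!: derivative_eq_intros)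
  from has_derivative_compose[OF 2 1] show "((\<lambda>x. h (x - p)) has_derivative (\<bullet>) (g (x - p))) (at x)" .
 qed
 have C1: "\<exists>g. C1s (iter_pd is f) g \<and> (\<forall>i. pd i (iter_pd is f) = (\<lambda>x. g x $ i))" for "is"
  by (rule smooth_class_C1s[OF smooth_class_iter_pd[OF assms(4)], of "is"]) blast
 have IT: "iter_pd is (\<lambda>x. LINT p|lborel. w p * f (x - p)) = (\<lambda>x. LINT p|lborel. w p * iter_pd is f (x - p))" for "is"
 proof (induction "is")
  case (Cons i "is")
  obtain g where g: "C1s (iter_pd is f) g" "pd i (iter_pd is f) = (\<lambda>x. g x $ i)" using C1 by blast
  show ?case
  proof
   fix x
   have "continuous_on S (\<lambda>p. g (x - p))"
    by (intro cont_comp[OF C1s_continuous_g[OF g(1)]] continuous_intros)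
   hence "integrable lborel (\<lambda>p. w p *\<^sub>R g (x - p))"
    by (rule integrable_weight_continuous[OF assms(1,2,3), rotated])
   hence "(LINT p|lborel. w p *\<^sub>R g (x - p)) $ i = (LINT p|lborel. (w p *\<^sub>R g (x - p)) $ i)"
    by (rule integral_bounded_linear[OF bounded_linear_vec_nth, symmetric])
   also have "... = (LINT p|lborel. w p * iter_pd (i # is) f (x - p))"
    by (simp only: vector_scaleR_component real_scaleR_def iter_pd.simps g(2))
   finally have 1: "(LINT p|lborel. w p *\<^sub>R g (x - p)) $ i = (LINT p|lborel. w p * iter_pd (i # is) f (x - p))" .
   have "iter_pd (i # is) (\<lambda>x. LINT p|lborel. w p * f (x - p)) x
    = pd i (\<lambda>x. LINT p|lborel. w p * iter_pd is f (x - p)) x" by (simp only: iter_pd.simps Cons.IH)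
   also have "... = (LINT p|lborel. w p *\<^sub>R g (x - p)) $ i" by (rule C1s_pd[OF C[OF g(1)]])
   finally show "iter_pd (i # is) (\<lambda>x. LINT p|lborel. w p * f (x - p)) x = (LINT p|lborel. w p * iter_pd (i # is) f (x - p))"
    unfolding 1 .
  qed
 qed (simp only: iter_pd.simps)
 show ?thesis unfolding smooth_def
 proof (intro allI)
  fix "is" x
  obtain g where "C1s (iter_pd is f) g" using C1 by blast
  from C1s_differentiable[OF C[OF this]]
  show "iter_pd is (\<lambda>x. LINT p|lborel. w p * f (x - p)) differentiable (at x)" unfolding IT .
 qed
qed

section \<open>The weak formulation with continuously differentiable test functions\<close>

text \<open>The form may fail to be symmetric, so boundedness is stated for two different arguments.
  Continuity of the entries serves the measurability of
  \<open>bilin A x (J x) (K x)\<close>.\<close>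

definition coefs :: "real => real => ('d::finite, 'm::finite) coeff => bool" where
 "coefs \<mu> M A \<longleftrightarrow> (\<forall>x \<xi>. \<mu> * (norm \<xi>)^2 <= bilin A x \<xi> \<xi>) \<and>
  (\<forall>x \<xi> \<eta>. \<bar>bilin A x \<xi> \<eta>\<bar> <= M * norm \<xi> * norm \<eta>) \<and>
  (\<forall>i j \<alpha> \<beta>. continuous_on UNIV (A i j \<alpha> \<beta>))"

lemma bilin_add_right: "bilin A x \<xi> (\<eta> + \<zeta>) = bilin A x \<xi> \<eta> + bilin A x \<xi> \<zeta>"
 by (simp add: bilin_def sum.distrib algebra_simps)
lemma bilin_diff_right: "bilin A x \<xi> (\<eta> - \<zeta>) = bilin A x \<xi> \<eta> - bilin A x \<xi> \<zeta>"
 by (simp add: bilin_def sum_subtractf algebra_simps)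
lemma bilin_diff_left: "bilin A x (\<xi> - \<zeta>) \<eta> = bilin A x \<xi> \<eta> - bilin A x \<zeta> \<eta>"
 by (simp add: bilin_def sum_subtractf algebra_simps)
lemma bilin_scaleR_right: "bilin A x \<xi> (c *\<^sub>R \<eta>) = c * bilin A x \<xi> \<eta>"
 by (simp add: bilin_def sum_distrib_left mult_ac)
lemma bilin_zero_right [simp]: "bilin A x \<xi> 0 = 0"
 by (simp add: bilin_def)

lemma measurable_vec_nth2 [measurable (raw)]:
 fixes J :: "'a => real^'d::finite^'m::finite"
 assumes "J \<in> borel_measurable N" shows "(\<lambda>x. J x $ \<beta> $ i) \<in> borel_measurable N"
proof -
 have "continuous_on UNIV (\<lambda>J::real^'d^'m. J $ \<beta> $ i)" by (intro continuous_intros)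
 from borel_measurable_continuous_onI[OF this] assms show ?thesis by measurable
qed

lemma bilin_measurable:
 assumes "\<And>i j \<alpha> \<beta>. continuous_on UNIV (A i j \<alpha> \<beta>)" "J \<in> borel_measurable borel" "K \<in> borel_measurable borel"
 "a \<in> borel_measurable borel"
 shows "(\<lambda>x. bilin A (a x) (J x) (K x)) \<in> borel_measurable borel"
proof -
 have "A i j \<alpha> \<beta> \<in> borel_measurable borel" for i j \<alpha> \<beta>
  by (rule borel_measurable_continuous_onI[OF assms(1)])
 hence [measurable]: "(\<lambda>x. A i j \<alpha> \<beta> (a x)) \<in> borel_measurable borel" for i j \<alpha> \<beta>
  using assms(4) by measurable
 note [measurable] = assms(2,3)
 show ?thesis unfolding bilin_def by measurable
qed

text \<open>The corrector and its products with cut-offs are only continuously differentiable, so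
  the equation is restated for such test functions. Both sides stand under one integral, to which
  pointwise lower bounds apply directly.\<close>

definition weakeq :: "('d::finite, 'm::finite) coeff => (real^'d) set => (real^'d => real^'d^'m) => (real^'d => real^'d^'m) => bool" where
 "weakeq A \<Omega> J g \<longleftrightarrow> (\<forall>\<phi> K R. C1 \<phi> K --> (\<forall>x. norm x > R --> \<phi> x = 0) -->
  (LINT x:\<Omega>|lborel. bilin A x (J x) (K x) + g x \<bullet> K x) = 0)"

lemma L2_loc_norm_integrable:
 assumes "L2_loc_upto \<Omega> g" "\<Omega> \<in> sets borel"
 shows "set_integrable lborel (\<Omega> \<inter> cball c R) (\<lambda>x. norm (g x))"
proof -
 have [measurable]: "g \<in> borel_measurable borel" "\<Omega> \<in> sets borel" using assms by (auto simp: L2_loc_upto_def)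
 have "set_integrable lborel (\<Omega> \<inter> cball c R) (\<lambda>x. 1 + (norm (g x))^2)"
 proof (rule set_integral_add)
  show "set_integrable lborel (\<Omega> \<inter> cball c R) (\<lambda>x. (norm (g x))^2)"
   using assms(1) compact_cball unfolding L2_loc_upto_def by blast
  have "set_integrable lborel (cball c R) (\<lambda>x. 1::real)"
   unfolding set_integrable_def by (rule borel_integrable_compact) auto
  thus "set_integrable lborel (\<Omega> \<inter> cball c R) (\<lambda>x. 1::real)"
   by (rule set_integrable_subset) auto
 qed
 thus ?thesis
 proof (rule set_integrable_bound)
  show "AE x in lborel. x \<in> \<Omega> \<inter> cball c R --> norm (norm (g x)) <= norm (1 + (norm (g x))^2)"
  proof (intro AE_I2 impI)
   fix x
   have "0 <= (norm (g x) - 1)^2" by simp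
   hence *: "2 * norm (g x) <= 1 + (norm (g x))^2" by (simp add: power2_eq_square algebra_simps)
   have "0 <= norm (g x)" by simp
   with * show "norm (norm (g x)) <= norm (1 + (norm (g x))^2)" by (simp del: norm_ge_zero)
  qed
  have "(\<lambda>x. norm (g x)) \<in> borel_measurable borel" by measurable
  moreover have "indicat_real (\<Omega> \<inter> cball c R) \<in> borel_measurable borel"
   by (intro borel_measurable_indicator sets.Int assms(2) borel_closed closed_cball)
  ultimately show "set_borel_measurable lborel (\<Omega> \<inter> cball c R) (\<lambda>x. norm (g x))"
   by (simp add: set_borel_measurable_def borel_measurable_times)
 qed
qed

lemma C1_support_J:
 assumes "C1 \<phi> K" "\<And>x. norm x > R ==> \<phi> x = 0" "norm x > R"
 shows "K x = 0"
proof (rule C1_zero_on_open[OF assms(1)])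
 show "open {x. norm x > R}" by (rule open_Collect_less) (auto intro!: continuous_intros)
qed (use assms in auto)

text \<open>By mollification: the gradients converge uniformly because \<open>K\<close> is uniformly
  continuous on a ball and vanishes outside a smaller one, and all supports stay in one fixed
  ball.\<close>

lemma mollify_C1:
 fixes \<phi> :: "real^'d::finite => real^'m::finite"
 assumes C: "C1 \<phi> K" and supp: "\<And>x. norm x > R ==> \<phi> x = 0" and e: "0 < e"
 shows "\<exists>\<psi> L. C1 \<psi> L \<and> (\<forall>\<beta>. test_fun UNIV (\<lambda>x. \<psi> x $ \<beta>)) \<and>
  (\<forall>x. norm (L x - K x) <= e) \<and> (\<forall>x. norm x > R + 1 --> L x = 0)"
proof -
 have K0: "K x = 0" if "norm x > R" for x by (rule C1_support_J[OF C supp that])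
 have cK: "continuous_on UNIV K" by (rule C1_continuous_J[OF C])
 have "uniformly_continuous_on (cball 0 (R+2)) K"
  by (rule compact_uniformly_continuous[OF continuous_on_subset[OF cK]]) auto
 then obtain d where d: "d > 0" "\<And>x y. x \<in> cball 0 (R+2) ==> y \<in> cball 0 (R+2) ==> dist y x < d ==> dist (K y) (K x) < e"
  unfolding uniformly_continuous_on_def using e by metis
 define r where "r = min (d/2) 1"
 have r: "0 < r" "r < d" "r <= 1" using d(1) by (auto simp: r_def)
 have close: "norm (K (x - y) - K x) <= e" if "y \<in> cball 0 r" for x y
 proof (cases "norm x <= R + 1")
  case True
  have "norm y <= r" using that by simp
  have "norm (x - y) <= norm x + norm y" by (rule norm_triangle_ineq4)
  thus ?thesis using True r \<open>norm y <= r\<close> d(2)[of x "x - y"] norm_minus_commute[of x y] by (auto simp: dist_norm)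
 next
  case False
  have "norm y <= r" using that by simp
  have "norm x <= norm (x - y) + norm y" by (metis diff_add_cancel norm_triangle_ineq)
  hence "norm (x - y) > R" using False r \<open>norm y <= r\<close> by linarith
  thus ?thesis using False K0 e by simp
 qed
 define \<psi> where "\<psi> x = (LINT y|lborel. molli r y *\<^sub>R \<phi> (x - y))" for x
 define L where "L x = (LINT y|lborel. molli r y *\<^sub>R K (x - y))" for x
 have cphi: "continuous_on UNIV \<phi>" by (rule C1_continuous[OF C])
 have "C1 \<psi> L" unfolding \<psi>_def L_def
 proof (rule C1_param_integral[of "cball 0 r"])
  show "continuous_on (UNIV \<times> cball 0 r) (\<lambda>(x, y). \<phi> (x - y))"
   unfolding case_prod_unfold by (intro cont_comp[OF cphi] continuous_intros)
  show "continuous_on (UNIV \<times> cball 0 r) (\<lambda>(x, y). K (x - y))"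
   unfolding case_prod_unfold by (intro cont_comp[OF cK] continuous_intros)
  fix x y
  have 1: "(\<phi> has_derivative (\<lambda>k. K (x - y) *v k)) (at (x - y))" using C unfolding C1_def by blast
  have 2: "((\<lambda>x. x - y) has_derivative (\<lambda>k. k)) (at x)" by (auto intro!: derivative_eq_intros)
  from has_derivative_compose[OF 2 1] show "((\<lambda>x. \<phi> (x - y)) has_derivative (\<lambda>k. K (x - y) *v k)) (at x)"
   .
 qed (use r(1) molli_integrable molli_eq_0 in auto)
 moreover have "test_fun UNIV (\<lambda>x. \<psi> x $ \<beta>)" for \<beta>
 proof -
  have int: "integrable lborel (\<lambda>y. molli r y *\<^sub>R \<phi> (x - y))" for x
   by (rule integrable_weight_continuous[of "cball 0 r"])
    (use r(1) molli_integrable molli_eq_0 in auto, intro cont_comp[OF cphi] continuous_intros)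
  \<comment> \<open>The substitution \<open>p = x - y\<close> moves the variable \<open>x\<close>
    into the mollifier, so that \<open>conv_smooth\<close> applies with the components of
    \<open>\<phi>\<close> as weights.\<close>
  have eq: "\<psi> x $ \<beta> = (LINT p|lborel. \<phi> p $ \<beta> * molli r (x - p))" for x
  proof -
   have "\<psi> x $ \<beta> = (LINT y|lborel. molli r y * \<phi> (x - y) $ \<beta>)"
    using integral_bounded_linear[OF bounded_linear_vec_nth int, of x \<beta>] by (simp add: \<psi>_def)
   also have "... = (LINT y|lborel. (\<lambda>p. \<phi> p $ \<beta> * molli r (x - p)) (x - y))" by (simp add: mult.commute)
   also have "... = (LINT p|lborel. \<phi> p $ \<beta> * molli r (x - p))"
   proof (rule integral_reflect)
    have "continuous_on UNIV (\<lambda>p. \<phi> p $ \<beta> * molli r (x - p))"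
     by (intro continuous_intros cphi cont_comp[OF molli_continuous[OF r(1), of UNIV]])
    thus "(\<lambda>p. \<phi> p $ \<beta> * molli r (x - p)) \<in> borel_measurable borel" by (rule borel_measurable_continuous_onI)
   qed
   finally show ?thesis .
  qed
  have "smooth (\<lambda>x. LINT p|lborel. \<phi> p $ \<beta> * molli r (x - p))"
  proof (rule conv_smooth[of "cball 0 R"])
   have "integrable lborel (\<lambda>p. indicator (cball 0 R) p *\<^sub>R (\<phi> p $ \<beta>))"
    by (rule borel_integrable_compact) (auto intro!: continuous_intros continuous_on_subset[OF cphi])
   moreover have "(\<lambda>p. indicator (cball 0 R) p *\<^sub>R (\<phi> p $ \<beta>)) = (\<lambda>p. \<phi> p $ \<beta>)"
    using supp by (auto simp: fun_eq_iff not_le split: split_indicator)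
   ultimately show "integrable lborel (\<lambda>p. \<phi> p $ \<beta>)" by simp
  qed (use supp molli_class in auto)
  hence sm: "smooth (\<lambda>x. \<psi> x $ \<beta>)" by (simp add: eq)
  have z: "\<psi> x = 0" if "norm x > R + 1" for x
  proof -
   have "molli r y *\<^sub>R \<phi> (x - y) = 0" for y
   proof (cases "y \<in> cball 0 r")
    case True
    hence "norm y <= 1" using r by simp
    have "norm x <= norm (x - y) + norm y" by (metis diff_add_cancel norm_triangle_ineq)
    thus ?thesis using that supp[of "x - y"] \<open>norm y <= 1\<close> by simp
   qed (simp add: molli_eq_0[OF r(1)])
   hence "(\<lambda>y. molli r y *\<^sub>R \<phi> (x - y)) = (\<lambda>y. 0)" by blast
   thus ?thesis by (simp only: \<psi>_def integral_zero)
  qed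
  have sub: "closure {x. \<psi> x $ \<beta> \<noteq> 0} \<subseteq> cball 0 (R+1)"
   by (rule closure_minimal) (use z in \<open>force simp: not_less[symmetric]\<close>, simp)
  show ?thesis unfolding test_fun_def
   using sm bounded_subset[OF bounded_cball sub] by (simp add: compact_eq_bounded_closed)
 qed
 moreover have "norm (L x - K x) <= e" for x
 proof -
  have int: "integrable lborel (\<lambda>y. molli r y *\<^sub>R K (x - y))"
   by (rule integrable_weight_continuous[of "cball 0 r"])
    (use r(1) molli_integrable molli_eq_0 in auto, intro cont_comp[OF cK] continuous_intros)
  have i2: "integrable lborel (\<lambda>y::real^'d. molli r y *\<^sub>R K x)" using molli_integrable[OF r(1)] by auto
  have "K x = (LINT y|lborel. molli r (y::real^'d) *\<^sub>R K x)" using molli_integral[OF r(1), where 'd='d] molli_integrable[OF r(1), where 'd='d] by simp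
  hence "L x - K x = (LINT y|lborel. molli r y *\<^sub>R K (x - y)) - (LINT y|lborel. molli r (y::real^'d) *\<^sub>R K x)" by (simp add: L_def)
  also have "... = (LINT y|lborel. molli r y *\<^sub>R (K (x - y) - K x))"
   using int i2 by (simp add: scaleR_diff_right)
  finally have eq: "L x - K x = (LINT y|lborel. molli r y *\<^sub>R (K (x - y) - K x))" .
  have "norm (L x - K x) <= e * (LINT y|lborel. \<bar>molli r (y::real^'d)\<bar>)" unfolding eq
  proof (rule norm_weighted_integral_le[where S="cball 0 r"])
   show "integrable lborel (\<lambda>y. molli r y *\<^sub>R (K (x - y) - K x))" using int i2 by (simp add: scaleR_diff_right)
  qed (use r(1) molli_integrable molli_eq_0 close e in auto)
  thus ?thesis by (simp add: molli_abs_integral[OF r(1)])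
 qed
 moreover have "L x = 0" if "norm x > R + 1" for x
 proof -
  have "molli r y *\<^sub>R K (x - y) = 0" for y
  proof (cases "y \<in> cball 0 r")
   case True
   hence "norm y <= 1" using r by simp
   have "norm x <= norm (x - y) + norm y" by (metis diff_add_cancel norm_triangle_ineq)
   thus ?thesis using that K0[of "x - y"] \<open>norm y <= 1\<close> by simp
  qed (simp add: molli_eq_0[OF r(1)])
  hence "(\<lambda>y. molli r y *\<^sub>R K (x - y)) = (\<lambda>y. 0)" by blast
  thus ?thesis by (simp only: L_def integral_zero)
 qed
 ultimately show ?thesis by blast
qed

lemma weak_integrable:
 fixes A :: "('d::finite, 'm::finite) coeff"
 assumes A: "coefs \<mu> M A" "0 <= M" and Om: "\<Omega> \<in> sets borel" and J: "L2_loc_upto \<Omega> J" and g: "L2_loc_upto \<Omega> g"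
  and K: "continuous_on UNIV K" "\<And>x. norm x > R ==> K x = 0"
 shows "set_integrable lborel \<Omega> (\<lambda>x. bilin A x (J x) (K x))" "set_integrable lborel \<Omega> (\<lambda>x. g x \<bullet> K x)"
proof -
 have [measurable]: "J \<in> borel_measurable borel" "g \<in> borel_measurable borel" "K \<in> borel_measurable borel" "\<Omega> \<in> sets borel"
  using J g Om borel_measurable_continuous_onI[OF K(1)] by (auto simp: L2_loc_upto_def)
 have [measurable]: "(\<lambda>x. bilin A x (J x) (K x)) \<in> borel_measurable borel"
  by (rule bilin_measurable) (use A in \<open>auto simp: coefs_def\<close>)
 obtain B where B: "\<And>x. norm (K x) <= B" "0 < B"
 proof -
  have "bounded (K ` cball 0 R)"
   by (rule compact_imp_bounded[OF compact_continuous_image[OF continuous_on_subset[OF K(1)]]]) auto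
  then obtain B where "0 < B" "\<forall>y\<in>K ` cball 0 R. norm y <= B" unfolding bounded_pos by blast
  hence B: "\<And>x. x \<in> cball 0 R ==> norm (K x) <= B" "0 < B" by blast+
  hence "norm (K x) <= B" for x using K(2)[of x] by (cases "x \<in> cball 0 R") auto
  thus ?thesis using that B(2) by blast
 qed
 have i: "integrable lborel (\<lambda>x. c * (indicator (\<Omega> \<inter> cball 0 R) x *\<^sub>R norm (h x)))" if "L2_loc_upto \<Omega> h" for h :: "real^'d => real^'d^'m" and c
  using L2_loc_norm_integrable[OF that Om, of 0 R] unfolding set_integrable_def by simp
 show "set_integrable lborel \<Omega> (\<lambda>x. bilin A x (J x) (K x))" unfolding set_integrable_def
 proof (rule Bochner_Integration.integrable_bound[OF i[OF J, of "M * B"]])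
  show "AE x in lborel. norm (indicat_real \<Omega> x *\<^sub>R bilin A x (J x) (K x)) <= norm (M * B * (indicator (\<Omega> \<inter> cball 0 R) x *\<^sub>R norm (J x)))"
  proof (rule AE_I2)
   fix x
   have "\<bar>bilin A x (J x) (K x)\<bar> <= M * norm (J x) * norm (K x)" using A unfolding coefs_def by blast
   also have "... <= M * norm (J x) * B" by (rule mult_left_mono[OF B(1)]) (use A(2) in simp)
   finally have "\<bar>bilin A x (J x) (K x)\<bar> <= M * B * norm (J x)" by (simp add: mult_ac)
   thus "norm (indicat_real \<Omega> x *\<^sub>R bilin A x (J x) (K x)) <= norm (M * B * (indicator (\<Omega> \<inter> cball 0 R) x *\<^sub>R norm (J x)))"
    using K(2)[of x] A(2) B(2) by (cases "norm x > R") (auto split: split_indicator)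
  qed
 qed simp
 show "set_integrable lborel \<Omega> (\<lambda>x. g x \<bullet> K x)" unfolding set_integrable_def
 proof (rule Bochner_Integration.integrable_bound[OF i[OF g, of B]])
  show "AE x in lborel. norm (indicat_real \<Omega> x *\<^sub>R (g x \<bullet> K x)) <= norm (B * (indicator (\<Omega> \<inter> cball 0 R) x *\<^sub>R norm (g x)))"
  proof (rule AE_I2)
   fix x
   have "\<bar>g x \<bullet> K x\<bar> <= norm (g x) * norm (K x)" by (rule Cauchy_Schwarz_ineq2)
   also have "... <= norm (g x) * B" by (rule mult_left_mono[OF B(1)]) simp
   finally have "\<bar>g x \<bullet> K x\<bar> <= B * norm (g x)" by (simp add: mult_ac)
   thus "norm (indicat_real \<Omega> x *\<^sub>R (g x \<bullet> K x)) <= norm (B * (indicator (\<Omega> \<inter> cball 0 R) x *\<^sub>R norm (g x)))"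
    using K(2)[of x] B(2) by (cases "norm x > R") (auto split: split_indicator)
  qed
 qed simp
qed

text \<open>Density: by \<open>mollify_C1\<close> the gradient of the test function is a uniform
  limit of gradients of smooth test functions supported in a common ball. On that ball
  \<open>J\<close> and \<open>g\<close> are integrable, so both sides of the equation depend
  continuously on the gradient.\<close>

lemma weak_neumann_C1:
 fixes A :: "('d::finite, 'm::finite) coeff"
 assumes A: "coefs \<mu> M A" "0 <= M" and Om: "\<Omega> \<in> sets borel" and J: "L2_loc_upto \<Omega> J" and g: "L2_loc_upto \<Omega> g"
  and w: "weak_neumann A \<Omega> J g"
 shows "weakeq A \<Omega> J g"
 unfolding weakeq_def
proof (intro allI impI)
 fix \<phi> :: "real^'d => real^'m" and K R
 assume C: "C1 \<phi> K" and "\<forall>x. R < norm x --> \<phi> x = 0"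
 hence supp: "\<And>x. R < norm x ==> \<phi> x = 0" by blast
 have K0: "K x = 0" if "norm x > R" for x by (rule C1_support_J[OF C supp that])
 let ?W = "\<lambda>K. LINT x:\<Omega>|lborel. bilin A x (J x) (K x) + g x \<bullet> K x"
 let ?D = "\<Omega> \<inter> cball 0 (R+1)"
 define B where "B = (LINT x:?D|lborel. M * norm (J x) + norm (g x))"
 have iD: "set_integrable lborel ?D (\<lambda>x. M * norm (J x) + norm (g x))"
  by (intro set_integral_add set_integrable_mult_right L2_loc_norm_integrable J g Om)
 have B0: "0 <= B" unfolding B_def set_lebesgue_integral_def using A(2) by (intro integral_nonneg_AE) auto
 have "\<bar>?W K\<bar> <= e * B" if e: "e > 0" for e
 proof -
  obtain \<psi> L where L: "C1 \<psi> L" "\<And>\<beta>. test_fun UNIV (\<lambda>x. \<psi> x $ \<beta>)"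
   "\<And>x. norm (L x - K x) <= e" "\<And>x. norm x > R + 1 ==> L x = 0"
   using mollify_C1[OF C supp e] by blast
  note cL = C1_continuous_J[OF L(1)] and cK = C1_continuous_J[OF C]
  note iL = weak_integrable[OF A Om J g cL L(4)] and iK = weak_integrable[OF A Om J g cK K0]
  have "?W L = 0"
  proof -
   have "(LINT x:\<Omega>|lborel. bilin A x (J x) (L x)) = - (LINT x:\<Omega>|lborel. (\<Sum>i\<in>UNIV. \<Sum>\<alpha>\<in>UNIV. g x $ \<alpha> $ i * L x $ \<alpha> $ i))"
   proof -
    have "grad \<psi> = L" using grad_C1[OF L(1)] by blast
    thus ?thesis using w L(2) unfolding weak_neumann_def by blast
   qed
   also have "(\<lambda>x. \<Sum>i\<in>UNIV. \<Sum>\<alpha>\<in>UNIV. g x $ \<alpha> $ i * L x $ \<alpha> $ i) = (\<lambda>x. g x \<bullet> L x)"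
    by (subst sum.swap) (simp add: inner_vec_def)
   finally show ?thesis using iL by (simp add: set_integral_add)
  qed
  moreover have "?W K - ?W L = (LINT x:\<Omega>|lborel. bilin A x (J x) (K x - L x) + g x \<bullet> (K x - L x))"
  proof -
   have "?W K - ?W L = (LINT x:\<Omega>|lborel. (bilin A x (J x) (K x) + g x \<bullet> K x) - (bilin A x (J x) (L x) + g x \<bullet> L x))"
    by (rule set_integral_diff(2)[OF set_integral_add(1)[OF iK] set_integral_add(1)[OF iL], symmetric])
   thus ?thesis by (simp add: bilin_diff_right inner_diff_right algebra_simps)
  qed
  moreover have "\<bar>LINT x:\<Omega>|lborel. bilin A x (J x) (K x - L x) + g x \<bullet> (K x - L x)\<bar> <= e * B"
  proof -
   let ?h = "\<lambda>x. indicator \<Omega> x *\<^sub>R (bilin A x (J x) (K x - L x) + g x \<bullet> (K x - L x))"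
   have ih: "integrable lborel ?h"
   proof -
    have "set_integrable lborel \<Omega> (\<lambda>x. (bilin A x (J x) (K x) + g x \<bullet> K x) - (bilin A x (J x) (L x) + g x \<bullet> L x))"
     by (rule set_integral_diff(1)[OF set_integral_add(1)[OF iK] set_integral_add(1)[OF iL]])
    thus ?thesis unfolding set_integrable_def by (simp add: bilin_diff_right inner_diff_right algebra_simps)
   qed
   have pt: "norm (?h x) <= e * (indicator ?D x *\<^sub>R (M * norm (J x) + norm (g x)))" for x
   proof (cases "norm x > R + 1")
    case True
    thus ?thesis using L(4)[of x] K0[of x] by (auto split: split_indicator)
   next
    case False
    have n: "norm (K x - L x) <= e" using L(3)[of x] by (simp add: norm_minus_commute)
    have "\<bar>bilin A x (J x) (K x - L x)\<bar> <= M * norm (J x) * norm (K x - L x)" using A unfolding coefs_def by blast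
    also have "... <= M * norm (J x) * e" by (rule mult_left_mono[OF n]) (use A(2) in simp)
    finally have 1: "\<bar>bilin A x (J x) (K x - L x)\<bar> <= M * norm (J x) * e" .
    have "\<bar>g x \<bullet> (K x - L x)\<bar> <= norm (g x) * norm (K x - L x)" by (rule Cauchy_Schwarz_ineq2)
    also have "... <= norm (g x) * e" by (rule mult_left_mono[OF n]) simp
    finally have 2: "\<bar>g x \<bullet> (K x - L x)\<bar> <= norm (g x) * e" .
    from 1 2 have "\<bar>bilin A x (J x) (K x - L x) + g x \<bullet> (K x - L x)\<bar> <= e * (M * norm (J x) + norm (g x))"
     by (simp add: algebra_simps)
    thus ?thesis using False by (auto split: split_indicator)
   qed
   have "norm (LINT x|lborel. ?h x) <= (LINT x|lborel. e * (indicator ?D x *\<^sub>R (M * norm (J x) + norm (g x))))"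
   proof (rule order_trans[OF integral_norm_bound integral_mono])
    show "integrable lborel (\<lambda>x. norm (?h x))" by (rule integrable_norm[OF ih])
    show "integrable lborel (\<lambda>x. e * (indicator ?D x *\<^sub>R (M * norm (J x) + norm (g x))))"
     using iD unfolding set_integrable_def by (rule integrable_mult_right)
   qed (rule pt)
   thus ?thesis by (simp add: B_def set_lebesgue_integral_def)
  qed
  ultimately show ?thesis by simp
 qed
 hence h: "\<bar>?W K\<bar> <= e * B" if "e > 0" for e using that by blast
 have "\<bar>?W K\<bar> <= 0"
 proof (rule field_le_epsilon)
  fix e :: real assume "0 < e"
  have "e / (B + 1) > 0" using \<open>0 < e\<close> B0 by simp
  from h[OF this] have "\<bar>?W K\<bar> <= e / (B + 1) * B" .
  also have "... <= e" using \<open>0 < e\<close> B0 by (simp add: field_simps)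
  finally show "\<bar>?W K\<bar> <= 0 + e" by simp
 qed
 thus "?W K = 0" by simp
qed

section \<open>The half-space and the corrected test function\<close>

text \<open>The inward direction is \<open>- n\<close>: for a unit normal, a step of length
  \<open>s\<close> along it raises the height by \<open>s\<close>. Normal segments are therefore
  written \<open>x + s *\<^sub>R (- n)\<close> throughout.\<close>

definition ht :: "real^'d::finite => real => real^'d => real" where
 "ht n a x = - a - x \<bullet> n"

definition proj :: "real^'d::finite => real^'d => real^'d" where
 "proj n y = y - (y \<bullet> n) *\<^sub>R n"

text \<open>The tangential part of a Jacobian, that is, \<open>J\<close> composed with
  \<open>proj n\<close>; see \<open>tang_mult\<close>.\<close>

definition tang :: "real^'d::finite => real^'d^'m::finite => real^'d^'m" where
 "tang n J = J - outer (J *v n) n"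

lemma halfspace_ht: "halfspace n a = {x. 0 < ht n a x}"
 by (auto simp: halfspace_def ht_def)

lemma ht_add: "ht n a (x + y) = ht n a x - y \<bullet> n"
 by (simp add: ht_def inner_add_left)

lemma ht_normal: "norm n = 1 ==> ht n a (x + s *\<^sub>R (- n)) = ht n a x + s"
 unfolding ht_add by (simp add: norm_eq_1)

lemma ht_cont [continuous_intros]: "continuous_on S f ==> continuous_on S (\<lambda>x. ht n a (f x))"
 unfolding ht_def by (intro continuous_intros)

lemma ht_meas [measurable]: "ht n a \<in> borel_measurable borel"
 by (rule borel_measurable_continuous_onI) (intro continuous_intros)

lemma ht_C1s: "C1s (\<lambda>x. ht n a x + c) (\<lambda>x. - n)"
 unfolding C1s_def ht_def by (auto intro!: derivative_eq_intros simp: inner_commute)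

lemma proj_inner: "norm n = 1 ==> proj n y \<bullet> n = 0"
 by (simp add: proj_def inner_diff_left dot_square_norm)

lemma proj_proj: "norm n = 1 ==> proj n (proj n y) = proj n y"
 using proj_inner[of n y] by (subst proj_def) simp

lemma norm_proj_le: assumes "norm n = 1" shows "norm (proj n y) <= norm y"
proof -
 have "(norm (proj n y))^2 = (norm y)^2 - (y \<bullet> n)^2"
  using assms unfolding proj_def power2_norm_eq_inner norm_eq_1
  by (simp add: inner_diff_left inner_diff_right inner_commute[of n y] power2_eq_square)
 hence "(norm (proj n y))^2 <= (norm y)^2" by simp
 thus ?thesis by (rule power2_le_imp_le) simp
qed

lemma tang_mult: "tang n J *v h = J *v proj n h"
 by (simp add: tang_def proj_def matrix_vector_mult_diff_rdistrib outer_mult_vec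
  matrix_vector_mult_diff_distrib matrix_vector_mult_scaleR inner_commute)

lemma bounded_linear_tang: "bounded_linear (tang n)"
proof (rule bounded_linear_intro[where K="1 + norm n * norm n"])
 show "tang n (x + y) = tang n x + tang n y" for x y :: "real^'a^'b"
  by (simp add: tang_def matrix_vector_mult_add_rdistrib outer_def vec_eq_iff algebra_simps)
 show "tang n (r *\<^sub>R x) = r *\<^sub>R tang n x" for x :: "real^'a^'b" and r
  by (simp add: tang_def scaleR_matrix_vector_assoc[symmetric] outer_def vec_eq_iff algebra_simps)
 show "norm (tang n x) <= norm x * (1 + norm n * norm n)" for x :: "real^'a^'b"
 proof -
  have "norm (tang n x) <= norm x + norm (outer (x *v n) n)" unfolding tang_def by (rule norm_triangle_ineq4)
  also have "... <= norm x + norm x * norm n * norm n"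
   using mult_right_mono[OF norm_mult_vec_le[of x n] norm_ge_zero[of n]] by simp
  finally show ?thesis by (simp add: algebra_simps)
 qed
qed

lemma nn_swap:
 fixes f :: "'a::euclidean_space => 'b::euclidean_space => ennreal"
 assumes "(\<lambda>(x,y). f x y) \<in> borel_measurable (borel \<Otimes>\<^sub>M borel)"
 shows "(\<integral>\<^sup>+x. (\<integral>\<^sup>+y. f x y \<partial>lborel) \<partial>lborel) = (\<integral>\<^sup>+y. (\<integral>\<^sup>+x. f x y \<partial>lborel) \<partial>lborel)"
 by (rule lborel_pair.Fubini'[symmetric]) (use assms in simp)

text \<open>Tonelli, together with the observation that a fixed point is met only for
  \<open>s\<close> in an interval of length \<open>l\<close>, because the starting point of the
  segment has to lie in a slab of height \<open>l\<close>. The factor is therefore the height of the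
  slab and not the length of the segments; this is where thin layers gain.\<close>

lemma fubini_normal:
 fixes n :: "real^'d::finite"
 assumes n: "norm n = 1" and h[measurable]: "h \<in> borel_measurable borel" and [measurable]: "S \<in> sets borel" "S' \<in> sets borel"
  and l: "0 <= l" and S: "\<And>x. x \<in> S ==> 0 < ht n a x \<and> ht n a x < l"
  and S': "\<And>x s. x \<in> S ==> 0 <= s ==> s <= r ==> x + s *\<^sub>R (- n) \<in> S'"
 shows "(\<integral>\<^sup>+x\<in>S. (\<integral>\<^sup>+s\<in>{0..r}. h (x + s *\<^sub>R (- n)) \<partial>lborel) \<partial>lborel) <= ennreal l * (\<integral>\<^sup>+x\<in>S'. h x \<partial>lborel)"
proof -
 let ?f = "\<lambda>x s. h (x + s *\<^sub>R (- n)) * indicator {0..r} s * indicator S x"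
 let ?g = "\<lambda>x s. h x * indicator {0..r} s * indicator S (x + s *\<^sub>R n)"
 have mf: "(\<lambda>(x,s). ?f x s) \<in> borel_measurable (borel \<Otimes>\<^sub>M borel)" by measurable
 have mg: "(\<lambda>(x,s). ?g x s) \<in> borel_measurable (borel \<Otimes>\<^sub>M borel)" by measurable
 have "(\<integral>\<^sup>+x\<in>S. (\<integral>\<^sup>+s\<in>{0..r}. h (x + s *\<^sub>R (- n)) \<partial>lborel) \<partial>lborel) = (\<integral>\<^sup>+x. (\<integral>\<^sup>+s. ?f x s \<partial>lborel) \<partial>lborel)"
  by (intro nn_integral_cong) (subst nn_integral_multc[symmetric]; simp)
 also have "... = (\<integral>\<^sup>+s. (\<integral>\<^sup>+x. ?f x s \<partial>lborel) \<partial>lborel)" by (rule nn_swap[OF mf])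
 also have "... = (\<integral>\<^sup>+s. (\<integral>\<^sup>+x. ?g x s \<partial>lborel) \<partial>lborel)"
 proof (rule nn_integral_cong)
  fix s :: real
  have "(\<integral>\<^sup>+x. ?f x s \<partial>lborel) = (\<integral>\<^sup>+x. ?f (x + s *\<^sub>R n) s \<partial>lborel)"
   by (rule nn_integral_shift[symmetric]) measurable
  thus "(\<integral>\<^sup>+x. ?f x s \<partial>lborel) = (\<integral>\<^sup>+x. ?g x s \<partial>lborel)" by simp
 qed
 also have "... = (\<integral>\<^sup>+x. (\<integral>\<^sup>+s. ?g x s \<partial>lborel) \<partial>lborel)" by (rule nn_swap[OF mg, symmetric])
 also have "... <= (\<integral>\<^sup>+x. ennreal l * (h x * indicator S' x) \<partial>lborel)"
 proof (rule nn_integral_mono)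
  fix x
  have "(\<integral>\<^sup>+s. ?g x s \<partial>lborel) <= (\<integral>\<^sup>+s. h x * indicator S' x * indicator {ht n a x - l..ht n a x} s \<partial>lborel)"
  proof (rule nn_integral_mono)
   fix s :: real
   have "x \<in> S'" "s \<in> {ht n a x - l..ht n a x}" if "x + s *\<^sub>R n \<in> S" "s \<in> {0..r}"
   proof -
    show "x \<in> S'" using S'[OF that(1), of s] that(2) by simp
    have "ht n a (x + s *\<^sub>R n) = ht n a x - s" using n by (simp add: ht_add dot_square_norm)
    thus "s \<in> {ht n a x - l..ht n a x}" using S[OF that(1)] by auto
   qed
   thus "?g x s <= h x * indicator S' x * indicator {ht n a x - l..ht n a x} s"
    by (auto split: split_indicator)
  qed
  also have "... = h x * indicator S' x * ennreal l" using l by (subst nn_integral_cmult) auto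
  finally show "(\<integral>\<^sup>+s. ?g x s \<partial>lborel) <= ennreal l * (h x * indicator S' x)" by (simp add: mult_ac)
 qed
 also have "... = ennreal l * (\<integral>\<^sup>+x\<in>S'. h x \<partial>lborel)" by (rule nn_integral_cmult) measurable
 finally show ?thesis .
qed

text \<open>The pointwise bound of \<open>C1_increment_sq_le\<close>, integrated. For each
  \<open>s\<close> the translation is undone inside the integral over \<open>x\<close>, which is
  possible because the segments stay in \<open>S'\<close>.\<close>

lemma increment_integral_le:
 fixes v :: "real^'d::finite => real^'m::finite"
 assumes C: "C1 v J" and [measurable]: "S \<in> sets borel" "S' \<in> sets borel"
  and S': "\<And>x s. x \<in> S ==> 0 <= s ==> s <= 1 ==> x + s *\<^sub>R z \<in> S'"
 shows "(\<integral>\<^sup>+x\<in>S. nsq (v (x + z) - v x) \<partial>lborel) <= nsq z * (\<integral>\<^sup>+x\<in>S'. nsq (J x) \<partial>lborel)"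
proof -
 have [measurable]: "J \<in> borel_measurable borel" by (rule C1_measurable_J[OF C])
 let ?h = "\<lambda>x. nsq (J x)"
 let ?f = "\<lambda>x s. ?h (x + s *\<^sub>R z) * indicator {0..1::real} s * indicator S x"
 have mf: "(\<lambda>(x,s). ?f x s) \<in> borel_measurable (borel \<Otimes>\<^sub>M borel)" by measurable
 have "(\<integral>\<^sup>+x\<in>S. nsq (v (x + z) - v x) \<partial>lborel) <= (\<integral>\<^sup>+x. nsq z * (\<integral>\<^sup>+s. ?f x s \<partial>lborel) \<partial>lborel)"
 proof (rule nn_integral_mono)
  fix x
  have "(\<integral>\<^sup>+s. ?f x s \<partial>lborel) = (\<integral>\<^sup>+s\<in>{0..1}. ?h (x + s *\<^sub>R z) \<partial>lborel) * indicator S x"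
   by (rule nn_integral_multc) measurable
  thus "nsq (v (x + z) - v x) * indicator S x <= nsq z * (\<integral>\<^sup>+s. ?f x s \<partial>lborel)"
   using C1_increment_sq_le[OF C, of 1 x z] by (auto split: split_indicator)
 qed
 also have "... = nsq z * (\<integral>\<^sup>+x. (\<integral>\<^sup>+s. ?f x s \<partial>lborel) \<partial>lborel)"
  by (rule nn_integral_cmult) measurable
 also have "(\<integral>\<^sup>+x. (\<integral>\<^sup>+s. ?f x s \<partial>lborel) \<partial>lborel) = (\<integral>\<^sup>+s. (\<integral>\<^sup>+x. ?f x s \<partial>lborel) \<partial>lborel)" by (rule nn_swap[OF mf])
 also have "... <= (\<integral>\<^sup>+s. (\<integral>\<^sup>+x\<in>S'. ?h x \<partial>lborel) * indicator {0..1::real} s \<partial>lborel)"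
 proof (rule nn_integral_mono)
  fix s :: real
  have "(\<integral>\<^sup>+x. ?f x s \<partial>lborel) <= (\<integral>\<^sup>+x. ?h (x + s *\<^sub>R z) * indicator S' (x + s *\<^sub>R z) * indicator {0..1::real} s \<partial>lborel)"
   by (intro nn_integral_mono) (use S' in \<open>auto split: split_indicator\<close>)
  also have "... = (\<integral>\<^sup>+x. ?h (x + s *\<^sub>R z) * indicator S' (x + s *\<^sub>R z) \<partial>lborel) * indicator {0..1::real} s"
   by (rule nn_integral_multc) measurable
  also have "(\<integral>\<^sup>+x. ?h (x + s *\<^sub>R z) * indicator S' (x + s *\<^sub>R z) \<partial>lborel) = (\<integral>\<^sup>+x\<in>S'. ?h x \<partial>lborel)"
   by (rule nn_integral_shift) measurable
  finally show "(\<integral>\<^sup>+x. ?f x s \<partial>lborel) <= (\<integral>\<^sup>+x\<in>S'. ?h x \<partial>lborel) * indicator {0..1::real} s" .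
 qed
 also have "... = (\<integral>\<^sup>+x\<in>S'. ?h x \<partial>lborel)" by (subst nn_integral_cmult) auto
 finally show ?thesis by (simp add: mult_left_mono)
qed

text \<open>By translation invariance, the integral of \<open>F (x + y)\<close> over
  \<open>y\<close> is constant in \<open>x\<close> near 0; differentiating it under the integral
  sign gives the claim. This is the form of integration by parts used below.\<close>

lemma integral_J_zero:
 fixes F :: "real^'d::finite => real^'m::finite"
 assumes C: "C1 F K" and supp: "\<And>x. norm x > R ==> F x = 0"
 shows "integrable lborel K" "(LINT y|lborel. K y) = 0"
proof -
 have K0: "K x = 0" if "norm x > R" for x by (rule C1_support_J[OF C supp that])
 note cF = C1_continuous[OF C] and cK = C1_continuous_J[OF C]
 have "integrable lborel (\<lambda>x. indicator (cball 0 R) x *\<^sub>R K x)"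
  by (rule borel_integrable_compact) (auto intro: continuous_on_subset[OF cK])
 moreover have "(\<lambda>x. indicator (cball 0 R) x *\<^sub>R K x) = K"
  using K0 by (auto simp: fun_eq_iff not_le split: split_indicator)
 ultimately show iK: "integrable lborel K" by simp
 \<comment> \<open>The radius \<open>R + 1\<close> leaves room for shifts \<open>x\<close> of length
   less than 1, so that cutting the integral off does not change it.\<close>
 let ?w = "indicator (cball (0::real^'d) (R+1)) :: real^'d => real"
 let ?U = "\<lambda>x. LINT y|lborel. ?w y *\<^sub>R F (x + y)"
 let ?UJ = "\<lambda>x. LINT y|lborel. ?w y *\<^sub>R K (x + y)"
 have CU: "C1 ?U ?UJ"
 proof (rule C1_param_integral[of "cball 0 (R+1)"])
  show "integrable lborel ?w"
   using borel_integrable_compact[of "cball (0::real^'d) (R+1)" "\<lambda>_. 1::real"] by simp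
  show "continuous_on (UNIV \<times> cball 0 (R+1)) (\<lambda>(x, y). F (x + y))"
   unfolding case_prod_unfold by (intro cont_comp[OF cF] continuous_intros)
  show "continuous_on (UNIV \<times> cball 0 (R+1)) (\<lambda>(x, y). K (x + y))"
   unfolding case_prod_unfold by (intro cont_comp[OF cK] continuous_intros)
  show "((\<lambda>x. F (x + p)) has_derivative (*v) (K (x + p))) (at x)" for x p
   using C1_shift[OF C, of p] unfolding C1_def by blast
 qed auto
 have eq: "?U x = (LINT y|lborel. F y)" if "x \<in> ball 0 1" for x
 proof -
  have "F (x + y) = 0" if "y \<notin> cball 0 (R+1)" for y
  proof (rule supp)
   have "norm y <= norm (x + y) + norm x" by (metis add_diff_cancel_left' norm_triangle_ineq4)
   thus "R < norm (x + y)" using that \<open>x \<in> ball 0 1\<close> by simp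
  qed
  hence "(\<lambda>y. ?w y *\<^sub>R F (x + y)) = (\<lambda>y. F (y + x))" by (auto simp: fun_eq_iff add.commute split: split_indicator)
  thus ?thesis using integral_shift[of F x] borel_measurable_continuous_onI[OF cF] by simp
 qed
 have "C1 (\<lambda>x. LINT y|lborel. F y) (\<lambda>x. 0)" by (simp add: C1_def)
 from C1_diff[OF CU this] have "?UJ 0 - 0 = 0"
  by (rule C1_zero_on_open[of _ _ "ball 0 1"]) (use eq in auto)
 moreover have "(\<lambda>y. ?w y *\<^sub>R K (0 + y)) = K" using K0 by (auto simp: fun_eq_iff split: split_indicator)
 ultimately show "(LINT y|lborel. K y) = 0" by simp
qed

section \<open>Tangential averages and the corrector\<close>

lemma C1_proj:
 assumes C: "C1 v J" shows "C1 (\<lambda>y. v (x + r *\<^sub>R proj n y)) (\<lambda>y. r *\<^sub>R tang n (J (x + r *\<^sub>R proj n y)))"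
 unfolding C1_def
proof safe
 have cp: "continuous_on UNIV (\<lambda>y. x + r *\<^sub>R proj n y)" unfolding proj_def by (intro continuous_intros)
 show "continuous_on UNIV (\<lambda>y. r *\<^sub>R tang n (J (x + r *\<^sub>R proj n y)))"
  unfolding tang_def by (intro continuous_intros cont_comp[OF C1_continuous_J[OF C]] cp)
 fix y
 have 1: "(v has_derivative (\<lambda>k. J (x + r *\<^sub>R proj n y) *v k)) (at (x + r *\<^sub>R proj n y))" using C unfolding C1_def by blast
 have 2: "((\<lambda>y. x + r *\<^sub>R proj n y) has_derivative (\<lambda>k. r *\<^sub>R proj n k)) (at y)"
  unfolding proj_def by (auto intro!: derivative_eq_intros)
 from has_derivative_compose[OF 2 1]
 show "((\<lambda>y. v (x + r *\<^sub>R proj n y)) has_derivative (*v) (r *\<^sub>R tang n (J (x + r *\<^sub>R proj n y)))) (at y)"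
  by (rule has_derivative_eq_rhs) (auto simp: fun_eq_iff scaleR_matrix_vector_assoc[symmetric] tang_mult matrix_vector_mult_scaleR)
qed

text \<open>The averaging variable runs over the full unit ball and is then projected to the
  tangential directions. This gives a weighted tangential average without a measure on the
  hyperplane, and Tonelli applies in \<open>y\<close> with respect to Lebesgue measure.\<close>

definition theta :: "real^'d::finite => real => (real^'d => real^'m::finite) => real^'d => ennreal" where
 "theta n \<rho> v x = (\<integral>\<^sup>+y\<in>cball 0 1. nsq (v (x + \<rho> *\<^sub>R proj n y) - v x) \<partial>lborel)"

lemma compact_support_bound:
 fixes f :: "real^'d::finite => 'b::real_normed_vector"
 assumes "continuous_on UNIV f" "\<And>x. norm x > R ==> f x = 0"
 shows "\<exists>B>0. \<forall>x. norm (f x) <= B"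
proof -
 have "bounded (f ` cball 0 R)"
  by (rule compact_imp_bounded[OF compact_continuous_image[OF continuous_on_subset[OF assms(1)]]]) auto
 then obtain B where B: "0 < B" "\<forall>y\<in>f ` cball 0 R. norm y <= B" unfolding bounded_pos by blast
 have "norm (f x) <= B" for x using B assms(2)[of x] by (cases "norm x > R") auto
 thus ?thesis using B(1) by blast
qed

lemma weighted_ball_integral_bound:
 fixes f :: "real^'d::finite => real^'m::finite" and c :: "real^'d => real"
 assumes c: "continuous_on UNIV c" "\<And>y. \<bar>c y\<bar> <= B" and f: "continuous_on UNIV f"
  and supp: "\<And>y. norm y > 1 ==> c y = 0"
 shows "nsq (LINT y|lborel. c y *\<^sub>R f y)
  <= ennreal (measure lborel (cball 0 1 :: (real^'d) set) * B^2) * (\<integral>\<^sup>+y\<in>cball 0 1. nsq (f y) \<partial>lborel)"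
proof -
 let ?S = "cball 0 1 :: (real^'d) set"
 have B: "0 <= B" using c(2)[of 0] by linarith
 have "(LINT y|lborel. c y *\<^sub>R f y) = (LINT y:?S|lborel. c y *\<^sub>R f y)"
  unfolding set_lebesgue_integral_def
  by (rule Bochner_Integration.integral_cong[OF refl]) (use supp in \<open>auto simp: not_le split: split_indicator\<close>)
 moreover have "set_integrable lborel ?S (\<lambda>y. c y *\<^sub>R f y)"
  unfolding set_integrable_def
  by (rule borel_integrable_compact) (auto intro!: continuous_intros continuous_on_subset[OF c(1)] continuous_on_subset[OF f])
 ultimately have "nsq (LINT y|lborel. c y *\<^sub>R f y) <= emeasure lborel ?S * (\<integral>\<^sup>+y\<in>?S. nsq (c y *\<^sub>R f y) \<partial>lborel)"
  using sq_norm_set_integral_le[of lborel ?S "\<lambda>y. c y *\<^sub>R f y"] by (simp del: norm_scaleR)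
 also have "... <= emeasure lborel ?S * (\<integral>\<^sup>+y. ennreal (B^2) * (nsq (f y) * indicator ?S y) \<partial>lborel)"
 proof (intro mult_left_mono nn_integral_mono)
  fix y
  have "(norm (c y *\<^sub>R f y))^2 <= B^2 * (norm (f y))^2"
   using c(2)[of y] B by (simp add: power_mult_distrib mult_right_mono abs_le_square_iff[symmetric])
  thus "nsq (c y *\<^sub>R f y) * indicator ?S y <= ennreal (B^2) * (nsq (f y) * indicator ?S y)"
   by (auto split: split_indicator simp: ennreal_mult[symmetric] simp del: norm_scaleR intro!: ennreal_leI)
 qed auto
 also have "... = emeasure lborel ?S * (ennreal (B^2) * (\<integral>\<^sup>+y\<in>?S. nsq (f y) \<partial>lborel))"
 proof -
  have [measurable]: "f \<in> borel_measurable borel" by (rule borel_measurable_continuous_onI[OF f])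
  have [measurable]: "?S \<in> sets borel" by simp
  have m: "(\<lambda>y. nsq (f y) * indicator ?S y) \<in> borel_measurable lborel" by measurable
  show ?thesis unfolding nn_integral_cmult[OF m] ..
 qed
 also have "emeasure lborel ?S = ennreal (measure lborel ?S)"
  by (rule emeasure_eq_ennreal_measure) (use emeasure_lborel_cball_finite[of "0::real^'d" 1] in \<open>simp add: less_top[symmetric]\<close>)
 finally show ?thesis by (simp add: ennreal_mult mult.assoc)
qed

text \<open>\<open>w\<close> is the tangential mollification of \<open>v\<close> at scale
  \<open>\<rho>\<close>. A tangential derivative of \<open>w\<close> can be put on the kernel at the
  price of \<open>1 / \<rho>\<close>; the value \<open>v x\<close> may be subtracted beforehand, so
  both bounds involve only the oscillation \<open>theta\<close>. Normal derivatives gain nothing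
  from such an average, hence the operator \<open>tang\<close>.\<close>

lemma tangential_average:
 "\<exists>C>0. \<forall>(n::real^'d::finite) \<rho> (v::real^'d => real^'m::finite) J. norm n = 1 --> 0 < \<rho> --> C1 v J -->
  (\<exists>w W. C1 w W \<and> (\<forall>x. nsq (v x - w x) <= ennreal C * theta n \<rho> v x) \<and>
   (\<forall>x. nsq (tang n (W x)) <= ennreal (C / \<rho>^2) * theta n \<rho> v x))"
proof -
 let ?k = "molli 1 :: real^'d => real"
 obtain G where G: "C1s ?k G" by (rule smooth_class_C1s[OF molli_class[of 1]]) blast
 have k0: "?k y = 0" if "norm y > 1" for y using molli_eq_0[of 1 y] that by simp
 have G0: "G y = 0" if "norm y > 1" for y
 proof -
  have "(?k has_derivative (\<lambda>h. G y \<bullet> h)) (at y)" using G unfolding C1s_def by blast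
  moreover have "(?k has_derivative (\<lambda>h. 0)) (at y)"
  proof (rule has_derivative_transform_within_open[OF has_derivative_const])
   show "open {x::real^'d. norm x > 1}" by (rule open_Collect_less) (auto intro!: continuous_intros)
  qed (use that k0 in auto)
  ultimately have "(\<lambda>h. G y \<bullet> h) = (\<lambda>h. 0)" by (rule has_derivative_unique)
  from fun_cong[OF this, of "G y"] have "G y \<bullet> G y = 0" .
  thus ?thesis by simp
 qed
 obtain B0 where B0: "0 < B0" "\<And>y. norm (?k y) <= B0"
  using compact_support_bound[OF C1s_continuous[OF G] k0] by blast
 obtain B1 where B1: "0 < B1" "\<And>y. norm (G y) <= B1"
  using compact_support_bound[OF C1s_continuous_g[OF G] G0] by blast
 define V where "V = measure lborel (cball 0 1 :: (real^'d) set)"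
 define N where "N = real CARD('d)"
 \<comment> \<open>The first summand serves \<open>v - w\<close>, the second one the tangential
   gradient; there \<open>N^2\<close> is the cost of passing from single columns to the whole
   matrix.\<close>
 define C where "C = V * B0^2 + N^2 * (V * B1^2) + 1"
 have V0: "0 <= V" by (simp add: V_def)
 have C0: "0 < C" using V0 by (simp add: C_def add_nonneg_pos)
 have ik: "integrable lborel ?k" by (rule molli_integrable) simp
 show ?thesis
 proof (intro exI[of _ C] conjI C0 allI impI)
  fix n :: "real^'d" and \<rho> :: real and v :: "real^'d => real^'m" and J
  assume n: "norm n = 1" and r: "0 < \<rho>" and C: "C1 v J"
  note cv = C1_continuous[OF C] and cJ = C1_continuous_J[OF C]
  have cp: "continuous_on S (\<lambda>z. f z + \<rho> *\<^sub>R proj n (g z))" if "continuous_on S f" "continuous_on S g" for S :: "'z::topological_space set" and f g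
   unfolding proj_def by (intro continuous_intros that)
  define w where "w x = (LINT y|lborel. ?k y *\<^sub>R v (x + \<rho> *\<^sub>R proj n y))" for x
  define W where "W x = (LINT y|lborel. ?k y *\<^sub>R J (x + \<rho> *\<^sub>R proj n y))" for x
  have Cw: "C1 w W" unfolding w_def W_def
  proof (rule C1_param_integral[of "cball 0 1"])
   show "continuous_on (UNIV \<times> cball 0 1) (\<lambda>(x, y). v (x + \<rho> *\<^sub>R proj n y))"
    unfolding case_prod_unfold by (intro cont_comp[OF cv] cp continuous_intros)
   show "continuous_on (UNIV \<times> cball 0 1) (\<lambda>(x, y). J (x + \<rho> *\<^sub>R proj n y))"
    unfolding case_prod_unfold by (intro cont_comp[OF cJ] cp continuous_intros)
   show "((\<lambda>x. v (x + \<rho> *\<^sub>R proj n y)) has_derivative (*v) (J (x + \<rho> *\<^sub>R proj n y))) (at x)" for x y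
    using C1_shift[OF C, of "\<rho> *\<^sub>R proj n y"] unfolding C1_def by blast
  qed (use k0 ik in auto)
  let ?d = "\<lambda>x y. v (x + \<rho> *\<^sub>R proj n y) - v x"
  have cd: "continuous_on UNIV (?d x)" for x by (intro continuous_intros cont_comp[OF cv] cp)
  have int_v: "integrable lborel (\<lambda>y. ?k y *\<^sub>R v (x + \<rho> *\<^sub>R proj n y))" for x
  proof (rule integrable_weight_continuous[of "cball 0 1"])
   show "continuous_on (cball 0 1) (\<lambda>y. v (x + \<rho> *\<^sub>R proj n y))" by (intro cont_comp[OF cv] cp continuous_intros)
  qed (use k0 ik in auto)
  have int_J: "integrable lborel (\<lambda>y. ?k y *\<^sub>R J (x + \<rho> *\<^sub>R proj n y))" for x
  proof (rule integrable_weight_continuous[of "cball 0 1"])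
   show "continuous_on (cball 0 1) (\<lambda>y. J (x + \<rho> *\<^sub>R proj n y))" by (intro cont_comp[OF cJ] cp continuous_intros)
  qed (use k0 ik in auto)
  have i1: "integrable lborel (\<lambda>y. ?k y *\<^sub>R v x)" for x using ik by auto
  have dif: "w x - v x = (LINT y|lborel. ?k y *\<^sub>R ?d x y)" for x
  proof -
   have "(LINT y|lborel. ?k y *\<^sub>R v x) = v x" using molli_integral[of 1, where 'd='d] ik by simp
   thus ?thesis using int_v[of x] i1[of x] by (simp add: w_def scaleR_diff_right)
  qed
  have P1: "nsq (v x - w x) <= ennreal C * theta n \<rho> v x" for x
  proof -
   have "nsq (w x - v x) <= ennreal (V * B0^2) * theta n \<rho> v x"
    unfolding dif V_def theta_def
    by (rule weighted_ball_integral_bound) (use C1s_continuous[OF G] B0 cd k0 in auto)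
   also have "... <= ennreal C * theta n \<rho> v x"
    using V0 by (intro mult_right_mono ennreal_leI) (auto simp: C_def)
   finally show ?thesis by (simp add: norm_minus_commute)
  qed
  have col: "nsq (tang n (W x) *v axis i 1) <= ennreal (V * B1^2 / \<rho>^2) * theta n \<rho> v x" for x i
  proof -
   \<comment> \<open>By \<open>tang_mult\<close>, the column of \<open>tang n (W x)\<close> with
     index \<open>i\<close> is \<open>W x *v e\<close>, and \<open>e\<close> is fixed by
     \<open>proj n\<close>.\<close>
   define e where "e = proj n (axis i 1)"
   have pe: "proj n e = e" by (simp add: e_def proj_proj n)
   have ne: "norm e <= 1" using norm_proj_le[OF n, of "axis i 1"] by (simp add: e_def norm_axis_1)
   \<comment> \<open>The derivative of \<open>?F\<close> in the direction \<open>e\<close>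
     integrates to zero. This is the integration by parts that trades the derivative
     \<open>W x *v e\<close>, times \<open>\<rho>\<close>, for the gradient \<open>G\<close> of the
     kernel against the increment of \<open>v\<close>.\<close>
   let ?F = "\<lambda>y. ?k y *\<^sub>R ?d x y"
   let ?K = "\<lambda>y. ?k y *\<^sub>R (\<rho> *\<^sub>R tang n (J (x + \<rho> *\<^sub>R proj n y)) - 0) + outer (?d x y) (G y)"
   have CF: "C1 ?F ?K"
    by (rule C1_scale[OF G C1_diff[OF C1_proj[OF C]]]) (simp add: C1_def)
   have z: "integrable lborel ?K" "(LINT y|lborel. ?K y) = 0"
    using integral_J_zero[OF CF, of 1] k0 by auto
   have "0 = (LINT y|lborel. ?K y) *v e" using z(2) by simp
   also have "... = (LINT y|lborel. ?K y *v e)"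
    by (rule integral_bounded_linear[OF bounded_linear_mult_vec_left z(1), symmetric])
   also have "... = (LINT y|lborel. \<rho> *\<^sub>R (?k y *\<^sub>R J (x + \<rho> *\<^sub>R proj n y) *v e) + (G y \<bullet> e) *\<^sub>R ?d x y)"
    by (rule Bochner_Integration.integral_cong[OF refl])
     (simp add: matrix_vector_mult_add_rdistrib outer_mult_vec scaleR_matrix_vector_assoc[symmetric] tang_mult pe mult.commute)
   also have "... = (LINT y|lborel. \<rho> *\<^sub>R (?k y *\<^sub>R J (x + \<rho> *\<^sub>R proj n y) *v e)) + (LINT y|lborel. (G y \<bullet> e) *\<^sub>R ?d x y)"
   proof (rule Bochner_Integration.integral_add)
    show "integrable lborel (\<lambda>y. \<rho> *\<^sub>R (?k y *\<^sub>R J (x + \<rho> *\<^sub>R proj n y) *v e))"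
     using integrable_bounded_linear[OF bounded_linear_mult_vec_left int_J[of x]] by simp
    have "integrable lborel (\<lambda>y. indicator (cball 0 1) y *\<^sub>R ((G y \<bullet> e) *\<^sub>R ?d x y))"
     by (rule borel_integrable_compact)
      (auto intro!: continuous_intros continuous_on_subset[OF cd] continuous_on_subset[OF C1s_continuous_g[OF G]])
    moreover have "(\<lambda>y. indicator (cball 0 1) y *\<^sub>R ((G y \<bullet> e) *\<^sub>R ?d x y)) = (\<lambda>y. (G y \<bullet> e) *\<^sub>R ?d x y)"
     using G0 by (auto simp: fun_eq_iff not_le split: split_indicator)
    ultimately show "integrable lborel (\<lambda>y. (G y \<bullet> e) *\<^sub>R ?d x y)" by simp
   qed
   also have "(LINT y|lborel. \<rho> *\<^sub>R (?k y *\<^sub>R J (x + \<rho> *\<^sub>R proj n y) *v e)) = \<rho> *\<^sub>R (W x *v e)"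
    using integral_bounded_linear[OF bounded_linear_mult_vec_left int_J[of x], of e] by (simp add: W_def)
   finally have "\<rho> *\<^sub>R (W x *v e) = - (LINT y|lborel. (G y \<bullet> e) *\<^sub>R ?d x y)" by (simp add: eq_neg_iff_add_eq_0)
   hence "norm (\<rho> *\<^sub>R (W x *v e)) = norm (LINT y|lborel. (G y \<bullet> e) *\<^sub>R ?d x y)" by (simp only: norm_minus_cancel)
   hence "\<rho> * norm (W x *v e) = norm (LINT y|lborel. (G y \<bullet> e) *\<^sub>R ?d x y)" using r by simp
   hence "\<rho>^2 * (norm (W x *v e))^2 = (norm (LINT y|lborel. (G y \<bullet> e) *\<^sub>R ?d x y))^2"
    by (simp only: power_mult_distrib[symmetric])
   hence "(norm (W x *v e))^2 = (norm (LINT y|lborel. (G y \<bullet> e) *\<^sub>R ?d x y))^2 * (1 / \<rho>^2)" using r by (simp add: field_simps)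
   hence "nsq (W x *v e) = nsq (LINT y|lborel. (G y \<bullet> e) *\<^sub>R ?d x y) * ennreal (1 / \<rho>^2)"
    by (simp add: ennreal_mult[symmetric])
   also have "... <= (ennreal (V * B1^2) * theta n \<rho> v x) * ennreal (1 / \<rho>^2)"
   proof (rule mult_right_mono)
    show "nsq (LINT y|lborel. (G y \<bullet> e) *\<^sub>R ?d x y) <= ennreal (V * B1^2) * theta n \<rho> v x"
     unfolding V_def theta_def
    proof (rule weighted_ball_integral_bound)
     show "\<bar>G y \<bullet> e\<bar> <= B1" for y
      using Cauchy_Schwarz_ineq2[of "G y" e] B1(2)[of y] ne B1(1) mult_mono[of "norm (G y)" B1 "norm e" 1] by simp
    qed (use G0 cd in \<open>auto intro!: continuous_intros C1s_continuous_g[OF G]\<close>)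
   qed simp
   also have "... = ennreal (V * B1^2 / \<rho>^2) * theta n \<rho> v x"
   proof -
    have "ennreal (V * B1^2 / \<rho>^2) = ennreal (V * B1^2) * ennreal (1 / \<rho>^2)"
     using V0 by (subst ennreal_mult[symmetric]) auto
    thus ?thesis by (simp add: mult_ac)
   qed
   finally show ?thesis by (simp add: tang_mult e_def)
  qed
  have P2: "nsq (tang n (W x)) <= ennreal (C / \<rho>^2) * theta n \<rho> v x" for x
  proof -
   let ?c = "\<lambda>i. norm (tang n (W x) *v axis i 1)"
   have "(norm (tang n (W x)))^2 <= (\<Sum>i\<in>UNIV. ?c i)^2"
    by (intro power_mono norm_matrix_le_columns) simp
   also have "... <= N * (\<Sum>i\<in>UNIV. (?c i)^2)"
    using Cauchy_Schwarz_ineq_sum[of "\<lambda>_. 1" ?c UNIV] by (simp add: N_def)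
   finally have "nsq (tang n (W x)) <= ennreal N * (\<Sum>i\<in>UNIV. ennreal ((?c i)^2))"
    by (simp add: ennreal_mult[symmetric] sum_nonneg N_def ennreal_leI)
   also have "... <= ennreal N * (\<Sum>i\<in>(UNIV::'d set). ennreal (V * B1^2 / \<rho>^2) * theta n \<rho> v x)"
    by (intro mult_left_mono sum_mono col) simp
   also have "... = ennreal (N * (N * (V * B1^2 / \<rho>^2))) * theta n \<rho> v x"
   proof -
    have "0 <= V * B1^2 / \<rho>^2" using V0 by simp
    thus ?thesis by (simp only: N_def ennreal_mult ennreal_of_nat_eq_real_of_nat mult.assoc sum_constant of_nat_0_le_iff mult_nonneg_nonneg)
   qed
   also have "... <= ennreal (C / \<rho>^2) * theta n \<rho> v x"
   proof (intro mult_right_mono ennreal_leI)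
    have "N * (N * (V * B1^2 / \<rho>^2)) = N^2 * (V * B1^2) / \<rho>^2" by (simp add: power2_eq_square)
    also have "... <= C / \<rho>^2" using V0 by (intro divide_right_mono) (auto simp: C_def)
    finally show "N * (N * (V * B1^2 / \<rho>^2)) <= C / \<rho>^2" .
   qed simp
   finally show ?thesis .
  qed
  show "\<exists>w W. C1 w W \<and> (\<forall>x. nsq (v x - w x) <= ennreal C * theta n \<rho> v x) \<and>
   (\<forall>x. nsq (tang n (W x)) <= ennreal (C / \<rho>^2) * theta n \<rho> v x)"
   using Cw P1 P2 by blast
 qed
qed

text \<open>With \<open>q = s / \<rho>\<close> this is \<open>30 / \<rho>\<close> times the square
  of \<open>(q - 1) * (2 - q)\<close> for \<open>1 < q < 2\<close>, and 0 elsewhere; 30 is the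
  reciprocal of the integral of that square over [1, 2], so the kernel has mass one. The square of a
  positive part is continuously differentiable, which is the regularity that the corrector asks
  for.\<close>

definition kk :: "real => real => real" where
 "kk \<rho> s = 30 / \<rho> * (max 0 ((s / \<rho> - 1) * (2 - s / \<rho>)))^2"

definition kk' :: "real => real => real" where
 "kk' \<rho> s = 30 / \<rho> * (2 * max 0 ((s / \<rho> - 1) * (2 - s / \<rho>)) * ((3 - 2 * (s / \<rho>)) / \<rho>))"

lemma posq_deriv: "((\<lambda>s::real. (max 0 s)^2) has_real_derivative 2 * max 0 s) (at s)"
proof -
 consider "s > 0" | "s < 0" | "s = 0" by linarith
 thus ?thesis
 proof cases
  case 1
  have "((\<lambda>s::real. s^2) has_real_derivative 2 * max 0 s) (at s)"
   using 1 by (auto intro!: derivative_eq_intros)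
  thus ?thesis
   by (rule has_field_derivative_transform_within_open[where S="{0<..}"]) (use 1 in auto)
 next
  case 2
  have "((\<lambda>s::real. 0) has_real_derivative 2 * max 0 s) (at s)" using 2 by simp
  thus ?thesis
   by (rule has_field_derivative_transform_within_open[where S="{..<0}"]) (use 2 in auto)
 next
  case 3
  have "((\<lambda>h::real. (max 0 h)^2 / h) \<longlongrightarrow> 0) (at 0)"
  proof (rule Lim_null_comparison)
   show "\<forall>\<^sub>F h in at 0. norm ((max 0 h)^2 / h) <= \<bar>h::real\<bar>"
    by (intro always_eventually allI) (auto simp: max_def power2_eq_square)
   show "((\<lambda>h::real. \<bar>h\<bar>) \<longlongrightarrow> 0) (at 0)" by (auto intro!: tendsto_eq_intros)
  qed
  thus ?thesis using 3 by (simp add: has_field_derivative_iff)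
 qed
qed

lemma kk_deriv: "0 < \<rho> ==> (kk \<rho> has_real_derivative kk' \<rho> s) (at s)"
proof -
 assume r: "0 < \<rho>"
 have 1: "((\<lambda>s. (s / \<rho> - 1) * (2 - s / \<rho>)) has_real_derivative ((3 - 2 * (s / \<rho>)) / \<rho>)) (at s)"
  using r by (auto intro!: derivative_eq_intros simp: field_simps)
 from DERIV_cmult[OF DERIV_chain2[OF posq_deriv 1], of "30 / \<rho>"]
 show ?thesis by (simp add: kk_def[abs_def] kk'_def)
qed

lemma kk_cont: "0 < \<rho> ==> continuous_on UNIV (kk \<rho>)" "0 < \<rho> ==> continuous_on UNIV (kk' \<rho>)"
 unfolding kk_def[abs_def] kk'_def[abs_def] by (auto intro!: continuous_intros)

text \<open>Up to the factor \<open>1 / \<rho>\<close>, the maximum at \<open>q = 3/2\<close> is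
  30/16, hence at most 2, and at the ends of the middle half of the layer the value is 30 *
  (3/16)^2, slightly above 1. The latter bound makes the integral \<open>\<psi>\<close> of the
  kernel at least 1/2 below the layer.\<close>

lemma kk_props:
 assumes r: "0 < \<rho>"
 shows "0 <= kk \<rho> s" "kk \<rho> s <= 2 / \<rho>" "kk \<rho> s \<noteq> 0 ==> \<rho> < s \<and> s < 2 * \<rho>"
  "2 * \<rho> <= s ==> kk' \<rho> s = 0" "5/4 * \<rho> <= s ==> s <= 7/4 * \<rho> ==> 1 / \<rho> <= kk \<rho> s"
proof -
 define q where "q = s / \<rho>"
 have s: "s = q * \<rho>" using r by (simp add: q_def)
 have k: "kk \<rho> s = 30 / \<rho> * (max 0 ((q - 1) * (2 - q)))^2" by (simp add: kk_def q_def)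
 show "0 <= kk \<rho> s" using r by (simp add: k)
 have "(q - 1) * (2 - q) <= 1/4"
 proof -
  have "0 <= (q - 3/2)^2" by simp
  thus ?thesis by (simp add: power2_eq_square algebra_simps)
 qed
 hence "(max 0 ((q - 1) * (2 - q)))^2 <= (1/4)^2" by (intro power_mono) auto
 hence "30 * (max 0 ((q - 1) * (2 - q)))^2 <= 2" by (simp add: power2_eq_square)
 thus "kk \<rho> s <= 2 / \<rho>" using r by (simp add: k divide_right_mono)
 show "kk \<rho> s \<noteq> 0 ==> \<rho> < s \<and> s < 2 * \<rho>"
 proof -
  assume "kk \<rho> s \<noteq> 0"
  hence "max 0 ((q - 1) * (2 - q)) \<noteq> 0" by (auto simp: k)
  moreover have "max 0 z \<noteq> 0 ==> 0 < z" for z :: real by (auto simp: max_def split: if_splits)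
  ultimately have "0 < (q - 1) * (2 - q)" by blast
  hence "1 < q \<and> q < 2" by (auto simp: zero_less_mult_iff)
  thus ?thesis using r by (simp add: s)
 qed
 show "kk' \<rho> s = 0" if "2 * \<rho> <= s"
 proof -
  have "2 <= q" using that r by (simp add: s)
  hence "(q - 1) * (2 - q) <= 0" by (intro mult_nonneg_nonpos) auto
  thus ?thesis by (simp add: kk'_def q_def)
 qed
 show "1 / \<rho> <= kk \<rho> s" if "5/4 * \<rho> <= s" "s <= 7/4 * \<rho>"
 proof -
  have q: "5/4 <= q" "q <= 7/4" using that r by (auto simp: s)
  have "0 <= (q - 5/4) * (7/4 - q)" using q by simp
  hence "3/16 <= (q - 1) * (2 - q)" by (simp add: algebra_simps)
  hence "(3/16)^2 <= (max 0 ((q - 1) * (2 - q)))^2" by (intro power_mono) auto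
  hence "1 <= 30 * (max 0 ((q - 1) * (2 - q)))^2" by (simp add: power2_eq_square)
  thus ?thesis using r by (simp add: k divide_right_mono)
 qed
qed

lemma theta_meas:
 fixes v :: "real^'d::finite => real^'m::finite"
 assumes "continuous_on UNIV v" shows "theta n \<rho> v \<in> borel_measurable borel"
proof -
 have [measurable]: "v \<in> borel_measurable borel" by (rule borel_measurable_continuous_onI[OF assms])
 have [measurable]: "proj n \<in> borel_measurable borel"
  by (rule borel_measurable_continuous_onI) (unfold proj_def[abs_def], intro continuous_intros)
 have [measurable]: "cball (0::real^'d) 1 \<in> sets borel" by simp
 show ?thesis unfolding theta_def[abs_def] by measurable
qed

lemma bounded_linear_outer: "bounded_linear (\<lambda>p. outer p q)"
proof (rule bounded_linear_intro[where K="norm q"])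
 show "outer (x + y) q = outer x q + outer y q" for x y
  by (simp add: outer_def vec_eq_iff algebra_simps)
 show "outer (r *\<^sub>R x) q = r *\<^sub>R outer x q" for x r
  by (simp add: outer_def vec_eq_iff)
qed simp

lemma norm_sq_le2: "(norm (a + b))^2 <= 2 * (norm a)^2 + 2 * (norm (b::'a::real_normed_vector))^2"
proof -
 have "(norm (a + b))^2 <= (norm a + norm b)^2" by (intro power_mono norm_triangle_ineq) simp
 also have "... <= 2 * (norm a)^2 + 2 * (norm b)^2"
  using zero_le_power2[of "norm a - norm b"] by (simp add: power2_eq_square algebra_simps)
 finally show ?thesis .
qed

lemma ennreal_norm_sq_le2: "nsq (a + b) <= 2 * nsq a + 2 * nsq (b::'a::real_normed_vector)"
proof -
 have "nsq (a + b) <= ennreal (2 * (norm a)^2 + 2 * (norm b)^2)" by (rule ennreal_leI[OF norm_sq_le2])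
 also have "... = 2 * nsq a + 2 * nsq b"
  by (simp add: ennreal_plus ennreal_mult)
 finally show ?thesis .
qed

lemma set_integrable_Icc_cont:
 fixes f :: "real => 'b::euclidean_space"
 shows "continuous_on {a..b} f ==> set_integrable lborel {a..b} f"
 unfolding set_integrable_def by (rule borel_integrable_compact) auto

lemma set_integral_Icc_const: "a <= b ==> (LINT s:{a..b}|lborel. (c::real)) = (b - a) * c"
 by (simp add: set_lebesgue_integral_def)

lemma ennreal_mult_mult_le: "0 <= a ==> 0 <= b ==> a * b <= c ==> ennreal a * (ennreal b * X) <= ennreal c * X"
 by (simp add: mult.assoc[symmetric] ennreal_mult[symmetric] mult_right_mono ennreal_leI)

text \<open>\<open>\<Phi>(x)\<close> is the integral over s of \<open>k(t(x) + s) (v(x) - w(x - s n))\<close>, with w the tangential average of v and k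
 supported in the layer between \<open>\<rho>\<close> and \<open>2\<rho>\<close>.  Moving the normal derivative of w onto k shows that its
 gradient is \<open>\<psi> J\<close> up to a remainder that only involves v - w and tangential derivatives of w.\<close>
lemma corrector:
 "\<exists>C>0. \<forall>(n::real^'d::finite) a \<rho> (v::real^'d => real^'m::finite) J. norm n = 1 --> 0 < \<rho> --> C1 v J -->
  (\<exists>\<Phi> K \<psi> Rm. C1 \<Phi> K \<and> (\<forall>x. 0 < ht n a x -->
   K x = \<psi> x *\<^sub>R J x + Rm x \<and> 0 <= \<psi> x \<and> \<psi> x <= 4 \<and> (ht n a x < \<rho> --> 1/2 <= \<psi> x) \<and>
   (2 * \<rho> <= ht n a x --> \<Phi> x = 0 \<and> K x = 0 \<and> \<psi> x = 0 \<and> Rm x = 0) \<and>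
   nsq (Rm x) <= ennreal (C / \<rho>^2) *
    (theta n \<rho> v x * indicator {x. \<rho> <= ht n a x \<and> ht n a x < 2 * \<rho>} x
     + ennreal (1 / \<rho>) * (\<integral>\<^sup>+s\<in>{0..2*\<rho>}. theta n \<rho> v (x + s *\<^sub>R (-n))
        * indicator {x. \<rho> <= ht n a x \<and> ht n a x < 2 * \<rho>} (x + s *\<^sub>R (-n)) \<partial>lborel)) \<and>
   nsq (\<Phi> x) <= ennreal C *
    (ennreal (1 / \<rho>) * (\<integral>\<^sup>+s\<in>{0..2*\<rho>}. theta n \<rho> v (x + s *\<^sub>R (-n))
        * indicator {x. \<rho> <= ht n a x \<and> ht n a x < 2 * \<rho>} (x + s *\<^sub>R (-n)) \<partial>lborel)
     + ennreal \<rho> * (\<integral>\<^sup>+s\<in>{0..2*\<rho>}. nsq (J (x + s *\<^sub>R (-n)))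
        * indicator {x. 0 < ht n a x \<and> ht n a x < 2 * \<rho>} (x + s *\<^sub>R (-n)) \<partial>lborel))))"
 using tangential_average[where 'd='d and 'm='m]
proof (elim exE conjE, goal_cases)
 case (1 C1c)
 note C1c = 1(1) and TA = 1(2)[rule_format]
 \<comment> \<open>64 is the cost of the normal increment of \<open>v\<close> in the bound for
   \<open>\<Phi>\<close>, and 16 times \<open>C1c\<close> covers the terms with \<open>theta\<close>
   in both bounds.\<close>
 define C where "C = 64 + 16 * C1c"
 have C0: "C > 0" using C1c by (simp add: C_def)
 show ?thesis
 proof (intro exI[of _ C] conjI C0 allI impI)
  fix n :: "real^'d" and a \<rho> :: real and v :: "real^'d => real^'m" and J
  assume n: "norm n = 1" and r: "0 < \<rho>" and C: "C1 v J"
  obtain w W where Cw: "C1 w W" and w1: "\<And>x. nsq (v x - w x) <= ennreal C1c * theta n \<rho> v x"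
   and w2: "\<And>x. nsq (tang n (W x)) <= ennreal (C1c / \<rho>^2) * theta n \<rho> v x"
   using TA[OF n r C] by blast
  note cv = C1_continuous[OF C] and cJ = C1_continuous_J[OF C] and cw = C1_continuous[OF Cw] and cW = C1_continuous_J[OF Cw]
  let ?k = "kk \<rho>" and ?k' = "kk' \<rho>" and ?t = "ht n a" and ?I = "{0..2*\<rho>}"
  let ?A = "{x. \<rho> <= ?t x \<and> ?t x < 2 * \<rho>}"
  have ck: "continuous_on UNIV ?k" and ck': "continuous_on UNIV ?k'" using kk_cont[OF r] by auto
  define p where "p x s = x + s *\<^sub>R (- n)" for x s
  have cp: "continuous_on S (\<lambda>z. p (f z) (g z))" if "continuous_on S f" "continuous_on S g" for S :: "'z::topological_space set" and f g
   unfolding p_def by (intro continuous_intros that)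
  have tp: "?t (p x s) = ?t x + s" for x s unfolding p_def by (rule ht_normal[OF n])
  let ?g = "\<lambda>x s. ?k (?t x + s) *\<^sub>R (v x - w (p x s))"
  let ?gJ = "\<lambda>x s. ?k (?t x + s) *\<^sub>R (J x - W (p x s)) + outer (v x - w (p x s)) (?k' (?t x + s) *\<^sub>R (- n))"
  define \<Phi> where "\<Phi> x = (LINT s:?I|lborel. ?g x s)" for x
  define K where "K x = (LINT s:?I|lborel. ?gJ x s)" for x
  define \<psi> where "\<psi> x = (LINT s:?I|lborel. ?k (?t x + s))" for x
  define IW where "IW x = (LINT s:?I|lborel. ?k (?t x + s) *\<^sub>R W (p x s))" for x
  define Rm where "Rm x = ?k (?t x) *\<^sub>R outer (v x - w x) n - tang n (IW x)" for x
  have CPhi: "C1 \<Phi> K" unfolding \<Phi>_def K_def set_lebesgue_integral_def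
  proof (rule C1_param_integral[of ?I])
   show "integrable lborel (indicator ?I :: real => real)"
    using borel_integrable_compact[of ?I "\<lambda>_. 1::real"] by simp
   show "continuous_on (UNIV \<times> ?I) (\<lambda>(x, s). ?g x s)" unfolding case_prod_unfold
    by (intro continuous_intros cont_comp[OF ck] cont_comp[OF cv] cont_comp[OF cw] cp)
   show "continuous_on (UNIV \<times> ?I) (\<lambda>(x, s). ?gJ x s)" unfolding case_prod_unfold
    by (intro continuous_intros cont_comp[OF ck] cont_comp[OF ck'] cont_comp[OF cv] cont_comp[OF cw] cont_comp[OF cJ] cont_comp[OF cW] cp)
   fix x s
   have "C1 (\<lambda>x. ?g x s) (\<lambda>x. ?gJ x s)" unfolding p_def
    by (rule C1_scale[OF C1s_compose[OF kk_deriv[OF r] ck' ht_C1s] C1_diff[OF C C1_shift[OF Cw]]])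
   thus "((\<lambda>x. ?g x s) has_derivative (*v) (?gJ x s)) (at x)" unfolding C1_def by blast
  qed auto
  have ci: "continuous_on ?I (\<lambda>s. ?k (?t x + s))" "continuous_on ?I (\<lambda>s. ?k' (?t x + s))"
   "continuous_on ?I (\<lambda>s. w (p x s))" "continuous_on ?I (\<lambda>s. W (p x s))" for x
   by (intro continuous_intros cont_comp[OF ck] cont_comp[OF ck'] cont_comp[OF cw] cont_comp[OF cW] cp)+
  have iW: "set_integrable lborel ?I (\<lambda>s. ?k (?t x + s) *\<^sub>R W (p x s))" for x
   by (rule set_integrable_Icc_cont) (intro continuous_intros ci)
  have ik: "set_integrable lborel ?I (\<lambda>s. ?k (?t x + s))" for x
   by (rule set_integrable_Icc_cont) (intro continuous_intros ci)
  \<comment> \<open>The fundamental theorem of calculus in \<open>s\<close>, applied to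
    \<open>?h\<close>, expresses the integral of \<open>k'\<close> times \<open>v - w\<close> by a
    boundary term and the normal column of \<open>IW\<close>. Inserted into \<open>K\<close>, that
    column removes the normal part of \<open>IW\<close>; beside
    \<open>\<psi> x *\<^sub>R J x\<close> only the boundary term and \<open>tang n (IW x)\<close>
    are left.\<close>
  have decomp: "K x = \<psi> x *\<^sub>R J x + Rm x" if t: "0 < ?t x" for x
  proof -
   let ?d = "\<lambda>s. v x - w (p x s)"
   let ?h = "\<lambda>s. ?k (?t x + s) *\<^sub>R ?d s"
   let ?h' = "\<lambda>s. ?k' (?t x + s) *\<^sub>R ?d s + ?k (?t x + s) *\<^sub>R (W (p x s) *v n)"
   have der: "(?h has_vector_derivative ?h' s) (at s within ?I)" for s
   proof -
    have 1: "((\<lambda>s. ?k (?t x + s)) has_real_derivative ?k' (?t x + s)) (at s within ?I)"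
    proof (rule has_field_derivative_at_within)
     have "((\<lambda>s. ?t x + s) has_real_derivative 1) (at s)" by (auto intro!: derivative_eq_intros)
     from DERIV_chain2[OF kk_deriv[OF r] this]
     show "((\<lambda>s. ?k (?t x + s)) has_real_derivative ?k' (?t x + s)) (at s)" by simp
    qed
    have 2: "(?d has_vector_derivative (0 - W (p x s) *v (- n))) (at s within ?I)"
     unfolding p_def by (intro has_vector_derivative_diff has_vector_derivative_const C1_line[OF Cw])
    have "W (p x s) *v (- n) = - (W (p x s) *v n)"
     using matrix_vector_mult_scaleR[of "W (p x s)" "-1" n] by simp
    with has_vector_derivative_scaleR[OF 1 2] show ?thesis by (simp add: algebra_simps)
   qed
   have ch: "continuous_on ?I ?h'" by (intro continuous_intros ci)
   have "(LINT s:?I|lborel. ?h' s) = ?h (2*\<rho>) - ?h 0"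
    by (rule integral_FTC_set(2)) (use r der ch in auto)
   \<comment> \<open>In the half-space, \<open>?t x + 2 * \<rho>\<close> lies above the support of
     the kernel, so only the end \<open>s = 0\<close> contributes.\<close>
   also have "?h (2*\<rho>) = 0" using kk_props(3)[OF r, of "?t x + 2*\<rho>"] t by auto
   also have "0 - ?h 0 = - (?k (?t x) *\<^sub>R (v x - w x))" by (simp add: p_def)
   finally have ftc: "(LINT s:?I|lborel. ?h' s) = - (?k (?t x) *\<^sub>R (v x - w x))" .
   have i1: "set_integrable lborel ?I (\<lambda>s. ?k' (?t x + s) *\<^sub>R ?d s)"
    by (rule set_integrable_Icc_cont) (intro continuous_intros ci)
   have i2: "set_integrable lborel ?I (\<lambda>s. ?k (?t x + s) *\<^sub>R (W (p x s) *v n))"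
    by (rule set_integrable_Icc_cont) (intro continuous_intros ci)
   have W2: "(LINT s:?I|lborel. ?k (?t x + s) *\<^sub>R (W (p x s) *v n)) = IW x *v n"
    using integral_bounded_linear[OF bounded_linear_mult_vec_left iW[of x, unfolded set_integrable_def], of n]
    by (simp add: IW_def set_lebesgue_integral_def scaleR_matrix_vector_assoc[symmetric])
   have k'd: "(LINT s:?I|lborel. ?k' (?t x + s) *\<^sub>R ?d s) = - (?k (?t x) *\<^sub>R (v x - w x)) - IW x *v n"
    using ftc set_integral_add(2)[OF i1 i2] W2 by (simp add: algebra_simps)
   have i3: "set_integrable lborel ?I (\<lambda>s. ?k (?t x + s) *\<^sub>R J x)"
    by (rule set_integrable_Icc_cont) (intro continuous_intros ci)
   have i4: "set_integrable lborel ?I (\<lambda>s. outer (?k' (?t x + s) *\<^sub>R ?d s) (- n))"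
    by (rule set_integrable_Icc_cont) (intro continuous_intros ci)
   have "K x = (LINT s:?I|lborel. (?k (?t x + s) *\<^sub>R J x - ?k (?t x + s) *\<^sub>R W (p x s)) + outer (?k' (?t x + s) *\<^sub>R ?d s) (- n))"
    unfolding K_def
    by (rule arg_cong[where f="set_lebesgue_integral lborel ?I"], rule ext)
     (simp add: scaleR_diff_right outer_def vec_eq_iff algebra_simps)
   also have "... = (LINT s:?I|lborel. ?k (?t x + s) *\<^sub>R J x) - IW x + (LINT s:?I|lborel. outer (?k' (?t x + s) *\<^sub>R ?d s) (- n))"
    by (simp add: set_integral_add(2)[OF set_integral_diff(1)[OF i3 iW] i4] set_integral_diff(2)[OF i3 iW] IW_def)
   also have "(LINT s:?I|lborel. ?k (?t x + s) *\<^sub>R J x) = \<psi> x *\<^sub>R J x"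
   proof -
    have "(LINT s|lborel. (indicator ?I s * ?k (?t x + s)) *\<^sub>R J x) = (LINT s|lborel. indicator ?I s * ?k (?t x + s)) *\<^sub>R J x"
     by (rule integral_scaleR_left) (use ik[of x] in \<open>simp add: set_integrable_def\<close>)
    thus ?thesis by (simp add: \<psi>_def set_lebesgue_integral_def)
   qed
   also have "(LINT s:?I|lborel. outer (?k' (?t x + s) *\<^sub>R ?d s) (- n)) = outer (LINT s:?I|lborel. ?k' (?t x + s) *\<^sub>R ?d s) (- n)"
    using integral_bounded_linear[OF bounded_linear_outer i1[unfolded set_integrable_def], of "- n"]
    by (simp add: set_lebesgue_integral_def linear_simps(5)[OF bounded_linear_outer])
   finally show ?thesis unfolding k'd
    by (simp add: Rm_def tang_def outer_def vec_eq_iff algebra_simps)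
  qed
  have mt[measurable]: "theta n \<rho> v \<in> borel_measurable borel" by (rule theta_meas[OF cv])
  have [measurable]: "J \<in> borel_measurable borel" by (rule borel_measurable_continuous_onI[OF cJ])
  have [measurable]: "p x \<in> borel_measurable borel" for x unfolding p_def by measurable
  have [measurable]: "?A \<in> sets borel" by measurable
  have mA: "(\<lambda>s. theta n \<rho> v (p x s) * indicator ?A (p x s) * indicator ?I s) \<in> borel_measurable lborel" for x
   by measurable
  have eI: "emeasure lborel ?I = ennreal (2 * \<rho>)" using r by simp
  have k4: "(?k s)^2 <= 4 / \<rho>^2" for s
  proof -
   have "(?k s)^2 <= (2 / \<rho>)^2" by (intro power_mono kk_props(1,2) r)
   thus ?thesis by (simp add: power_divide)
  qed
  define H2 where "H2 x = (\<integral>\<^sup>+s\<in>?I. theta n \<rho> v (p x s) * indicator ?A (p x s) \<partial>lborel)" for x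
  define H3 where "H3 x = (\<integral>\<^sup>+s\<in>?I. nsq (J (p x s)) * indicator {x. 0 < ?t x \<and> ?t x < 2 * \<rho>} (p x s) \<partial>lborel)" for x
  have psi: "0 <= \<psi> x" "\<psi> x <= 4" for x
  proof -
   show "0 <= \<psi> x" unfolding \<psi>_def set_lebesgue_integral_def
    by (rule integral_nonneg_AE) (use kk_props(1)[OF r] in \<open>auto split: split_indicator\<close>)
   have "\<psi> x <= (LINT s:?I|lborel. 2 / \<rho>)" unfolding \<psi>_def
    by (rule set_integral_mono[OF ik]) (use kk_props(2)[OF r] in \<open>auto intro!: set_integrable_Icc_cont\<close>)
   also have "... = 4" using r by (subst set_integral_Icc_const) auto
   finally show "\<psi> x <= 4" .
  qed
  \<comment> \<open>Seen from a point below the layer, the integral covers the whole middle half of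
    the layer, which has length \<open>\<rho> / 2\<close> and on which the kernel is at least
    \<open>1 / \<rho>\<close>.\<close>
  have psi2: "1/2 <= \<psi> x" if "0 < ?t x" "?t x < \<rho>" for x
  proof -
   let ?B = "{5/4 * \<rho> - ?t x..7/4 * \<rho> - ?t x}"
   have "1/2 = (LINT s:?B|lborel. 1 / \<rho>)" using r by (subst set_integral_Icc_const) auto
   also have "... <= \<psi> x" unfolding \<psi>_def set_lebesgue_integral_def
   proof (rule integral_mono)
    show "integrable lborel (\<lambda>s. indicat_real ?B s *\<^sub>R (1 / \<rho>))"
     using set_integrable_Icc_cont[of "5/4 * \<rho> - ?t x" "7/4 * \<rho> - ?t x" "\<lambda>_. 1 / \<rho>"] by (simp add: set_integrable_def)
    show "integrable lborel (\<lambda>s. indicat_real ?I s *\<^sub>R ?k (?t x + s))" using ik[of x] by (simp add: set_integrable_def)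
    show "indicat_real ?B s *\<^sub>R (1 / \<rho>) <= indicat_real ?I s *\<^sub>R ?k (?t x + s)" for s
    proof (cases "s \<in> ?B")
     case True
     hence s: "5/4 * \<rho> <= ?t x + s" "?t x + s <= 7/4 * \<rho>" by simp_all
     have "s \<in> ?I" using s that r by simp
     thus ?thesis using True kk_props(5)[OF r s] by simp
    next
     case False
     thus ?thesis using kk_props(1)[OF r, of "?t x + s"] by simp
    qed
   qed
   finally show ?thesis .
  qed
  have far: "\<Phi> x = 0" "K x = 0" "\<psi> x = 0" "Rm x = 0" if "0 < ?t x" "2 * \<rho> <= ?t x" for x
  proof -
   have k0: "?k (?t x + s) = 0" "?k' (?t x + s) = 0" if "s \<in> ?I" for s
   proof -
    have ge: "2 * \<rho> <= ?t x + s" using \<open>2 * \<rho> <= ?t x\<close> that by simp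
    show "?k (?t x + s) = 0"
    proof (rule ccontr)
     assume "?k (?t x + s) \<noteq> 0"
     from kk_props(3)[OF r this] ge show False by linarith
    qed
    show "?k' (?t x + s) = 0" by (rule kk_props(4)[OF r ge])
   qed
   have "indicat_real ?I s *\<^sub>R ?g x s = 0" "indicat_real ?I s *\<^sub>R ?gJ x s = 0" "indicat_real ?I s *\<^sub>R ?k (?t x + s) = 0" for s
    by (cases "s \<in> ?I"; simp add: k0 outer_def vec_eq_iff)+
   thus z: "\<Phi> x = 0" "K x = 0" "\<psi> x = 0" by (simp_all only: \<Phi>_def K_def \<psi>_def set_lebesgue_integral_def integral_zero)
   show "Rm x = 0" using decomp[OF that(1)] z by simp
  qed
  have Rb: "nsq (Rm x) <= ennreal (C / \<rho>^2) * (theta n \<rho> v x * indicator ?A x + ennreal (1 / \<rho>) * H2 x)" if "0 < ?t x" for x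
  proof -
   let ?a = "?k (?t x) *\<^sub>R outer (v x - w x) n"
   have a: "2 * nsq ?a <= ennreal (C / \<rho>^2) * (theta n \<rho> v x * indicator ?A x)"
   proof (cases "?k (?t x) = 0")
    case False
    hence x: "x \<in> ?A" using kk_props(3)[OF r, of "?t x"] by auto
    have "2 * (norm ?a)^2 <= (8 / \<rho>^2) * (norm (v x - w x))^2"
     using mult_right_mono[OF k4[of "?t x"], of "(norm (v x - w x))^2"] n by (simp add: power_mult_distrib)
    note c = this
    have "2 * nsq ?a = ennreal (2 * (norm ?a)^2)" by (simp add: ennreal_mult del: norm_scaleR norm_outer)
    also have "... <= ennreal ((8 / \<rho>^2) * (norm (v x - w x))^2)" by (rule ennreal_leI[OF c])
    also have "... = ennreal (8 / \<rho>^2) * nsq (v x - w x)" by (rule ennreal_mult) auto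
    also have "... <= ennreal (8 / \<rho>^2) * (ennreal C1c * theta n \<rho> v x)" by (intro mult_left_mono w1) simp
    also have "... <= ennreal (C / \<rho>^2) * theta n \<rho> v x"
     by (rule ennreal_mult_mult_le) (use C1c r in \<open>auto simp: C_def divide_right_mono\<close>)
    finally show ?thesis using x by simp
   qed simp
   have it: "set_integrable lborel ?I (\<lambda>s. ?k (?t x + s) *\<^sub>R tang n (W (p x s)))"
    unfolding tang_def by (rule set_integrable_Icc_cont) (intro continuous_intros ci)
   have "tang n (IW x) = (LINT s:?I|lborel. ?k (?t x + s) *\<^sub>R tang n (W (p x s)))"
    using integral_bounded_linear[OF bounded_linear_tang iW[of x, unfolded set_integrable_def], of n]
    by (simp add: IW_def set_lebesgue_integral_def linear_simps(5)[OF bounded_linear_tang])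
   hence "nsq (tang n (IW x)) <= emeasure lborel ?I * (\<integral>\<^sup>+s\<in>?I. nsq (?k (?t x + s) *\<^sub>R tang n (W (p x s))) \<partial>lborel)"
    using sq_norm_set_integral_le[OF it] by (simp del: norm_scaleR)
   also have "... <= emeasure lborel ?I * (\<integral>\<^sup>+s. ennreal (4 * C1c / \<rho>^4) * (theta n \<rho> v (p x s) * indicator ?A (p x s) * indicator ?I s) \<partial>lborel)"
   proof (intro mult_left_mono nn_integral_mono)
    fix s
    show "nsq (?k (?t x + s) *\<^sub>R tang n (W (p x s))) * indicator ?I s <= ennreal (4 * C1c / \<rho>^4) * (theta n \<rho> v (p x s) * indicator ?A (p x s) * indicator ?I s)"
    proof (cases "?k (?t x + s) = 0")
     case False
     hence x: "p x s \<in> ?A" using kk_props(3)[OF r, of "?t x + s"] by (simp add: tp)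
     have "(norm (?k (?t x + s) *\<^sub>R tang n (W (p x s))))^2 <= (4 / \<rho>^2) * (norm (tang n (W (p x s))))^2"
      using mult_right_mono[OF k4[of "?t x + s"], of "(norm (tang n (W (p x s))))^2"] by (simp add: power_mult_distrib)
     hence "nsq (?k (?t x + s) *\<^sub>R tang n (W (p x s))) <= ennreal ((4 / \<rho>^2) * (norm (tang n (W (p x s))))^2)" by (rule ennreal_leI)
     also have "... = ennreal (4 / \<rho>^2) * nsq (tang n (W (p x s)))" by (rule ennreal_mult) auto
     also have "... <= ennreal (4 / \<rho>^2) * (ennreal (C1c / \<rho>^2) * theta n \<rho> v (p x s))" by (intro mult_left_mono w2) simp
     also have "... <= ennreal (4 * C1c / \<rho>^4) * theta n \<rho> v (p x s)"
     proof (rule ennreal_mult_mult_le)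
      have "4 / \<rho>^2 * (C1c / \<rho>^2) = 4 * C1c / \<rho>^4" by (simp add: power4_eq_xxxx power2_eq_square)
      thus "4 / \<rho>^2 * (C1c / \<rho>^2) <= 4 * C1c / \<rho>^4" by simp
     qed (use C1c r in auto)
     finally show ?thesis using x by (auto split: split_indicator)
    qed simp
   qed simp
   also have "... = ennreal (2 * \<rho>) * (ennreal (4 * C1c / \<rho>^4) * H2 x)"
    unfolding eI H2_def nn_integral_cmult[OF mA] ..
   also have "... <= ennreal (8 * C1c / \<rho>^3) * H2 x"
   proof (rule ennreal_mult_mult_le)
    have "2 * \<rho> * (4 * C1c / \<rho>^4) = 8 * C1c / \<rho>^3" using r by (simp add: power4_eq_xxxx power3_eq_cube)
    thus "2 * \<rho> * (4 * C1c / \<rho>^4) <= 8 * C1c / \<rho>^3" by simp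
   qed (use C1c r in auto)
   finally have b: "nsq (tang n (IW x)) <= ennreal (8 * C1c / \<rho>^3) * H2 x" .
   have b2: "2 * nsq (- tang n (IW x)) <= ennreal (C / \<rho>^2) * (ennreal (1 / \<rho>) * H2 x)"
   proof -
    have "2 * nsq (- tang n (IW x)) <= ennreal 2 * (ennreal (8 * C1c / \<rho>^3) * H2 x)"
     using b by (simp add: mult_left_mono)
    also have "... <= ennreal (C / \<rho>^2 * (1 / \<rho>)) * H2 x"
    proof (rule ennreal_mult_mult_le)
     have "2 * (8 * C1c / \<rho>^3) = (16 * C1c) / \<rho>^3" by simp
     also have "... <= C / \<rho>^3" using r by (intro divide_right_mono) (auto simp: C_def)
     also have "... = C / \<rho>^2 * (1 / \<rho>)" by (simp add: power2_eq_square power3_eq_cube)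
     finally show "2 * (8 * C1c / \<rho>^3) <= C / \<rho>^2 * (1 / \<rho>)" .
    qed (use C1c r in auto)
    also have "... = ennreal (C / \<rho>^2) * (ennreal (1 / \<rho>) * H2 x)"
    proof -
     have "ennreal (C / \<rho>^2 * (1 / \<rho>)) = ennreal (C / \<rho>^2) * ennreal (1 / \<rho>)" by (rule ennreal_mult) (use C0 r in auto)
     thus ?thesis by (simp only: mult.assoc)
    qed
    finally show ?thesis .
   qed
   have "nsq (Rm x) <= 2 * nsq ?a + 2 * nsq (- tang n (IW x))"
    unfolding Rm_def using ennreal_norm_sq_le2[of ?a "- tang n (IW x)"] by simp
   also have "... <= ennreal (C / \<rho>^2) * (theta n \<rho> v x * indicator ?A x) + ennreal (C / \<rho>^2) * (ennreal (1 / \<rho>) * H2 x)"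
    by (rule add_mono[OF a b2])
   finally show ?thesis by (simp only: distrib_left)
  qed
  have Pb: "nsq (\<Phi> x) <= ennreal C * (ennreal (1 / \<rho>) * H2 x + ennreal \<rho> * H3 x)" if t: "0 < ?t x" for x
  proof -
   have ig: "set_integrable lborel ?I (?g x)"
    by (rule set_integrable_Icc_cont) (intro continuous_intros ci)
   have "nsq (\<Phi> x) <= emeasure lborel ?I * (\<integral>\<^sup>+s\<in>?I. nsq (?g x s) \<partial>lborel)"
    unfolding \<Phi>_def by (rule sq_norm_set_integral_le[OF ig]) simp
   also have "... <= emeasure lborel ?I * (\<integral>\<^sup>+s. ennreal (8 * C1c / \<rho>^2) * (theta n \<rho> v (p x s) * indicator ?A (p x s) * indicator ?I s) + ennreal (16 / \<rho>) * (H3 x * indicator ?I s) \<partial>lborel)"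
   proof (intro mult_left_mono nn_integral_mono)
    fix s
    show "nsq (?g x s) * indicator ?I s <= ennreal (8 * C1c / \<rho>^2) * (theta n \<rho> v (p x s) * indicator ?A (p x s) * indicator ?I s) + ennreal (16 / \<rho>) * (H3 x * indicator ?I s)"
    proof (cases "?k (?t x + s) = 0 \<or> s \<notin> ?I")
     case False
     hence s: "s \<in> ?I" and ks: "?k (?t x + s) \<noteq> 0" by auto
     have tt: "\<rho> < ?t x + s" "?t x + s < 2 * \<rho>" using kk_props(3)[OF r ks] by auto
     hence x: "p x s \<in> ?A" by (auto simp: tp)
     have "nsq (?g x s) <= ennreal (4 / \<rho>^2) * nsq (v x - w (p x s))"
     proof -
      have "(norm (?g x s))^2 <= (4 / \<rho>^2) * (norm (v x - w (p x s)))^2"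
       using mult_right_mono[OF k4[of "?t x + s"], of "(norm (v x - w (p x s)))^2"] by (simp add: power_mult_distrib)
      thus ?thesis by (simp add: ennreal_mult[symmetric] ennreal_leI del: norm_scaleR)
     qed
     \<comment> \<open>Inserting \<open>v (p x s)\<close> separates a normal increment of
       \<open>v\<close>, controlled by \<open>H3\<close>, from the difference \<open>v - w\<close>
       at a point of the layer, controlled by \<open>theta\<close>.\<close>
     also have "nsq (v x - w (p x s)) <= 2 * nsq (v x - v (p x s)) + 2 * nsq (v (p x s) - w (p x s))"
      using ennreal_norm_sq_le2[of "v x - v (p x s)" "v (p x s) - w (p x s)"] by simp
     also have "... <= ennreal 2 * (ennreal (2 * \<rho>) * H3 x) + ennreal 2 * (ennreal C1c * theta n \<rho> v (p x s))"
     proof (rule add_mono)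
      have "nsq (v x - v (p x s)) <= ennreal (s * (norm (- n))^2) * (\<integral>\<^sup>+q\<in>{0..s}. nsq (J (x + q *\<^sub>R (- n))) \<partial>lborel)"
       using C1_increment_sq_le[OF C, of s x "- n"] s by (simp add: p_def norm_minus_commute)
      also have "... <= ennreal (2 * \<rho>) * H3 x"
      proof (rule mult_mono)
       show "ennreal (s * (norm (- n))^2) <= ennreal (2 * \<rho>)" using s n by (intro ennreal_leI) simp
       show "(\<integral>\<^sup>+q\<in>{0..s}. nsq (J (x + q *\<^sub>R (- n))) \<partial>lborel) <= H3 x" unfolding H3_def
        by (rule nn_integral_mono) (use s t tt in \<open>auto simp: tp p_def[symmetric] simp del: add_uminus_conv_diff scaleR_minus_right split: split_indicator\<close>)
      qed auto
      finally show "2 * nsq (v x - v (p x s)) <= ennreal 2 * (ennreal (2 * \<rho>) * H3 x)"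
       by (simp add: mult_left_mono)
      show "2 * nsq (v (p x s) - w (p x s)) <= ennreal 2 * (ennreal C1c * theta n \<rho> v (p x s))"
       using w1[of "p x s"] by (simp add: mult_left_mono)
     qed
     finally have "nsq (?g x s) <= ennreal (4 / \<rho>^2) * (ennreal 2 * (ennreal (2 * \<rho>) * H3 x) + ennreal 2 * (ennreal C1c * theta n \<rho> v (p x s)))"
      by (simp add: mult_left_mono)
     also have "... = ennreal (4 / \<rho>^2 * (2 * (2 * \<rho>))) * H3 x + ennreal (4 / \<rho>^2 * (2 * C1c)) * theta n \<rho> v (p x s)"
     proof -
      have c1: "ennreal (4 / \<rho>^2 * (2 * (2 * \<rho>))) = ennreal (4 / \<rho>^2) * (ennreal 2 * ennreal (2 * \<rho>))"
       using r by (simp only: ennreal_mult mult_nonneg_nonneg zero_le_numeral less_imp_le divide_nonneg_nonneg zero_le_power2)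
      have c2: "ennreal (4 / \<rho>^2 * (2 * C1c)) = ennreal (4 / \<rho>^2) * (ennreal 2 * ennreal C1c)"
       using C1c by (simp only: ennreal_mult mult_nonneg_nonneg zero_le_numeral less_imp_le divide_nonneg_nonneg zero_le_power2)
      show ?thesis unfolding c1 c2 by (simp only: distrib_left mult.assoc)
     qed
     also have "4 / \<rho>^2 * (2 * (2 * \<rho>)) = 16 / \<rho>" using r by (simp add: power2_eq_square field_simps)
     also have "4 / \<rho>^2 * (2 * C1c) = 8 * C1c / \<rho>^2" by simp
     finally show ?thesis using x s by (simp add: add.commute)
    qed auto
   qed simp
   also have "... = ennreal (2 * \<rho>) * (ennreal (8 * C1c / \<rho>^2) * H2 x + ennreal (16 / \<rho>) * (H3 x * ennreal (2 * \<rho>)))"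
   proof -
    have "(\<integral>\<^sup>+s. ennreal (8 * C1c / \<rho>^2) * (theta n \<rho> v (p x s) * indicator ?A (p x s) * indicator ?I s) + ennreal (16 / \<rho>) * (H3 x * indicator ?I s) \<partial>lborel)
     = ennreal (8 * C1c / \<rho>^2) * H2 x + ennreal (16 / \<rho>) * (H3 x * emeasure lborel ?I)"
     unfolding H2_def by (subst nn_integral_add) (use mA in \<open>auto simp: nn_integral_cmult nn_integral_cmult_indicator\<close>)
    thus ?thesis by (simp only: eI)
   qed
   also have "... = ennreal (2 * \<rho>) * (ennreal (8 * C1c / \<rho>^2) * H2 x) + ennreal (2 * \<rho>) * (ennreal (16 / \<rho> * (2 * \<rho>)) * H3 x)"
   proof -
    have c: "ennreal (16 / \<rho> * (2 * \<rho>)) = ennreal (16 / \<rho>) * ennreal (2 * \<rho>)" by (rule ennreal_mult) (use r in auto)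
    show ?thesis unfolding c by (simp only: distrib_left mult.assoc mult.commute[of "H3 x"])
   qed
   also have "... <= ennreal (C * (1 / \<rho>)) * H2 x + ennreal (C * \<rho>) * H3 x"
   proof (intro add_mono ennreal_mult_mult_le)
    have "2 * \<rho> * (8 * C1c / \<rho>^2) = 16 * C1c * (1 / \<rho>)" using r by (simp add: power2_eq_square)
    also have "... <= C * (1 / \<rho>)" using r by (intro mult_right_mono) (auto simp: C_def)
    finally show "2 * \<rho> * (8 * C1c / \<rho>^2) <= C * (1 / \<rho>)" .
    have "2 * \<rho> * (16 / \<rho> * (2 * \<rho>)) = 64 * \<rho>" using r by simp
    also have "... <= C * \<rho>" using r C1c by (intro mult_right_mono) (auto simp: C_def)
    finally show "2 * \<rho> * (16 / \<rho> * (2 * \<rho>)) <= C * \<rho>" .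
   qed (use r C1c in auto)
   also have "... = ennreal C * (ennreal (1 / \<rho>) * H2 x + ennreal \<rho> * H3 x)"
   proof -
    have "ennreal (C * (1 / \<rho>)) = ennreal C * ennreal (1 / \<rho>)" "ennreal (C * \<rho>) = ennreal C * ennreal \<rho>"
     by (intro ennreal_mult; use C0 r in auto)+
    thus ?thesis by (simp only: distrib_left mult.assoc)
   qed
   finally show ?thesis .
  qed
  show "\<exists>\<Phi> K \<psi> Rm. C1 \<Phi> K \<and> (\<forall>x. 0 < ?t x -->
   K x = \<psi> x *\<^sub>R J x + Rm x \<and> 0 <= \<psi> x \<and> \<psi> x <= 4 \<and> (?t x < \<rho> --> 1/2 <= \<psi> x) \<and>
   (2 * \<rho> <= ?t x --> \<Phi> x = 0 \<and> K x = 0 \<and> \<psi> x = 0 \<and> Rm x = 0) \<and>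
   nsq (Rm x) <= ennreal (C / \<rho>^2) *
    (theta n \<rho> v x * indicator ?A x
     + ennreal (1 / \<rho>) * (\<integral>\<^sup>+s\<in>?I. theta n \<rho> v (x + s *\<^sub>R (-n)) * indicator ?A (x + s *\<^sub>R (-n)) \<partial>lborel)) \<and>
   nsq (\<Phi> x) <= ennreal C *
    (ennreal (1 / \<rho>) * (\<integral>\<^sup>+s\<in>?I. theta n \<rho> v (x + s *\<^sub>R (-n)) * indicator ?A (x + s *\<^sub>R (-n)) \<partial>lborel)
     + ennreal \<rho> * (\<integral>\<^sup>+s\<in>?I. nsq (J (x + s *\<^sub>R (-n)))
        * indicator {x. 0 < ?t x \<and> ?t x < 2 * \<rho>} (x + s *\<^sub>R (-n)) \<partial>lborel)))"
   by (intro exI[of _ \<Phi>] exI[of _ K] exI[of _ \<psi>] exI[of _ Rm] conjI allI impI)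
    (rule CPhi | rule decomp, assumption | rule psi | rule psi2, assumption, assumption | rule far, assumption, assumption
     | rule Rb[unfolded H2_def p_def], assumption | rule Pb[unfolded H2_def H3_def p_def], assumption)+
 qed
qed

section \<open>Energy estimates in slabs\<close>

text \<open>Laterally the set is cut off by a ball about \<open>x0\<close> and not by a cylinder:
  translations in any direction are then accounted for by the triangle inequality and a larger
  \<open>T\<close>.\<close>

definition slab :: "real^'d::finite => real => real^'d => real => real => (real^'d) set" where
 "slab n a x0 r T = {x. 0 < ht n a x \<and> ht n a x < r \<and> dist x x0 < T}"

text \<open>Valued in \<open>ennreal\<close>, so that translations and Tonelli come without
  integrability conditions; finiteness is recovered where an inequality has to be
  rearranged.\<close>

definition energy :: "(real^'d::finite) set => (real^'d => 'b::real_normed_vector) => ennreal" where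
 "energy S h = (\<integral>\<^sup>+x\<in>S. nsq (h x) \<partial>lborel)"

lemma slab_borel [measurable]: "slab n a x0 r T \<in> sets borel"
 unfolding slab_def by measurable

lemma slab_mono: "r <= r' ==> T <= T' ==> slab n a x0 r T \<subseteq> slab n a x0 r' T'"
 unfolding slab_def by auto

lemma energy_mono: "S \<subseteq> S' ==> energy S h <= energy S' h"
 unfolding energy_def by (intro nn_integral_mono) (auto split: split_indicator)

lemma energy_slab_mono: "r <= r' ==> T <= T' ==> energy (slab n a x0 r T) h <= energy (slab n a x0 r' T') h"
 by (intro energy_mono slab_mono)

text \<open>Integrates a pointwise inequality \<open>p <= a + r\<close> in which \<open>a\<close>
  has integral zero. It is written with the positive and negative parts of \<open>a\<close> because
  \<open>p\<close> and \<open>r\<close> are extended nonnegative and \<open>r\<close> may have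
  infinite integral; integrability of \<open>a\<close> makes the two parts cancel.\<close>

lemma nn_integral_le_of_zero_integral:
 assumes a: "integrable N a" "(LINT x|N. a x) = 0"
  and [measurable]: "p \<in> borel_measurable N" "r \<in> borel_measurable N"
  and le: "\<And>x. p x + ennreal (- a x) <= ennreal (a x) + r x"
 shows "(\<integral>\<^sup>+x. p x \<partial>N) <= (\<integral>\<^sup>+x. r x \<partial>N)"
proof -
 have [measurable]: "a \<in> borel_measurable N" using a(1) by auto
 have fin: "(\<integral>\<^sup>+x. ennreal (a x) \<partial>N) \<noteq> \<infinity>" "(\<integral>\<^sup>+x. ennreal (- a x) \<partial>N) \<noteq> \<infinity>"
  using a(1) unfolding real_integrable_def by auto
 have "enn2real (\<integral>\<^sup>+x. ennreal (a x) \<partial>N) = enn2real (\<integral>\<^sup>+x. ennreal (- a x) \<partial>N)"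
  using a(2) real_lebesgue_integral_def[OF a(1)] by simp
 hence eq: "(\<integral>\<^sup>+x. ennreal (- a x) \<partial>N) = (\<integral>\<^sup>+x. ennreal (a x) \<partial>N)"
  using fin by (metis ennreal_enn2real less_top infinity_ennreal_def)
 have "(\<integral>\<^sup>+x. p x \<partial>N) + (\<integral>\<^sup>+x. ennreal (- a x) \<partial>N) = (\<integral>\<^sup>+x. p x + ennreal (- a x) \<partial>N)"
  by (rule nn_integral_add[symmetric]) auto
 also have "... <= (\<integral>\<^sup>+x. ennreal (a x) + r x \<partial>N)" by (rule nn_integral_mono) (rule le)
 also have "... = (\<integral>\<^sup>+x. ennreal (a x) \<partial>N) + (\<integral>\<^sup>+x. r x \<partial>N)" by (rule nn_integral_add) auto
 finally have "(\<integral>\<^sup>+x. ennreal (a x) \<partial>N) + (\<integral>\<^sup>+x. p x \<partial>N) <= (\<integral>\<^sup>+x. ennreal (a x) \<partial>N) + (\<integral>\<^sup>+x. r x \<partial>N)"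
  unfolding eq by (simp add: add.commute)
 thus ?thesis using fin(1) by (simp add: ennreal_add_left_cancel_le)
qed

lemma ennreal_split_le:
 assumes "P <= a + R" "0 <= P" "0 <= R"
 shows "ennreal P + ennreal (- a) <= ennreal a + ennreal R"
proof (cases "0 <= a")
 case True
 thus ?thesis using assms by (simp add: ennreal_neg ennreal_plus[symmetric] ennreal_leI del: ennreal_plus)
next
 case False
 hence "ennreal P + ennreal (- a) = ennreal (P - a)" using assms by (simp add: ennreal_plus[symmetric] del: ennreal_plus)
 also have "... <= ennreal R" using assms by (intro ennreal_leI) simp
 finally show ?thesis by (simp add: add_increasing)
qed

section \<open>Continuously differentiable cut-off functions\<close>

definition cutb :: "real => real" where "cutb s = (max 0 (1 - (max 0 s)^2))^2"
definition cutb' :: "real => real" where "cutb' s = 2 * max 0 (1 - (max 0 s)^2) * (- (2 * max 0 s))"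

lemma cutb_deriv: "(cutb has_real_derivative cutb' s) (at s)"
proof -
 have 1: "((\<lambda>s::real. 1 - (max 0 s)^2) has_real_derivative (0 - 2 * max 0 s)) (at s)"
  by (intro DERIV_diff DERIV_const posq_deriv)
 from DERIV_chain2[OF posq_deriv 1] show ?thesis by (simp add: cutb_def[abs_def] cutb'_def)
qed

lemma cutb'_cont: "continuous_on UNIV cutb'"
 unfolding cutb'_def[abs_def] by (intro continuous_intros)

lemma cutb_props: "0 <= cutb s" "cutb s <= 1" "s <= 0 ==> cutb s = 1" "1 <= s ==> cutb s = 0" "1 <= s ==> cutb' s = 0"
 "\<bar>cutb' s\<bar> <= 4"
proof -
 have m: "0 <= max 0 (1 - (max 0 s)^2)" "max 0 (1 - (max 0 s)^2) <= 1" by auto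
 show "0 <= cutb s" by (simp add: cutb_def)
 show "cutb s <= 1" unfolding cutb_def using power_mono[OF m(2) m(1), of 2] by simp
 show "s <= 0 ==> cutb s = 1" by (simp add: cutb_def)
 have z: "max 0 (1 - (max 0 s)^2) = 0" if "1 <= s"
 proof -
  have "max 0 s = s" using that by simp
  moreover have "1 - s^2 <= 0" using one_le_power[OF that, of 2] by linarith
  ultimately show ?thesis by (simp only: max_absorb1)
 qed
 show "1 <= s ==> cutb s = 0" using z by (simp add: cutb_def)
 show z': "1 <= s ==> cutb' s = 0" using z by (simp add: cutb'_def)
 show "\<bar>cutb' s\<bar> <= 4"
 proof (cases "1 <= s")
  case False
  hence "max 0 s <= 1" by simp
  hence "max 0 (1 - (max 0 s)^2) * max 0 s <= 1 * 1" by (intro mult_mono m) auto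
  moreover have "\<bar>cutb' s\<bar> = 4 * (max 0 (1 - (max 0 s)^2) * max 0 s)"
   using m by (simp add: cutb'_def abs_mult)
  ultimately show ?thesis by linarith
 qed (simp add: z')
qed

text \<open>The cut-off is a function of the square of \<open>f\<close>, because a distance, and
  likewise the absolute value of the height, fails to be differentiable at its zeros.\<close>

lemma cutoff_exists:
 fixes f :: "real^'d::finite => real"
 assumes f: "C1s (\<lambda>x. (f x)^2) F" and F: "\<And>x. norm (F x) <= 2 * \<bar>f x\<bar>" and W: "0 < W" and T: "0 <= T"
 shows "\<exists>ch G. C1s ch G \<and> (\<forall>x. 0 <= ch x \<and> ch x <= 1 \<and> (\<bar>f x\<bar> <= T --> ch x = 1) \<and> (T + W <= \<bar>f x\<bar> --> ch x = 0 \<and> G x = 0) \<and> norm (G x) <= 8 / W)"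
proof -
 \<comment> \<open>\<open>D\<close> equals \<open>(T + W)^2 - T^2\<close>, so that \<open>q\<close>
   is 0 where \<open>\<bar>f x\<bar> = T\<close> and 1 where
   \<open>\<bar>f x\<bar> = T + W\<close>.\<close>
 define D where "D = W * (2 * T + W)"
 have D: "0 < D" using W T by (simp add: D_def)
 define q where "q x = ((f x)^2 - T^2) / D" for x
 have Cq: "C1s q (\<lambda>x. (1/D) *\<^sub>R F x)"
 proof -
  have 1: "((\<lambda>s. (s - T^2) / D) has_real_derivative 1/D) (at s)" for s
   using D by (auto intro!: derivative_eq_intros)
  from C1s_compose[OF 1 _ f] show ?thesis by (simp add: q_def[abs_def])
 qed
 define ch where "ch x = cutb (q x)" for x
 define G where "G x = cutb' (q x) *\<^sub>R ((1/D) *\<^sub>R F x)" for x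
 have "C1s ch G" unfolding ch_def[abs_def] G_def[abs_def] by (rule C1s_compose[OF cutb_deriv cutb'_cont Cq])
 moreover have "0 <= ch x" "ch x <= 1" for x using cutb_props by (auto simp: ch_def)
 moreover have "ch x = 1" if "\<bar>f x\<bar> <= T" for x
 proof -
  have "(f x)^2 <= T^2" using that T by (metis abs_le_square_iff abs_of_nonneg)
  thus ?thesis using D by (simp add: ch_def q_def cutb_props(3) divide_nonpos_pos)
 qed
 moreover have far: "ch x = 0" "G x = 0" if "T + W <= \<bar>f x\<bar>" for x
 proof -
  have "(T + W)^2 <= (f x)^2" using that T W power_mono[of "T + W" "\<bar>f x\<bar>" 2] by simp
  hence "D <= (f x)^2 - T^2" by (simp add: D_def power2_eq_square algebra_simps)
  hence "1 <= q x" using D by (simp add: q_def)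
  thus "ch x = 0" "G x = 0" by (auto simp: ch_def G_def cutb_props)
 qed
 moreover have "norm (G x) <= 8 / W" for x
 proof (cases "T + W <= \<bar>f x\<bar>")
  case False
  have "norm (G x) = \<bar>cutb' (q x)\<bar> * (norm (F x) / D)" using D by (simp add: G_def)
  also have "... <= 4 * ((2 * (T + W)) / D)"
   using F[of x] False D cutb_props(6)[of "q x"] by (intro mult_mono divide_right_mono) auto
  also have "... <= 8 / W"
  proof -
   have "4 * ((2 * (T + W)) / D) = 8 / W * ((T + W) / (2 * T + W))" using W T by (simp add: D_def)
   also have "... <= 8 / W * 1" using W T by (intro mult_left_mono) auto
   finally show ?thesis by simp
  qed
  finally show ?thesis .
 qed (use far W in simp)
 ultimately show ?thesis by blast
qed

lemma cutoff_ball: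
 fixes x0 :: "real^'d::finite"
 assumes "0 < W" "0 <= T"
 shows "\<exists>ch G. C1s ch G \<and> (\<forall>x. 0 <= ch x \<and> ch x <= 1 \<and> (dist x x0 <= T --> ch x = 1) \<and> (T + W <= dist x x0 --> ch x = 0 \<and> G x = 0) \<and> norm (G x) <= 8 / W)"
proof -
 have "C1s (\<lambda>x. (dist x x0)^2) (\<lambda>x. 2 *\<^sub>R (x - x0))"
  unfolding C1s_def dist_norm power2_norm_eq_inner
  by (auto intro!: derivative_eq_intros continuous_intros simp: inner_commute algebra_simps)
 from cutoff_exists[OF this _ assms] show ?thesis by (simp add: dist_norm)
qed

lemma cutoff_ht:
 fixes n :: "real^'d::finite"
 assumes "norm n = 1" "0 < W" "0 <= T"
 shows "\<exists>ch G. C1s ch G \<and> (\<forall>x. 0 <= ch x \<and> ch x <= 1 \<and> (\<bar>ht n a x\<bar> <= T --> ch x = 1) \<and> (T + W <= \<bar>ht n a x\<bar> --> ch x = 0 \<and> G x = 0) \<and> norm (G x) <= 8 / W)"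
proof -
 have "C1s (\<lambda>x. ht n a x * ht n a x) (\<lambda>x. ht n a x *\<^sub>R (- n) + ht n a x *\<^sub>R (- n))"
  using C1s_mult[OF ht_C1s[of n a 0] ht_C1s[of n a 0]] by simp
 hence "C1s (\<lambda>x. (ht n a x)^2) (\<lambda>x. (2 * ht n a x) *\<^sub>R (- n))"
  by (simp only: power2_eq_square mult_2 scaleR_add_left)
 from cutoff_exists[OF this _ assms(2,3)] show ?thesis using assms(1) by (simp add: abs_mult)
qed

lemma C1_L2_loc:
 assumes "C1 v J" and [measurable]: "\<Omega> \<in> sets borel" shows "L2_loc_upto \<Omega> J"
 unfolding L2_loc_upto_def
proof (intro conjI allI impI)
 have c: "continuous_on UNIV J" by (rule C1_continuous_J[OF assms(1)])
 show "J \<in> borel_measurable lborel" using borel_measurable_continuous_onI[OF c] by simp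
 fix K :: "(real^'a) set" assume K: "compact K"
 have "set_integrable lborel K (\<lambda>x. (norm (J x))^2)" unfolding set_integrable_def
  by (rule borel_integrable_compact[OF K]) (intro continuous_intros continuous_on_subset[OF c] subset_UNIV)
 moreover have "\<Omega> \<inter> K \<in> sets lborel" using borel_compact[OF K] by auto
 ultimately show "set_integrable lborel (\<Omega> \<inter> K) (\<lambda>x. (norm (J x))^2)"
  by (rule set_integrable_subset) auto
qed

section \<open>The energy inequality for one layer\<close>

lemma theta_integral_le:
 fixes v :: "real^'d::finite => real^'m::finite"
 assumes n: "norm n = 1" and r: "0 < \<rho>" and cv: "continuous_on UNIV v" and S: "S \<in> sets borel"
  and X: "\<And>y. y \<bullet> n = 0 ==> norm y <= \<rho> ==> (\<integral>\<^sup>+x\<in>S. nsq (v (x + y) - v x) \<partial>lborel) <= Y"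
 shows "(\<integral>\<^sup>+x\<in>S. theta n \<rho> v x \<partial>lborel) <= ennreal (measure lborel (cball 0 1 :: (real^'d) set)) * Y"
proof -
 let ?B = "cball 0 1 :: (real^'d) set"
 have mv[measurable]: "v \<in> borel_measurable borel" by (rule borel_measurable_continuous_onI[OF cv])
 have mp[measurable]: "proj n \<in> borel_measurable borel"
  by (rule borel_measurable_continuous_onI) (unfold proj_def[abs_def], intro continuous_intros)
 have mB[measurable]: "?B \<in> sets borel" by simp
 note [measurable] = S
 let ?f = "\<lambda>x y. nsq (v (x + \<rho> *\<^sub>R proj n y) - v x) * indicator ?B y * indicator S x"
 have mf: "(\<lambda>(x,y). ?f x y) \<in> borel_measurable (borel \<Otimes>\<^sub>M borel)" by measurable
 have m1: "(\<lambda>y. nsq (v (x + \<rho> *\<^sub>R proj n y) - v x) * indicator ?B y) \<in> borel_measurable lborel" for x by measurable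
 have "(\<integral>\<^sup>+x\<in>S. theta n \<rho> v x \<partial>lborel) = (\<integral>\<^sup>+x. (\<integral>\<^sup>+y. ?f x y \<partial>lborel) \<partial>lborel)"
  unfolding theta_def nn_integral_multc[OF m1] ..
 also have "... = (\<integral>\<^sup>+y. (\<integral>\<^sup>+x. ?f x y \<partial>lborel) \<partial>lborel)" by (rule nn_swap[OF mf])
 also have "... <= (\<integral>\<^sup>+y. Y * indicator ?B y \<partial>lborel)"
 proof (rule nn_integral_mono)
  fix y
  show "(\<integral>\<^sup>+x. ?f x y \<partial>lborel) <= Y * indicator ?B y"
  proof (cases "y \<in> ?B")
   case True
   have "norm (\<rho> *\<^sub>R proj n y) <= \<rho>"
    using True norm_proj_le[OF n, of y] r mult_left_mono[of "norm (proj n y)" 1 \<rho>] by simp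
   moreover have "(\<rho> *\<^sub>R proj n y) \<bullet> n = 0" by (simp add: proj_inner[OF n])
   ultimately have "(\<integral>\<^sup>+x\<in>S. nsq (v (x + \<rho> *\<^sub>R proj n y) - v x) \<partial>lborel) <= Y" using X by blast
   thus ?thesis using True by simp
  qed simp
 qed
 also have "... = Y * emeasure lborel ?B" by (rule nn_integral_cmult_indicator) simp
 also have "emeasure lborel ?B = ennreal (measure lborel ?B)"
  by (rule emeasure_eq_ennreal_measure) (use emeasure_lborel_cball_finite[of "0::real^'d" 1] in \<open>simp add: less_top[symmetric]\<close>)
 finally show ?thesis by (simp add: mult.commute)
qed

text \<open>Coercivity with errors: \<open>c *\<^sub>R J\<close> is the main part of the test
  gradient and \<open>R\<close> its remainder. Young's inequality with weight \<open>s\<close>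
  against the remainder costs only a small multiple of the squared norm of \<open>J\<close>; the
  product of \<open>g\<close> with the main part is absorbed by half of the coercive term.\<close>

lemma test_lower_bound:
 fixes J g R :: "real^'d::finite^'m::finite"
 assumes A: "coefs \<mu> M A" and mu: "0 < \<mu>" and M: "0 <= M" and s: "0 < s" "s <= 1" and c: "0 <= c" "c <= 4"
 shows "\<mu>/2 * c * (norm J)^2 <= (bilin A x J (c *\<^sub>R J + R) + g \<bullet> (c *\<^sub>R J + R))
  + (s * \<mu>/4 * (norm J)^2 + (M^2/\<mu> + 1) / s * (norm R)^2 + (2/\<mu> + 1) * (norm g)^2)"
proof -
 let ?j = "norm J" and ?r = "norm R" and ?g = "norm g"
 have 1: "c * (\<mu> * ?j^2) <= c * bilin A x J J" using A c unfolding coefs_def by (intro mult_left_mono) auto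
 have 2: "- (M * ?j * ?r) <= bilin A x J R" using A unfolding coefs_def by (smt (verit))
 have 3: "- (?g * ?j) <= g \<bullet> J" "- (?g * ?r) <= g \<bullet> R"
  using Cauchy_Schwarz_ineq2[of g J] Cauchy_Schwarz_ineq2[of g R] by linarith+
 have c3: "- (c * (?g * ?j)) <= c * (g \<bullet> J)" using mult_left_mono[OF 3(1) c(1)] by simp
 have 4: "c * (?g * ?j) <= \<mu>/2 * c * ?j^2 + 2/\<mu> * ?g^2"
 proof -
  have "0 <= (\<mu> * ?j - ?g)^2 / (2 * \<mu>)" using mu by simp
  also have "(\<mu> * ?j - ?g)^2 / (2 * \<mu>) = \<mu>/2 * ?j^2 - ?g * ?j + ?g^2 / (2 * \<mu>)"
   using mu by (simp add: power2_eq_square field_simps)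
  finally have "?g * ?j <= \<mu>/2 * ?j^2 + ?g^2 / (2 * \<mu>)" by simp
  from mult_left_mono[OF this c(1)] have "c * (?g * ?j) <= \<mu>/2 * c * ?j^2 + c * (?g^2 / (2 * \<mu>))" by (simp add: algebra_simps)
  moreover have "c * (?g^2 / (2 * \<mu>)) <= 4 * (?g^2 / (2 * \<mu>))" using c mu by (intro mult_right_mono) auto
  ultimately show ?thesis by simp
 qed
 have 5: "M * ?j * ?r <= s * \<mu>/4 * ?j^2 + (M^2/\<mu>) / s * ?r^2"
 proof -
  have sm: "0 < s * \<mu>" using s mu by simp
  have "0 <= (s * \<mu> * ?j - 2 * M * ?r)^2 / (4 * (s * \<mu>))" using sm by (intro divide_nonneg_pos) auto
  also have "(s * \<mu> * ?j - 2 * M * ?r)^2 / (4 * (s * \<mu>)) = s * \<mu>/4 * ?j^2 - M * ?j * ?r + (M^2/\<mu>) / s * ?r^2"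
   using s mu by (simp add: power2_eq_square field_simps)
  finally show ?thesis by simp
 qed
 have 6: "?g * ?r <= ?g^2 + 1 / s * ?r^2"
 proof -
  have "0 <= (?g - ?r)^2" by simp
  hence "2 * (?g * ?r) <= ?g^2 + ?r^2" by (simp add: power2_eq_square algebra_simps)
  moreover have "0 <= ?g * ?r" by (intro mult_nonneg_nonneg) auto
  ultimately have "?g * ?r <= ?g^2 + 1 * ?r^2" by linarith
  also have "... <= ?g^2 + 1 / s * ?r^2" using s by (intro add_left_mono mult_right_mono) auto
  finally show ?thesis .
 qed
 have e: "bilin A x J (c *\<^sub>R J + R) + g \<bullet> (c *\<^sub>R J + R) = c * bilin A x J J + bilin A x J R + c * (g \<bullet> J) + g \<bullet> R"
  by (simp add: bilin_add_right bilin_scaleR_right inner_add_right)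
 have f: "(M^2/\<mu> + 1) / s * ?r^2 = (M^2/\<mu>) / s * ?r^2 + 1 / s * ?r^2" by (simp add: add_divide_distrib algebra_simps)
 have h: "(2/\<mu> + 1) * ?g^2 = 2/\<mu> * ?g^2 + ?g^2" by (simp add: algebra_simps)
 have i: "c * (\<mu> * ?j^2) = \<mu> * c * ?j^2" by simp
 have i2: "\<mu>/2 * c * ?j^2 = (\<mu> * c * ?j^2) / 2" by simp
 show ?thesis unfolding e f h using 1 2 3(2) c3 4 5 6 unfolding i i2 by linarith
qed

text \<open>The test function is the corrector times a cut-off of width \<open>W\<close>.
  \<open>X\<close> stands for the mean-square tangential increments in units of
  \<open>\<rho>^2\<close>, and \<open>(\<rho>/W)^2\<close> comes from the gradient of the cut-off.
  Of the enlargement \<open>3*W\<close>, one part is the cut-off, and the normal segments of length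
  \<open>2*\<rho>\<close> take at most the other two.\<close>

lemma energy_step:
 assumes mu: "0 < \<mu>" and M: "0 <= M"
 shows "\<exists>C>0. \<forall>(n::real^'d::finite) a x0 A (v::real^'d => real^'m::finite) J g \<rho> W T X s.
  norm n = 1 --> coefs \<mu> M A --> C1 v J --> L2_loc_upto (halfspace n a) g --> weakeq A (halfspace n a) J g -->
  0 < \<rho> --> \<rho> <= W --> 0 <= T --> 0 < s --> s <= 1 -->
  (\<forall>y. y \<bullet> n = 0 --> norm y <= \<rho> -->
   (\<integral>\<^sup>+x\<in>slab n a x0 (2*\<rho>) (T+3*W) \<inter> {x. \<rho> <= ht n a x}. nsq (v (x + y) - v x) \<partial>lborel) <= ennreal (\<rho>^2) * X) -->
  energy (slab n a x0 \<rho> T) J <= ennreal s * energy (slab n a x0 (2*\<rho>) (T+3*W)) J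
   + ennreal (C/s) * (X + ennreal ((\<rho>/W)^2) * energy (slab n a x0 (2*\<rho>) (T+3*W)) J + energy (slab n a x0 (2*\<rho>) (T+3*W)) g)"
 using corrector[where 'd='d and 'm='m]
proof (elim exE conjE, goal_cases)
 case (1 K0)
 note K0 = 1(1) and COR = 1(2)
 define V where "V = measure lborel (cball 0 1 :: (real^'d) set)"
 have V: "0 <= V" by (simp add: V_def)
 define K1 where "K1 = M^2/\<mu> + 1"
 define K2 where "K2 = 2/\<mu> + 1"
 have K1: "1 <= K1" and K2: "1 <= K2" using mu M by (auto simp: K1_def K2_def)
 \<comment> \<open>6 is 2 times the 1 + 2 contributed by \<open>H1\<close> and \<open>H2\<close>;
   the two terms with 256 = 128 * 2 come from the gradient of the cut-off, through \<open>H2\<close>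
   and \<open>H3\<close>.\<close>
 define K3 where "K3 = 6 * K0 * V + 256 * K0 * V + 256 * K0"
 define C where "C = (4/\<mu>) * (K1 * K3 + K2)"
 have K3: "0 < K3" using K0 V by (simp add: K3_def add_nonneg_pos)
 have C0: "0 < C" using mu K1 K2 K3 by (simp add: C_def add_pos_pos)
 show ?thesis
 proof (intro exI[of _ C] conjI C0 allI impI)
  fix n :: "real^'d" and a :: real and x0 A and v :: "real^'d => real^'m" and J g and \<rho> W T s :: real and X
  assume n: "norm n = 1" and A: "coefs \<mu> M A" and Cv: "C1 v J" and g: "L2_loc_upto (halfspace n a) g"
   and weak: "weakeq A (halfspace n a) J g" and r: "0 < \<rho>" and W: "\<rho> <= W" and T: "0 <= T" and s: "0 < s" "s <= 1"
   and X: "\<forall>y. y \<bullet> n = 0 --> norm y <= \<rho> -->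
   (\<integral>\<^sup>+x\<in>slab n a x0 (2*\<rho>) (T+3*W) \<inter> {x. \<rho> <= ht n a x}. nsq (v (x + y) - v x) \<partial>lborel) <= ennreal (\<rho>^2) * X"
  let ?t = "ht n a" and ?\<Omega> = "halfspace n a"
  let ?A = "{x. \<rho> <= ?t x \<and> ?t x < 2 * \<rho>}" and ?B = "{x. 0 < ?t x \<and> ?t x < 2 * \<rho>}"
  let ?S = "slab n a x0 (2*\<rho>) (T+W)" and ?S' = "slab n a x0 (2*\<rho>) (T+3*W)"
  let ?D = "{x. dist x x0 < T + 3 * W}"
  have W0: "0 < W" using r W by simp
  note cv = C1_continuous[OF Cv] and cJ = C1_continuous_J[OF Cv]
  have mJ[measurable]: "J \<in> borel_measurable borel" by (rule borel_measurable_continuous_onI[OF cJ])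
  have mg[measurable]: "g \<in> borel_measurable borel" using g by (simp add: L2_loc_upto_def)
  have mth[measurable]: "theta n \<rho> v \<in> borel_measurable borel" by (rule theta_meas[OF cv])
  have mA[measurable]: "?A \<in> sets borel" and mB[measurable]: "?B \<in> sets borel" and mD[measurable]: "?D \<in> sets borel" by measurable
  have Om: "?\<Omega> \<in> sets borel" unfolding halfspace_ht by measurable
  define H1 where "H1 x = theta n \<rho> v x * indicator ?A x" for x
  define H2 where "H2 x = (\<integral>\<^sup>+s\<in>{0..2*\<rho>}. theta n \<rho> v (x + s *\<^sub>R (-n)) * indicator ?A (x + s *\<^sub>R (-n)) \<partial>lborel)" for x
  define H3 where "H3 x = (\<integral>\<^sup>+s\<in>{0..2*\<rho>}. nsq (J (x + s *\<^sub>R (-n))) * indicator ?B (x + s *\<^sub>R (-n)) \<partial>lborel)" for x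
  obtain \<Phi> K \<psi> Rm where CP: "C1 \<Phi> K" and dec: "\<And>x. 0 < ?t x ==> K x = \<psi> x *\<^sub>R J x + Rm x"
   and psi: "\<And>x. 0 < ?t x ==> 0 <= \<psi> x" "\<And>x. 0 < ?t x ==> \<psi> x <= 4" "\<And>x. 0 < ?t x ==> ?t x < \<rho> ==> 1/2 <= \<psi> x"
   and far: "\<And>x. 0 < ?t x ==> 2 * \<rho> <= ?t x ==> \<Phi> x = 0 \<and> K x = 0 \<and> \<psi> x = 0 \<and> Rm x = 0"
   and Rb: "\<And>x. 0 < ?t x ==> nsq (Rm x) <= ennreal (K0 / \<rho>^2) * (H1 x + ennreal (1 / \<rho>) * H2 x)"
   and Pb: "\<And>x. 0 < ?t x ==> nsq (\<Phi> x) <= ennreal K0 * (ennreal (1 / \<rho>) * H2 x + ennreal \<rho> * H3 x)"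
   using COR[rule_format, OF n r Cv, of a] unfolding H1_def H2_def H3_def by blast
  obtain ch G where CG: "C1s ch G" and ch: "\<And>x. 0 <= ch x" "\<And>x. ch x <= 1" "\<And>x. dist x x0 <= T ==> ch x = 1"
   "\<And>x. T + W <= dist x x0 ==> ch x = 0 \<and> G x = 0" "\<And>x. norm (G x) <= 8 / W"
   using cutoff_ball[OF W0 T, of x0] by blast
  let ?\<phi> = "\<lambda>x. ch x *\<^sub>R \<Phi> x" and ?K = "\<lambda>x. ch x *\<^sub>R K x + outer (\<Phi> x) (G x)"
  have C\<phi>: "C1 ?\<phi> ?K" by (rule C1_scale[OF CG CP])
  have supp: "?\<phi> x = 0" if "norm x > norm x0 + T + W" for x
  proof -
   have "norm x <= dist x x0 + norm x0" by (metis dist_norm diff_add_cancel norm_triangle_ineq)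
   thus ?thesis using that ch(4)[of x] by simp
  qed
  have mK[measurable]: "?K \<in> borel_measurable borel" by (rule C1_measurable_J[OF C\<phi>])
  let ?a = "\<lambda>x. indicator ?\<Omega> x *\<^sub>R (bilin A x (J x) (?K x) + g x \<bullet> ?K x)"
  have LJ: "L2_loc_upto ?\<Omega> J" by (rule C1_L2_loc[OF Cv Om])
  have K0s: "?K x = 0" if "norm x > norm x0 + T + W" for x by (rule C1_support_J[OF C\<phi> supp that])
  have ia: "integrable lborel ?a"
   using set_integral_add(1)[OF weak_integrable[OF A M Om LJ g C1_continuous_J[OF C\<phi>] K0s]] by (simp add: set_integrable_def)
  have a0: "(LINT x|lborel. ?a x) = 0"
   using weak C\<phi> supp unfolding weakeq_def set_lebesgue_integral_def by blast
  define Rt where "Rt x = ch x *\<^sub>R Rm x + outer (\<Phi> x) (G x)" for x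
  let ?p = "\<lambda>x. ennreal (\<mu>/4 * (norm (J x))^2) * indicator (slab n a x0 \<rho> T) x"
  let ?r = "\<lambda>x. (ennreal (s * \<mu>/4 * (norm (J x))^2) + ennreal (K1 / s) *
   (ennreal (2 * K0 / \<rho>^2) * (H1 x + ennreal (1 / \<rho>) * H2 x) + ennreal (128 * K0 / W^2) * (ennreal (1 / \<rho>) * H2 x + ennreal \<rho> * H3 x))
   + ennreal (K2 * (norm (g x))^2)) * indicator ?S x"
  have Rtb: "nsq (Rt x) <= ennreal (2 * K0 / \<rho>^2) * (H1 x + ennreal (1 / \<rho>) * H2 x) + ennreal (128 * K0 / W^2) * (ennreal (1 / \<rho>) * H2 x + ennreal \<rho> * H3 x)"
   if x: "0 < ?t x" for x
  proof -
   have 1: "nsq (Rt x) <= 2 * nsq (ch x *\<^sub>R Rm x) + 2 * nsq (outer (\<Phi> x) (G x))"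
    unfolding Rt_def by (rule ennreal_norm_sq_le2)
   have "(norm (ch x *\<^sub>R Rm x))^2 <= (norm (Rm x))^2"
    using ch(1,2)[of x] by (intro power_mono) (auto simp: mult_left_le_one_le)
   hence 2: "2 * nsq (ch x *\<^sub>R Rm x) <= ennreal (2 * K0 / \<rho>^2) * (H1 x + ennreal (1 / \<rho>) * H2 x)"
   proof -
    assume "(norm (ch x *\<^sub>R Rm x))^2 <= (norm (Rm x))^2"
    hence "2 * nsq (ch x *\<^sub>R Rm x) <= ennreal 2 * nsq (Rm x)"
     by (simp add: mult_left_mono ennreal_leI del: norm_scaleR)
    also have "... <= ennreal 2 * (ennreal (K0 / \<rho>^2) * (H1 x + ennreal (1 / \<rho>) * H2 x))" by (intro mult_left_mono Rb x) simp
    also have "... <= ennreal (2 * K0 / \<rho>^2) * (H1 x + ennreal (1 / \<rho>) * H2 x)"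
     by (rule ennreal_mult_mult_le) (use K0 r in auto)
    finally show ?thesis .
   qed
   have "(norm (outer (\<Phi> x) (G x)))^2 <= 64 / W^2 * (norm (\<Phi> x))^2"
   proof -
    have "(norm (G x))^2 <= (8 / W)^2" by (intro power_mono ch(5)) simp
    hence "(norm (\<Phi> x))^2 * (norm (G x))^2 <= (norm (\<Phi> x))^2 * (64 / W^2)" by (intro mult_left_mono) (simp_all add: power_divide)
    thus ?thesis by (simp add: power_mult_distrib mult.commute)
   qed
   hence "nsq (outer (\<Phi> x) (G x)) <= ennreal (64 / W^2 * (norm (\<Phi> x))^2)" by (rule ennreal_leI)
   also have "... = ennreal (64 / W^2) * nsq (\<Phi> x)" by (rule ennreal_mult) auto
   also have "... <= ennreal (64 / W^2) * (ennreal K0 * (ennreal (1 / \<rho>) * H2 x + ennreal \<rho> * H3 x))" by (intro mult_left_mono Pb x) simp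
   also have "... <= ennreal (64 * K0 / W^2) * (ennreal (1 / \<rho>) * H2 x + ennreal \<rho> * H3 x)"
    by (rule ennreal_mult_mult_le) (use K0 W0 in auto)
   finally have "2 * nsq (outer (\<Phi> x) (G x)) <= ennreal 2 * (ennreal (64 * K0 / W^2) * (ennreal (1 / \<rho>) * H2 x + ennreal \<rho> * H3 x))"
    by (simp add: mult_left_mono del: norm_outer)
   also have "... <= ennreal (128 * K0 / W^2) * (ennreal (1 / \<rho>) * H2 x + ennreal \<rho> * H3 x)"
    by (rule ennreal_mult_mult_le) (use K0 W0 in auto)
   finally have 3: "2 * nsq (outer (\<Phi> x) (G x)) <= ennreal (128 * K0 / W^2) * (ennreal (1 / \<rho>) * H2 x + ennreal \<rho> * H3 x)" .
   show ?thesis by (rule order_trans[OF 1 add_mono[OF 2 3]])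
  qed
  \<comment> \<open>\<open>\<mu>/4\<close> is half of the \<open>\<mu>/2\<close> in
    \<open>test_lower_bound\<close>, because cut-off times \<open>\<psi>\<close> is at least 1/2 on
    the small slab. Off \<open>?S\<close> the integrand \<open>?a\<close> vanishes: the point lies
    outside the half-space, above the layer, or beyond the cut-off.\<close>
  have le: "?p x + ennreal (- ?a x) <= ennreal (?a x) + ?r x" for x
  proof (cases "x \<in> ?S")
   case True
   hence x: "0 < ?t x" "?t x < 2 * \<rho>" "dist x x0 < T + W" by (auto simp: slab_def)
   let ?c = "ch x * \<psi> x"
   have c: "0 <= ?c" "?c <= 4"
    using ch(1,2)[of x] psi(1,2)[OF x(1)] mult_mono[of "ch x" 1 "\<psi> x" 4] by auto
   have KR: "?K x = ?c *\<^sub>R J x + Rt x" by (simp add: dec[OF x(1)] Rt_def scaleR_add_right)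
   let ?P = "\<mu>/4 * (norm (J x))^2 * indicator (slab n a x0 \<rho> T) x"
   let ?R = "s * \<mu>/4 * (norm (J x))^2 + K1 / s * (norm (Rt x))^2 + K2 * (norm (g x))^2"
   have P: "?P <= \<mu>/2 * ?c * (norm (J x))^2"
   proof (cases "x \<in> slab n a x0 \<rho> T")
    case True
    hence "1/2 <= ?c" using ch(3)[of x] psi(3)[OF x(1)] by (auto simp: slab_def)
    hence "\<mu>/2 * (1/2) * (norm (J x))^2 <= \<mu>/2 * ?c * (norm (J x))^2" using mu by (intro mult_right_mono mult_left_mono) auto
    thus ?thesis using True by simp
   next
    case False
    thus ?thesis using c mu by simp
   qed
   also have "... <= (bilin A x (J x) (?K x) + g x \<bullet> ?K x) + ?R"
    unfolding KR K1_def K2_def by (rule test_lower_bound[OF A mu M s c])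
   also have "bilin A x (J x) (?K x) + g x \<bullet> ?K x = ?a x" using x by (simp add: halfspace_ht)
   finally have e1: "ennreal ?P + ennreal (- ?a x) <= ennreal (?a x) + ennreal ?R"
    by (rule ennreal_split_le) (use mu s K1 K2 in \<open>auto intro!: add_nonneg_nonneg mult_nonneg_nonneg divide_nonneg_nonneg\<close>)
   have eP: "ennreal ?P = ?p x" by (auto split: split_indicator)
   have eR: "ennreal ?R <= ?r x"
   proof -
    have "ennreal ?R = ennreal (s * \<mu>/4 * (norm (J x))^2) + ennreal (K1 / s * (norm (Rt x))^2) + ennreal (K2 * (norm (g x))^2)"
     using mu s K1 K2 by (subst ennreal_plus; simp)+
    also have "ennreal (K1 / s * (norm (Rt x))^2) = ennreal (K1 / s) * nsq (Rt x)"
     by (rule ennreal_mult) (use s K1 in auto)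
    also have "ennreal (s * \<mu>/4 * (norm (J x))^2) + ennreal (K1 / s) * nsq (Rt x) + ennreal (K2 * (norm (g x))^2) <= ?r x"
     using True by (simp add: add_mono mult_left_mono Rtb[OF x(1)])
    finally show ?thesis .
   qed
   show ?thesis using order_trans[OF e1 add_left_mono[OF eR]] unfolding eP .
  next
   case False
   have ax: "?a x = 0"
   proof (cases "0 < ?t x")
    case True
    hence "2 * \<rho> <= ?t x \<or> T + W <= dist x x0" using False by (auto simp: slab_def)
    hence "?K x = 0" using far[OF True] ch(4)[of x] by (auto simp: outer_def vec_eq_iff)
    thus ?thesis by simp
   qed (simp add: halfspace_ht)
   have "x \<notin> slab n a x0 \<rho> T" using False r W0 by (auto simp: slab_def)
   hence px: "?p x = 0" by simp
   show ?thesis unfolding ax px by simp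
  qed
  have mH1[measurable]: "H1 \<in> borel_measurable borel" unfolding H1_def[abs_def] by measurable
  have mH2[measurable]: "H2 \<in> borel_measurable borel" unfolding H2_def[abs_def] by measurable
  have mH3[measurable]: "H3 \<in> borel_measurable borel" unfolding H3_def[abs_def] by measurable
  have main: "(\<integral>\<^sup>+x. ?p x \<partial>lborel) <= (\<integral>\<^sup>+x. ?r x \<partial>lborel)"
   by (rule nn_integral_le_of_zero_integral[OF ia a0 _ _ le]) measurable
  have lhs: "(\<integral>\<^sup>+x. ?p x \<partial>lborel) = ennreal (\<mu>/4) * energy (slab n a x0 \<rho> T) J"
  proof -
   have m: "(\<lambda>x. nsq (J x) * indicator (slab n a x0 \<rho> T) x) \<in> borel_measurable lborel" by measurable
   have "?p x = ennreal (\<mu>/4) * (nsq (J x) * indicator (slab n a x0 \<rho> T) x)" for x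
    using mu by (simp add: ennreal_mult[symmetric] split: split_indicator)
   thus ?thesis unfolding energy_def by (simp only: nn_integral_cmult[OF m])
  qed
  let ?Y = "\<integral>\<^sup>+x\<in>?S' \<inter> {x. \<rho> <= ?t x}. theta n \<rho> v x \<partial>lborel"
  have Y: "?Y <= ennreal V * (ennreal (\<rho>^2) * X)"
   unfolding V_def by (rule theta_integral_le[OF n r cv]) (use X in auto)
  have S1: "(\<integral>\<^sup>+x. H1 x * indicator ?S x \<partial>lborel) <= ?Y"
   unfolding H1_def by (intro nn_integral_mono) (use W0 in \<open>auto simp: slab_def split: split_indicator\<close>)
  have sub: "0 < ?t x \<and> ?t x < 2 * \<rho>" if "x \<in> ?S" for x using that by (auto simp: slab_def)
  have shD: "x + q *\<^sub>R (- n) \<in> ?D" if "x \<in> ?S" "0 <= q" "q <= 2 * \<rho>" for x q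
  proof -
   have "dist (x + q *\<^sub>R (- n)) x0 <= dist x x0 + q"
    using norm_triangle_ineq4[of "x - x0" "q *\<^sub>R n"] n that(2) by (simp add: dist_norm algebra_simps)
   thus ?thesis using that W by (auto simp: slab_def)
  qed
  have S2: "(\<integral>\<^sup>+x. H2 x * indicator ?S x \<partial>lborel) <= ennreal (2*\<rho>) * ?Y"
  proof -
   have m: "(\<lambda>x. theta n \<rho> v x * indicator ?A x) \<in> borel_measurable borel" by measurable
   have "(\<integral>\<^sup>+x. H2 x * indicator ?S x \<partial>lborel) <= ennreal (2*\<rho>) * (\<integral>\<^sup>+x\<in>?D. theta n \<rho> v x * indicator ?A x \<partial>lborel)"
    unfolding H2_def by (rule fubini_normal[OF n m slab_borel mD _ sub shD]) (use r in auto)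
   also have "... <= ennreal (2*\<rho>) * ?Y"
    by (intro mult_left_mono nn_integral_mono) (use r in \<open>auto simp: slab_def split: split_indicator\<close>)
   finally show ?thesis .
  qed
  have S3: "(\<integral>\<^sup>+x. H3 x * indicator ?S x \<partial>lborel) <= ennreal (2*\<rho>) * energy ?S' J"
  proof -
   have m: "(\<lambda>x. nsq (J x) * indicator ?B x) \<in> borel_measurable borel" by measurable
   have "(\<integral>\<^sup>+x. H3 x * indicator ?S x \<partial>lborel) <= ennreal (2*\<rho>) * (\<integral>\<^sup>+x\<in>?D. nsq (J x) * indicator ?B x \<partial>lborel)"
    unfolding H3_def by (rule fubini_normal[OF n m slab_borel mD _ sub shD]) (use r in auto)
   also have "... <= ennreal (2*\<rho>) * energy ?S' J"
    unfolding energy_def by (intro mult_left_mono nn_integral_mono) (auto simp: slab_def split: split_indicator)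
   finally show ?thesis .
  qed
  have rhs: "(\<integral>\<^sup>+x. ?r x \<partial>lborel) = ennreal (s * \<mu>/4) * energy ?S J + ennreal (K1 / s) *
   (ennreal (2 * K0 / \<rho>^2) * ((\<integral>\<^sup>+x. H1 x * indicator ?S x \<partial>lborel) + ennreal (1 / \<rho>) * (\<integral>\<^sup>+x. H2 x * indicator ?S x \<partial>lborel))
    + ennreal (128 * K0 / W^2) * (ennreal (1 / \<rho>) * (\<integral>\<^sup>+x. H2 x * indicator ?S x \<partial>lborel) + ennreal \<rho> * (\<integral>\<^sup>+x. H3 x * indicator ?S x \<partial>lborel)))
   + ennreal K2 * energy ?S g"
  proof -
   let ?h1 = "\<lambda>x. H1 x * indicator ?S x" and ?h2 = "\<lambda>x. H2 x * indicator ?S x" and ?h3 = "\<lambda>x. H3 x * indicator ?S x"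
    and ?hj = "\<lambda>x. nsq (J x) * indicator ?S x" and ?hg = "\<lambda>x. nsq (g x) * indicator ?S x"
   have m: "?h1 \<in> borel_measurable lborel" "?h2 \<in> borel_measurable lborel" "?h3 \<in> borel_measurable lborel"
    "?hj \<in> borel_measurable lborel" "?hg \<in> borel_measurable lborel" by measurable
   have "?r x = ennreal (s * \<mu>/4) * ?hj x + ennreal (K1 / s) * (ennreal (2 * K0 / \<rho>^2) * (?h1 x + ennreal (1 / \<rho>) * ?h2 x)
    + ennreal (128 * K0 / W^2) * (ennreal (1 / \<rho>) * ?h2 x + ennreal \<rho> * ?h3 x)) + ennreal K2 * ?hg x" for x
   proof (cases "x \<in> ?S")
    case True
    have "ennreal (s * \<mu>/4 * (norm (J x))^2) = ennreal (s * \<mu>/4) * nsq (J x)" by (rule ennreal_mult) (use s mu in auto)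
    moreover have "ennreal (K2 * (norm (g x))^2) = ennreal K2 * nsq (g x)" by (rule ennreal_mult) (use K2 in auto)
    ultimately show ?thesis using True by (simp only: indicator_simps mult_1_right)
   next
    case False
    hence i: "indicator ?S x = (0::ennreal)" by simp
    show ?thesis unfolding i by simp
   qed
   thus ?thesis unfolding energy_def
    by (simp only: nn_integral_add nn_integral_cmult m borel_measurable_add borel_measurable_times_ennreal borel_measurable_const)
  qed
  show "energy (slab n a x0 \<rho> T) J <= ennreal s * energy ?S' J
   + ennreal (C/s) * (X + ennreal ((\<rho>/W)^2) * energy ?S' J + energy ?S' g)"
  \<comment> \<open>If a quantity on the right is infinite, the claim is trivial; otherwise all
    energies are named by reals and compared there. The same division recurs in the estimates
    below.\<close>
  proof (cases "energy ?S' J = top \<or> energy ?S' g = top \<or> X = top")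
   case True
   hence "ennreal s * energy ?S' J + ennreal (C/s) * (X + ennreal ((\<rho>/W)^2) * energy ?S' J + energy ?S' g) = top"
    using s C0 by (auto simp: ennreal_mult_eq_top_iff ennreal_mult_top)
   thus ?thesis by (metis top_greatest)
  next
   case False
   obtain e where ee: "energy ?S' J = ennreal e" "0 <= e" using False by (cases "energy ?S' J") auto
   obtain f where ff: "energy ?S' g = ennreal f" "0 <= f" using False by (cases "energy ?S' g") auto
   obtain x where xx: "X = ennreal x" "0 <= x" using False by (cases X) auto
   note efx = ee ff xx
   have SS: "energy ?S J <= energy ?S' J" "energy ?S g <= energy ?S' g"
    by (intro energy_slab_mono; use W0 in simp)+
   obtain e0 where e0: "energy (slab n a x0 \<rho> T) J = ennreal e0" "0 <= e0"
   proof -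
    have "energy (slab n a x0 \<rho> T) J <= energy ?S' J" by (intro energy_slab_mono) (use W0 r in auto)
    hence "energy (slab n a x0 \<rho> T) J \<noteq> top" unfolding ee(1) by (rule neq_top_trans[OF ennreal_neq_top])
    thus ?thesis using that by (cases "energy (slab n a x0 \<rho> T) J") auto
   qed
   define y where "y = V * (\<rho>^2 * x)"
   have y0: "0 <= y" using V efx by (simp add: y_def)
   have "?Y <= ennreal y" using Y V efx by (simp add: y_def ennreal_mult)
   hence Yy: "?Y <= ennreal y" .
   have T1: "(\<integral>\<^sup>+x. H1 x * indicator ?S x \<partial>lborel) <= ennreal y" by (rule order_trans[OF S1 Yy])
   have "(\<integral>\<^sup>+x. H2 x * indicator ?S x \<partial>lborel) <= ennreal (2*\<rho>) * ennreal y"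
    by (rule order_trans[OF S2 mult_left_mono[OF Yy]]) simp
   also have "... = ennreal (2*\<rho>*y)" by (rule ennreal_mult[symmetric]) (use r y0 in auto)
   finally have T2: "(\<integral>\<^sup>+x. H2 x * indicator ?S x \<partial>lborel) <= ennreal (2*\<rho>*y)" .
   have T3: "(\<integral>\<^sup>+x. H3 x * indicator ?S x \<partial>lborel) <= ennreal (2*\<rho>*e)"
    using S3 r efx by (simp add: ennreal_mult)
   let ?Z = "s * \<mu>/4 * e + K1 / s * (2 * K0 / \<rho>^2 * (y + 1/\<rho> * (2*\<rho>*y)) + 128 * K0 / W^2 * (1/\<rho> * (2*\<rho>*y) + \<rho> * (2*\<rho>*e))) + K2 * f"
   define Z where "Z = ?Z"
   have Z0: "0 <= Z" unfolding Z_def using s mu K1 K0 r W0 K2 efx y0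
    by (intro add_nonneg_nonneg mult_nonneg_nonneg divide_nonneg_nonneg) auto
   have "ennreal (\<mu>/4) * ennreal e0 <= ennreal (s * \<mu>/4) * ennreal e + ennreal (K1 / s) *
   (ennreal (2 * K0 / \<rho>^2) * (ennreal y + ennreal (1 / \<rho>) * ennreal (2*\<rho>*y))
    + ennreal (128 * K0 / W^2) * (ennreal (1 / \<rho>) * ennreal (2*\<rho>*y) + ennreal \<rho> * ennreal (2*\<rho>*e)))
   + ennreal K2 * ennreal f"
    unfolding e0(1)[symmetric] lhs[symmetric]
    by (rule order_trans[OF main]) (unfold rhs, intro add_mono mult_left_mono T1 T2 T3 SS[unfolded efx] zero_le)
   also have "... = ennreal ?Z"
    using s mu K1 K0 r W0 K2 efx y0
    by (simp only: ennreal_mult[symmetric] ennreal_plus[symmetric] mult_nonneg_nonneg add_nonneg_nonneg divide_nonneg_nonneg zero_le_power2 less_imp_le zero_le_numeral zero_le_one)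
   finally have "ennreal (\<mu>/4) * ennreal e0 <= ennreal Z" unfolding Z_def .
   moreover have "ennreal (\<mu>/4) * ennreal e0 = ennreal (\<mu>/4 * e0)" by (rule ennreal_mult[symmetric]) (use mu e0 in auto)
   ultimately have "\<mu>/4 * e0 <= Z" using Z0 by (simp only: ennreal_le_iff)
   hence "e0 <= 4/\<mu> * Z" using mu by (simp add: field_simps)
   also have "4/\<mu> * Z = 4/\<mu> * ?Z" by (simp only: Z_def)
   also have "... <= s * e + C/s * (x + (\<rho>/W)^2 * e + f)"
   proof -
    define q where "q = (\<rho>/W)^2"
    have q: "0 <= q" "q <= 1" using r W W0 by (auto simp: q_def power_le_one)
    have 1: "2 * K0 / \<rho>^2 * (y + 1/\<rho> * (2*\<rho>*y)) = 6 * K0 * V * x"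
     using r by (simp add: y_def field_simps)
    have 2: "128 * K0 / W^2 * (1/\<rho> * (2*\<rho>*y) + \<rho> * (2*\<rho>*e)) = q * (256 * K0 * V * x) + 256 * K0 * (q * e)"
     using r W0 by (simp add: y_def q_def power_divide power2_eq_square field_simps)
    have "q * (256 * K0 * V * x) <= 1 * (256 * K0 * V * x)" using q K0 V efx by (intro mult_right_mono) auto
    moreover have "6 * K0 * V * x + 256 * K0 * V * x + 256 * K0 * (q * e) <= K3 * x + K3 * (q * e)"
    proof (rule add_mono)
     have "6 * K0 * V * x + 256 * K0 * V * x = (6 * K0 * V + 256 * K0 * V) * x" by (simp add: algebra_simps)
     also have "... <= K3 * x" using efx K0 by (intro mult_right_mono) (auto simp: K3_def)
     finally show "6 * K0 * V * x + 256 * K0 * V * x <= K3 * x" .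
     show "256 * K0 * (q * e) <= K3 * (q * e)" using q efx K0 V by (intro mult_right_mono) (auto simp: K3_def)
    qed
    ultimately have 3: "6 * K0 * V * x + (q * (256 * K0 * V * x) + 256 * K0 * (q * e)) <= K3 * (x + q * e)"
     by (simp add: distrib_left)
    have "4/\<mu> * ?Z <= 4/\<mu> * (s * \<mu>/4 * e + K1 / s * (K3 * (x + q * e)) + K2 * f)"
     unfolding 1 2 using 3 mu s K1 K2 by (intro mult_left_mono add_mono) auto
    also have "... = s * e + ((4/\<mu>) * (K1 * K3)) / s * (x + q * e) + (4/\<mu>) * K2 * f"
     using mu s by (simp add: field_simps)
    also have "... <= s * e + C / s * (x + q * e) + C / s * f"
    proof (intro add_mono mult_right_mono order_refl divide_right_mono)
     show "4/\<mu> * (K1 * K3) <= C" using mu K2 by (simp add: C_def distrib_left)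
     have "4/\<mu> * K2 <= C" using mu K1 K3 by (simp add: C_def distrib_left)
     also have "C <= C / s" using s C0 by (simp add: field_simps)
     finally show "4/\<mu> * K2 <= C / s" .
    qed (use s q efx in auto)
    finally show ?thesis by (simp add: q_def algebra_simps)
   qed
   finally have "e0 <= s * e + C/s * (x + (\<rho>/W)^2 * e + f)" .
   hence "ennreal e0 <= ennreal (s * e + C/s * (x + (\<rho>/W)^2 * e + f))" by (rule ennreal_leI)
   also have "... = ennreal s * ennreal e + ennreal (C/s) * (ennreal x + ennreal ((\<rho>/W)^2) * ennreal e + ennreal f)"
    using s C0 efx
    by (simp only: ennreal_reals)
   finally show ?thesis unfolding efx e0 .
  qed
 qed
qed

section \<open>Two-sided slabs and hole filling\<close>

definition sslab :: "real^'d::finite => real => real^'d => real => real => (real^'d) set" where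
 "sslab n a x0 r T = {x. \<bar>ht n a x\<bar> < r \<and> dist x x0 < T}"

lemma sslab_borel [measurable]: "sslab n a x0 r T \<in> sets borel"
 unfolding sslab_def by measurable

lemma sslab_mono: "r <= r' ==> T <= T' ==> sslab n a x0 r T \<subseteq> sslab n a x0 r' T'"
 unfolding sslab_def by auto

lemma energy_Un_le:
 assumes "J \<in> borel_measurable borel" "S \<in> sets borel" "S' \<in> sets borel" "S \<inter> S' = {}"
 shows "energy (S \<union> S') J = energy S J + energy S' J"
proof -
 note [measurable] = assms(1-3)
 have m: "(\<lambda>x. nsq (J x)) \<in> borel_measurable lborel" by measurable
 show ?thesis unfolding energy_def
  by (subst nn_integral_disjoint_pair[OF m]) (use assms in auto)
qed

lemma le_ennrealD: "E <= ennreal e ==> \<exists>b\<ge>0. E = ennreal b"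
 by (cases E) (auto simp: top_unique)

lemma dist_shift_le: "dist (x + y) x0 <= dist x x0 + norm (y::'a::real_normed_vector)"
 by (metis dist_norm add_diff_eq add.commute norm_triangle_ineq diff_add_eq)

text \<open>The layer integral in \<open>energy_step\<close> is bounded by the energy of the layer itself, that is by a
 difference of energies of two slabs.\<close>
lemma hole_filling_step:
 assumes mu: "0 < \<mu>" and M: "0 <= M"
 shows "\<exists>\<kappa> K. 0 < \<kappa> \<and> \<kappa> < 1 \<and> 1 <= K \<and> (\<forall>(n::real^'d::finite) a x0 A (v::real^'d => real^'m::finite) J g \<rho> T.
  norm n = 1 --> coefs \<mu> M A --> C1 v J --> L2_loc_upto (halfspace n a) g --> weakeq A (halfspace n a) J g -->
  0 < \<rho> --> 0 <= T -->
  energy (slab n a x0 \<rho> T) J <= ennreal \<kappa> * energy (slab n a x0 (2*\<rho>) (T+K*\<rho>)) J + energy (slab n a x0 (2*\<rho>) (T+K*\<rho>)) g)"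
 using energy_step[OF mu M, where 'd='d and 'm='m]
proof (elim exE conjE, goal_cases)
 case (1 C)
 note C = 1(1) and ST = 1(2)
 \<comment> \<open>Chosen so that \<open>1 / K^2 <= 1 / (64 * C)\<close>: the cut-off term,
   multiplied by \<open>8 * C\<close>, then adds another 1/8 of the energy to the 1/8 that comes
   from \<open>s\<close>.\<close>
 define K where "K = 1 + 64 * C"
 have K: "1 <= K" using C by (simp add: K_def)
 \<comment> \<open>The ratio produced by hole filling: \<open>8 * C\<close> times the energy of the
   small slab is added to both sides of an inequality whose coefficient is 1/4.\<close>
 define \<kappa> where "\<kappa> = (1/4 + 8 * C) / (1 + 8 * C)"
 have k: "0 < \<kappa>" "\<kappa> < 1" using C by (auto simp: \<kappa>_def field_simps)
 show ?thesis
 proof (rule exI[of _ \<kappa>], rule exI[of _ "4 * K"], intro conjI k allI impI)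
  show "1 <= 4 * K" using K by simp
  fix n :: "real^'d" and a :: real and x0 A and v :: "real^'d => real^'m" and J g and \<rho> T :: real
  assume n: "norm n = 1" and A: "coefs \<mu> M A" and Cv: "C1 v J" and g: "L2_loc_upto (halfspace n a) g"
   and weak: "weakeq A (halfspace n a) J g" and r: "0 < \<rho>" and T: "0 <= T"
  let ?W = "K * \<rho>" and ?S' = "slab n a x0 (2*\<rho>) (T + 4 * K * \<rho>)" and ?S0 = "slab n a x0 \<rho> (T + 4 * K * \<rho>)"
  let ?A = "?S' \<inter> {x. \<rho> <= ht n a x}" and ?S3 = "slab n a x0 (2*\<rho>) (T + 3 * ?W)"
  have mJ: "J \<in> borel_measurable borel" by (rule C1_measurable_J[OF Cv])
  have mA[measurable]: "?A \<in> sets borel" by measurable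
  have rW: "\<rho> <= ?W" using K r by simp
  have "energy (slab n a x0 \<rho> T) J <= ennreal (1/8) * energy ?S3 J
   + ennreal (C/(1/8)) * (energy ?A J + ennreal ((\<rho>/?W)^2) * energy ?S3 J + energy ?S3 g)"
  proof (rule ST[rule_format, OF n A Cv g weak r rW T])
   fix y assume y: "y \<bullet> n = 0" "norm y <= \<rho>"
   have "(\<integral>\<^sup>+x\<in>?S3 \<inter> {x. \<rho> <= ht n a x}. nsq (v (x + y) - v x) \<partial>lborel) <= nsq y * (\<integral>\<^sup>+x\<in>?A. nsq (J x) \<partial>lborel)"
   proof (rule increment_integral_le[OF Cv])
    fix x s assume x: "x \<in> ?S3 \<inter> {x. \<rho> <= ht n a x}" and s: "0 <= s" "s <= (1::real)"
    have h: "ht n a (x + s *\<^sub>R y) = ht n a x" using y by (simp add: ht_add)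
    have "norm (s *\<^sub>R y) <= 1 * \<rho>" unfolding norm_scaleR using s y by (intro mult_mono) auto
    moreover have "dist x x0 < T + 3 * ?W" using x by (simp add: slab_def)
    ultimately have "dist (x + s *\<^sub>R y) x0 < T + 4 * K * \<rho>" using dist_shift_le[of x "s *\<^sub>R y" x0] rW by linarith
    thus "x + s *\<^sub>R y \<in> ?A" using x h by (auto simp: slab_def)
   qed measurable
   also have "... <= ennreal (\<rho>^2) * energy ?A J" unfolding energy_def
    using y by (intro mult_right_mono ennreal_leI power_mono) auto
   finally show "(\<integral>\<^sup>+x\<in>?S3 \<inter> {x. \<rho> <= ht n a x}. nsq (v (x + y) - v x) \<partial>lborel) <= ennreal (\<rho>^2) * energy ?A J" .
  qed auto
  also have "... <= ennreal (1/8) * energy ?S' J + ennreal (8*C) * (energy ?A J + ennreal (1/(64*C)) * energy ?S' J + energy ?S' g)"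
  proof -
   have S3: "energy ?S3 J <= energy ?S' J" "energy ?S3 g <= energy ?S' g"
    by (rule energy_slab_mono; use rW r in linarith)+
   have "(\<rho>/?W)^2 = 1 / K^2" using r K by (simp add: power_divide power_mult_distrib)
   also have "... <= 1 / (64*C)"
   proof (rule divide_left_mono)
    have "64 * C <= K * 1" by (simp add: K_def)
    also have "K * 1 <= K * K" using K by (intro mult_left_mono) auto
    finally show "64 * C <= K^2" by (simp add: power2_eq_square)
   qed (use C K in auto)
   finally have q: "ennreal ((\<rho>/?W)^2) <= ennreal (1 / (64*C))" by (rule ennreal_leI)
   have c: "C / (1/8) = 8 * C" by simp
   show ?thesis unfolding c by (intro add_mono mult_mono order_refl S3 q zero_le)
  qed
  finally have main: "energy (slab n a x0 \<rho> T) J <= ennreal (1/8) * energy ?S' J + ennreal (8*C) * (energy ?A J + ennreal (1/(64*C)) * energy ?S' J + energy ?S' g)" .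
  show "energy (slab n a x0 \<rho> T) J <= ennreal \<kappa> * energy (slab n a x0 (2*\<rho>) (T+4*K*\<rho>)) J + energy (slab n a x0 (2*\<rho>) (T+4*K*\<rho>)) g"
  proof (cases "energy ?S' J = top \<or> energy ?S' g = top")
   case True
   hence "ennreal \<kappa> * energy ?S' J + energy ?S' g = top" using k by (auto simp: ennreal_mult_eq_top_iff)
   hence "energy (slab n a x0 \<rho> T) J <= ennreal \<kappa> * energy ?S' J + energy ?S' g" by (simp only: top_greatest)
   thus ?thesis .
  next
   case False
   obtain e where e: "energy ?S' J = ennreal e" "0 <= e" using False by (cases "energy ?S' J") auto
   obtain f where f: "energy ?S' g = ennreal f" "0 <= f" using False by (cases "energy ?S' g") auto
   have sub: "?A \<subseteq> ?S'" "?S0 \<subseteq> ?S'" "slab n a x0 \<rho> T \<subseteq> ?S0"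
   proof -
    have "0 <= 4 * K * \<rho>" using r K by simp
    thus "?A \<subseteq> ?S'" "?S0 \<subseteq> ?S'" "slab n a x0 \<rho> T \<subseteq> ?S0" using r by (auto simp: slab_def)
   qed
   have le: "energy ?A J <= ennreal e" "energy ?S0 J <= ennreal e" "energy (slab n a x0 \<rho> T) J <= energy ?S0 J"
    using energy_mono[OF sub(1), of J] energy_mono[OF sub(2), of J] energy_mono[OF sub(3), of J] by (simp_all only: e(1))
   obtain b where b: "energy ?A J = ennreal b" "0 <= b" using le_ennrealD[OF le(1)] by blast
   obtain e1 where e1: "energy ?S0 J = ennreal e1" "0 <= e1" using le_ennrealD[OF le(2)] by blast
   obtain e0 where e0: "energy (slab n a x0 \<rho> T) J = ennreal e0" "0 <= e0" using le_ennrealD[OF le(3)[unfolded e1(1)]] by blast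
   \<comment> \<open>The layer \<open>?A\<close> is the large slab without its part
     \<open>?S0\<close> below height \<open>\<rho>\<close>, so its energy is a difference of two
     energies; \<open>?S0\<close> is the hole that gets filled.\<close>
   have U: "?S' = ?A \<union> ?S0" using r by (auto simp: slab_def)
   have "energy ?S' J = energy ?A J + energy ?S0 J"
    by (subst U, rule energy_Un_le[OF mJ mA slab_borel]) (auto simp: slab_def)
   hence "ennreal e = ennreal (b + e1)" unfolding e b e1 using b e1 by (simp only: ennreal_plus)
   hence eb: "e = b + e1" using e(2) b(2) e1(2) by (simp only: ennreal_inj add_nonneg_nonneg)
   have e01: "e0 <= e1" using le(3) e0 e1 by simp
   have "ennreal e0 <= ennreal (1/8 * e + 8*C * (b + 1/(64*C) * e + f))"
    using main unfolding e f b e0 using C e f b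
    by (simp only: ennreal_reals)
   hence "e0 <= 1/8 * e + 8*C * (b + 1/(64*C) * e + f)" using C e f b by (subst (asm) ennreal_le_iff) auto
   also have "... = 1/4 * e + 8 * C * b + 8 * C * f" using C by (simp add: field_simps)
   finally have "e0 <= 1/4 * e + 8 * C * b + 8 * C * f" .
   moreover have "8 * C * b = 8 * C * e - 8 * C * e1" using eb by (simp add: algebra_simps)
   moreover have "8 * C * e0 <= 8 * C * e1" using e01 C by simp
   ultimately have "e0 * (1 + 8 * C) <= (1/4 + 8 * C) * e + 8 * C * f" by (simp add: algebra_simps)
   hence "e0 <= ((1/4 + 8 * C) * e + 8 * C * f) / (1 + 8 * C)" using C by (simp add: pos_le_divide_eq)
   also have "... = \<kappa> * e + 8 * C / (1 + 8 * C) * f" by (simp only: \<kappa>_def add_divide_distrib[of "(1/4 + 8 * C) * e"] times_divide_eq_left)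
   also have "... <= \<kappa> * e + 1 * f" using C f by (intro add_left_mono mult_right_mono) (auto simp: field_simps)
   finally have "ennreal e0 <= ennreal (\<kappa> * e + f)" by (intro ennreal_leI) simp
   also have "... = ennreal \<kappa> * ennreal e + ennreal f" using k e f by (simp add: ennreal_mult)
   finally show ?thesis unfolding e f e0 .
  qed
 qed
qed

text \<open>Iteration over doubled heights. The lateral enlargements for \<open>\<rho>\<close>,
  \<open>2 * \<rho>\<close> and so on add up to \<open>(2^N - 1) * \<rho>\<close>, and the geometric
  series in \<open>\<kappa>\<close> sums the contributions of \<open>g\<close>. Apart from
  \<open>g\<close>, a layer of bounded height thus holds only a small fraction of the energy at a
  large height.\<close>

lemma hole_filling:
 assumes mu: "0 < \<mu>" and M: "0 <= M"
 shows "\<exists>\<kappa> K. 0 < \<kappa> \<and> \<kappa> < 1 \<and> 1 <= K \<and> (\<forall>(n::real^'d::finite) a x0 A (v::real^'d => real^'m::finite) J g \<rho> T N.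
  norm n = 1 --> coefs \<mu> M A --> C1 v J --> L2_loc_upto (halfspace n a) g --> weakeq A (halfspace n a) J g -->
  0 < \<rho> --> 0 <= T -->
  energy (slab n a x0 \<rho> T) J <= ennreal (\<kappa>^N) * energy (slab n a x0 (2^N*\<rho>) (T+K*((2^N-1)*\<rho>))) J
   + ennreal (1/(1-\<kappa>)) * energy (slab n a x0 (2^N*\<rho>) (T+K*((2^N-1)*\<rho>))) g)"
 using hole_filling_step[OF mu M, where 'd='d and 'm='m]
proof (elim exE conjE, goal_cases)
 case (1 \<kappa> K)
 note k = 1(1-3) and ST = 1(4)
 show ?thesis
 proof (rule exI[of _ \<kappa>], rule exI[of _ K], intro conjI k allI impI)
  fix n :: "real^'d" and a :: real and x0 A and v :: "real^'d => real^'m" and J g and \<rho> T :: real and N :: nat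
  assume n: "norm n = 1" and A: "coefs \<mu> M A" and Cv: "C1 v J" and g: "L2_loc_upto (halfspace n a) g"
   and weak: "weakeq A (halfspace n a) J g"
  assume "0 < \<rho>" "0 <= T"
  thus "energy (slab n a x0 \<rho> T) J <= ennreal (\<kappa>^N) * energy (slab n a x0 (2^N*\<rho>) (T+K*((2^N-1)*\<rho>))) J
   + ennreal (1/(1-\<kappa>)) * energy (slab n a x0 (2^N*\<rho>) (T+K*((2^N-1)*\<rho>))) g"
  proof (induction N arbitrary: \<rho> T)
   case 0
   show ?case by simp
  next
   case (Suc N)
   let ?S = "slab n a x0 (2^Suc N*\<rho>) (T+K*((2^Suc N-1)*\<rho>))"
   have S: "slab n a x0 (2^N*(2*\<rho>)) (T+K*\<rho>+K*((2^N-1)*(2*\<rho>))) = ?S"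
    by (simp add: algebra_simps)
   have p: "0 < 2*\<rho>" "0 <= T+K*\<rho>" using Suc.prems k(3) by auto
   have pw: "1 <= (2::real)^N" by simp
   have mono: "energy (slab n a x0 (2*\<rho>) (T+K*\<rho>)) g <= energy ?S g"
   proof (intro energy_slab_mono add_left_mono mult_left_mono)
    show "2 * \<rho> <= 2^Suc N*\<rho>" using Suc.prems pw by simp
    have "1 * \<rho> <= (2^Suc N-1)*\<rho>" using Suc.prems pw by (intro mult_right_mono) auto
    thus "\<rho> <= (2^Suc N-1)*\<rho>" by simp
   qed (use k in auto)
   have "energy (slab n a x0 \<rho> T) J <= ennreal \<kappa> * energy (slab n a x0 (2*\<rho>) (T+K*\<rho>)) J + energy (slab n a x0 (2*\<rho>) (T+K*\<rho>)) g"
    by (rule ST[rule_format, OF n A Cv g weak Suc.prems])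
   also have "... <= ennreal \<kappa> * (ennreal (\<kappa>^N) * energy ?S J + ennreal (1/(1-\<kappa>)) * energy ?S g) + energy ?S g"
    using Suc.IH[OF p] unfolding S by (intro add_mono mult_left_mono mono) auto
   also have "... = ennreal (\<kappa>^Suc N) * energy ?S J + (ennreal \<kappa> * ennreal (1/(1-\<kappa>)) + ennreal 1) * energy ?S g"
    using k by (simp add: distrib_left distrib_right ennreal_mult mult.assoc add.assoc)
   also have "ennreal \<kappa> * ennreal (1/(1-\<kappa>)) + ennreal 1 = ennreal (\<kappa> * (1/(1-\<kappa>)) + 1)"
    using k by (simp only: ennreal_mult ennreal_plus mult_nonneg_nonneg divide_nonneg_nonneg less_imp_le zero_le_one diff_ge_0_iff_ge)
   also have "\<kappa> * (1/(1-\<kappa>)) + 1 = 1/(1-\<kappa>)" using k by (simp add: field_simps)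
   finally show ?case .
  qed
 qed
qed

section \<open>Differences of translates: Caccioppoli and trace inequalities\<close>

lemma young_ineq: "0 < s ==> (x::real) * y <= x^2 / s + s / 4 * y^2"
proof -
 assume s: "0 < s"
 have "0 <= (2 * x - s * y)^2 / (4 * s)" using s by (intro divide_nonneg_pos) auto
 also have "(2 * x - s * y)^2 / (4 * s) = x^2 / s - x * y + s / 4 * y^2"
  using s by (simp add: power2_eq_square field_simps)
 finally show ?thesis by simp
qed

text \<open>Pointwise lower bound for the difference of the two tested equations; \<^term>\<open>i\<close> and \<^term>\<open>i'\<close>
 are the values of the indicator of the half-space at \<^term>\<open>x\<close> and at the translated point.\<close>
lemma shifted_test_lower_bound:
 fixes p p' g g' K :: "real^'d::finite^'m::finite" and D :: "real^'m" and G :: "real^'d"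
 assumes A: "coefs \<mu> M A" and mu: "0 < \<mu>" and M: "0 <= M" and s: "0 < s" and om: "0 <= \<omega>"
  and close: "\<And>\<xi> \<eta>. \<bar>bilin A x' \<xi> \<eta> - bilin A x \<xi> \<eta>\<bar> <= \<omega> * norm \<xi> * norm \<eta>"
  and i: "i = 0 \<or> i = (1::real)" "i' = 0 \<or> i' = (1::real)" and z: "0 <= \<zeta>" "\<zeta> <= 1"
  and K: "K = \<zeta>^2 *\<^sub>R (p' - p) + outer D ((2 * \<zeta>) *\<^sub>R G)"
 shows "i * (\<mu>/2 * \<zeta>^2 * (norm (p' - p))^2) <=
  (i' * (bilin A x' p' K + g' \<bullet> K) - i * (bilin A x p K + g \<bullet> K))
  + ((2*M^2/\<mu> + 6 * \<omega> + 6 * s) * ((norm G)^2 * (norm D)^2) + (4 * \<omega> + 4 * s) * ((norm p)^2 + (norm p')^2)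
    + (if i = i' then 0 else M^2/s * (norm p')^2) + 1/s * (i' * (norm g')^2 + i * (norm g)^2))"
proof -
 let ?d = "norm (p' - p)" and ?k = "norm K" and ?h = "(norm G)^2 * (norm D)^2"
 have d2: "?d^2 <= 2 * (norm p)^2 + 2 * (norm p')^2" using norm_sq_le2[of p' "- p"] by simp
 have k2: "?k^2 <= 4 * ((norm p)^2 + (norm p')^2) + 8 * ?h"
 proof -
  have a1: "?k^2 <= 2 * (norm (\<zeta>^2 *\<^sub>R (p' - p)))^2 + 2 * (norm (outer D ((2 * \<zeta>) *\<^sub>R G)))^2" unfolding K by (rule norm_sq_le2)
  have a2: "(norm (\<zeta>^2 *\<^sub>R (p' - p)))^2 <= ?d^2"
   using z by (intro power_mono) (auto simp: power_le_one mult_left_le_one_le)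
  have a3: "(norm (outer D ((2 * \<zeta>) *\<^sub>R G)))^2 = \<zeta>^2 * (4 * ?h)" by (simp add: power_mult_distrib)
  have a4: "\<zeta>^2 * (4 * ?h) <= 1 * (4 * ?h)" using z by (intro mult_right_mono) (auto simp: power_le_one)
  have a5: "(norm (outer D ((2 * \<zeta>) *\<^sub>R G)))^2 <= 4 * ?h" unfolding a3 using a4 by simp
  have "?k^2 <= 2 * ?d^2 + 2 * (4 * ?h)"
   by (rule order_trans[OF a1 add_mono[OF mult_left_mono[OF a2] mult_left_mono[OF a5]]]) simp_all
  also have "... <= 2 * (2 * (norm p)^2 + 2 * (norm p')^2) + 2 * (4 * ?h)" using d2 by simp
  finally show ?thesis by (simp add: algebra_simps)
 qed
 have h0: "0 <= ?h" by simp
 \<comment> \<open>Coercivity for the difference of the gradients at the unshifted coefficients;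
   Young's inequality pays for the gradient of the cut-off with half of the coercive term.\<close>
 have b1: "i * (\<mu>/2 * \<zeta>^2 * ?d^2) - 2*M^2/\<mu> * ?h <= i * bilin A x (p' - p) K"
 proof (cases "i = 0")
  case True
  thus ?thesis using mu by simp
 next
  case False
  hence i1: "i = 1" using i by simp
  have "\<zeta>^2 * (\<mu> * ?d^2) <= \<zeta>^2 * bilin A x (p' - p) (p' - p)"
   using A unfolding coefs_def by (intro mult_left_mono) auto
  moreover have "- (M * ?d * (2 * \<zeta> * (norm G * norm D))) <= bilin A x (p' - p) (outer D ((2 * \<zeta>) *\<^sub>R G))"
  proof -
   have "norm (outer D ((2 * \<zeta>) *\<^sub>R G)) = 2 * \<zeta> * (norm G * norm D)" using z by simp
   moreover have "\<bar>bilin A x (p' - p) (outer D ((2 * \<zeta>) *\<^sub>R G))\<bar> <= M * ?d * norm (outer D ((2 * \<zeta>) *\<^sub>R G))"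
    using A unfolding coefs_def by blast
   ultimately have "\<bar>bilin A x (p' - p) (outer D ((2 * \<zeta>) *\<^sub>R G))\<bar> <= M * ?d * (2 * \<zeta> * (norm G * norm D))" by (simp only:)
   thus ?thesis by (simp only: abs_le_iff minus_le_iff)
  qed
  moreover have "M * ?d * (2 * \<zeta> * (norm G * norm D)) <= \<mu>/2 * \<zeta>^2 * ?d^2 + 2*M^2/\<mu> * ?h"
  proof -
   have "0 <= (\<mu> * (\<zeta> * ?d) - 2 * M * (norm G * norm D))^2 / (2 * \<mu>)" using mu by simp
   also have "... = \<mu>/2 * \<zeta>^2 * ?d^2 + 2*M^2/\<mu> * ?h - M * ?d * (2 * \<zeta> * (norm G * norm D))"
    using mu by (simp add: power2_eq_square field_simps)
   finally show ?thesis by simp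
  qed
  moreover have "bilin A x (p' - p) K = \<zeta>^2 * bilin A x (p' - p) (p' - p) + bilin A x (p' - p) (outer D ((2 * \<zeta>) *\<^sub>R G))"
   unfolding K by (simp only: bilin_add_right bilin_scaleR_right)
  moreover have "\<zeta>^2 * (\<mu> * ?d^2) = 2 * (\<mu>/2 * \<zeta>^2 * ?d^2)" by simp
  ultimately have "\<mu>/2 * \<zeta>^2 * ?d^2 - 2*M^2/\<mu> * ?h <= bilin A x (p' - p) K" by linarith
  thus ?thesis unfolding i1 by simp
 qed
 have b2: "- (\<omega>/2 * (norm p')^2 + \<omega>/2 * ?k^2) <= i * (bilin A x' p' K - bilin A x p' K)"
 proof -
  have "\<omega> * norm p' * ?k <= \<omega> * (((norm p')^2 + ?k^2) / 2)"
  proof -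
   have "norm p' * ?k <= ((norm p')^2 + ?k^2) / 2"
    using zero_le_power2[of "norm p' - ?k"] by (simp add: power2_eq_square algebra_simps)
   from mult_left_mono[OF this om] show ?thesis by (simp only: mult.assoc)
  qed
  moreover have "\<bar>bilin A x' p' K - bilin A x p' K\<bar> <= \<omega> * norm p' * ?k" by (rule close)
  ultimately have "\<bar>bilin A x' p' K - bilin A x p' K\<bar> <= \<omega>/2 * (norm p')^2 + \<omega>/2 * ?k^2" by (simp add: algebra_simps)
  thus ?thesis using i(1) by auto
 qed
 \<comment> \<open>Present only where exactly one of the two points lies in the half-space. Nothing
   makes this term small, hence the division by \<open>s\<close>; it is the source of the boundary
   layer in the final estimate.\<close>
 have b3: "- ((if i = i' then 0 else M^2/s * (norm p')^2) + s/4 * ?k^2) <= (i' - i) * bilin A x' p' K"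
 proof (cases "i = i'")
  case True
  thus ?thesis using s by simp
 next
  case False
  have "\<bar>bilin A x' p' K\<bar> <= M * norm p' * ?k" using A unfolding coefs_def by blast
  also have "... <= (M * norm p')^2 / s + s/4 * ?k^2" by (rule young_ineq[OF s])
  finally have "\<bar>bilin A x' p' K\<bar> <= M^2/s * (norm p')^2 + s/4 * ?k^2" by (simp add: power_mult_distrib)
  thus ?thesis using False i by auto
 qed
 have b4: "- (1/s * (j * (norm h)^2) + s/4 * ?k^2) <= j * (h \<bullet> K)" "j * (h \<bullet> K) <= 1/s * (j * (norm h)^2) + s/4 * ?k^2"
  if j: "j = 0 \<or> j = (1::real)" for j h
 proof -
  have "\<bar>h \<bullet> K\<bar> <= norm h * ?k" by (rule Cauchy_Schwarz_ineq2)
  also have "... <= (norm h)^2 / s + s/4 * ?k^2" by (rule young_ineq[OF s])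
  finally have "\<bar>h \<bullet> K\<bar> <= (norm h)^2 / s + s/4 * ?k^2" .
  moreover have "0 <= s/4 * ?k^2" using s by simp
  ultimately show "- (1/s * (j * (norm h)^2) + s/4 * ?k^2) <= j * (h \<bullet> K)" "j * (h \<bullet> K) <= 1/s * (j * (norm h)^2) + s/4 * ?k^2"
   using j by auto
 qed
 \<comment> \<open>A telescoping sum: the difference of the gradients with fixed coefficients, then
   the change of coefficients, then the change of domain.\<close>
 have e: "i' * (bilin A x' p' K + g' \<bullet> K) - i * (bilin A x p K + g \<bullet> K)
  = i * bilin A x (p' - p) K + i * (bilin A x' p' K - bilin A x p' K) + (i' - i) * bilin A x' p' K + i' * (g' \<bullet> K) - i * (g \<bullet> K)"
  by (simp add: bilin_diff_left algebra_simps)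
 have k3: "(\<omega>/2 + 3/4 * s) * ?k^2 <= (\<omega>/2 + 3/4 * s) * (4 * ((norm p)^2 + (norm p')^2) + 8 * ?h)"
  using om s by (intro mult_left_mono k2) auto
 define q where "q = (norm p)^2 + (norm p')^2"
 have q0: "0 <= q" "(norm p')^2 <= q" by (auto simp: q_def)
 have f1: "(\<omega>/2 + 3/4 * s) * (4 * q + 8 * ?h) = 2 * (\<omega> * q) + 3 * (s * q) + 4 * (\<omega> * ?h) + 6 * (s * ?h)"
  by (simp add: algebra_simps)
 have f2: "(2*M^2/\<mu> + 6 * \<omega> + 6 * s) * ?h = 2*M^2/\<mu> * ?h + 6 * (\<omega> * ?h) + 6 * (s * ?h)" "(4 * \<omega> + 4 * s) * q = 4 * (\<omega> * q) + 4 * (s * q)"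
  by (simp_all add: algebra_simps)
 have f3: "(\<omega>/2 + 3/4 * s) * ?k^2 = \<omega>/2 * ?k^2 + 3 * (s/4 * ?k^2)" by (simp add: algebra_simps)
 have f4: "\<omega>/2 * (norm p')^2 <= \<omega> * q"
 proof -
  have "\<omega>/2 * (norm p')^2 <= \<omega> * (norm p')^2" using om by (intro mult_right_mono) auto
  also have "... <= \<omega> * q" by (rule mult_left_mono[OF q0(2) om])
  finally show ?thesis .
 qed
 have n: "0 <= \<omega> * q" "0 <= s * q" "0 <= \<omega> * ?h" "0 <= s * ?h" using om s q0 h0 by auto
 have f5: "1/s * (i' * (norm g')^2 + i * (norm g)^2) = 1/s * (i' * (norm g')^2) + 1/s * (i * (norm g)^2)" by (rule distrib_left)
 show ?thesis unfolding e q_def[symmetric] f2 f5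
  using b1 b2 b3 b4(1)[OF i(2), of g'] b4(2)[OF i(1), of g] k3[folded q_def] f1 f3 f4 n by linarith
qed

lemma energy_shift_le:
 fixes J :: "real^'d::finite => real^'d^'m::finite"
 assumes [measurable]: "J \<in> borel_measurable borel" "S \<in> sets borel" "S' \<in> sets borel"
  and sub: "\<And>x. x \<in> S ==> x + z \<in> S'"
 shows "energy S (\<lambda>x. J (x + z)) <= energy S' J"
proof -
 have "energy S (\<lambda>x. J (x + z)) <= (\<integral>\<^sup>+x. nsq (J (x + z)) * indicator S' (x + z) \<partial>lborel)"
  unfolding energy_def by (intro nn_integral_mono) (use sub in \<open>auto split: split_indicator\<close>)
 also have "... = energy S' J" unfolding energy_def
  by (rule nn_integral_shift[where f="\<lambda>x. nsq (J x) * indicator S' x"]) measurable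
 finally show ?thesis .
qed

text \<open>The symmetric slab of height \<open>2 |z . n|\<close> on the right-hand side arises because the half-space is not invariant
 under translation by z.\<close>
lemma caccioppoli_difference:
 assumes mu: "0 < \<mu>" and M: "0 <= M"
 shows "\<exists>C>0. \<forall>(n::real^'d::finite) a x0 A (v::real^'d => real^'m::finite) J g z R T \<omega> s.
  norm n = 1 --> coefs \<mu> M A --> C1 v J --> L2_loc_upto (halfspace n a) g --> weakeq A (halfspace n a) J g -->
  0 < R --> 0 <= T --> norm z <= R/4 --> 0 < s --> s <= 1 --> 0 <= \<omega> -->
  (\<forall>x \<xi> \<eta>. \<bar>bilin A (x + z) \<xi> \<eta> - bilin A x \<xi> \<eta>\<bar> <= \<omega> * norm \<xi> * norm \<eta>) -->
  energy (slab n a x0 (R/2) T) (\<lambda>x. J (x + z) - J x) <= ennreal (C * ((norm z / R)^2 + \<omega> + s)) * energy (sslab n a x0 R (T+2*R)) J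
  + ennreal (C/s) * (energy (sslab n a x0 (2 * \<bar>z \<bullet> n\<bar>) (T+2*R)) J + energy (slab n a x0 R (T+2*R)) g)"
proof -
 \<comment> \<open>3200 is 2 * 1600, where 1600 / R^2 bounds the squared gradient of the cut-off;
   608 is 6 * 1600 / 16, the 16 coming from \<open>norm z <= R/4\<close>, plus 8 for the gradients
   of \<open>v\<close> at the two points. The factor \<open>2/\<mu>\<close> undoes the coercivity
   constant.\<close>
 define C where "C = (2/\<mu>) * (3200 * M^2/\<mu> + 608 + M^2 + 2)"
 define B where "B = 3200 * M^2/\<mu> + 608 + M^2 + 2"
 have B0: "0 <= 3200 * M^2/\<mu>" "0 <= M^2" using mu by auto
 have CB: "C = (2/\<mu>) * B" by (simp add: C_def B_def)
 have C0: "0 < C"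
 proof -
  have "0 < B" unfolding B_def using B0 by linarith
  thus ?thesis unfolding CB using mu by simp
 qed
 show ?thesis
 proof (intro exI[of _ C] conjI C0 allI impI)
  fix n :: "real^'d" and a :: real and x0 A and v :: "real^'d => real^'m" and J g and z :: "real^'d" and R T \<omega> s :: real
  assume n: "norm n = 1" and A: "coefs \<mu> M A" and Cv: "C1 v J" and g: "L2_loc_upto (halfspace n a) g"
   and weak: "weakeq A (halfspace n a) J g" and R: "0 < R" and T: "0 <= T" and z: "norm z <= R/4" and s: "0 < s" "s <= 1"
   and om: "0 <= \<omega>" and close: "\<forall>x \<xi> \<eta>. \<bar>bilin A (x + z) \<xi> \<eta> - bilin A x \<xi> \<eta>\<bar> <= \<omega> * norm \<xi> * norm \<eta>"
  let ?t = "ht n a" and ?\<Omega> = "halfspace n a"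
  let ?S = "sslab n a x0 (3/4*R) (T+R)" and ?S' = "sslab n a x0 R (T+2*R)" and ?Z = "sslab n a x0 (2 * \<bar>z \<bullet> n\<bar>) (T+2*R)"
   and ?F = "slab n a x0 R (T+2*R)" and ?L = "slab n a x0 (R/2) T"
  \<comment> \<open>The points \<open>x\<close> for which exactly one of \<open>x\<close> and
    \<open>x + z\<close> lies in the half-space. There
    \<open>\<bar>?t (x + z)\<bar> <= \<bar>z \<bullet> n\<bar>\<close> and
    \<open>z \<bullet> n\<close> is nonzero; the factor 2 in \<open>?Z\<close> makes the inequality
    strict.\<close>
  let ?st = "{x. (0 < ?t x) \<noteq> (0 < ?t (x + z))}"
  note cv = C1_continuous[OF Cv] and cJ = C1_continuous_J[OF Cv]
  have mJ[measurable]: "J \<in> borel_measurable borel" by (rule borel_measurable_continuous_onI[OF cJ])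
  have mv[measurable]: "v \<in> borel_measurable borel" by (rule borel_measurable_continuous_onI[OF cv])
  have mg[measurable]: "g \<in> borel_measurable borel" using g by (simp add: L2_loc_upto_def)
  have Om[measurable]: "?\<Omega> \<in> sets borel" unfolding halfspace_ht by measurable
  have mst[measurable]: "?st \<in> sets borel" by measurable
  have htz: "?t (x + z) = ?t x - z \<bullet> n" for x by (rule ht_add)
  have zn: "\<bar>z \<bullet> n\<bar> <= R/4" using Cauchy_Schwarz_ineq2[of z n] n z by simp
  obtain c1 G1 where c1: "C1s c1 G1" "\<And>x. 0 <= c1 x" "\<And>x. c1 x <= 1" "\<And>x. \<bar>?t x\<bar> <= R/2 ==> c1 x = 1"
   "\<And>x. R/2 + R/4 <= \<bar>?t x\<bar> ==> c1 x = 0 \<and> G1 x = 0" "\<And>x. norm (G1 x) <= 8 / (R/4)"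
   using cutoff_ht[OF n, of "R/4" "R/2" a] R by auto
  obtain c2 G2 where c2: "C1s c2 G2" "\<And>x. 0 <= c2 x" "\<And>x. c2 x <= 1" "\<And>x. dist x x0 <= T ==> c2 x = 1"
   "\<And>x. T + R <= dist x x0 ==> c2 x = 0 \<and> G2 x = 0" "\<And>x. norm (G2 x) <= 8 / R"
   using cutoff_ball[OF R T, of x0] by auto
  define \<zeta> where "\<zeta> x = c1 x * c2 x" for x
  define G where "G x = c1 x *\<^sub>R G2 x + c2 x *\<^sub>R G1 x" for x
  have C\<zeta>: "C1s \<zeta> G" unfolding \<zeta>_def[abs_def] G_def[abs_def] by (rule C1s_mult[OF c1(1) c2(1)])
  have \<zeta>: "0 <= \<zeta> x" "\<zeta> x <= 1" for x
   using c1(2,3)[of x] c2(2,3)[of x] by (auto simp: \<zeta>_def mult_le_one)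
  have \<zeta>1: "\<zeta> x = 1" if "x \<in> ?L" for x using that c1(4)[of x] c2(4)[of x] by (simp add: \<zeta>_def slab_def)
  have \<zeta>0: "\<zeta> x = 0" "G x = 0" if "x \<notin> ?S" for x
  proof -
   have "R/2 + R/4 <= \<bar>?t x\<bar> \<or> T + R <= dist x x0" using that by (auto simp: sslab_def)
   thus "\<zeta> x = 0" "G x = 0" using c1(5)[of x] c2(5)[of x] by (auto simp: \<zeta>_def G_def)
  qed
  have nG: "(norm (G x))^2 <= 1600 / R^2" for x
  proof -
   have "norm (G x) <= c1 x * norm (G2 x) + c2 x * norm (G1 x)"
    unfolding G_def using norm_triangle_ineq[of "c1 x *\<^sub>R G2 x" "c2 x *\<^sub>R G1 x"] c1(2)[of x] c2(2)[of x] by simp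
   also have "... <= 1 * (8 / R) + 1 * (8 / (R/4))"
    by (intro add_mono mult_mono c1 c2) auto
   also have "... = 40 / R" using R by simp
   finally have "(norm (G x))^2 <= (40 / R)^2" by (intro power_mono) auto
   thus ?thesis by (simp add: power_divide)
  qed
  define D where "D x = v (x + z) - v x" for x
  define d where "d x = J (x + z) - J x" for x
  have CD: "C1 D d" unfolding D_def[abs_def] d_def[abs_def] by (rule C1_diff[OF C1_shift[OF Cv] Cv])
  have mD[measurable]: "D \<in> borel_measurable borel" by (rule C1_measurable[OF CD])
  let ?\<phi> = "\<lambda>x. (\<zeta> x * \<zeta> x) *\<^sub>R D x" and ?K = "\<lambda>x. (\<zeta> x * \<zeta> x) *\<^sub>R d x + outer (D x) (\<zeta> x *\<^sub>R G x + \<zeta> x *\<^sub>R G x)"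
  have C\<phi>: "C1 ?\<phi> ?K" by (rule C1_scale[OF C1s_mult[OF C\<zeta> C\<zeta>] CD])
  have Keq: "?K x = (\<zeta> x)^2 *\<^sub>R (J (x + z) - J x) + outer (D x) ((2 * \<zeta> x) *\<^sub>R G x)" for x
   by (simp only: power2_eq_square d_def mult_2 scaleR_add_left)
  have K0: "?K x = 0" if "x \<notin> ?S" for x using \<zeta>0[OF that] by (simp add: outer_def vec_eq_iff)
  let ?B = "norm x0 + T + R"
  have far: "x \<notin> ?S" if "norm x > ?B" for x
  proof -
   have "norm x <= dist x x0 + norm x0" by (metis dist_norm diff_add_cancel norm_triangle_ineq)
   thus ?thesis using that by (auto simp: sslab_def)
  qed
  have supp: "?\<phi> x = 0" if "norm x > ?B" for x using \<zeta>0[OF far[OF that]] by simp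
  have C\<phi>2: "C1 (\<lambda>x. ?\<phi> (x + (- z))) (\<lambda>x. ?K (x + (- z)))" by (rule C1_shift[OF C\<phi>])
  have supp2: "?\<phi> (x + (- z)) = 0" if "norm x > ?B + norm z" for x
  proof -
   have "norm x <= norm (x + (- z)) + norm z" using norm_triangle_ineq[of "x + (- z)" z] by simp
   thus ?thesis using supp[of "x + (- z)"] that by simp
  qed
  have LJ: "L2_loc_upto ?\<Omega> J" by (rule C1_L2_loc[OF Cv Om])
  have int: "integrable lborel (\<lambda>x. indicator ?\<Omega> x *\<^sub>R (bilin A x (J x) (H x) + g x \<bullet> H x))"
   "(LINT x|lborel. indicator ?\<Omega> x *\<^sub>R (bilin A x (J x) (H x) + g x \<bullet> H x)) = 0"
   if C: "C1 \<psi> H" and sp: "\<And>x. norm x > Q ==> \<psi> x = 0" for \<psi> H Q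
  proof -
   have H0: "H x = 0" if "norm x > Q" for x by (rule C1_support_J[OF C sp that])
   show "integrable lborel (\<lambda>x. indicator ?\<Omega> x *\<^sub>R (bilin A x (J x) (H x) + g x \<bullet> H x))"
    using set_integral_add(1)[OF weak_integrable[OF A M Om LJ g C1_continuous_J[OF C] H0]] by (simp add: set_integrable_def)
   show "(LINT x|lborel. indicator ?\<Omega> x *\<^sub>R (bilin A x (J x) (H x) + g x \<bullet> H x)) = 0"
    by (rule weak[unfolded weakeq_def set_lebesgue_integral_def, rule_format, OF C sp])
  qed
  let ?a1 = "\<lambda>x. indicator ?\<Omega> x *\<^sub>R (bilin A x (J x) (?K x) + g x \<bullet> ?K x)"
  \<comment> \<open>The equation is tested with \<open>?\<phi>\<close> and with its translate.
    Shifting the second integral by \<open>z\<close> brings both to the same test gradient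
    \<open>?K x\<close>, and the difference of the integrands is \<open>?a\<close>.\<close>
  let ?a2 = "\<lambda>x. indicator ?\<Omega> x *\<^sub>R (bilin A x (J x) (?K (x + (- z))) + g x \<bullet> ?K (x + (- z)))"
  note i1 = int[OF C\<phi> supp] and i2 = int[OF C\<phi>2 supp2]
  have i2': "integrable lborel (\<lambda>x. ?a2 (x + z))" by (rule integrable_shift[OF i2(1)])
  have ma2: "?a2 \<in> borel_measurable borel" using borel_measurable_integrable[OF i2(1)] by simp
  have i2z: "(LINT x|lborel. ?a2 (x + z)) = 0" by (rule trans[OF integral_shift[OF ma2] i2(2)])
  let ?a = "\<lambda>x. indicator ?\<Omega> (x + z) * (bilin A (x + z) (J (x + z)) (?K x) + g (x + z) \<bullet> ?K x) - indicator ?\<Omega> x * (bilin A x (J x) (?K x) + g x \<bullet> ?K x)"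
  have aeq: "?a = (\<lambda>x. ?a2 (x + z) - ?a1 x)" by (simp add: fun_eq_iff)
  have ia: "integrable lborel ?a" unfolding aeq by (rule Bochner_Integration.integrable_diff[OF i2' i1(1)])
  have a0: "(LINT x|lborel. ?a x) = 0" unfolding aeq using Bochner_Integration.integral_diff[OF i2' i1(1)] i2z i1(2) by simp
  define \<alpha>1 where "\<alpha>1 = (2*M^2/\<mu> + 6*\<omega> + 6 * s) * (1600 / R^2)"
  define \<alpha>2 where "\<alpha>2 = 4*\<omega> + 4 * s"
  have \<alpha>: "0 <= \<alpha>1" "0 <= \<alpha>2" using mu om s by (auto simp: \<alpha>1_def \<alpha>2_def)
  let ?p = "\<lambda>x. ennreal (\<mu>/2) * (nsq (J (x + z) - J x) * indicator ?L x)"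
  let ?r = "\<lambda>x. ennreal \<alpha>1 * (nsq (v (x + z) - v x) * indicator ?S x)
   + ennreal \<alpha>2 * (nsq (J x) * indicator ?S x) + ennreal \<alpha>2 * (nsq (J (x + z)) * indicator ?S x)
   + ennreal (M^2/s) * (nsq (J (x + z)) * indicator (?S \<inter> ?st) x)
   + ennreal (1/s) * (nsq (g (x + z)) * indicator (?S \<inter> {x. 0 < ?t (x + z)}) x)
   + ennreal (1/s) * (nsq (g x) * indicator (?S \<inter> {x. 0 < ?t x}) x)"
  have le: "?p x + ennreal (- ?a x) <= ennreal (?a x) + ?r x" for x
  proof (cases "x \<in> ?S")
   case True
   define i :: real where "i = indicator ?\<Omega> x"
   define i' :: real where "i' = indicator ?\<Omega> (x + z)"
   have i: "i = 0 \<or> i = 1" "i' = 0 \<or> i' = 1" by (auto simp: i_def i'_def split: split_indicator)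
   let ?P = "i * (\<mu>/2 * (\<zeta> x)^2 * (norm (J (x + z) - J x))^2)"
   let ?R1 = "(2*M^2/\<mu> + 6*\<omega> + 6 * s) * ((norm (G x))^2 * (norm (D x))^2) + (4*\<omega> + 4 * s) * ((norm (J x))^2 + (norm (J (x + z)))^2)
    + (if i = i' then 0 else M^2/s * (norm (J (x + z)))^2) + 1/s * (i' * (norm (g (x + z)))^2 + i * (norm (g x))^2)"
   let ?R = "\<alpha>1 * (norm (D x))^2 + \<alpha>2 * (norm (J x))^2 + \<alpha>2 * (norm (J (x + z)))^2
    + M^2/s * (if i = i' then 0 else (norm (J (x + z)))^2) + 1/s * (i' * (norm (g (x + z)))^2) + 1/s * (i * (norm (g x))^2)"
   have "?P <= ?a x + ?R1" unfolding i_def[symmetric] i'_def[symmetric]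
    by (rule shifted_test_lower_bound[OF A mu M s(1) om _ i \<zeta> Keq]) (use close in blast)
   also have "?R1 <= ?R"
   proof -
    have "(2*M^2/\<mu> + 6*\<omega> + 6 * s) * ((norm (G x))^2 * (norm (D x))^2) <= (2*M^2/\<mu> + 6*\<omega> + 6 * s) * (1600 / R^2 * (norm (D x))^2)"
     using mu om s by (intro mult_left_mono mult_right_mono nG) auto
    hence r1: "(2*M^2/\<mu> + 6*\<omega> + 6 * s) * ((norm (G x))^2 * (norm (D x))^2) <= \<alpha>1 * (norm (D x))^2"
     by (simp only: \<alpha>1_def mult.assoc)
    have r2: "(4*\<omega> + 4 * s) * ((norm (J x))^2 + (norm (J (x + z)))^2) = \<alpha>2 * (norm (J x))^2 + \<alpha>2 * (norm (J (x + z)))^2"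
     by (simp only: \<alpha>2_def distrib_left)
    have r3: "(if i = i' then 0 else M^2/s * (norm (J (x + z)))^2) = M^2/s * (if i = i' then 0 else (norm (J (x + z)))^2)" by simp
    have r4: "1/s * (i' * (norm (g (x + z)))^2 + i * (norm (g x))^2) = 1/s * (i' * (norm (g (x + z)))^2) + 1/s * (i * (norm (g x))^2)"
     by (rule distrib_left)
    show ?thesis unfolding r2 r3 r4 using r1 by linarith
   qed
   finally have pr: "?P <= ?a x + ?R" by simp
   have P0: "0 <= ?P" using i mu by auto
   have R0: "0 <= ?R" using \<alpha> s i by (auto intro!: add_nonneg_nonneg)
   have e1: "ennreal ?P + ennreal (- ?a x) <= ennreal (?a x) + ennreal ?R" by (rule ennreal_split_le[OF pr P0 R0])
   have eP: "?p x <= ennreal ?P"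
   proof (cases "x \<in> ?L")
    case True
    hence "i = 1" by (auto simp: i_def halfspace_ht slab_def)
    thus ?thesis using True \<zeta>1[OF True] mu by (simp add: ennreal_mult[symmetric])
   qed simp
   have eR: "ennreal ?R <= ?r x"
   proof -
    have n: "0 <= \<alpha>1 * (norm (D x))^2" "0 <= \<alpha>2 * (norm (J x))^2" "0 <= \<alpha>2 * (norm (J (x + z)))^2"
     "0 <= M^2/s * (if i = i' then 0 else (norm (J (x + z)))^2)" "0 <= 1/s * (i' * (norm (g (x + z)))^2)" "0 <= 1/s * (i * (norm (g x))^2)"
     using \<alpha> s i by auto
    have "ennreal ?R = ennreal (\<alpha>1 * (norm (D x))^2) + ennreal (\<alpha>2 * (norm (J x))^2) + ennreal (\<alpha>2 * (norm (J (x + z)))^2)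
    + ennreal (M^2/s * (if i = i' then 0 else (norm (J (x + z)))^2)) + ennreal (1/s * (i' * (norm (g (x + z)))^2)) + ennreal (1/s * (i * (norm (g x))^2))"
     using n by (simp only: ennreal_plus add_nonneg_nonneg)
    also have "... <= ?r x"
    proof (intro add_mono)
     show "ennreal (\<alpha>1 * (norm (D x))^2) <= ennreal \<alpha>1 * (nsq (v (x + z) - v x) * indicator ?S x)"
      using True \<alpha> by (simp add: D_def ennreal_mult)
     show "ennreal (\<alpha>2 * (norm (J x))^2) <= ennreal \<alpha>2 * (nsq (J x) * indicator ?S x)"
      using True \<alpha> by (simp add: ennreal_mult)
     show "ennreal (\<alpha>2 * (norm (J (x + z)))^2) <= ennreal \<alpha>2 * (nsq (J (x + z)) * indicator ?S x)"
      using True \<alpha> by (simp add: ennreal_mult)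
     show "ennreal (M^2/s * (if i = i' then 0 else (norm (J (x + z)))^2)) <= ennreal (M^2/s) * (nsq (J (x + z)) * indicator (?S \<inter> ?st) x)"
     proof (cases "i = i'")
      case False
      hence "x \<in> ?st" by (auto simp: i_def i'_def halfspace_ht split: split_indicator_asm)
      moreover have "ennreal (M^2/s * (norm (J (x + z)))^2) = ennreal (M^2/s) * nsq (J (x + z))"
       by (rule ennreal_mult) (use s in auto)
      ultimately show ?thesis using True False by (simp only: indicator_simps IntI if_False mult_1_right order_refl)
     qed simp
     have e: "ennreal (1/s * (norm h)^2) = ennreal (1/s) * nsq h" for h :: "real^'d^'m"
      by (rule ennreal_mult) (use s in auto)
     show "ennreal (1/s * (i' * (norm (g (x + z)))^2)) <= ennreal (1/s) * (nsq (g (x + z)) * indicator (?S \<inter> {x. 0 < ?t (x + z)}) x)"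
      using True e[of "g (x + z)"] by (cases "0 < ?t (x + z)") (auto simp: i'_def halfspace_ht)
     show "ennreal (1/s * (i * (norm (g x))^2)) <= ennreal (1/s) * (nsq (g x) * indicator (?S \<inter> {x. 0 < ?t x}) x)"
      using True e[of "g x"] by (cases "0 < ?t x") (auto simp: i_def halfspace_ht)
    qed
    finally show ?thesis .
   qed
   show ?thesis by (rule order_trans[OF add_right_mono[OF eP] order_trans[OF e1 add_left_mono[OF eR]]])
  next
   case False
   have "x \<notin> ?L" using False R T by (auto simp: slab_def sslab_def)
   hence px: "?p x = 0" by simp
   have ax: "?a x = 0" unfolding K0[OF False] by simp
   show ?thesis unfolding px ax by simp
  qed
  have main: "(\<integral>\<^sup>+x. ?p x \<partial>lborel) <= (\<integral>\<^sup>+x. ?r x \<partial>lborel)"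
   by (rule nn_integral_le_of_zero_integral[OF ia a0 _ _ le]) measurable
  have lhs: "(\<integral>\<^sup>+x. ?p x \<partial>lborel) = ennreal (\<mu>/2) * energy ?L (\<lambda>x. J (x + z) - J x)"
  proof -
   have m: "(\<lambda>x. nsq (J (x + z) - J x) * indicator ?L x) \<in> borel_measurable lborel" by measurable
   show ?thesis unfolding energy_def by (rule nn_integral_cmult[OF m])
  qed
  let ?I1 = "\<integral>\<^sup>+x\<in>?S. nsq (v (x + z) - v x) \<partial>lborel"
  have rhs: "(\<integral>\<^sup>+x. ?r x \<partial>lborel) = ennreal \<alpha>1 * ?I1 + ennreal \<alpha>2 * energy ?S J + ennreal \<alpha>2 * energy ?S (\<lambda>x. J (x + z))
   + ennreal (M^2/s) * energy (?S \<inter> ?st) (\<lambda>x. J (x + z)) + ennreal (1/s) * energy (?S \<inter> {x. 0 < ?t (x + z)}) (\<lambda>x. g (x + z))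
   + ennreal (1/s) * energy (?S \<inter> {x. 0 < ?t x}) g"
  proof -
   let ?h1 = "\<lambda>x. nsq (v (x + z) - v x) * indicator ?S x"
   let ?h2 = "\<lambda>x. nsq (J x) * indicator ?S x" and ?h3 = "\<lambda>x. nsq (J (x + z)) * indicator ?S x"
   let ?h4 = "\<lambda>x. nsq (J (x + z)) * indicator (?S \<inter> ?st) x"
   let ?h5 = "\<lambda>x. nsq (g (x + z)) * indicator (?S \<inter> {x. 0 < ?t (x + z)}) x"
   let ?h6 = "\<lambda>x. nsq (g x) * indicator (?S \<inter> {x. 0 < ?t x}) x"
   have m: "?h1 \<in> borel_measurable lborel" "?h2 \<in> borel_measurable lborel" "?h3 \<in> borel_measurable lborel"
    "?h4 \<in> borel_measurable lborel" "?h5 \<in> borel_measurable lborel" "?h6 \<in> borel_measurable lborel" by measurable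
   show ?thesis unfolding energy_def
    by (simp only: nn_integral_add nn_integral_cmult m borel_measurable_add borel_measurable_times_ennreal borel_measurable_const)
  qed
  have I1: "?I1 <= nsq z * energy ?S' J" unfolding energy_def
  proof (rule increment_integral_le[OF Cv])
   fix x q assume x: "x \<in> ?S" and q: "0 <= q" "q <= (1::real)"
   have "\<bar>q * (z \<bullet> n)\<bar> <= 1 * (R/4)" unfolding abs_mult using q zn by (intro mult_mono) auto
   moreover have "norm (q *\<^sub>R z) <= 1 * (R/4)" unfolding norm_scaleR using q z by (intro mult_mono) auto
   ultimately show "x + q *\<^sub>R z \<in> ?S'" using x dist_shift_le[of x "q *\<^sub>R z" x0] R by (auto simp: sslab_def ht_add)
  qed measurable
  have shS: "x + z \<in> ?S'" if "x \<in> ?S" for x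
   using that zn z dist_shift_le[of x z x0] R by (auto simp: sslab_def ht_add)
  have I2: "energy ?S J <= energy ?S' J" by (intro energy_mono sslab_mono) (use R in auto)
  have I3: "energy ?S (\<lambda>x. J (x + z)) <= energy ?S' J" by (rule energy_shift_le) (use shS in \<open>auto\<close>)
  have I4: "energy (?S \<inter> ?st) (\<lambda>x. J (x + z)) <= energy ?Z J"
   by (rule energy_shift_le) (use shS in \<open>auto simp: sslab_def htz\<close>)
  have I5: "energy (?S \<inter> {x. 0 < ?t (x + z)}) (\<lambda>x. g (x + z)) <= energy ?F g"
  proof (rule energy_shift_le)
   fix x assume x: "x \<in> ?S \<inter> {x. 0 < ?t (x + z)}"
   hence "x + z \<in> ?S'" using shS by blast
   thus "x + z \<in> ?F" using x by (simp add: sslab_def slab_def)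
  qed measurable
  have I6: "energy (?S \<inter> {x. 0 < ?t x}) g <= energy ?F g"
   by (rule energy_mono) (use R in \<open>auto simp: sslab_def slab_def\<close>)
  show "energy ?L (\<lambda>x. J (x + z) - J x) <= ennreal (C * ((norm z / R)^2 + \<omega> + s)) * energy ?S' J
  + ennreal (C/s) * (energy ?Z J + energy ?F g)"
  proof (cases "energy ?S' J = top \<or> energy ?F g = top")
   case True
   have "0 < (norm z / R)^2 + \<omega> + s" using om s by (intro add_nonneg_pos) auto
   hence "0 < C * ((norm z / R)^2 + \<omega> + s)" using C0 by (rule mult_pos_pos[rotated])
   hence "ennreal (C * ((norm z / R)^2 + \<omega> + s)) * energy ?S' J + ennreal (C/s) * (energy ?Z J + energy ?F g) = top"
    using True s C0 by (auto simp: ennreal_mult_eq_top_iff)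
   thus ?thesis by (simp only: top_greatest)
  next
   case False
   obtain e where e: "energy ?S' J = ennreal e" "0 <= e" using False by (cases "energy ?S' J") auto
   obtain f where f: "energy ?F g = ennreal f" "0 <= f" using False by (cases "energy ?F g") auto
   have "energy ?Z J <= ennreal e" unfolding e(1)[symmetric] by (intro energy_mono sslab_mono) (use zn R in auto)
   then obtain y where y: "energy ?Z J = ennreal y" "0 <= y" using le_ennrealD by blast
   have "ennreal (\<mu>/2) * energy ?L (\<lambda>x. J (x + z) - J x) <= ennreal \<alpha>1 * (nsq z * ennreal e) + ennreal \<alpha>2 * ennreal e + ennreal \<alpha>2 * ennreal e
    + ennreal (M^2/s) * ennreal y + ennreal (1/s) * ennreal f + ennreal (1/s) * ennreal f"
    unfolding lhs[symmetric]
    by (rule order_trans[OF main]) (unfold rhs, intro add_mono mult_left_mono I1[unfolded e] I2[unfolded e] I3[unfolded e] I4[unfolded y] I5[unfolded f] I6[unfolded f] zero_le)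
   also have "... = ennreal (\<alpha>1 * ((norm z)^2 * e) + \<alpha>2 * e + \<alpha>2 * e + M^2/s * y + 1/s * f + 1/s * f)"
    using \<alpha> s e f y by (simp only: ennreal_reals)
   finally have 1: "ennreal (\<mu>/2) * energy ?L (\<lambda>x. J (x + z) - J x) <= ennreal (\<alpha>1 * ((norm z)^2 * e) + \<alpha>2 * e + \<alpha>2 * e + M^2/s * y + 1/s * f + 1/s * f)" .
   have 2: "(2/\<mu>) * (\<alpha>1 * ((norm z)^2 * e) + \<alpha>2 * e + \<alpha>2 * e + M^2/s * y + 1/s * f + 1/s * f)
    <= C * ((norm z / R)^2 + \<omega> + s) * e + C/s * (y + f)"
   proof -
    define q where "q = (norm z / R)^2"
    have "norm z / R <= 1/4" using z R by (simp add: field_simps)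
    hence "q <= (1/4)^2" unfolding q_def using R by (intro power_mono) auto
    hence q: "0 <= q" "q <= 1/16" by (auto simp: q_def power2_eq_square)
    have "\<alpha>1 * (norm z)^2 = (3200 * M^2/\<mu>) * q + 9600 * (\<omega> + s) * q"
     by (simp add: \<alpha>1_def q_def power_divide add_divide_distrib distrib_left distrib_right)
    also have "9600 * (\<omega> + s) * q <= 9600 * (\<omega> + s) * (1/16)" using om s q by (intro mult_left_mono) auto
    finally have 3: "\<alpha>1 * (norm z)^2 + \<alpha>2 + \<alpha>2 <= (3200 * M^2/\<mu>) * q + 608 * (\<omega> + s)" by (simp add: \<alpha>2_def add_divide_distrib)
    also have "... <= B * q + B * (\<omega> + s)"
     by (intro add_mono mult_right_mono) (use q om s B0 in \<open>auto simp: B_def\<close>)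
    finally have "\<alpha>1 * (norm z)^2 + \<alpha>2 + \<alpha>2 <= B * (q + \<omega> + s)" by (simp only: distrib_left add.assoc)
    hence 4: "(\<alpha>1 * (norm z)^2 + \<alpha>2 + \<alpha>2) * e <= B * (q + \<omega> + s) * e" using e by (intro mult_right_mono) auto
    have 5: "M^2/s * y + 1/s * f + 1/s * f <= B/s * (y + f)"
    proof -
     have "M^2/s * y + 1/s * f + 1/s * f = M^2/s * y + 2/s * f" by (simp add: add_divide_distrib[symmetric])
     also have "... <= B/s * y + B/s * f"
      by (intro add_mono mult_right_mono divide_right_mono) (use y f s B0 in \<open>auto simp: B_def\<close>)
     finally show ?thesis by (simp only: distrib_left)
    qed
    have "(2/\<mu>) * (\<alpha>1 * ((norm z)^2 * e) + \<alpha>2 * e + \<alpha>2 * e + M^2/s * y + 1/s * f + 1/s * f)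
     = (2/\<mu>) * ((\<alpha>1 * (norm z)^2 + \<alpha>2 + \<alpha>2) * e + (M^2/s * y + 1/s * f + 1/s * f))" by (simp only: distrib_right mult.assoc add.assoc)
    also have "... <= (2/\<mu>) * (B * (q + \<omega> + s) * e + B/s * (y + f))"
     using mu by (intro mult_left_mono add_mono 4 5) auto
    also have "... = C * (q + \<omega> + s) * e + C/s * (y + f)"
    proof -
     have "C/s = (2/\<mu>) * (B/s)" by (simp add: CB)
     thus ?thesis by (simp only: CB ring_distribs mult.assoc)
    qed
    finally show ?thesis unfolding q_def .
   qed
   have "energy ?L (\<lambda>x. J (x + z) - J x) = ennreal (2/\<mu>) * (ennreal (\<mu>/2) * energy ?L (\<lambda>x. J (x + z) - J x))"
    using mu by (simp add: mult.assoc[symmetric] ennreal_mult[symmetric])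
   also have "... <= ennreal (2/\<mu>) * ennreal (\<alpha>1 * ((norm z)^2 * e) + \<alpha>2 * e + \<alpha>2 * e + M^2/s * y + 1/s * f + 1/s * f)"
    by (rule mult_left_mono[OF 1]) simp
   also have "... = ennreal ((2/\<mu>) * (\<alpha>1 * ((norm z)^2 * e) + \<alpha>2 * e + \<alpha>2 * e + M^2/s * y + 1/s * f + 1/s * f))"
    by (rule ennreal_mult[symmetric]) (use mu \<alpha> s e f y in auto)
   also have "... <= ennreal (C * ((norm z / R)^2 + \<omega> + s) * e + C/s * (y + f))" by (rule ennreal_leI[OF 2])
   also have "... = ennreal (C * ((norm z / R)^2 + \<omega> + s)) * ennreal e + ennreal (C/s) * (ennreal y + ennreal f)"
    using C0 om s e f y by (simp only: ennreal_reals)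
   finally show ?thesis unfolding e f y .
  qed
 qed
qed

text \<open>A value at low height is compared with the values along the normal segment of length
  \<open>R/4\<close> above it, and the comparison is averaged over the segment. The fraction
  \<open>\<rho> / R\<close> is the thin height relative to the averaging length;
  \<open>8 * \<rho> <= R\<close> keeps the segments below height \<open>R/2\<close>.\<close>

lemma trace_ineq:
 fixes D :: "real^'d::finite => real^'m::finite"
 assumes n: "norm n = 1" and C: "C1 D d" and r: "0 < \<rho>" and R: "8 * \<rho> <= R"
 shows "energy (slab n a x0 (2*\<rho>) T) D <= ennreal (16 * (\<rho> / R)) * energy (slab n a x0 (R/2) (T+R)) D
  + ennreal (\<rho> * R) * energy (slab n a x0 (R/2) (T+R)) d"
proof -
 let ?S = "slab n a x0 (2*\<rho>) T" and ?S' = "slab n a x0 (R/2) (T+R)" and ?I = "{0..R/4}"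
 have R0: "0 < R" using r R by linarith
 have mD[measurable]: "D \<in> borel_measurable borel" by (rule C1_measurable[OF C])
 have md[measurable]: "d \<in> borel_measurable borel" by (rule C1_measurable_J[OF C])
 define hD where "hD x = nsq (D x)" for x
 define hd where "hd x = nsq (d x)" for x
 have mhD[measurable]: "hD \<in> borel_measurable borel" unfolding hD_def[abs_def] by measurable
 have mhd[measurable]: "hd \<in> borel_measurable borel" unfolding hd_def[abs_def] by measurable
 define PD where "PD x = (\<integral>\<^sup>+s\<in>?I. hD (x + s *\<^sub>R (- n)) \<partial>lborel)" for x
 define Pd where "Pd x = (\<integral>\<^sup>+s\<in>?I. hd (x + s *\<^sub>R (- n)) \<partial>lborel)" for x
 have mPD[measurable]: "PD \<in> borel_measurable borel" unfolding PD_def[abs_def] by measurable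
 have mPd[measurable]: "Pd \<in> borel_measurable borel" unfolding Pd_def[abs_def] by measurable
 have mm[measurable]: "(\<lambda>s. hD (x + s *\<^sub>R (- n)) * indicator ?I s) \<in> borel_measurable lborel" for x by measurable
 have pt: "ennreal (R/4) * hD x <= 2 * PD x + ennreal (2 * (R/4) * (R/4)) * Pd x" for x
 proof -
  have 1: "hD x <= 2 * hD (x + s *\<^sub>R (- n)) + ennreal (2 * (R/4)) * Pd x" if s: "s \<in> ?I" for s
  proof -
   let ?y = "x + s *\<^sub>R (- n)"
   have "hD x <= 2 * nsq (D ?y) + 2 * nsq (D x - D ?y)"
    using ennreal_norm_sq_le2[of "D ?y" "D x - D ?y"] by (simp add: hD_def)
   also have "nsq (D x - D ?y) = nsq (D ?y - D x)" by (simp add: norm_minus_commute)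
   also have "nsq (D ?y - D x) <= ennreal (s * (norm (- n))^2) * (\<integral>\<^sup>+q\<in>{0..s}. nsq (d (x + q *\<^sub>R (- n))) \<partial>lborel)"
    by (rule C1_increment_sq_le[OF C]) (use s in auto)
   also have "... <= ennreal (R/4) * Pd x"
   proof (rule mult_mono)
    show "ennreal (s * (norm (- n))^2) <= ennreal (R/4)" using s n by (intro ennreal_leI) simp
    show "(\<integral>\<^sup>+q\<in>{0..s}. nsq (d (x + q *\<^sub>R (- n))) \<partial>lborel) <= Pd x" unfolding Pd_def hd_def
     by (rule nn_integral_mono) (use s in \<open>auto split: split_indicator\<close>)
   qed auto
   finally have "hD x <= 2 * hD ?y + 2 * (ennreal (R/4) * Pd x)" by (simp add: hD_def add_left_mono mult_left_mono)
   also have "2 * (ennreal (R/4) * Pd x) = ennreal (2 * (R/4)) * Pd x"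
   proof -
    have "ennreal (2 * (R/4)) = ennreal 2 * ennreal (R/4)" by (rule ennreal_mult) (use R0 in auto)
    thus ?thesis by (simp only: mult.assoc ennreal_numeral)
   qed
   finally show ?thesis .
  qed
  have eI: "emeasure lborel ?I = ennreal (R/4)" using R0 by simp
  have "ennreal (R/4) * hD x = (\<integral>\<^sup>+s. hD x * indicator ?I s \<partial>lborel)"
   by (subst nn_integral_cmult_indicator) (auto simp: eI mult.commute)
  also have "... <= (\<integral>\<^sup>+s. 2 * (hD (x + s *\<^sub>R (- n)) * indicator ?I s) + (ennreal (2 * (R/4)) * Pd x) * indicator ?I s \<partial>lborel)"
   by (rule nn_integral_mono) (use 1 in \<open>auto split: split_indicator\<close>)
  also have "... = (\<integral>\<^sup>+s. 2 * (hD (x + s *\<^sub>R (- n)) * indicator ?I s) \<partial>lborel) + (\<integral>\<^sup>+s. (ennreal (2 * (R/4)) * Pd x) * indicator ?I s \<partial>lborel)"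
   by (rule nn_integral_add) measurable
  also have "(\<integral>\<^sup>+s. 2 * (hD (x + s *\<^sub>R (- n)) * indicator ?I s) \<partial>lborel) = 2 * PD x"
   unfolding PD_def by (rule nn_integral_cmult[OF mm])
  also have "(\<integral>\<^sup>+s. (ennreal (2 * (R/4)) * Pd x) * indicator ?I s \<partial>lborel) = (ennreal (2 * (R/4)) * Pd x) * ennreal (R/4)"
   by (subst nn_integral_cmult_indicator) (auto simp: eI)
  also have "... = ennreal (2 * (R/4) * (R/4)) * Pd x"
  proof -
   have "ennreal (2 * (R/4) * (R/4)) = ennreal (2 * (R/4)) * ennreal (R/4)" by (rule ennreal_mult) (use R0 in auto)
   thus ?thesis by (simp only: mult.assoc mult.commute[of "Pd x"])
  qed
  finally show ?thesis .
 qed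
 have sub: "0 < ht n a x \<and> ht n a x < 2 * \<rho>" if "x \<in> ?S" for x using that by (auto simp: slab_def)
 have sh: "x + s *\<^sub>R (- n) \<in> ?S'" if "x \<in> ?S" "0 <= s" "s <= R/4" for x s
 proof -
  have "dist (x + s *\<^sub>R (- n)) x0 <= dist x x0 + norm (s *\<^sub>R (- n))" by (rule dist_shift_le)
  also have "norm (s *\<^sub>R (- n)) = s" using n that(2) by simp
  finally show ?thesis using that R R0 by (auto simp: slab_def ht_normal[OF n] simp del: add_uminus_conv_diff scaleR_minus_right)
 qed
 have l0: "0 <= 2 * \<rho>" using r by simp
 have F1: "(\<integral>\<^sup>+x\<in>?S. PD x \<partial>lborel) <= ennreal (2*\<rho>) * energy ?S' D"
  unfolding PD_def energy_def hD_def[symmetric] by (rule fubini_normal[OF n mhD slab_borel slab_borel l0 sub sh])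
 have F2: "(\<integral>\<^sup>+x\<in>?S. Pd x \<partial>lborel) <= ennreal (2*\<rho>) * energy ?S' d"
  unfolding Pd_def energy_def hd_def[symmetric] by (rule fubini_normal[OF n mhd slab_borel slab_borel l0 sub sh])
 have mS: "(\<lambda>x. PD x * indicator ?S x) \<in> borel_measurable lborel" "(\<lambda>x. Pd x * indicator ?S x) \<in> borel_measurable lborel"
  "(\<lambda>x. hD x * indicator ?S x) \<in> borel_measurable lborel" by measurable
 have "ennreal (R/4) * energy ?S D = (\<integral>\<^sup>+x. ennreal (R/4) * (hD x * indicator ?S x) \<partial>lborel)"
  unfolding energy_def hD_def[symmetric] by (rule nn_integral_cmult[OF mS(3), symmetric])
 also have "... <= (\<integral>\<^sup>+x. 2 * (PD x * indicator ?S x) + ennreal (2 * (R/4) * (R/4)) * (Pd x * indicator ?S x) \<partial>lborel)"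
  by (rule nn_integral_mono) (use pt in \<open>auto split: split_indicator\<close>)
 also have "... = 2 * (\<integral>\<^sup>+x\<in>?S. PD x \<partial>lborel) + ennreal (2 * (R/4) * (R/4)) * (\<integral>\<^sup>+x\<in>?S. Pd x \<partial>lborel)"
  by (simp only: nn_integral_add nn_integral_cmult mS borel_measurable_times_ennreal borel_measurable_const)
 also have "... <= ennreal 2 * (ennreal (2*\<rho>) * energy ?S' D) + ennreal (2 * (R/4) * (R/4)) * (ennreal (2*\<rho>) * energy ?S' d)"
 proof (rule add_mono)
  show "2 * (\<integral>\<^sup>+x\<in>?S. PD x \<partial>lborel) <= ennreal 2 * (ennreal (2*\<rho>) * energy ?S' D)"
   unfolding ennreal_numeral by (rule mult_left_mono[OF F1]) simp
  show "ennreal (2 * (R/4) * (R/4)) * (\<integral>\<^sup>+x\<in>?S. Pd x \<partial>lborel) <= ennreal (2 * (R/4) * (R/4)) * (ennreal (2*\<rho>) * energy ?S' d)"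
   by (rule mult_left_mono[OF F2]) simp
 qed
 also have "... <= ennreal (4 * \<rho>) * energy ?S' D + ennreal (R^2 * \<rho> / 4) * energy ?S' d"
  by (intro add_mono ennreal_mult_mult_le) (use r R0 in \<open>auto simp: power2_eq_square\<close>)
 finally have "ennreal (4/R) * (ennreal (R/4) * energy ?S D) <= ennreal (4/R) * (ennreal (4 * \<rho>) * energy ?S' D + ennreal (R^2 * \<rho> / 4) * energy ?S' d)"
  by (rule mult_left_mono) simp
 also have "ennreal (4/R) * (ennreal (R/4) * energy ?S D) = energy ?S D"
  using R0 by (simp add: mult.assoc[symmetric] ennreal_mult[symmetric])
 also have "ennreal (4/R) * (ennreal (4 * \<rho>) * energy ?S' D + ennreal (R^2 * \<rho> / 4) * energy ?S' d)
  <= ennreal (16 * (\<rho> / R)) * energy ?S' D + ennreal (\<rho> * R) * energy ?S' d"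
  unfolding distrib_left by (intro add_mono ennreal_mult_mult_le) (use r R0 in \<open>auto simp: power2_eq_square\<close>)
 finally show ?thesis .
qed

section \<open>Tangential increments and the decay inequality\<close>

lemma energy_add_le:
 fixes f g :: "real^'d::finite => 'b::euclidean_space"
 assumes [measurable]: "f \<in> borel_measurable borel" "g \<in> borel_measurable borel" "S \<in> sets borel"
 shows "energy S (\<lambda>x. f x + g x) <= 2 * energy S f + 2 * energy S g"
proof -
 have m: "(\<lambda>x. nsq (f x) * indicator S x) \<in> borel_measurable lborel"
  "(\<lambda>x. nsq (g x) * indicator S x) \<in> borel_measurable lborel" by measurable
 have "energy S (\<lambda>x. f x + g x) <= (\<integral>\<^sup>+x. 2 * (nsq (f x) * indicator S x) + 2 * (nsq (g x) * indicator S x) \<partial>lborel)"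
  unfolding energy_def
  by (intro nn_integral_mono) (use ennreal_norm_sq_le2 in \<open>auto split: split_indicator\<close>)
 also have "... = 2 * energy S f + 2 * energy S g" unfolding energy_def
  by (simp only: nn_integral_add nn_integral_cmult m borel_measurable_times_ennreal borel_measurable_const)
 finally show ?thesis .
qed

text \<open>The increment is split at \<open>x + z\<close>, where \<open>z\<close> is a translation
  that nearly preserves the coefficients and \<open>\<omega>\<close> measures by how much they
  change. From \<open>x + z\<close> to \<open>x + y\<close> the step has length at most
  \<open>c\<close>, which is small. From \<open>x\<close> to \<open>x + z\<close> the increment is
  estimated in a thin layer: \<open>trace_ineq\<close> gains \<open>\<theta>\<close> on the
  difference itself, and Caccioppoli with \<open>s = \<theta>^2\<close> gains
  \<open>\<theta>^2\<close> on its gradient.\<close>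

lemma tangential_increment:
 assumes mu: "0 < \<mu>" and M: "0 <= M"
 shows "\<exists>C>0. \<forall>(n::real^'d::finite) a x0 A (v::real^'d => real^'m::finite) J g y z R T \<omega> \<theta> c.
  norm n = 1 --> coefs \<mu> M A --> C1 v J --> L2_loc_upto (halfspace n a) g --> weakeq A (halfspace n a) J g -->
  0 < R --> 0 <= T --> 0 < \<theta> --> \<theta> <= 1/8 --> 0 <= \<omega> --> \<omega> <= \<theta>^2 -->
  y \<bullet> n = 0 --> norm y <= \<theta> * R --> norm (y - z) <= c --> c <= \<theta> * R --> c^2 <= \<theta> * (\<theta> * R)^2 -->
  (\<forall>x \<xi> \<eta>. \<bar>bilin A (x + z) \<xi> \<eta> - bilin A x \<xi> \<eta>\<bar> <= \<omega> * norm \<xi> * norm \<eta>) -->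
  energy (slab n a x0 (2*(\<theta>*R)) T) (\<lambda>x. v (x + y) - v x) <= ennreal ((\<theta>*R)^2) * (ennreal (C * \<theta>) * energy (sslab n a x0 R (T+3*R)) J
  + ennreal (C/\<theta>^3) * (energy (sslab n a x0 (2 * c) (T+3*R)) J + energy (slab n a x0 R (T+3*R)) g))"
 using caccioppoli_difference[OF mu M, where 'd='d and 'm='m]
proof (elim exE conjE, goal_cases)
 case (1 C)
 note C = 1(1) and CA = 1(2)
 \<comment> \<open>130 is 2 + 2 * 16 * 4, from the short step and from the function term of
   \<open>trace_ineq\<close>; \<open>12 * C\<close> is twice the \<open>6 * C\<close> of its
   gradient term.\<close>
 define C' where "C' = 130 + 12 * C"
 have C'0: "C' > 0" using C by (simp add: C'_def)
 show ?thesis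
 proof (intro exI[of _ C'] conjI C'0 allI impI)
  fix n :: "real^'d" and a :: real and x0 A and v :: "real^'d => real^'m" and J g and y z :: "real^'d" and R T \<omega> \<theta> c :: real
  assume n: "norm n = 1" and A: "coefs \<mu> M A" and Cv: "C1 v J" and g: "L2_loc_upto (halfspace n a) g"
   and weak: "weakeq A (halfspace n a) J g" and R: "0 < R" and T: "0 <= T" and th: "0 < \<theta>" "\<theta> <= 1/8"
   and om: "0 <= \<omega>" "\<omega> <= \<theta>^2" and y: "y \<bullet> n = 0" "norm y <= \<theta> * R" and yz: "norm (y - z) <= c" and c: "c <= \<theta> * R" "c^2 <= \<theta> * (\<theta> * R)^2"
   and close: "\<forall>x \<xi> \<eta>. \<bar>bilin A (x + z) \<xi> \<eta> - bilin A x \<xi> \<eta>\<bar> <= \<omega> * norm \<xi> * norm \<eta>"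
  let ?S = "slab n a x0 (2*(\<theta>*R)) T" and ?H = "slab n a x0 (R/2) (T+R)" and ?S' = "sslab n a x0 R (T+3*R)"
   and ?Z = "sslab n a x0 (2 * c) (T+3*R)" and ?F = "slab n a x0 R (T+3*R)"
  have mv[measurable]: "v \<in> borel_measurable borel" by (rule C1_measurable[OF Cv])
  have tR: "\<theta> * R <= R/8" "0 < \<theta> * R" using th R by auto
  have nz: "norm z <= 2 * (\<theta> * R)"
  proof -
   have "norm z <= norm y + norm (y - z)" using norm_triangle_ineq4[of y "y - z"] by simp
   thus ?thesis using y yz c by linarith
  qed
  have zR: "norm z <= R/4" using nz tR by linarith
  have zn: "\<bar>z \<bullet> n\<bar> <= c"
  proof -
   have "z \<bullet> n = - ((y - z) \<bullet> n)" using y by (simp add: inner_diff_left)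
   thus ?thesis using Cauchy_Schwarz_ineq2[of "y - z" n] n yz by simp
  qed
  let ?D = "\<lambda>x. v (x + z) - v x" and ?d = "\<lambda>x. J (x + z) - J x"
  have CD: "C1 ?D ?d" by (rule C1_diff[OF C1_shift[OF Cv] Cv])
  have t2: "0 < \<theta>^2" "\<theta>^2 <= 1" using th by (auto simp: power_le_one)
  have TR: "T + R + 2 * R = T + 3 * R" by simp
  have e1a: "energy ?H ?d <= ennreal (C * ((norm z / R)^2 + \<omega> + \<theta>^2)) * energy ?S' J
  + ennreal (C/\<theta>^2) * (energy (sslab n a x0 (2 * \<bar>z \<bullet> n\<bar>) (T+3*R)) J + energy ?F g)"
   using CA[rule_format, OF n A Cv g weak R _ zR t2 om(1), of "T + R" x0] close T R unfolding TR by auto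
  have e1: "energy ?H ?d <= ennreal (6 * C * \<theta>^2) * energy ?S' J + ennreal (C/\<theta>^2) * (energy ?Z J + energy ?F g)"
  proof (rule order_trans[OF e1a add_mono[OF mult_right_mono[OF ennreal_leI] mult_left_mono[OF add_right_mono[OF energy_mono[OF sslab_mono]]]]])
   have "(norm z / R)^2 <= (2 * \<theta>)^2" using nz R by (intro power_mono) (auto simp: pos_divide_le_eq)
   hence b: "(norm z / R)^2 + \<omega> + \<theta>^2 <= 6 * \<theta>^2" using om by (simp add: power_mult_distrib)
   show "C * ((norm z / R)^2 + \<omega> + \<theta>^2) <= 6 * C * \<theta>^2" using mult_left_mono[OF b, of C] C by simp
  qed (use zn in auto)
  have e2: "energy ?H ?D <= ennreal ((2 * (\<theta> * R))^2) * energy ?S' J"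
  proof -
   have "energy ?H ?D <= nsq z * energy ?S' J" unfolding energy_def
   proof (rule increment_integral_le[OF Cv])
    fix x q assume x: "x \<in> ?H" and q: "0 <= q" "q <= (1::real)"
    have "\<bar>z \<bullet> n\<bar> <= R/4" using zn c tR by linarith
    hence "\<bar>q * (z \<bullet> n)\<bar> <= 1 * (R/4)" unfolding abs_mult using q by (intro mult_mono) auto
    moreover have "norm (q *\<^sub>R z) <= 1 * (R/4)" unfolding norm_scaleR using q zR by (intro mult_mono) auto
    ultimately show "x + q *\<^sub>R z \<in> ?S'" using x dist_shift_le[of x "q *\<^sub>R z" x0] R by (auto simp: slab_def sslab_def ht_add)
   qed measurable
   also have "... <= ennreal ((2 * (\<theta> * R))^2) * energy ?S' J" by (intro mult_right_mono ennreal_leI power_mono nz) auto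
   finally show ?thesis .
  qed
  have "energy ?S ?D <= ennreal (16 * (\<theta> * R / R)) * energy ?H ?D + ennreal (\<theta> * R * R) * energy ?H ?d"
   by (rule trace_ineq[OF n CD]) (use tR in linarith)+
  also have "... <= ennreal (16 * \<theta>) * (ennreal ((2 * (\<theta> * R))^2) * energy ?S' J) + ennreal (\<theta> * R * R) * (ennreal (6 * C * \<theta>^2) * energy ?S' J + ennreal (C/\<theta>^2) * (energy ?Z J + energy ?F g))"
   using R by (intro add_mono mult_mono e1 e2) auto
  finally have e3: "energy ?S ?D <= ennreal (16 * \<theta>) * (ennreal ((2 * (\<theta> * R))^2) * energy ?S' J) + ennreal (\<theta> * R * R) * (ennreal (6 * C * \<theta>^2) * energy ?S' J + ennreal (C/\<theta>^2) * (energy ?Z J + energy ?F g))" .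
  let ?E = "\<lambda>x. v (x + y) - v (x + z)"
  have e4: "energy ?S ?E <= ennreal (\<theta> * (\<theta> * R)^2) * energy ?S' J"
  proof -
   have CE: "C1 (\<lambda>x. v (x + z)) (\<lambda>x. J (x + z))" by (rule C1_shift[OF Cv])
   have "(\<integral>\<^sup>+x\<in>?S. nsq (v (x + (y - z) + z) - v (x + z)) \<partial>lborel) <= nsq (y - z) * (\<integral>\<^sup>+x\<in>sslab n a x0 (R/2) (T+R). nsq (J (x + z)) \<partial>lborel)"
   proof (rule increment_integral_le[OF CE])
    fix x q assume x: "x \<in> ?S" and q: "0 <= q" "q <= (1::real)"
    have nn: "norm (q *\<^sub>R (y - z)) <= 1 * (R/8)" unfolding norm_scaleR using q yz c tR by (intro mult_mono) auto
    moreover have "\<bar>(q *\<^sub>R (y - z)) \<bullet> n\<bar> <= norm (q *\<^sub>R (y - z))" using Cauchy_Schwarz_ineq2[of "q *\<^sub>R (y - z)" n] n by simp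
    ultimately have "\<bar>(q *\<^sub>R (y - z)) \<bullet> n\<bar> <= R/8" by linarith
    thus "x + q *\<^sub>R (y - z) \<in> sslab n a x0 (R/2) (T+R)" using x nn dist_shift_le[of x "q *\<^sub>R (y - z)" x0] R tR
     unfolding slab_def sslab_def ht_add mem_Collect_eq by (intro conjI; linarith)
   qed measurable
   also have "... <= ennreal (\<theta> * (\<theta> * R)^2) * energy ?S' J"
   proof (intro mult_mono ennreal_leI)
    have "(norm (y - z))^2 <= c^2" using yz by (intro power_mono) auto
    thus "(norm (y - z))^2 <= \<theta> * (\<theta> * R)^2" using c by linarith
    have "energy (sslab n a x0 (R/2) (T+R)) (\<lambda>x. J (x + z)) <= energy ?S' J"
    proof (rule energy_shift_le)
     show "J \<in> borel_measurable borel" by (rule C1_measurable_J[OF Cv])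
     fix x assume x: "x \<in> sslab n a x0 (R/2) (T+R)"
     have "\<bar>z \<bullet> n\<bar> <= R/4" using zn c tR by linarith
     thus "x + z \<in> ?S'" using x dist_shift_le[of x z x0] zR R by (auto simp: sslab_def ht_add)
    qed measurable
    thus "(\<integral>\<^sup>+x\<in>sslab n a x0 (R/2) (T+R). nsq (J (x + z)) \<partial>lborel) <= energy ?S' J" by (simp add: energy_def)
   qed auto
   finally show ?thesis by (simp add: energy_def)
  qed
  have "energy ?S (\<lambda>x. ?E x + ?D x) <= 2 * energy ?S ?E + 2 * energy ?S ?D"
   by (rule energy_add_le) measurable
  hence "energy ?S (\<lambda>x. v (x + y) - v x) <= ennreal 2 * energy ?S ?E + ennreal 2 * energy ?S ?D" by simp
  also have "... <= ennreal 2 * (ennreal (\<theta> * (\<theta> * R)^2) * energy ?S' J) + ennreal 2 * (ennreal (16 * \<theta>) * (ennreal ((2 * (\<theta> * R))^2) * energy ?S' J) + ennreal (\<theta> * R * R) * (ennreal (6 * C * \<theta>^2) * energy ?S' J + ennreal (C/\<theta>^2) * (energy ?Z J + energy ?F g)))"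
   by (intro add_mono mult_left_mono e3 e4) auto
  finally have main: "energy ?S (\<lambda>x. v (x + y) - v x) <= ennreal 2 * (ennreal (\<theta> * (\<theta> * R)^2) * energy ?S' J) + ennreal 2 * (ennreal (16 * \<theta>) * (ennreal ((2 * (\<theta> * R))^2) * energy ?S' J) + ennreal (\<theta> * R * R) * (ennreal (6 * C * \<theta>^2) * energy ?S' J + ennreal (C/\<theta>^2) * (energy ?Z J + energy ?F g)))" .
  show "energy ?S (\<lambda>x. v (x + y) - v x) <= ennreal ((\<theta>*R)^2) * (ennreal (C' * \<theta>) * energy ?S' J + ennreal (C'/\<theta>^3) * (energy ?Z J + energy ?F g))"
  proof (cases "energy ?S' J = top \<or> energy ?F g = top")
   case True
   hence "ennreal ((\<theta>*R)^2) * (ennreal (C' * \<theta>) * energy ?S' J + ennreal (C'/\<theta>^3) * (energy ?Z J + energy ?F g)) = top"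
    using th R C'0 by (auto simp: ennreal_mult_eq_top_iff)
   thus ?thesis by (simp only: top_greatest)
  next
   case False
   obtain e where e: "energy ?S' J = ennreal e" "0 <= e" using False by (cases "energy ?S' J") auto
   obtain f where f: "energy ?F g = ennreal f" "0 <= f" using False by (cases "energy ?F g") auto
   have "energy ?Z J <= ennreal e" unfolding e(1)[symmetric] by (intro energy_mono sslab_mono) (use c tR R in linarith)+
   then obtain w where w: "energy ?Z J = ennreal w" "0 <= w" using le_ennrealD by blast
   have "energy ?S (\<lambda>x. v (x + y) - v x) <= ennreal (2 * (\<theta> * (\<theta> * R)^2 * e) + 2 * (16 * \<theta> * ((2 * (\<theta> * R))^2 * e) + \<theta> * R * R * (6 * C * \<theta>^2 * e + C/\<theta>^2 * (w + f))))"
    using main unfolding e f w using e f w C th R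
    by (simp only: ennreal_reals)
   also have "... <= ennreal ((\<theta>*R)^2 * (C' * \<theta> * e + C'/\<theta>^3 * (w + f)))"
   proof (rule ennreal_leI)
    have i1: "2 * (\<theta> * (\<theta> * R)^2 * e) + 2 * (16 * \<theta> * ((2 * (\<theta> * R))^2 * e)) + 2 * (\<theta> * R * R * (6 * C * \<theta>^2 * e)) = (\<theta>*R)^2 * (C' * \<theta> * e)"
     by (simp add: C'_def power2_eq_square algebra_simps)
    have i2: "2 * (\<theta> * R * R * (C/\<theta>^2 * (w + f))) = (\<theta>*R)^2 * (2 * C / \<theta>^3 * (w + f))"
     using th by (simp add: power2_eq_square power3_eq_cube)
    have "2 * C / \<theta>^3 * (w + f) <= C' / \<theta>^3 * (w + f)"
     using th C w f by (intro mult_right_mono divide_right_mono) (auto simp: C'_def)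
    hence "(\<theta>*R)^2 * (2 * C / \<theta>^3 * (w + f)) <= (\<theta>*R)^2 * (C' / \<theta>^3 * (w + f))" by (rule mult_left_mono) simp
    thus "2 * (\<theta> * (\<theta> * R)^2 * e) + 2 * (16 * \<theta> * ((2 * (\<theta> * R))^2 * e) + \<theta> * R * R * (6 * C * \<theta>^2 * e + C/\<theta>^2 * (w + f))) <= (\<theta>*R)^2 * (C' * \<theta> * e + C'/\<theta>^3 * (w + f))"
     using i1 i2 by (simp only: distrib_left)
   qed
   also have "... = ennreal ((\<theta>*R)^2) * (ennreal (C' * \<theta>) * ennreal e + ennreal (C'/\<theta>^3) * (ennreal w + ennreal f))"
   proof -
    have p3: "0 <= \<theta>^3" using th by simp
    show ?thesis using e f w C'0 th p3
     by (simp only: ennreal_reals)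
   qed
   finally show ?thesis unfolding e f w .
  qed
 qed
qed

text \<open>This is \<open>energy_step\<close> with \<open>\<rho> = \<theta> * R\<close>,
  \<open>W = R/4\<close> and \<open>s = 1/16\<close>, its increments bounded by
  \<open>tangential_increment\<close>. The cut-off term carries \<open>16 * \<theta>^2\<close> and
  fits under the term with \<open>C * \<theta>\<close>. The parameter \<open>c\<close> unites
  translations by \<open>y\<close> itself, where \<open>c = 0\<close>, and by lattice
  vectors.\<close>

lemma decay_generic:
 assumes mu: "0 < \<mu>" and M: "0 <= M"
 shows "\<exists>C>0. \<forall>(n::real^'d::finite) a x0 A (v::real^'d => real^'m::finite) J g R T \<omega> \<theta> c.
  norm n = 1 --> coefs \<mu> M A --> C1 v J --> L2_loc_upto (halfspace n a) g --> weakeq A (halfspace n a) J g -->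
  0 < R --> 0 <= T --> 0 < \<theta> --> \<theta> <= 1/8 --> 0 <= \<omega> --> \<omega> <= \<theta>^2 --> c <= \<theta> * R --> c^2 <= \<theta> * (\<theta> * R)^2 -->
  (\<forall>y. y \<bullet> n = 0 --> norm y <= \<theta> * R -->
   (\<exists>z. norm (y - z) <= c \<and> (\<forall>x \<xi> \<eta>. \<bar>bilin A (x + z) \<xi> \<eta> - bilin A x \<xi> \<eta>\<bar> <= \<omega> * norm \<xi> * norm \<eta>))) -->
  energy (slab n a x0 (\<theta>*R) T) J <= ennreal (1/16) * energy (slab n a x0 (2*(\<theta>*R)) (T+R)) J
   + ennreal (C * \<theta>) * energy (sslab n a x0 R (T+4*R)) J
   + ennreal (C/\<theta>^3) * (energy (sslab n a x0 (2 * c) (T+4*R)) J + energy (slab n a x0 R (T+4*R)) g)"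
 using energy_step[OF mu M, where 'd='d and 'm='m] tangential_increment[OF mu M, where 'd='d and 'm='m]
proof (elim exE conjE, goal_cases)
 case (1 Ce Ct)
 note Ce = 1(1) and ST = 1(2) and Ct = 1(3) and TI = 1(4)
 define C where "C = 16 * Ce * Ct + 256 * Ce"
 have C: "C > 0" using Ce Ct by (simp add: C_def add_pos_pos)
 show ?thesis
 proof (intro exI[of _ C] conjI C allI impI)
  fix n :: "real^'d" and a :: real and x0 A and v :: "real^'d => real^'m" and J g and R T \<omega> \<theta> c :: real
  assume n: "norm n = 1" and A: "coefs \<mu> M A" and Cv: "C1 v J" and g: "L2_loc_upto (halfspace n a) g"
   and weak: "weakeq A (halfspace n a) J g" and R: "0 < R" and T: "0 <= T" and th: "0 < \<theta>" "\<theta> <= 1/8"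
   and om: "0 <= \<omega>" "\<omega> <= \<theta>^2" and c: "c <= \<theta> * R" "c^2 <= \<theta> * (\<theta> * R)^2"
   and Y: "\<forall>y. y \<bullet> n = 0 --> norm y <= \<theta> * R -->
   (\<exists>z. norm (y - z) <= c \<and> (\<forall>x \<xi> \<eta>. \<bar>bilin A (x + z) \<xi> \<eta> - bilin A x \<xi> \<eta>\<bar> <= \<omega> * norm \<xi> * norm \<eta>))"
  let ?E = "energy (slab n a x0 (2*(\<theta>*R)) (T+R)) J" and ?S = "energy (sslab n a x0 R (T+4*R)) J"
   and ?Z = "energy (sslab n a x0 (2*c) (T+4*R)) J" and ?F = "energy (slab n a x0 R (T+4*R)) g"
  let ?X = "ennreal (Ct * \<theta>) * ?S + ennreal (Ct/\<theta>^3) * (?Z + ?F)"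
  let ?e = "energy (slab n a x0 (2*(\<theta>*R)) (T+3*(R/4))) J" and ?f = "energy (slab n a x0 (2*(\<theta>*R)) (T+3*(R/4))) g"
  have tR: "\<theta> * R <= R/8" "0 < \<theta> * R" using th R by auto
  have step: "energy (slab n a x0 (\<theta>*R) T) J <= ennreal (1/16) * ?e + ennreal (Ce/(1/16)) * (?X + ennreal ((\<theta>*R/(R/4))^2) * ?e + ?f)"
  proof (rule ST[rule_format, OF n A Cv g weak tR(2) _ T])
   fix y assume y: "y \<bullet> n = 0" "norm y <= \<theta> * R"
   obtain z where z: "norm (y - z) <= c" "\<forall>x \<xi> \<eta>. \<bar>bilin A (x + z) \<xi> \<eta> - bilin A x \<xi> \<eta>\<bar> <= \<omega> * norm \<xi> * norm \<eta>"
    using Y y by blast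
   have T': "0 <= T + 3*(R/4)" using T R by simp
   have "(\<integral>\<^sup>+x\<in>slab n a x0 (2*(\<theta>*R)) (T+3*(R/4)) \<inter> {x. \<theta>*R <= ht n a x}. nsq (v (x + y) - v x) \<partial>lborel)
    <= energy (slab n a x0 (2*(\<theta>*R)) (T+3*(R/4))) (\<lambda>x. v (x + y) - v x)"
    unfolding energy_def[symmetric] by (rule energy_mono) auto
   also have "... <= ennreal ((\<theta>*R)^2) * (ennreal (Ct * \<theta>) * energy (sslab n a x0 R (T+3*(R/4)+3*R)) J
  + ennreal (Ct/\<theta>^3) * (energy (sslab n a x0 (2 * c) (T+3*(R/4)+3*R)) J + energy (slab n a x0 R (T+3*(R/4)+3*R)) g))"
    using TI[rule_format, OF n A Cv g weak R T' th om y z(1) c] z(2) by blast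
   also have "... <= ennreal ((\<theta>*R)^2) * ?X"
    by (rule mult_left_mono[OF add_mono[OF mult_left_mono[OF energy_mono[OF sslab_mono]] mult_left_mono[OF add_mono[OF energy_mono[OF sslab_mono] energy_mono[OF slab_mono]]]]])
     (use R in \<open>simp_all add: add_divide_distrib\<close>)
   finally show "(\<integral>\<^sup>+x\<in>slab n a x0 (2*(\<theta>*R)) (T+3*(R/4)) \<inter> {x. \<theta>*R <= ht n a x}. nsq (v (x + y) - v x) \<partial>lborel) <= ennreal ((\<theta>*R)^2) * ?X" .
  qed (use tR in linarith)+
  have eE: "?e <= ?E" by (rule energy_slab_mono) (use R in auto)
  have ss: "slab n a x0 q T' \<subseteq> sslab n a x0 q T'" for q T' by (auto simp: slab_def sslab_def)
  have eS: "?e <= ?S" by (rule energy_mono[OF order_trans[OF ss sslab_mono]]) (use tR R in linarith)+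
  have fF: "?f <= ?F" by (rule energy_slab_mono) (use tR R in linarith)+
  have ES: "?E <= ?S" by (rule energy_mono[OF order_trans[OF ss sslab_mono]]) (use tR R in linarith)+
  have ZS: "?Z <= ?S" by (rule energy_mono[OF sslab_mono]) (use c tR R in linarith)+
  show "energy (slab n a x0 (\<theta>*R) T) J <= ennreal (1/16) * ?E + ennreal (C * \<theta>) * ?S + ennreal (C/\<theta>^3) * (?Z + ?F)"
  proof (cases "?S = top \<or> ?F = top")
   case True
   hence "ennreal (1/16) * ?E + ennreal (C * \<theta>) * ?S + ennreal (C/\<theta>^3) * (?Z + ?F) = top"
    using th R C by (auto simp: ennreal_mult_eq_top_iff)
   thus ?thesis by (simp only: top_greatest)
  next
   case False
   obtain s where s: "?S = ennreal s" "0 <= s" using False by (cases "?S") auto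
   obtain f where f: "?F = ennreal f" "0 <= f" using False by (cases "?F") auto
   obtain z where z: "?Z = ennreal z" "0 <= z" using ZS le_ennrealD unfolding s by blast
   obtain e where e: "?E = ennreal e" "0 <= e" using ES le_ennrealD unfolding s by blast
   obtain e' where e': "?e = ennreal e'" "0 <= e'" using eS le_ennrealD unfolding s by blast
   obtain f' where f': "?f = ennreal f'" "0 <= f'" using fF le_ennrealD unfolding f by blast
   have le: "e' <= e" "e' <= s" "f' <= f" using eE eS fF unfolding s f e e' f' using s f e e' f' by auto
   have p3: "0 <= \<theta>^3" using th by simp
   have "energy (slab n a x0 (\<theta>*R) T) J <= ennreal (1/16 * e' + Ce/(1/16) * (Ct * \<theta> * s + Ct/\<theta>^3 * (z + f) + (\<theta>*R/(R/4))^2 * e' + f'))"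
    using step unfolding e e' f f' s z using e e' f f' s z Ce Ct th R p3
    by (simp only: ennreal_reals)
   also have "... <= ennreal (1/16 * e + C * \<theta> * s + C/\<theta>^3 * (z + f))"
   proof (rule ennreal_leI)
    have q: "(\<theta>*R/(R/4))^2 = 16 * \<theta>^2" using R by (simp add: power_mult_distrib)
    have "\<theta>^2 * e' <= \<theta> * s"
    proof (rule mult_mono)
     show "\<theta>^2 <= \<theta>" using th by (simp add: power2_eq_square mult_left_le_one_le)
    qed (use le e' th in auto)
    hence 1: "16 * Ce * ((\<theta>*R/(R/4))^2 * e') <= 256 * Ce * (\<theta> * s)" unfolding q using Ce by simp
    have "1 <= 1/\<theta>^3" using th power_le_one[of \<theta> 3] by (simp add: pos_le_divide_eq)
    from mult_right_mono[OF this f(2)] have "f' <= 1/\<theta>^3 * (z + f)" using le(3) z(2) p3 by (simp add: add_divide_distrib add_increasing)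
    hence 2: "16 * Ce * f' <= 16 * Ce * (1/\<theta>^3 * (z + f))" by (rule mult_left_mono) (use Ce in simp)
    have 3: "16 * Ce * (1/\<theta>^3 * (z + f)) <= 256 * Ce * (1/\<theta>^3 * (z + f))" using Ce z(2) f(2) p3 by (intro mult_right_mono) auto
    have a: "C * \<theta> * s = 16 * Ce * (Ct * \<theta> * s) + 256 * Ce * (\<theta> * s)" by (simp add: C_def algebra_simps)
    have b: "C/\<theta>^3 * (z + f) = 16 * Ce * (Ct/\<theta>^3 * (z + f)) + 256 * Ce * (1/\<theta>^3 * (z + f))"
     by (simp add: C_def add_divide_distrib distrib_right distrib_left)
    have c: "Ce/(1/16) * (Ct * \<theta> * s + Ct/\<theta>^3 * (z + f) + (\<theta>*R/(R/4))^2 * e' + f') = 16 * Ce * (Ct * \<theta> * s) + 16 * Ce * (Ct/\<theta>^3 * (z + f)) + 16 * Ce * ((\<theta>*R/(R/4))^2 * e') + 16 * Ce * f'"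
    proof -
     have "Ce/(1/16) = 16 * Ce" by simp
     thus ?thesis by (simp only: distrib_left)
    qed
    show "1/16 * e' + Ce/(1/16) * (Ct * \<theta> * s + Ct/\<theta>^3 * (z + f) + (\<theta>*R/(R/4))^2 * e' + f') <= 1/16 * e + C * \<theta> * s + C/\<theta>^3 * (z + f)"
     unfolding a b c using 1 2 3 le(1) by linarith
   qed
   also have "... = ennreal (1/16) * ennreal e + ennreal (C * \<theta>) * ennreal s + ennreal (C/\<theta>^3) * (ennreal z + ennreal f)"
    using e f s z C th p3
    by (simp only: ennreal_reals)
   finally show ?thesis unfolding e f s z .
  qed
 qed
qed

section \<open>Small scales by Hoelder continuity, large scales by periodicity\<close>

definition hoelder_bilin where
 "hoelder_bilin \<sigma> M A \<longleftrightarrow> (\<forall>x y \<xi> \<eta>. \<bar>bilin A x \<xi> \<eta> - bilin A y \<xi> \<eta>\<bar> <= M * dist x y powr \<sigma> * norm \<xi> * norm \<eta>)"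

lemma integer_approx:
 fixes y :: "real^'d::finite"
 shows "\<exists>z. (\<forall>k. z $ k \<in> \<int>) \<and> norm (y - z) <= sqrt (real CARD('d))"
proof -
 define z :: "real^'d" where "z = (\<chi> k. of_int \<lfloor>y $ k\<rfloor>)"
 have "\<bar>(y - z) $ k\<bar> <= 1" for k unfolding z_def by simp linarith
 hence "((y - z) $ k)^2 <= 1" for k using abs_le_square_iff[of "(y - z) $ k" 1] by simp
 hence "(\<Sum>k\<in>UNIV. ((y - z) $ k)^2) <= (\<Sum>k\<in>(UNIV::'d set). 1)" by (intro sum_mono)
 hence "norm (y - z) <= sqrt (real CARD('d))" unfolding norm_vec_def L2_set_def by (intro real_sqrt_le_mono) simp
 thus ?thesis by (intro exI[of _ z]) (simp add: z_def)
qed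

lemma bilin_periodic: "periodic_coeff A ==> (\<forall>k. z $ k \<in> \<int>) ==> bilin A (x + z) \<xi> \<eta> = bilin A x \<xi> \<eta>"
 unfolding bilin_def periodic_coeff_def by simp

text \<open>\<open>Cd\<close> and \<open>K1\<close> are chosen before \<open>\<theta>\<close>,
  whereas \<open>C2\<close>, \<open>r0\<close> and \<open>R0\<close> come after it; this order is
  what lets the summation over scales absorb the term with \<open>Cd * \<theta>\<close>. The
  hypothesis on \<open>sslab\<close> turns two-sided energies into one-sided ones.\<close>

lemma decay_step:
 assumes mu: "0 < \<mu>" and M: "0 <= M" and sig: "0 < \<sigma>" and C0: "0 < C0"
 shows "\<exists>Cd K1. 0 < Cd \<and> 4 <= K1 \<and> (\<forall>\<theta>. 0 < \<theta> --> \<theta> <= 1/8 --> (\<exists>C2 r0 R0. 0 < C2 \<and> 0 < r0 \<and> 0 < R0 \<and>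
  (\<forall>(n::real^'d::finite) a x0 A (v::real^'d => real^'m::finite) J g R T.
  norm n = 1 --> coefs \<mu> M A --> hoelder_bilin \<sigma> M A --> periodic_coeff A -->
  C1 v J --> L2_loc_upto (halfspace n a) g --> weakeq A (halfspace n a) J g -->
  (\<forall>r T. energy (sslab n a x0 r T) J <= ennreal C0 * energy (slab n a x0 r T) J) -->
  0 < R --> 0 <= T --> R <= r0 \<or> R0 <= R -->
  energy (slab n a x0 (\<theta>*R) T) J <= ennreal (1/16) * energy (slab n a x0 (2*(\<theta>*R)) (T+R)) J
   + ennreal (Cd * \<theta>) * energy (slab n a x0 R (T+K1*R)) J
   + ennreal C2 * energy (slab n a x0 R (T+K1*R)) g)))"
 using decay_generic[OF mu M, where 'd='d and 'm='m] hole_filling[OF mu M, where 'd='d and 'm='m]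
proof (elim exE conjE, goal_cases)
 case (1 C \<kappa> K)
 note C = 1(1) and DG = 1(2) and k = 1(3-5) and HF = 1(6)
 show ?thesis
 proof (rule exI[of _ "2 * C * C0"], rule exI[of _ "4 + K"], intro conjI allI impI, goal_cases)
  case (3 \<theta>)
  note th = 3
  define c where "c = sqrt (real CARD('d))"
  have c0: "0 < c" by (simp add: c_def)
  have "\<theta>^4 > 0" using th by simp
  \<comment> \<open>Hole filling has to outweigh the factor \<open>C/\<theta>^3\<close> in front of
    the boundary layer and leave one power of \<open>\<theta>\<close> over, hence the fourth
    power.\<close>
  then obtain N where N: "\<kappa>^N < \<theta>^4" using real_arch_pow_inv k(2) by blast
  \<comment> \<open>Two demands on a large scale \<open>R\<close>: after \<open>N\<close> doublings
    the layer height \<open>2 * c\<close> must still be at most \<open>R\<close>, and the lattice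
    error \<open>c\<close> must be at most \<open>\<theta>^2 * R\<close>.\<close>
  define R0 where "R0 = 2^N * (2 * c) + c/\<theta>^2"
  \<comment> \<open>Chosen so that \<open>M * r0 powr \<sigma> <= \<theta>^2\<close>; writing
    \<open>M+1\<close> avoids a division by zero.\<close>
  define r0 where "r0 = (\<theta>^2/(M+1)) powr (1/\<sigma>)"
  define C2 where "C2 = C/\<theta>^3 * (C0/(1-\<kappa>) + 1)"
  have C2: "0 < C2" using C C0 th k by (simp add: C2_def add_pos_pos)
  have R0: "0 < R0" unfolding R0_def using c0 th by (simp add: add_pos_pos)
  have r0: "0 < r0" using th M by (simp add: r0_def)
  have p3: "0 < \<theta>^3" using th by simp
  show ?case
  proof (rule exI[of _ C2], rule exI[of _ r0], rule exI[of _ R0], intro conjI C2 r0 R0 allI impI)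
   fix n :: "real^'d" and a :: real and x0 A and v :: "real^'d => real^'m" and J g and R T :: real
   assume n: "norm n = 1" and A: "coefs \<mu> M A" and H: "hoelder_bilin \<sigma> M A" and per: "periodic_coeff A" and Cv: "C1 v J" and g: "L2_loc_upto (halfspace n a) g"
    and weak: "weakeq A (halfspace n a) J g" and sym: "\<forall>r T. energy (sslab n a x0 r T) J <= ennreal C0 * energy (slab n a x0 r T) J"
    and R: "0 < R" and T: "0 <= T" and reg: "R <= r0 \<or> R0 <= R"
   let ?E = "energy (slab n a x0 (2*(\<theta>*R)) (T+R)) J" and ?S = "energy (slab n a x0 R (T+(4+K)*R)) J"
    and ?F = "energy (slab n a x0 R (T+(4+K)*R)) g"
   have KR: "4 * R <= (4+K) * R" using R k by (intro mult_right_mono) auto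
   have SS: "energy (sslab n a x0 R (T+4*R)) J <= ennreal C0 * ?S"
   proof -
    have "energy (sslab n a x0 R (T+4*R)) J <= ennreal C0 * energy (slab n a x0 R (T+4*R)) J" using sym by blast
    also have "... <= ennreal C0 * ?S" by (intro mult_left_mono energy_slab_mono) (use KR in auto)
    finally show ?thesis .
   qed
   have FF: "energy (slab n a x0 R (T+4*R)) g <= ?F" by (intro energy_slab_mono) (use KR in auto)
   have key: "energy (slab n a x0 (\<theta>*R) T) J <= ennreal (1/16) * ?E
    + ennreal (C * \<theta>) * (ennreal C0 * ?S) + ennreal (C/\<theta>^3) * (ennreal C0 * (ennreal (\<theta>^4) * ?S + ennreal (1/(1-\<kappa>)) * ?F) + ?F)"
    using reg
   proof
    assume Rr: "R <= r0"
    have "energy (slab n a x0 (\<theta>*R) T) J <= ennreal (1/16) * ?E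
   + ennreal (C * \<theta>) * energy (sslab n a x0 R (T+4*R)) J
   + ennreal (C/\<theta>^3) * (energy (sslab n a x0 (2 * 0) (T+4*R)) J + energy (slab n a x0 R (T+4*R)) g)"
    proof (rule DG[rule_format, OF n A Cv g weak R T th, of "\<theta>^2" 0])
     fix y :: "real^'d" assume y: "norm y <= \<theta> * R"
     have tR: "\<theta> * R <= 1 * R" using th R by (intro mult_right_mono) auto
     have "norm y powr \<sigma> <= r0 powr \<sigma>" using y tR Rr sig by (intro powr_mono2) auto
     also have "... = \<theta>^2/(M+1)" unfolding r0_def powr_powr using sig th M by simp
     finally have "M * norm y powr \<sigma> <= M * (\<theta>^2/(M+1))" using M by (rule mult_left_mono)
     also have "... <= \<theta>^2" using M th by (simp add: pos_divide_le_eq algebra_simps)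
     finally have "M * norm y powr \<sigma> <= \<theta>^2" .
     hence "M * dist (x + y) x powr \<sigma> * norm \<xi> * norm \<eta> <= \<theta>^2 * norm \<xi> * norm \<eta>" for x and \<xi> \<eta> :: "real^'d^'m"
      by (intro mult_right_mono) (auto simp: dist_norm)
     hence "\<forall>x \<xi> \<eta>. \<bar>bilin A (x + y) \<xi> \<eta> - bilin A x \<xi> \<eta>\<bar> <= \<theta>^2 * norm \<xi> * norm \<eta>"
      using H unfolding hoelder_bilin_def by (meson order_trans)
     thus "\<exists>z. norm (y - z) <= 0 \<and> (\<forall>x \<xi> \<eta>. \<bar>bilin A (x + z) \<xi> \<eta> - bilin A x \<xi> \<eta>\<bar> <= \<theta>^2 * norm \<xi> * norm \<eta>)"
      by (intro exI[of _ y]) simp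
    qed (use th R in auto)
    \<comment> \<open>With \<open>z = y\<close> tangential, the translation preserves the half-space
      and the boundary layer is empty.\<close>
    also have "energy (sslab n a x0 (2 * 0) (T+4*R)) J = 0" unfolding sslab_def energy_def by simp
    also have "ennreal (1/16) * ?E + ennreal (C * \<theta>) * energy (sslab n a x0 R (T+4*R)) J
      + ennreal (C/\<theta>^3) * (0 + energy (slab n a x0 R (T+4*R)) g)
     <= ennreal (1/16) * ?E + ennreal (C * \<theta>) * (ennreal C0 * ?S) + ennreal (C/\<theta>^3) * (ennreal C0 * (ennreal (\<theta>^4) * ?S + ennreal (1/(1-\<kappa>)) * ?F) + ?F)"
     by (intro add_mono mult_left_mono SS FF) auto
    finally show ?thesis .
   next
    assume RR: "R0 <= R"
    have "2^N * (2 * c) <= R0" "c/\<theta>^2 <= R0" unfolding R0_def using c0 th by auto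
    hence q: "2^N * (2 * c) <= R" "c/\<theta>^2 <= R" using RR by linarith+
    hence cR: "2^N * (2 * c) <= R" "c <= \<theta>^2 * R" using th by (auto simp: pos_divide_le_eq mult.commute)
    have t2: "\<theta>^2 * R <= \<theta> * R" using th R by (simp add: power2_eq_square mult_left_le_one_le)
    have "energy (slab n a x0 (\<theta>*R) T) J <= ennreal (1/16) * ?E
   + ennreal (C * \<theta>) * energy (sslab n a x0 R (T+4*R)) J
   + ennreal (C/\<theta>^3) * (energy (sslab n a x0 (2 * c) (T+4*R)) J + energy (slab n a x0 R (T+4*R)) g)"
    proof (rule DG[rule_format, OF n A Cv g weak R T th, of 0 c])
     show "c <= \<theta> * R" using cR t2 by linarith
     have "c^2 <= (\<theta>^2 * R)^2" using cR c0 by (intro power_mono) auto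
     also have "... = \<theta> * (\<theta> * (\<theta> * R)^2)" by (simp add: power2_eq_square)
     also have "... <= 1 * (\<theta> * (\<theta> * R)^2)" using th by (intro mult_right_mono) auto
     finally show "c^2 <= \<theta> * (\<theta> * R)^2" by simp
     fix y :: "real^'d"
     obtain z where "\<forall>k. z $ k \<in> \<int>" "norm (y - z) <= c" using integer_approx[of y] unfolding c_def by blast
     thus "\<exists>z. norm (y - z) <= c \<and> (\<forall>x \<xi> \<eta>. \<bar>bilin A (x + z) \<xi> \<eta> - bilin A x \<xi> \<eta>\<bar> <= 0 * norm \<xi> * norm \<eta>)"
      by (intro exI[of _ z]) (simp add: bilin_periodic[OF per])
    qed auto
    moreover have "energy (sslab n a x0 (2 * c) (T+4*R)) J <= ennreal C0 * (ennreal (\<theta>^4) * ?S + ennreal (1/(1-\<kappa>)) * ?F)"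
    proof -
     have c2: "0 < 2 * c" and T4: "0 <= T + 4 * R" using c0 T R by auto
     have "(2^N-1)*(2*c) <= R" using cR c0 by (simp add: algebra_simps)
     hence kk: "K*((2^N-1)*(2*c)) <= K * R" using k by (intro mult_left_mono) auto
     have ins: "energy (slab n a x0 (2^N*(2*c)) (T+4*R+K*((2^N-1)*(2*c)))) h <= energy (slab n a x0 R (T+(4+K)*R)) h" for h :: "real^'d => real^'d^'m"
      by (rule energy_slab_mono[OF cR(1)]) (use kk in \<open>simp add: algebra_simps\<close>)
     have "energy (slab n a x0 (2*c) (T+4*R)) J <= ennreal (\<kappa>^N) * energy (slab n a x0 (2^N*(2*c)) (T+4*R+K*((2^N-1)*(2*c)))) J
      + ennreal (1/(1-\<kappa>)) * energy (slab n a x0 (2^N*(2*c)) (T+4*R+K*((2^N-1)*(2*c)))) g"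
      by (rule HF[rule_format, OF n A Cv g weak c2 T4])
     also have "... <= ennreal (\<theta>^4) * ?S + ennreal (1/(1-\<kappa>)) * ?F"
      using N by (intro add_mono mult_mono ins ennreal_leI) auto
     finally have "ennreal C0 * energy (slab n a x0 (2*c) (T+4*R)) J <= ennreal C0 * (ennreal (\<theta>^4) * ?S + ennreal (1/(1-\<kappa>)) * ?F)"
      by (rule mult_left_mono) simp
     with sym show ?thesis by (meson order_trans)
    qed
    ultimately show ?thesis
     by (elim order_trans) (intro add_mono mult_left_mono SS FF; simp)
   qed
   show "energy (slab n a x0 (\<theta>*R) T) J <= ennreal (1/16) * ?E + ennreal (2 * C * C0 * \<theta>) * ?S + ennreal C2 * ?F"
   proof (cases "?S = top \<or> ?F = top")
    case True
    hence "ennreal (1/16) * ?E + ennreal (2 * C * C0 * \<theta>) * ?S + ennreal C2 * ?F = top"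
     using th C C0 C2 by (auto simp: ennreal_mult_eq_top_iff)
    thus ?thesis by (simp only: top_greatest)
   next
    case False
    obtain s where s: "?S = ennreal s" "0 <= s" using False by (cases "?S") auto
    obtain f where f: "?F = ennreal f" "0 <= f" using False by (cases "?F") auto
    have k1: "0 <= 1/(1-\<kappa>)" and p4: "0 <= \<theta>^4" using k by auto
    have eq: "C * \<theta> * (C0 * s) + C/\<theta>^3 * (C0 * (\<theta>^4 * s + 1/(1-\<kappa>) * f) + f) = 2 * C * C0 * \<theta> * s + C2 * f"
    proof -
     have "C/\<theta>^3 * (C0 * (\<theta>^4 * s)) = C * C0 * \<theta> * s" using th by (simp add: power_eq_if)
     moreover have "C/\<theta>^3 * (C0 * (1/(1-\<kappa>) * f) + f) = C2 * f" unfolding C2_def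
      by (simp only: distrib_left distrib_right mult.assoc times_divide_eq_left times_divide_eq_right mult_1 mult_1_right)
     ultimately show ?thesis by (simp add: distrib_left)
    qed
    have "ennreal (C * \<theta>) * (ennreal C0 * ?S) + ennreal (C/\<theta>^3) * (ennreal C0 * (ennreal (\<theta>^4) * ?S + ennreal (1/(1-\<kappa>)) * ?F) + ?F)
     = ennreal (C * \<theta> * (C0 * s) + C/\<theta>^3 * (C0 * (\<theta>^4 * s + 1/(1-\<kappa>) * f) + f))"
     unfolding s f using s f C C0 th p3 p4 k1
     by (simp only: ennreal_reals)
    also have "... = ennreal (2 * C * C0 * \<theta>) * ?S + ennreal C2 * ?F"
     unfolding eq s f using s f C C0 th C2
     by (simp only: ennreal_reals)
    finally show ?thesis using key by (simp only: add.assoc)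
   qed
  qed
 qed (use C C0 k in auto)
qed

section \<open>Approximation by even functions\<close>

text \<open>Uniqueness of Haar measure, specialised: averaging over the unit ball, which a linear isometry preserves.\<close>
lemma nn_integral_isometric_involution:
 fixes f :: "'a::euclidean_space => ennreal"
 assumes mf[measurable]: "f \<in> borel_measurable borel" and lin: "linear R" and inv: "\<And>x. R (R x) = x" and iso: "\<And>x. norm (R x) = norm x"
 shows "(\<integral>\<^sup>+x. f (R x) \<partial>lborel) = (\<integral>\<^sup>+x. f x \<partial>lborel)"
proof -
 let ?B = "\<lambda>x::'a. indicator (ball 0 1) x :: ennreal"
 have mR[measurable]: "R \<in> borel_measurable borel"
  by (intro borel_measurable_continuous_onI linear_continuous_on) (use lin in \<open>simp add: linear_conv_bounded_linear\<close>)
 have mball[measurable]: "ball (0::'a) 1 \<in> sets borel" by simp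
 have mB[measurable]: "?B \<in> borel_measurable borel" by measurable
 define c where "c = (\<integral>\<^sup>+x. ?B x \<partial>lborel)"
 have c1: "c \<noteq> top" unfolding c_def using emeasure_lborel_ball_finite[of "0::'a" 1] by simp
 have "emeasure lborel (ball (0::'a) 1) \<noteq> 0" using content_ball_pos[of 1 "0::'a"] by (auto simp: measure_def)
 hence c0: "c \<noteq> 0" unfolding c_def by simp
 have sh: "(\<integral>\<^sup>+x. f (R x + y) \<partial>lborel) = (\<integral>\<^sup>+x. f (R x) \<partial>lborel)" for y
 proof -
  have m: "(\<lambda>x. f (R x)) \<in> borel_measurable borel" by measurable
  have "R x + y = R (x + R y)" for x using lin inv by (simp add: linear_add)
  thus ?thesis using nn_integral_shift[OF m, of "R y"] by simp
 qed
 have bb: "(\<integral>\<^sup>+x. ?B (y - R x) \<partial>lborel) = c" for y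
 proof -
  have "?B (y - R x) = ?B (x + (- R y))" for x
  proof -
   have "norm (y - R x) = norm (R (y - R x))" by (simp add: iso)
   also have "R (y - R x) = R y - x" using lin inv by (simp add: linear_diff)
   finally show ?thesis by (simp add: indicator_def norm_minus_commute)
  qed
  thus ?thesis using nn_integral_shift[OF mB, of "- R y"] by (simp only: c_def)
 qed
 have m1: "(\<lambda>(x,y). ?B y * f (R x + y)) \<in> borel_measurable (borel \<Otimes>\<^sub>M borel)" by measurable
 have m2: "(\<lambda>(x,y). ?B (y - R x) * f y) \<in> borel_measurable (borel \<Otimes>\<^sub>M borel)" by measurable
 have "(\<integral>\<^sup>+x. f (R x) \<partial>lborel) * c = (\<integral>\<^sup>+y. (\<integral>\<^sup>+x. f (R x) \<partial>lborel) * ?B y \<partial>lborel)" unfolding c_def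
  by (rule nn_integral_cmult[symmetric]) measurable
 also have "... = (\<integral>\<^sup>+y. (\<integral>\<^sup>+x. ?B y * f (R x + y) \<partial>lborel) \<partial>lborel)"
 proof (rule nn_integral_cong)
  fix y
  have m: "(\<lambda>x. f (R x + y)) \<in> borel_measurable lborel" by measurable
  show "(\<integral>\<^sup>+x. f (R x) \<partial>lborel) * ?B y = (\<integral>\<^sup>+x. ?B y * f (R x + y) \<partial>lborel)"
   unfolding nn_integral_cmult[OF m] sh by (rule mult.commute)
 qed
 also have "... = (\<integral>\<^sup>+x. (\<integral>\<^sup>+y. ?B y * f (R x + y) \<partial>lborel) \<partial>lborel)"
  by (rule nn_swap[OF m1, symmetric])
 also have "... = (\<integral>\<^sup>+x. (\<integral>\<^sup>+y. ?B (y - R x) * f y \<partial>lborel) \<partial>lborel)"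
 proof (rule nn_integral_cong)
  fix x
  have m: "(\<lambda>y. ?B y * f (R x + y)) \<in> borel_measurable borel" by measurable
  show "(\<integral>\<^sup>+y. ?B y * f (R x + y) \<partial>lborel) = (\<integral>\<^sup>+y. ?B (y - R x) * f y \<partial>lborel)"
   using nn_integral_shift[OF m, of "- R x"] by simp
 qed
 also have "... = (\<integral>\<^sup>+y. (\<integral>\<^sup>+x. ?B (y - R x) * f y \<partial>lborel) \<partial>lborel)"
  by (rule nn_swap[OF m2])
 also have "... = (\<integral>\<^sup>+y. c * f y \<partial>lborel)"
 proof (rule nn_integral_cong)
  fix y
  have m: "(\<lambda>x. ?B (y - R x)) \<in> borel_measurable lborel" by measurable
  show "(\<integral>\<^sup>+x. ?B (y - R x) * f y \<partial>lborel) = c * f y" unfolding nn_integral_multc[OF m] bb ..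
 qed
 also have "... = c * (\<integral>\<^sup>+y. f y \<partial>lborel)" by (rule nn_integral_cmult) measurable
 finally have "c * (\<integral>\<^sup>+x. f (R x) \<partial>lborel) = c * (\<integral>\<^sup>+y. f y \<partial>lborel)" by (simp only: mult.commute)
 thus ?thesis using c0 c1 by (simp add: ennreal_mult_cancel_left)
qed

section \<open>Approximation and continuity of translations in mean square\<close>

definition clampn :: "real => 'b::real_normed_vector => 'b" where
 "clampn k y = (k / max k (norm y)) *\<^sub>R y"

lemma clampn_props:
 assumes "0 < k"
 shows "norm (clampn k y) <= k" "norm y <= k ==> clampn k y = y" "continuous_on UNIV (clampn k)"
proof -
 show "norm (clampn k y) <= k"
 proof -
  have "k * norm y <= k * max k (norm y)" using assms by (intro mult_left_mono) auto
  thus ?thesis using assms by (simp add: clampn_def pos_divide_le_eq less_max_iff_disj abs_of_pos)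
 qed
 show "norm y <= k ==> clampn k y = y" using assms by (simp add: clampn_def max_absorb1)
 show "continuous_on UNIV (clampn k)" unfolding clampn_def[abs_def] using assms by (intro continuous_intros) (auto simp: max_def)
qed

text \<open>A measurable function is almost everywhere a limit of continuous functions. Clamping
  these at the bound of \<open>G\<close> and cutting them off outside a ball provides a dominating
  function, and neither operation disturbs the limit.\<close>

lemma L2_approx_bounded:
 fixes G :: "'a::euclidean_space => 'b::euclidean_space"
 assumes mG[measurable]: "G \<in> borel_measurable borel" and k: "0 < k" and b: "\<And>x. norm (G x) <= k" and s: "\<And>x. k < norm x ==> G x = 0"
  and e: "(0::real) < e"
 shows "\<exists>g. continuous_on UNIV g \<and> (\<forall>x. k + 1 < norm x --> g x = 0) \<and> (\<integral>\<^sup>+x. nsq (G x - g x) \<partial>lborel) < ennreal e"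
proof -
 have "G measurable_on UNIV"
  by (rule lebesgue_measurable_imp_measurable_on) (auto intro: measurable_completion)
 then obtain N g where N: "negligible N" and cg: "\<And>n. continuous_on UNIV (g n :: 'a => 'b)" and lim: "\<And>x. x \<notin> N ==> (\<lambda>n. g n x) \<longlonglongrightarrow> G x"
  unfolding measurable_on_def by auto
 define cut where "cut x = max 0 (min 1 (k + 1 - norm x))" for x :: 'a
 have cc: "continuous_on UNIV cut" unfolding cut_def[abs_def] by (intro continuous_intros)
 have c01: "0 <= cut x" "cut x <= 1" for x by (auto simp: cut_def)
 define h where "h n x = cut x *\<^sub>R clampn k (g n x)" for n x
 have ch: "continuous_on UNIV (h n)" for n unfolding h_def[abs_def]
  by (intro continuous_intros cc cont_comp[OF clampn_props(3)[OF k] cg])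
 have [measurable]: "h n \<in> borel_measurable borel" for n by (rule borel_measurable_continuous_onI[OF ch])
 have mcb[measurable]: "cball (0::'a) (k+1) \<in> sets borel" by simp
 have h0: "k + 1 < norm x ==> h n x = 0" for n x by (simp add: h_def cut_def)
 have hb: "norm (h n x) <= k" for n x
  using mult_mono[OF c01(2)[of x] clampn_props(1)[OF k, of "g n x"]] c01[of x] by (simp add: h_def)
 have "(\<lambda>n. \<integral>\<^sup>+x. nsq (G x - h n x) \<partial>lborel) \<longlonglongrightarrow> (\<integral>\<^sup>+x. 0 \<partial>(lborel :: 'a measure))"
 proof (rule nn_integral_dominated_convergence[where w="\<lambda>x. ennreal ((2 * k)^2) * indicator (cball (0::'a) (k+1)) x"])
  show "AE x in lborel. nsq (G x - h j x) <= ennreal ((2 * k)^2) * indicator (cball (0::'a) (k+1)) x" for j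
  proof (intro AE_I2)
   fix x
   show "nsq (G x - h j x) <= ennreal ((2 * k)^2) * indicator (cball (0::'a) (k+1)) x"
   proof (cases "x \<in> cball 0 (k+1)")
    case True
    have "norm (G x - h j x) <= 2 * k" using norm_triangle_ineq4[of "G x" "h j x"] b[of x] hb[of j x] by linarith
    hence "(norm (G x - h j x))^2 <= (2 * k)^2" by (intro power_mono) auto
    thus ?thesis using True by (simp add: ennreal_leI)
   next
    case False
    thus ?thesis using h0[of x j] s[of x] by simp
   qed
  qed
  show "(\<integral>\<^sup>+x. ennreal ((2 * k)^2) * indicator (cball (0::'a) (k+1)) x \<partial>lborel) < \<infinity>"
   using emeasure_lborel_cball_finite[of "0::'a" "k+1"] by (simp add: nn_integral_cmult_indicator ennreal_mult_less_top)
  have "AE x in lborel. x \<notin> N"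
  proof -
   have "N \<in> null_sets lebesgue" using N by (simp add: negligible_iff_null_sets)
   hence "AE x in lebesgue. x \<notin> N" by (rule AE_not_in)
   thus ?thesis by (simp add: AE_completion_iff)
  qed
  thus "AE x in lborel. (\<lambda>n. nsq (G x - h n x)) \<longlonglongrightarrow> 0"
  proof eventually_elim
   case (elim x)
   have "(\<lambda>n. clampn k (g n x)) \<longlonglongrightarrow> clampn k (G x)"
    by (rule continuous_on_tendsto_compose[OF clampn_props(3)[OF k] lim[OF elim]]) auto
   hence "(\<lambda>n. cut x *\<^sub>R clampn k (g n x)) \<longlonglongrightarrow> cut x *\<^sub>R clampn k (G x)" by (rule tendsto_scaleR[OF tendsto_const])
   moreover have "cut x *\<^sub>R clampn k (G x) = G x"
   proof (cases "norm x <= k")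
    case True thus ?thesis using clampn_props(2)[OF k b] by (simp add: cut_def)
   next
    case False thus ?thesis using s[of x] by (simp add: clampn_def)
   qed
   ultimately have "(\<lambda>n. h n x) \<longlonglongrightarrow> G x" by (simp add: h_def)
   hence "(\<lambda>n. (norm (G x - h n x))^2) \<longlonglongrightarrow> (norm (G x - G x))^2" by (intro tendsto_intros)
   hence "(\<lambda>n. nsq (G x - h n x)) \<longlonglongrightarrow> nsq (G x - G x)" by (rule tendsto_ennrealI)
   thus ?case by simp
  qed
 qed measurable
 hence "\<forall>\<^sub>F n in sequentially. (\<integral>\<^sup>+x. nsq (G x - h n x) \<partial>lborel) < ennreal e"
  by (rule order_tendstoD(2)) (use e in simp)
 then obtain n where "(\<integral>\<^sup>+x. nsq (G x - h n x) \<partial>lborel) < ennreal e"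
  using eventually_happens'[OF sequentially_bot] by force
 thus ?thesis using ch h0 by (intro exI[of _ "h n"]) simp
qed

lemma energy_diff_le:
 fixes f g h :: "real^'d::finite => 'b::euclidean_space"
 assumes [measurable]: "f \<in> borel_measurable borel" "g \<in> borel_measurable borel" "h \<in> borel_measurable borel" "S \<in> sets borel"
 shows "energy S (\<lambda>x. f x - h x) <= 2 * energy S (\<lambda>x. f x - g x) + 2 * energy S (\<lambda>x. g x - h x)"
proof -
 have "energy S (\<lambda>x. (f x - g x) + (g x - h x)) <= 2 * energy S (\<lambda>x. f x - g x) + 2 * energy S (\<lambda>x. g x - h x)"
  by (rule energy_add_le) measurable
 thus ?thesis by simp
qed

lemma L2_approx:
 fixes G :: "real^'d::finite => 'b::euclidean_space"
 assumes mG[measurable]: "G \<in> borel_measurable borel" and fin: "energy UNIV G < top" and e: "(0::real) < e"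
 shows "\<exists>g k. 0 < k \<and> continuous_on UNIV g \<and> (\<forall>x. k < norm x --> g x = 0) \<and> energy UNIV (\<lambda>x. G x - g x) < ennreal e"
proof -
 define H where "H n x = (if norm x <= real n + 1 \<and> norm (G x) <= real n + 1 then G x else 0)" for n x
 have [measurable]: "H n \<in> borel_measurable borel" for n unfolding H_def[abs_def] by measurable
 have "(\<lambda>n. \<integral>\<^sup>+x. nsq (G x - H n x) \<partial>lborel) \<longlonglongrightarrow> (\<integral>\<^sup>+x. 0 \<partial>(lborel :: (real^'d) measure))"
 proof (rule nn_integral_dominated_convergence[where w="\<lambda>x. nsq (G x)"])
  show "AE x in lborel. nsq (G x - H j x) <= nsq (G x)" for j
   by (intro AE_I2) (simp add: H_def)
  show "(\<integral>\<^sup>+x. nsq (G x) \<partial>lborel) < \<infinity>" using fin by (simp add: energy_def)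
  show "AE x in lborel. (\<lambda>n. nsq (G x - H n x)) \<longlonglongrightarrow> 0"
  proof (intro AE_I2)
   fix x
   obtain n0 where n0: "max (norm x) (norm (G x)) <= real n0" using real_arch_simple by blast
   have "H n x = G x" if "n0 <= n" for n using n0 that by (auto simp: H_def)
   hence "\<forall>\<^sub>F n in sequentially. 0 = nsq (G x - H n x)" unfolding eventually_sequentially by (intro exI[of _ n0]) simp
   thus "(\<lambda>n. nsq (G x - H n x)) \<longlonglongrightarrow> 0" by (rule tendsto_eventually[OF eventually_mono]) simp
  qed
 qed measurable
 hence "\<forall>\<^sub>F n in sequentially. (\<integral>\<^sup>+x. nsq (G x - H n x) \<partial>lborel) < ennreal (e/4)"
  by (rule order_tendstoD(2)) (use e in simp)
 then obtain n where n: "(\<integral>\<^sup>+x. nsq (G x - H n x) \<partial>lborel) < ennreal (e/4)"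
  using eventually_happens'[OF sequentially_bot] by force
 have Hb: "norm (H n x) <= real n + 1" for x by (simp add: H_def)
 have Hs: "real n + 1 < norm x ==> H n x = 0" for x by (simp add: H_def)
 have "\<exists>g. continuous_on UNIV g \<and> (\<forall>x. real n + 1 + 1 < norm x --> g x = 0) \<and> (\<integral>\<^sup>+x. nsq (H n x - g x) \<partial>lborel) < ennreal (e/4)"
  by (rule L2_approx_bounded[OF _ _ Hb Hs]) (use e in auto)
 then obtain g where g: "continuous_on UNIV g" "\<forall>x. real n + 1 + 1 < norm x --> g x = 0" "(\<integral>\<^sup>+x. nsq (H n x - g x) \<partial>lborel) < ennreal (e/4)"
  by (elim exE conjE)
 have [measurable]: "g \<in> borel_measurable borel" by (rule borel_measurable_continuous_onI[OF g(1)])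
 have "energy UNIV (\<lambda>x. G x - g x) <= 2 * energy UNIV (\<lambda>x. G x - H n x) + 2 * energy UNIV (\<lambda>x. H n x - g x)"
  by (rule energy_diff_le) measurable
 also have "... <= 2 * energy UNIV (\<lambda>x. G x - H n x) + 2 * ennreal (e/4)"
  using g(3) by (intro add_left_mono mult_left_mono) (auto simp: energy_def)
 also have "... < ennreal e"
 proof -
  have E: "energy UNIV (\<lambda>x. G x - H n x) < ennreal (e/4)" using n by (simp add: energy_def)
  then obtain w where w: "energy UNIV (\<lambda>x. G x - H n x) = ennreal w" "0 <= w" using le_ennrealD[OF less_imp_le[OF E]] by blast
  have "w < e/4" using E w e by (simp add: ennreal_less_iff)
  hence "ennreal (2 * w + 2 * (e/4)) < ennreal e" using w e by (intro ennreal_lessI) linarith+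
  moreover have "ennreal (2 * w + 2 * (e/4)) = 2 * ennreal w + 2 * ennreal (e/4)"
   using w e by (simp only: ennreal_reals)
  ultimately show ?thesis unfolding w by simp
 qed
 finally have "energy UNIV (\<lambda>x. G x - g x) < ennreal e" .
 with g show ?thesis by (intro exI[of _ g] exI[of _ "real n + 2"]) auto
qed

lemma energy_shift:
 fixes G :: "real^'d::finite => 'b::euclidean_space"
 assumes [measurable]: "G \<in> borel_measurable borel"
 shows "energy UNIV (\<lambda>x. G (x + q)) = energy UNIV G"
 unfolding energy_def using nn_integral_shift[of "\<lambda>x. nsq (G x)" q] by simp

text \<open>Three comparisons by way of a continuous function \<open>g\<close> with bounded support,
  which is uniformly continuous; with shares of \<open>e/16\<close> the doubled squares add up to
  10/16 of \<open>e\<close>.\<close>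

lemma L2_translation:
 fixes G :: "real^'d::finite => 'b::euclidean_space"
 assumes mG[measurable]: "G \<in> borel_measurable borel" and fin: "energy UNIV G < top" and e: "(0::real) < e"
 shows "\<exists>d>0. \<forall>q. norm q < d --> energy UNIV (\<lambda>x. G (x + q) - G x) <= ennreal e"
proof -
 obtain g k where k: "0 < k" and g: "continuous_on UNIV g" and g0: "\<And>x. k < norm x ==> g x = 0" and ge: "energy UNIV (\<lambda>x. G x - g x) < ennreal (e/16)"
  using L2_approx[OF mG fin, of "e/16"] e by auto
 have [measurable]: "g \<in> borel_measurable borel" by (rule borel_measurable_continuous_onI[OF g])
 define V where "V = measure lborel (cball (0::real^'d) (k+1))"
 have V: "emeasure lborel (cball (0::real^'d) (k+1)) = ennreal V" unfolding V_def
  using emeasure_lborel_cball_finite[of "0::real^'d" "k+1"] by (simp add: emeasure_eq_ennreal_measure)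
 have V0: "0 <= V" by (simp add: V_def)
 define \<eta> where "\<eta> = sqrt (e / (16 * (V + 1)))"
 have eta: "0 < \<eta>" "\<eta>^2 * V <= e/16" using e V0 by (auto simp: \<eta>_def field_simps)
 have "uniformly_continuous_on (cball 0 (k+2)) g"
  by (rule compact_uniformly_continuous[OF continuous_on_subset[OF g]]) auto
 then obtain d where d: "0 < d" and dd: "\<And>x y. x \<in> cball 0 (k+2) ==> y \<in> cball 0 (k+2) ==> dist y x < d ==> dist (g y) (g x) < \<eta>"
  using eta(1) unfolding uniformly_continuous_on_def by blast
 have "energy UNIV (\<lambda>x. G (x + q) - G x) <= ennreal e" if q: "norm q < min d 1" for q
 proof -
  have gq: "energy UNIV (\<lambda>x. g (x + q) - g x) <= ennreal (e/16)"
  proof -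
   have "energy UNIV (\<lambda>x. g (x + q) - g x) <= (\<integral>\<^sup>+x. ennreal (\<eta>^2) * indicator (cball (0::real^'d) (k+1)) x \<partial>lborel)"
    unfolding energy_def
   proof (rule nn_integral_mono)
    fix x
    show "nsq (g (x + q) - g x) * indicator UNIV x <= ennreal (\<eta>^2) * indicator (cball (0::real^'d) (k+1)) x"
    proof (cases "norm x <= k + 1")
     case True
     have "norm (x + q) <= k + 2" using norm_triangle_ineq[of x q] True q by simp
     hence "dist (g (x + q)) (g x) < \<eta>"
      by (intro dd) (use True q in \<open>simp_all add: dist_norm[of "x + q"]\<close>)
     hence "(norm (g (x + q) - g x))^2 <= \<eta>^2" by (intro power_mono) (auto simp: dist_norm)
     thus ?thesis using True by (simp add: ennreal_leI)
    next
     case False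
     have "norm x <= norm (x + q) + norm q" using norm_triangle_ineq4[of "x + q" q] by simp
     hence "k < norm (x + q)" using False q by simp
     thus ?thesis using g0[of "x + q"] g0[of x] False by simp
    qed
   qed
   also have "... = ennreal (\<eta>^2) * ennreal V" by (simp add: nn_integral_cmult_indicator V)
   also have "... <= ennreal (e/16)" using eta V0 by (simp add: ennreal_mult[symmetric] ennreal_leI)
   finally show ?thesis .
  qed
  have Gq: "energy UNIV (\<lambda>x. G (x + q) - g (x + q)) <= ennreal (e/16)"
   using energy_shift[of "\<lambda>x. G x - g x" q] ge by simp
  have gG: "energy UNIV (\<lambda>x. g x - G x) <= ennreal (e/16)"
   using ge by (simp add: energy_def norm_minus_commute)
  have "energy UNIV (\<lambda>x. G (x + q) - G x) <= 2 * energy UNIV (\<lambda>x. G (x + q) - g (x + q)) + 2 * energy UNIV (\<lambda>x. g (x + q) - G x)"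
   by (rule energy_diff_le) measurable
  also have "... <= 2 * ennreal (e/16) + 2 * (2 * ennreal (e/16) + 2 * ennreal (e/16))"
  proof (intro add_mono mult_left_mono Gq)
   have "energy UNIV (\<lambda>x. g (x + q) - G x) <= 2 * energy UNIV (\<lambda>x. g (x + q) - g x) + 2 * energy UNIV (\<lambda>x. g x - G x)"
    by (rule energy_diff_le) measurable
   also have "... <= 2 * ennreal (e/16) + 2 * ennreal (e/16)" by (intro add_mono mult_left_mono gq gG) auto
   finally show "energy UNIV (\<lambda>x. g (x + q) - G x) <= 2 * ennreal (e/16) + 2 * ennreal (e/16)" .
  qed auto
  also have "... <= ennreal e"
  proof -
   have "ennreal (2 * (e/16) + 2 * (2 * (e/16) + 2 * (e/16))) = 2 * ennreal (e/16) + 2 * (2 * ennreal (e/16) + 2 * ennreal (e/16))"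
    using e by (simp only: ennreal_reals)
   moreover have "ennreal (2 * (e/16) + 2 * (2 * (e/16) + 2 * (e/16))) <= ennreal e" using e by (intro ennreal_leI) simp
   ultimately show ?thesis by simp
  qed
  finally show ?thesis .
 qed
 thus ?thesis using d by (intro exI[of _ "min d 1"]) auto
qed

section \<open>Mollification of Sobolev functions\<close>

lemma set_integrable_of_square:
 fixes u :: "real^'d::finite => 'b::euclidean_space"
 assumes [measurable]: "u \<in> borel_measurable borel" and K: "compact K" and i: "set_integrable lborel K (\<lambda>x. (norm (u x))^2)"
 shows "set_integrable lborel K u"
proof -
 have [measurable]: "K \<in> sets borel" using K by (simp add: borel_closed compact_imp_closed)
 have "set_integrable lborel K (\<lambda>x. 1 + (norm (u x))^2)"
 proof (rule set_integral_add)
  show "set_integrable lborel K (\<lambda>x. 1::real)"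
   unfolding set_integrable_def by (rule borel_integrable_compact[OF K]) auto
 qed (rule i)
 thus ?thesis
 proof (rule set_integrable_bound)
  show "AE x in lborel. x \<in> K --> norm (u x) <= norm (1 + (norm (u x))^2)"
  proof (intro AE_I2 impI)
   fix x
   have "0 <= (norm (u x) - 1)^2" by simp
   hence *: "2 * norm (u x) <= 1 + (norm (u x))^2" by (simp add: power2_eq_square algebra_simps)
   have "0 <= norm (u x)" by simp
   with * show "norm (u x) <= norm (1 + (norm (u x))^2)" by (simp del: norm_ge_zero)
  qed
  show "set_borel_measurable lborel K u" unfolding set_borel_measurable_def by measurable
 qed
qed

lemma bump_eq_molli:
 fixes x p :: "real^'d::finite"
 assumes "0 < r"
 shows "bump r x p = (LINT y|lborel. bump r (0::real^'d) y) * molli r (x - p)"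
proof -
 have "(p - x) \<bullet> (p - x) = (x - p) \<bullet> (x - p)" by (simp add: inner_diff_left inner_diff_right)
 hence "bump r x p = bump r 0 (x - p)" by (simp add: bump_def)
 thus ?thesis using bump_integral_pos[OF assms, where 'd='d] by (simp add: molli_def)
qed

text \<open>The bump centred at \<open>x\<close> is a test function of the half-space once its ball
  lies inside, and the definition of the weak gradient then says that the gradient of the mollified
  \<open>u\<close> is the mollified \<open>Du\<close>. The threshold on the height keeps that ball
  at height at least \<open>h\<close>, and so in the compact set \<open>K\<close>, on which
  \<open>u\<close> is integrable.\<close>

lemma mollify_weak:
 fixes u :: "real^'d::finite => real^'m::finite" and Du :: "real^'d => real^'d^'m"
 assumes h: "0 < h" and H: "H1_loc (halfspace n a) u Du"
 shows "\<exists>w J. C1 w J \<and> (\<forall>x. 2 * h + h * norm n <= ht n a x --> dist x x0 + h <= B -->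
  (\<forall>\<beta> i. J x $ \<beta> $ i = (LINT p:halfspace n a|lborel. Du p $ \<beta> $ i * molli h (x - p))))"
proof -
 define K where "K = cball x0 B \<inter> {x. h <= ht n a x}"
 have cK: "compact K" unfolding K_def ht_def
  by (intro compact_Int_closed compact_cball closed_Collect_le continuous_intros)
 have KO: "K \<subseteq> halfspace n a" using h by (auto simp: K_def halfspace_ht)
 have mu[measurable]: "u \<in> borel_measurable borel" and mK[measurable]: "K \<in> sets borel"
  using H cK by (auto simp: H1_loc_def borel_closed compact_imp_closed)
 have "set_integrable lborel K (\<lambda>x. (norm (u x))^2)" using H cK KO unfolding H1_loc_def by blast
 hence iu: "set_integrable lborel K u" by (rule set_integrable_of_square[OF mu cK])
 \<comment> \<open>Cutting \<open>u\<close> off to the compact set \<open>K\<close> makes it an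
   admissible weight for \<open>C1s_param_integral\<close>; at the points in question the mollifier
   does not see the cut.\<close>
 define U where "U \<beta> p = indicat_real K p * u p $ \<beta>" for \<beta> p
 have iU: "integrable lborel (U \<beta>)" for \<beta>
 proof -
  have "integrable lborel (\<lambda>p. (indicat_real K p *\<^sub>R u p) $ \<beta>)"
   by (rule integrable_bounded_linear[OF bounded_linear_vec_nth iu[unfolded set_integrable_def]])
  thus ?thesis by (simp add: U_def[abs_def])
 qed
 have U0: "p \<notin> K ==> U \<beta> p = 0" for \<beta> p by (simp add: U_def)
 have "\<exists>g. C1s (molli h :: real^'d => real) g" by (rule smooth_class_C1s[OF molli_class]) blast
 then obtain gm where gm: "C1s (molli h :: real^'d => real) gm" ..
 have gd: "(molli h has_derivative (\<lambda>k. gm x \<bullet> k)) (at x)" for x using gm unfolding C1s_def by blast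
 have gm0: "gm x = 0" if "x \<notin> cball 0 h" for x
 proof -
  have "((\<lambda>y. 0) has_derivative (\<lambda>k. gm x \<bullet> k)) (at x)"
   by (rule has_derivative_transform_within_open[OF gd, of "- cball 0 h"]) (use that molli_eq_0[OF h] in auto)
  moreover have "((\<lambda>y. 0) has_derivative (\<lambda>k. 0)) (at x)" by simp
  ultimately have "(\<lambda>k. gm x \<bullet> k) = (\<lambda>k. 0)" by (rule has_derivative_unique)
  from fun_cong[OF this, of "gm x"] have "gm x \<bullet> gm x = 0" .
  thus ?thesis by simp
 qed
 have cg: "continuous_on S (\<lambda>p. gm (x - p))" for S x
  by (intro cont_comp[OF C1s_continuous_g[OF gm]] continuous_intros)
 have ig: "integrable lborel (\<lambda>p. U \<beta> p *\<^sub>R gm (x - p))" for \<beta> x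
  by (rule integrable_weight_continuous[OF cK iU U0 cg])
 define w where "w x = (\<chi> \<beta>. LINT p|lborel. U \<beta> p * molli h (x - p))" for x
 define J where "J x = (\<chi> \<beta>. LINT p|lborel. U \<beta> p *\<^sub>R gm (x - p))" for x
 have C: "C1 w J" unfolding C1_components
 proof
  fix \<beta>
  have "C1s (\<lambda>x. LINT p|lborel. U \<beta> p * molli h (x - p)) (\<lambda>x. LINT p|lborel. U \<beta> p *\<^sub>R gm (x - p))"
  proof (rule C1s_param_integral[OF cK iU U0])
   show "continuous_on (UNIV \<times> K) (\<lambda>(x, p). molli h (x - p))"
    unfolding case_prod_unfold by (intro cont_comp[OF C1s_continuous[OF gm]] continuous_intros)
   show "continuous_on (UNIV \<times> K) (\<lambda>(x, p). gm (x - p))"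
    unfolding case_prod_unfold by (intro cont_comp[OF C1s_continuous_g[OF gm]] continuous_intros)
   fix x p :: "real^'d"
   have 2: "((\<lambda>x. x - p) has_derivative (\<lambda>k. k)) (at x)" by (auto intro!: derivative_eq_intros)
   from has_derivative_compose[OF 2 gd] show "((\<lambda>x. molli h (x - p)) has_derivative (\<bullet>) (gm (x - p))) (at x)" .
  qed
  thus "C1s (\<lambda>x. w x $ \<beta>) (\<lambda>x. J x $ \<beta>)" by (simp add: w_def J_def)
 qed
 have "J x $ \<beta> $ i = (LINT p:halfspace n a|lborel. Du p $ \<beta> $ i * molli h (x - p))"
  if x: "2 * h + h * norm n <= ht n a x" "dist x x0 + h <= B" for x \<beta> i
 proof -
  let ?N = "LINT y|lborel. bump h (0::real^'d) y"
  have N: "?N > 0" by (rule bump_integral_pos[OF h])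
  have sub: "cball x h \<subseteq> K"
  proof
   fix p assume p: "p \<in> cball x h"
   have "dist p x0 <= dist x p + dist x x0" using dist_triangle[of p x0 x] by (simp add: dist_commute)
   hence "p \<in> cball x0 B" using p x(2) by (simp add: dist_commute)
   moreover have "\<bar>(p - x) \<bullet> n\<bar> <= h * norm n"
    using Cauchy_Schwarz_ineq2[of "p - x" n] p mult_right_mono[of "norm (p - x)" h "norm n"] by (simp add: dist_norm norm_minus_commute)
   hence "h <= ht n a p" using x(1) h by (simp add: ht_def inner_diff_left abs_le_iff)
   ultimately show "p \<in> K" by (simp add: K_def)
  qed
  have z: "gm (x - p) = 0" if "p \<notin> K" for p
  proof (rule gm0)
   have "p \<notin> cball x h" using sub that by blast
   thus "x - p \<notin> cball 0 h" by (simp add: dist_norm norm_minus_commute)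
  qed
  have t: "test_fun (halfspace n a) (bump h x)" by (rule bump_test_fun[OF h]) (use sub KO in blast)
  have Cb: "C1s (bump h x) (\<lambda>p. (- ?N) *\<^sub>R gm (x - p))"
   unfolding C1s_def
  proof (intro conjI allI)
   show "continuous_on UNIV (\<lambda>p. (- ?N) *\<^sub>R gm (x - p))" by (intro continuous_intros cg)
   fix p
   have "((\<lambda>p. x - p) has_derivative (\<lambda>k. - k)) (at p)" by (auto intro!: derivative_eq_intros)
   from has_derivative_compose[OF this gd] have "((\<lambda>p. molli h (x - p)) has_derivative (\<lambda>k. gm (x - p) \<bullet> (- k))) (at p)" .
   from has_derivative_mult_right[OF this, of ?N]
   show "(bump h x has_derivative (\<lambda>k. ((- ?N) *\<^sub>R gm (x - p)) \<bullet> k)) (at p)"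
    unfolding bump_eq_molli[OF h, of x, abs_def] by simp
  qed
  have pdb: "pd i (bump h x) p = - ?N * gm (x - p) $ i" for p using C1s_pd[OF Cb, of i p] by simp
  have "J x $ \<beta> $ i = (LINT p|lborel. U \<beta> p *\<^sub>R gm (x - p)) $ i" by (simp add: J_def)
  also have "... = (LINT p|lborel. (U \<beta> p *\<^sub>R gm (x - p)) $ i)"
   by (rule integral_bounded_linear[OF bounded_linear_vec_nth ig, symmetric])
  also have "... = (LINT p:halfspace n a|lborel. u p $ \<beta> * gm (x - p) $ i)"
   unfolding set_lebesgue_integral_def
  proof (rule Bochner_Integration.integral_cong[OF refl])
   fix p
   show "(U \<beta> p *\<^sub>R gm (x - p)) $ i = indicat_real (halfspace n a) p *\<^sub>R (u p $ \<beta> * gm (x - p) $ i)"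
    using KO z[of p] by (cases "p \<in> K") (auto simp: U_def)
  qed
  finally have 1: "J x $ \<beta> $ i = (LINT p:halfspace n a|lborel. u p $ \<beta> * gm (x - p) $ i)" .
  have "(LINT p:halfspace n a|lborel. u p $ \<beta> * pd i (bump h x) p) = - (LINT p:halfspace n a|lborel. Du p $ \<beta> $ i * bump h x p)"
   using H t unfolding H1_loc_def by blast
  moreover have "(LINT p:halfspace n a|lborel. u p $ \<beta> * pd i (bump h x) p) = (LINT p:halfspace n a|lborel. (- ?N) * (u p $ \<beta> * gm (x - p) $ i))"
   unfolding pdb by (simp add: mult_ac)
  moreover have "(LINT p:halfspace n a|lborel. Du p $ \<beta> $ i * bump h x p) = (LINT p:halfspace n a|lborel. ?N * (Du p $ \<beta> $ i * molli h (x - p)))"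
   unfolding bump_eq_molli[OF h, of x] by (simp add: mult_ac)
  ultimately have "?N * (LINT p:halfspace n a|lborel. u p $ \<beta> * gm (x - p) $ i) = ?N * (LINT p:halfspace n a|lborel. Du p $ \<beta> $ i * molli h (x - p))"
   by (simp only: set_integral_mult_right)
  thus ?thesis using N 1 by simp
 qed
 thus ?thesis using C by (intro exI[of _ w] exI[of _ J]) auto
qed

lemma mollifier_integrable:
 fixes G :: "real^'d::finite => 'b::euclidean_space"
 assumes h: "0 < h" and mG[measurable]: "G \<in> borel_measurable borel" and i: "integrable lborel G"
 shows "integrable lborel (\<lambda>q. molli h q *\<^sub>R G (y - q))"
proof -
 have mm[measurable]: "molli h \<in> borel_measurable borel" by (rule borel_measurable_continuous_onI[OF molli_continuous[OF h]])
 have "bounded (molli h ` cball (0::real^'d) h)"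
  by (rule compact_imp_bounded[OF compact_continuous_image[OF molli_continuous[OF h] compact_cball]])
 then obtain b where b: "\<forall>x\<in>molli h ` cball (0::real^'d) h. norm x <= b" unfolding bounded_iff ..
 have b': "\<bar>molli h x\<bar> <= \<bar>b\<bar>" for x :: "real^'d"
 proof (cases "x \<in> cball 0 h")
  case True
  hence "norm (molli h x) <= b" using b by blast
  thus ?thesis by simp
 qed (simp add: molli_eq_0[OF h])
 have iG: "integrable lborel (\<lambda>q. G (y - q))"
 proof -
  have "integrable (distr lborel borel (\<lambda>q. y - q)) G"
   using i lborel_affine[of "-1" y] by (simp add: density_1)
  thus ?thesis by (subst (asm) integrable_distr_eq) auto
 qed
 show ?thesis
 proof (rule Bochner_Integration.integrable_bound)
  show "integrable lborel (\<lambda>q. \<bar>b\<bar> *\<^sub>R G (y - q))" by (intro integrable_scaleR_right iG)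
  show "AE q in lborel. norm (molli h q *\<^sub>R G (y - q)) <= norm (\<bar>b\<bar> *\<^sub>R G (y - q))"
   by (intro AE_I2) (simp add: mult_right_mono b')
 qed measurable
qed

text \<open>Jensen's inequality for the probability density \<open>molli h\<close>, obtained from
  Cauchy-Schwarz by splitting the density into two square roots. The constant \<open>c\<close> will
  be a value of \<open>G\<close>, which makes the left-hand side the error of the
  mollification.\<close>

lemma mollifier_jensen:
 fixes G :: "real^'d::finite => 'b::euclidean_space"
 assumes h: "0 < h" and mG[measurable]: "G \<in> borel_measurable borel" and i: "integrable lborel G"
 shows "nsq ((LINT q|lborel. molli h q *\<^sub>R G (y - q)) - c) <= (\<integral>\<^sup>+q. ennreal (molli h q) * nsq (G (y - q) - c) \<partial>lborel)"
proof -
 have mm[measurable]: "molli h \<in> borel_measurable borel" by (rule borel_measurable_continuous_onI[OF molli_continuous[OF h]])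
 have i1: "integrable lborel (\<lambda>q. molli h q *\<^sub>R G (y - q))" by (rule mollifier_integrable[OF h mG i])
 have i2: "integrable lborel (\<lambda>q. molli h (q::real^'d) *\<^sub>R c)" by (intro integrable_scaleR_left molli_integrable h)
 have "(LINT q|lborel. molli h q *\<^sub>R G (y - q)) - c = (LINT q|lborel. molli h q *\<^sub>R G (y - q)) - (LINT q|(lborel::(real^'d) measure). molli h q *\<^sub>R c)"
  by (simp add: molli_integral[OF h] molli_integrable[OF h])
 also have "... = (LINT q|lborel. molli h q *\<^sub>R G (y - q) - molli h q *\<^sub>R c)" by (rule Bochner_Integration.integral_diff[OF i1 i2, symmetric])
 also have "... = (LINT q|lborel. molli h q *\<^sub>R (G (y - q) - c))" by (simp add: scaleR_diff_right)
 finally have e: "(LINT q|lborel. molli h q *\<^sub>R G (y - q)) - c = (LINT q|lborel. molli h q *\<^sub>R (G (y - q) - c))" .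
 have i3: "integrable lborel (\<lambda>q. molli h q *\<^sub>R (G (y - q) - c))"
  using Bochner_Integration.integrable_diff[OF i1 i2] by (simp add: scaleR_diff_right)
 have "ennreal (norm (LINT q|lborel. molli h q *\<^sub>R (G (y - q) - c))) <= (\<integral>\<^sup>+q. ennreal (norm (molli h q *\<^sub>R (G (y - q) - c))) \<partial>lborel)"
  by (rule integral_norm_bound_ennreal[OF i3])
 also have "... = (\<integral>\<^sup>+q. ennreal (sqrt (molli h q)) * ennreal (sqrt (molli h q) * norm (G (y - q) - c)) \<partial>lborel)"
  by (intro nn_integral_cong) (simp add: molli_nonneg[OF h] ennreal_mult[symmetric] mult.assoc[symmetric])
 finally have "(ennreal (norm (LINT q|lborel. molli h q *\<^sub>R (G (y - q) - c))))^2
  <= (\<integral>\<^sup>+q. ennreal (sqrt (molli h q)) * ennreal (sqrt (molli h q) * norm (G (y - q) - c)) \<partial>lborel)^2" by (rule power_mono) simp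
 also have "... <= (\<integral>\<^sup>+q. (ennreal (sqrt (molli h (q::real^'d))))^2 \<partial>lborel) * (\<integral>\<^sup>+q. (ennreal (sqrt (molli h q) * norm (G (y - q) - c)))^2 \<partial>lborel)"
  by (rule Cauchy_Schwarz_nn_integral) measurable
 also have "(\<integral>\<^sup>+q. (ennreal (sqrt (molli h (q::real^'d))))^2 \<partial>lborel) = (\<integral>\<^sup>+q. ennreal (molli h (q::real^'d)) \<partial>lborel)"
  by (intro nn_integral_cong) (simp add: molli_nonneg[OF h] ennreal_power)
 also have "... = 1"
  using nn_integral_eq_integral[OF molli_integrable[OF h, where 'd='d]] by (simp add: molli_nonneg[OF h] molli_integral[OF h])
 also have "(\<integral>\<^sup>+q. (ennreal (sqrt (molli h q) * norm (G (y - q) - c)))^2 \<partial>lborel) = (\<integral>\<^sup>+q. ennreal (molli h q) * nsq (G (y - q) - c) \<partial>lborel)"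
  by (intro nn_integral_cong) (simp add: molli_nonneg[OF h] ennreal_power power_mult_distrib ennreal_mult)
 finally show ?thesis unfolding e by (simp add: ennreal_power)
qed

text \<open>A mollification near the boundary would see points outside the half-space. Evaluating it
  at \<open>x - (3 * h) *\<^sub>R n\<close>, which lies higher by \<open>3 * h\<close>, avoids this
  up to the boundary itself. The error is then an average of translations by at most
  \<open>4 * h\<close>, small by \<open>L2_translation\<close>.\<close>

lemma approx_interior:
 fixes u :: "real^'d::finite => real^'m::finite" and Du :: "real^'d => real^'d^'m"
 assumes n: "norm n = 1" and H: "H1_loc (halfspace n a) u Du" and L: "L2_loc_upto (halfspace n a) Du" and e: "0 < e"
 shows "\<exists>w J. C1 w J \<and> energy (halfspace n a \<inter> ball x0 B) (\<lambda>x. J x - Du x) <= ennreal e"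
proof -
 let ?\<Omega> = "halfspace n a" and ?K = "halfspace n a \<inter> cball x0 (B + 5)"
 have [measurable]: "?\<Omega> \<in> sets borel" unfolding halfspace_ht by measurable
 have [measurable]: "Du \<in> borel_measurable borel" using L by (simp add: L2_loc_upto_def)
 have [measurable]: "cball x0 (B+5) \<in> sets borel" "ball x0 B \<in> sets borel" by auto
 \<comment> \<open>The gradient extended by zero. The margin 5 suffices because the shift by
   \<open>3 * h\<close> and the mollification of radius \<open>h\<close> together reach at most 4
   beyond radius \<open>B\<close>.\<close>
 define G where "G x = indicat_real ?K x *\<^sub>R Du x" for x
 have mG[measurable]: "G \<in> borel_measurable borel" unfolding G_def[abs_def] by measurable
 have iG: "integrable lborel G"
 proof -
  have s: "set_integrable lborel ?K (\<lambda>x. norm (Du x))" by (rule L2_loc_norm_integrable[OF L]) measurable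
  show ?thesis
  proof (rule Bochner_Integration.integrable_bound[OF s[unfolded set_integrable_def]])
   show "AE x in lborel. norm (G x) <= norm (indicat_real ?K x *\<^sub>R norm (Du x))" by (intro AE_I2) (simp add: G_def)
  qed measurable
 qed
 have fG: "energy UNIV G < top"
 proof -
  have "set_integrable lborel ?K (\<lambda>x. (norm (Du x))^2)" using L compact_cball unfolding L2_loc_upto_def by blast
  hence "integrable lborel (\<lambda>x. (norm (G x))^2)" unfolding set_integrable_def
   by (rule Bochner_Integration.integrable_cong[THEN iffD1, rotated 2]) (auto simp: G_def power_mult_distrib split: split_indicator)
  thus ?thesis unfolding energy_def integrable_iff_bounded by simp
 qed
 obtain d where d: "0 < d" and tr: "\<And>q. norm q < d ==> energy UNIV (\<lambda>x. G (x + q) - G x) <= ennreal e"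
  using L2_translation[OF mG fG e] by blast
 define h where "h = min (d/5) 1"
 have h: "0 < h" "h <= 1" "4 * h < d" using d by (auto simp: h_def)
 have mm[measurable]: "(molli h :: real^'d => real) \<in> borel_measurable borel" by (rule borel_measurable_continuous_onI[OF molli_continuous[OF h(1)]])
 obtain w J where C: "C1 w J" and J: "\<forall>x. 2 * h + h * norm n <= ht n a x --> dist x x0 + h <= B + 4 -->
  (\<forall>\<beta> i. J x $ \<beta> $ i = (LINT p:?\<Omega>|lborel. Du p $ \<beta> $ i * molli h (x - p)))"
  using mollify_weak[OF h(1) H, of x0 "B + 4"] by blast
 let ?z = "- ((3 * h) *\<^sub>R n)"
 have nz: "norm ?z = 3 * h" using n h by simp
 have Cz: "C1 (\<lambda>x. w (x + ?z)) (\<lambda>x. J (x + ?z))" by (rule C1_shift[OF C])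
 have Jx: "J (x + ?z) = (LINT q|lborel. molli h q *\<^sub>R G (x + ?z - q))" if x: "x \<in> ?\<Omega> \<inter> ball x0 B" for x
 proof -
  let ?y = "x + ?z"
  have dy: "dist ?y x0 <= B + 3 * h" using dist_shift_le[of x ?z x0] x nz by (simp add: dist_commute)
  have "n \<bullet> n = 1" using n by (simp add: norm_eq_1)
  hence hy: "2 * h + h * norm n <= ht n a ?y" using x n h by (simp add: halfspace_ht ht_def inner_diff_left algebra_simps)
  have Jy: "J ?y $ \<beta> $ i = (LINT p:?\<Omega>|lborel. Du p $ \<beta> $ i * molli h (?y - p))" for \<beta> i
   using J hy dy h by simp
  have "J ?y $ \<beta> $ i = (LINT q|lborel. molli h q *\<^sub>R G (?y - q)) $ \<beta> $ i" for \<beta> i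
  proof -
   have bl: "bounded_linear (\<lambda>X::real^'d^'m. X $ \<beta> $ i)"
    using bounded_linear_compose[OF bounded_linear_vec_nth bounded_linear_vec_nth] .
   let ?f = "\<lambda>p. molli h (?y - p) * G p $ \<beta> $ i"
   have mf: "?f \<in> borel_measurable borel" by measurable
   have "(LINT q|lborel. molli h q *\<^sub>R G (?y - q)) $ \<beta> $ i = (LINT q|lborel. (molli h q *\<^sub>R G (?y - q)) $ \<beta> $ i)"
    by (rule integral_bounded_linear[OF bl mollifier_integrable[OF h(1) mG iG], symmetric])
   also have "... = (LINT q|lborel. ?f (?y - q))" by simp
   also have "... = (LINT p|lborel. ?f p)" by (rule integral_reflect[OF mf])
   also have "... = (LINT p:?\<Omega>|lborel. Du p $ \<beta> $ i * molli h (?y - p))" unfolding set_lebesgue_integral_def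
   proof (rule Bochner_Integration.integral_cong[OF refl])
    fix p
    show "?f p = indicat_real ?\<Omega> p *\<^sub>R (Du p $ \<beta> $ i * molli h (?y - p))"
    proof (cases "dist ?y p <= h")
     case True
     have "dist x0 p <= dist x0 ?y + dist ?y p" by (rule dist_triangle)
     hence "dist x0 p <= B + 5" using True dy h by (simp add: dist_commute)
     thus ?thesis by (simp add: G_def indicator_def)
    next
     case False
     hence "molli h (?y - p) = 0" by (intro molli_eq_0[OF h(1)]) (simp add: dist_norm norm_minus_commute)
     thus ?thesis by simp
    qed
   qed
   finally show ?thesis using Jy by simp
  qed
  thus ?thesis by (simp add: vec_eq_iff)
 qed
 have mI: "(\<lambda>(x,q). ennreal (molli h q) * nsq (G (x + ?z - q) - G x)) \<in> borel_measurable (borel \<Otimes>\<^sub>M borel)" by measurable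
 have "energy (?\<Omega> \<inter> ball x0 B) (\<lambda>x. J (x + ?z) - Du x) <= (\<integral>\<^sup>+x. (\<integral>\<^sup>+q. ennreal (molli h q) * nsq (G (x + ?z - q) - G x) \<partial>lborel) \<partial>lborel)"
  unfolding energy_def
 proof (rule nn_integral_mono)
  fix x
  show "nsq (J (x + ?z) - Du x) * indicator (?\<Omega> \<inter> ball x0 B) x <= (\<integral>\<^sup>+q. ennreal (molli h q) * nsq (G (x + ?z - q) - G x) \<partial>lborel)"
  proof (cases "x \<in> ?\<Omega> \<inter> ball x0 B")
   case True
   hence "G x = Du x" by (simp add: G_def)
   thus ?thesis using mollifier_jensen[OF h(1) mG iG, of "x + ?z" "G x"] True unfolding Jx[OF True] by simp
  qed simp
 qed
 also have "... = (\<integral>\<^sup>+q. (\<integral>\<^sup>+x. ennreal (molli h q) * nsq (G (x + ?z - q) - G x) \<partial>lborel) \<partial>lborel)"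
  by (rule nn_swap[OF mI])
 also have "... <= (\<integral>\<^sup>+q. ennreal (molli h (q::real^'d)) * ennreal e \<partial>lborel)"
 proof (rule nn_integral_mono)
  fix q :: "real^'d"
  have m: "(\<lambda>x. nsq (G (x + ?z - q) - G x)) \<in> borel_measurable lborel" by measurable
  show "(\<integral>\<^sup>+x. ennreal (molli h q) * nsq (G (x + ?z - q) - G x) \<partial>lborel) <= ennreal (molli h q) * ennreal e"
  proof (cases "norm q <= h")
   case True
   have "norm (?z - q) <= 3 * h + h" using norm_triangle_ineq4[of ?z q] nz True by linarith
   hence "norm (?z - q) < d" using h by linarith
   hence "energy UNIV (\<lambda>x. G (x + (?z - q)) - G x) <= ennreal e" by (rule tr)
   hence "(\<integral>\<^sup>+x. nsq (G (x + ?z - q) - G x) \<partial>lborel) <= ennreal e" by (simp only: energy_def add_diff_eq indicator_UNIV mult_1_right)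
   thus ?thesis unfolding nn_integral_cmult[OF m] by (rule mult_left_mono) simp
  next
   case False
   hence "molli h q = 0" by (intro molli_eq_0[OF h(1)]) simp
   thus ?thesis by simp
  qed
 qed
 also have "... = ennreal e * (\<integral>\<^sup>+q. ennreal (molli h (q::real^'d)) \<partial>lborel)"
  unfolding mult.commute[of _ "ennreal e"] by (rule nn_integral_cmult) measurable
 also have "... = ennreal e"
  using nn_integral_eq_integral[OF molli_integrable[OF h(1), where 'd='d]] by (simp add: molli_nonneg[OF h(1)] molli_integral[OF h(1)])
 finally show ?thesis using Cz by blast
qed

section \<open>Reflection in the boundary\<close>

definition refl :: "real^'d::finite => real => real^'d => real^'d" where
 "refl n a x = x + (2 * ht n a x) *\<^sub>R n"

text \<open>Relative to a boundary point \<open>x0\<close> the reflection is linear: translation by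
  \<open>x0\<close> conjugates it to a linear isometric involution.\<close>

lemma nn_integral_refl:
 fixes f :: "real^'d::finite => ennreal"
 assumes n: "norm n = 1" and x0: "ht n a x0 = 0" and mf[measurable]: "f \<in> borel_measurable borel"
 shows "(\<integral>\<^sup>+x. f (refl n a x) \<partial>lborel) = (\<integral>\<^sup>+x. f x \<partial>lborel)"
proof -
 define L where "L y = y - (2 * (y \<bullet> n)) *\<^sub>R n" for y :: "real^'d"
 have nn: "n \<bullet> n = 1" using n by (simp add: norm_eq_1)
 have lin: "linear L" unfolding L_def by (rule linearI) (auto simp: algebra_simps inner_add_left)
 have inv: "L (L y) = y" for y using nn by (simp add: L_def inner_diff_left algebra_simps)
 have "L y \<bullet> L y = y \<bullet> y" for y using nn by (simp add: L_def inner_diff_left inner_diff_right inner_commute[of n y])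
 hence iso: "norm (L y) = norm y" for y by (simp add: norm_eq_sqrt_inner)
 have Lm[measurable]: "L \<in> borel_measurable borel" unfolding L_def[abs_def] by measurable
 have r: "refl n a x = L (x + (- x0)) + x0" for x
  using x0 by (simp add: refl_def L_def ht_def inner_diff_left algebra_simps)
 have m1: "(\<lambda>x. f (L x + x0)) \<in> borel_measurable borel" by measurable
 have m2: "(\<lambda>x. f (x + x0)) \<in> borel_measurable borel" by measurable
 have "(\<integral>\<^sup>+x. f (refl n a x) \<partial>lborel) = (\<integral>\<^sup>+x. f (L x + x0) \<partial>lborel)" unfolding r by (rule nn_integral_shift[OF m1])
 also have "... = (\<integral>\<^sup>+x. f (x + x0) \<partial>lborel)" by (rule nn_integral_isometric_involution[OF m2 lin inv iso])
 also have "... = (\<integral>\<^sup>+x. f x \<partial>lborel)" by (rule nn_integral_shift[OF mf])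
 finally show ?thesis .
qed

text \<open>Off the boundary hyperplane, which is a null set, each point of the two-sided slab
  either lies in the one-sided slab or is reflected into it. The reflection preserves Lebesgue
  measure and the distance to the boundary point \<open>x0\<close>.\<close>

lemma energy_sslab_even:
 fixes J :: "real^'d::finite => 'b::euclidean_space"
 assumes n: "norm n = 1" and x0: "ht n a x0 = 0" and mJ[measurable]: "J \<in> borel_measurable borel"
  and ev: "\<And>x. norm (J (refl n a x)) = norm (J x)"
 shows "energy (sslab n a x0 r T) J <= ennreal 2 * energy (slab n a x0 r T) J"
proof -
 have nn: "n \<bullet> n = 1" using n by (simp add: norm_eq_1)
 let ?f = "\<lambda>x. nsq (J x) * indicator (slab n a x0 r T) x"
 have mf[measurable]: "?f \<in> borel_measurable borel" by measurable
 have mr[measurable]: "refl n a \<in> borel_measurable borel" unfolding refl_def[abs_def] by measurable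
 have hr: "ht n a (refl n a x) = - ht n a x" for x using nn by (simp add: refl_def ht_def inner_add_left)
 have dr: "dist (refl n a x) x0 = dist x x0" for x
 proof -
  have e: "ht n a x = - ((x - x0) \<bullet> n)" using x0 by (simp add: ht_def inner_diff_left)
  have "(refl n a x - x0) \<bullet> (refl n a x - x0) = (x - x0) \<bullet> (x - x0) + 4 * (ht n a x * ((x - x0) \<bullet> n)) + 4 * (ht n a x * ht n a x)"
   using nn by (simp add: refl_def inner_add_left inner_add_right inner_diff_left inner_diff_right inner_commute algebra_simps)
  also have "... = (x - x0) \<bullet> (x - x0)" unfolding e by simp
  finally show ?thesis by (simp add: dist_norm norm_eq_sqrt_inner)
 qed
 have "negligible {x. n \<bullet> x = - a}" by (rule negligible_hyperplane) (use n in auto)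
 hence "{x. n \<bullet> x = - a} \<in> null_sets lebesgue" by (simp add: negligible_iff_null_sets)
 hence "AE x in lebesgue. x \<notin> {x. n \<bullet> x = - a}" by (rule AE_not_in)
 hence ae: "AE x in lborel. ht n a x \<noteq> 0" by (simp add: AE_completion_iff ht_def inner_commute[of n] diff_eq_eq eq_commute[of "- a"])
 have "energy (sslab n a x0 r T) J <= (\<integral>\<^sup>+x. ?f x + ?f (refl n a x) \<partial>lborel)" unfolding energy_def
 proof (rule nn_integral_mono_AE)
  show "AE x in lborel. nsq (J x) * indicator (sslab n a x0 r T) x <= ?f x + ?f (refl n a x)"
   using ae
  proof eventually_elim
   case (elim x)
   show ?case
   proof (cases "x \<in> sslab n a x0 r T")
    case True
    hence "x \<in> slab n a x0 r T \<or> refl n a x \<in> slab n a x0 r T" using elim by (auto simp: sslab_def slab_def hr dr)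
    thus ?thesis using True by (auto simp: ev add_increasing add_increasing2)
   qed simp
  qed
 qed
 also have "... = (\<integral>\<^sup>+x. ?f x \<partial>lborel) + (\<integral>\<^sup>+x. ?f (refl n a x) \<partial>lborel)"
 proof (rule nn_integral_add)
  show "?f \<in> borel_measurable lborel" by measurable
  have "(\<lambda>x. ?f (refl n a x)) \<in> borel_measurable borel" by (rule measurable_compose[OF mr mf])
  thus "(\<lambda>x. ?f (refl n a x)) \<in> borel_measurable lborel" by simp
 qed
 also have "(\<integral>\<^sup>+x. ?f (refl n a x) \<partial>lborel) = (\<integral>\<^sup>+x. ?f x \<partial>lborel)" by (rule nn_integral_refl[OF n x0 mf])
 finally show ?thesis by (simp add: energy_def mult_2)
qed

text \<open>For \<open>k = c - 1\<close> the coefficient \<open>2 * k + k^2\<close> is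
  \<open>c^2 - 1\<close>: multiplying the normal column by \<open>c\<close> changes the norm only
  through \<open>c^2\<close>, so the sign of \<open>c\<close> does not matter. This gives the
  evenness in \<open>approx_even\<close>.\<close>

lemma norm_add_outer:
 fixes X :: "real^'d::finite^'m::finite"
 assumes "norm n = 1"
 shows "(norm (X + k *\<^sub>R outer (X *v n) n))^2 = (norm X)^2 + (2 * k + k^2) * (norm (X *v n))^2"
proof -
 have "X \<bullet> outer (X *v n) n = (norm (X *v n))^2"
  by (simp add: outer_def inner_vec_def[of X] inner_vec_def[of "X *v n"] power2_norm_eq_inner matrix_vector_mul_component inner_commute)
 moreover have "outer (X *v n) n \<bullet> outer (X *v n) n = (norm (X *v n))^2"
  using assms by (simp add: power2_norm_eq_inner[symmetric])
 moreover have "(norm (X + k *\<^sub>R outer (X *v n) n))^2 = X \<bullet> X + 2 * k * (X \<bullet> outer (X *v n) n) + k^2 * (outer (X *v n) n \<bullet> outer (X *v n) n)"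
  unfolding power2_norm_eq_inner by (simp add: inner_add_left inner_add_right inner_commute power2_eq_square)
 ultimately show ?thesis by (simp add: power2_norm_eq_inner algebra_simps)
qed

text \<open>The approximation is \<open>w\<close> composed with the map that changes the height t to \<open>sqrt (t^2 + s^2)\<close>.\<close>
lemma approx_even:
 fixes w :: "real^'d::finite => real^'m::finite"
 assumes n: "norm n = 1" and x0: "ht n a x0 = 0" and C: "C1 w J" and e: "0 < e"
 shows "\<exists>v I. C1 v I \<and> (\<forall>r T. energy (sslab n a x0 r T) I <= ennreal 2 * energy (slab n a x0 r T) I)
  \<and> energy (halfspace n a \<inter> ball x0 B) (\<lambda>x. I x - J x) <= ennreal e"
proof -
 let ?\<Omega> = "halfspace n a \<inter> ball x0 B"
 have nn: "n \<bullet> n = 1" using n by (simp add: norm_eq_1)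
 have mb[measurable]: "ball x0 B \<in> sets borel" by simp
 have mh[measurable]: "halfspace n a \<in> sets borel" unfolding halfspace_ht by measurable
 have cJ: "continuous_on UNIV J" by (rule C1_continuous_J[OF C])
 have [measurable]: "J \<in> borel_measurable borel" by (rule borel_measurable_continuous_onI[OF cJ])
 \<comment> \<open>The absolute value of the height is even but has a kink on the boundary;
   \<open>rt s\<close> is even and differentiable for \<open>s > 0\<close>, and it tends to the
   height inside the half-space as \<open>s\<close> tends to 0.\<close>
 define rt where "rt s x = sqrt ((ht n a x)^2 + s^2)" for s x
 define P where "P s x = x - (rt s x - ht n a x) *\<^sub>R n" for s x
 \<comment> \<open>The derivative of \<open>rt\<close> with respect to the height; by the chain rule
   it multiplies the normal column of the Jacobian.\<close>
 define c where "c s x = ht n a x / rt s x" for s x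
 define I where "I s x = J (P s x) + (c s x - 1) *\<^sub>R outer (J (P s x) *v n) n" for s x
 have rt0: "0 < rt s x" if "0 < s" for s x using that by (simp add: rt_def add_nonneg_pos)
 have ch: "continuous_on UNIV (ht n a)" unfolding ht_def[abs_def] by (intro continuous_intros)
 have crt: "continuous_on UNIV (rt s)" for s unfolding rt_def[abs_def] by (intro continuous_intros ch)
 have cP: "continuous_on UNIV (P s)" for s unfolding P_def[abs_def] by (intro continuous_intros ch crt)
 have cc: "continuous_on UNIV (c s)" if "0 < s" for s
  unfolding c_def[abs_def] by (intro continuous_intros ch crt) (use rt0[OF that] in \<open>simp add: less_imp_neq[symmetric]\<close>)
 have cI: "continuous_on UNIV (I s)" if "0 < s" for s
  unfolding I_def[abs_def] by (intro continuous_intros cc[OF that] cont_comp[OF cJ cP])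
 have CI: "C1 (\<lambda>x. w (P s x)) (I s)" if s: "0 < s" for s
  unfolding C1_def
 proof (intro conjI allI cI[OF s])
  fix x
  have dh: "(ht n a has_derivative (\<lambda>k. - (k \<bullet> n))) (at x)"
   unfolding ht_def[abs_def] by (auto intro!: derivative_eq_intros)
  have drt: "(rt s has_derivative (\<lambda>k. - (c s x * (k \<bullet> n)))) (at x)"
  proof -
   have 1: "((\<lambda>x. (ht n a x)^2 + s^2) has_derivative (\<lambda>k. 2 * ht n a x * (- (k \<bullet> n)))) (at x)"
    using dh by (auto intro!: derivative_eq_intros)
   have p: "0 < (ht n a x)^2 + s^2" using s by (simp add: add_nonneg_pos)
   have sq: "(sqrt has_derivative (\<lambda>k. k * (inverse (sqrt ((ht n a x)^2 + s^2)) / 2))) (at ((ht n a x)^2 + s^2))"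
    using DERIV_real_sqrt[OF p] unfolding has_field_derivative_def by (rule has_derivative_eq_rhs) (simp add: fun_eq_iff)
   have "((\<lambda>x. sqrt ((ht n a x)^2 + s^2)) has_derivative (\<lambda>k. 2 * ht n a x * - (k \<bullet> n) * (inverse (sqrt ((ht n a x)^2 + s^2)) / 2))) (at x)"
    by (rule has_derivative_compose[OF 1, of sqrt, OF sq])
   hence "(rt s has_derivative (\<lambda>k. 2 * ht n a x * - (k \<bullet> n) * (inverse (sqrt ((ht n a x)^2 + s^2)) / 2))) (at x)"
    unfolding rt_def[abs_def] .
   moreover have "2 * ht n a x * - (k \<bullet> n) * (inverse (sqrt ((ht n a x)^2 + s^2)) / 2) = - (c s x * (k \<bullet> n))" for k
   proof -
    have "2 * t * - y * (z / 2) = - (t * z * y)" for t y z :: real by simp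
    thus ?thesis unfolding c_def rt_def divide_inverse .
   qed
   ultimately show ?thesis by (simp only:)
  qed
  have "(P s has_derivative (\<lambda>k. k - (- (c s x * (k \<bullet> n)) - - (k \<bullet> n)) *\<^sub>R n)) (at x)"
   unfolding P_def[abs_def] by (rule has_derivative_diff[OF has_derivative_ident has_derivative_scaleR_left[OF has_derivative_diff[OF drt dh]]])
  moreover have "(w has_derivative (\<lambda>h. J (P s x) *v h)) (at (P s x))" using C unfolding C1_def by blast
  ultimately have "((\<lambda>x. w (P s x)) has_derivative (\<lambda>k. J (P s x) *v (k - (- (c s x * (k \<bullet> n)) - - (k \<bullet> n)) *\<^sub>R n))) (at x)"
   by (rule has_derivative_compose[where f="P s" and g=w])
  moreover have "J (P s x) *v (k - (- (c s x * (k \<bullet> n)) - - (k \<bullet> n)) *\<^sub>R n) = I s x *v k" for k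
  proof -
   have e: "k - (- (c s x * (k \<bullet> n)) - - (k \<bullet> n)) *\<^sub>R n = k + ((c s x - 1) * (n \<bullet> k)) *\<^sub>R n" by (simp add: algebra_simps inner_commute)
   show ?thesis unfolding I_def e
    by (simp add: matrix_vector_right_distrib matrix_vector_mult_add_rdistrib matrix_vector_mult_scaleR scaleR_matrix_vector_assoc[symmetric] outer_mult_vec)
  qed
  ultimately show "((\<lambda>x. w (P s x)) has_derivative (*v) (I s x)) (at x)" by simp
 qed
 have hr: "ht n a (refl n a x) = - ht n a x" for x using nn by (simp add: refl_def ht_def inner_add_left)
 have Pr: "P s (refl n a x) = P s x" for s x
  by (simp add: P_def rt_def hr) (simp add: refl_def algebra_simps scaleR_2[symmetric])
 have ev: "norm (I s (refl n a x)) = norm (I s x)" for s x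
 proof -
  have cr: "c s (refl n a x) = - c s x" by (simp add: c_def rt_def hr)
  have "(norm (I s (refl n a x)))^2 = (norm (I s x))^2"
   unfolding I_def norm_add_outer[OF n] Pr cr by (simp add: power2_eq_square algebra_simps)
  thus ?thesis by (simp add: power2_eq_iff_nonneg)
 qed
 have sym: "energy (sslab n a x0 r T) (I s) <= ennreal 2 * energy (slab n a x0 r T) (I s)" if "0 < s" for r T s
  by (rule energy_sslab_even[OF n x0 borel_measurable_continuous_onI[OF cI[OF that]] ev])
 define sk where "sk k = inverse (real (Suc k))" for k
 have sk: "0 < sk k" "sk k <= 1" for k by (auto simp: sk_def inverse_le_1_iff)
 have skl: "sk \<longlonglongrightarrow> 0" unfolding sk_def[abs_def] by (rule LIMSEQ_inverse_real_of_nat)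
 have [measurable]: "I (sk k) \<in> borel_measurable borel" for k by (rule borel_measurable_continuous_onI[OF cI[OF sk(1)]])
 have "bounded (J ` cball x0 (B+1))" by (intro compact_imp_bounded compact_continuous_image continuous_on_subset[OF cJ]) auto
 then obtain b where b: "\<forall>y\<in>J ` cball x0 (B+1). norm y <= b" unfolding bounded_iff ..
 \<comment> \<open>Dominated convergence inside the half-space, where \<open>rt\<close> tends to
   \<open>ht\<close> and \<open>c\<close> to 1. The bound \<open>3 * b\<close> adds the three terms
   of \<open>I - J\<close>; \<open>P\<close> moves a point by at most 1, hence the radius
   \<open>B+1\<close> in the choice of \<open>b\<close>.\<close>
 have "(\<lambda>k. \<integral>\<^sup>+x. nsq (I (sk k) x - J x) * indicator ?\<Omega> x \<partial>lborel) \<longlonglongrightarrow> (\<integral>\<^sup>+x. 0 \<partial>(lborel :: (real^'d) measure))"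
 proof (rule nn_integral_dominated_convergence[where w="\<lambda>x. ennreal ((3 * b)^2) * indicator (ball x0 B) x"])
  show "AE x in lborel. nsq (I (sk k) x - J x) * indicator ?\<Omega> x <= ennreal ((3 * b)^2) * indicator (ball x0 B) x" for k
  proof (intro AE_I2)
   fix x
   show "nsq (I (sk k) x - J x) * indicator ?\<Omega> x <= ennreal ((3 * b)^2) * indicator (ball x0 B) x"
   proof (cases "x \<in> ?\<Omega>")
    case True
    have t: "0 < ht n a x" using True by (simp add: halfspace_ht)
    have r1: "ht n a x <= rt (sk k) x" unfolding rt_def by (rule real_le_rsqrt) simp
    have r2: "rt (sk k) x <= ht n a x + sk k" unfolding rt_def
     by (rule real_le_lsqrt) (use t sk[of k] in \<open>auto simp: power2_sum\<close>)
    have c1: "0 <= c (sk k) x" "c (sk k) x <= 1" using t r1 rt0[OF sk(1), of k x] by (auto simp: c_def)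
    have "dist (P (sk k) x) x0 <= dist x x0 + norm (- ((rt (sk k) x - ht n a x) *\<^sub>R n))"
     using dist_shift_le[of x "- ((rt (sk k) x - ht n a x) *\<^sub>R n)" x0] by (simp add: P_def)
    also have "... <= dist x x0 + 1" using n r1 r2 sk(2)[of k] by simp
    finally have "norm (J (P (sk k) x)) <= b" using b True by (simp add: dist_commute)
    moreover have "norm (J x) <= b" using b True by simp
    moreover have "norm ((c (sk k) x - 1) *\<^sub>R outer (J (P (sk k) x) *v n) n) <= 1 * norm (J (P (sk k) x))"
    proof -
     have "norm (J (P (sk k) x) *v n) <= norm (J (P (sk k) x))" using norm_mult_vec_le[of "J (P (sk k) x)" n] n by simp
     hence "\<bar>c (sk k) x - 1\<bar> * norm (J (P (sk k) x) *v n) <= 1 * norm (J (P (sk k) x))" using c1 by (intro mult_mono) auto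
     thus ?thesis using n by simp
    qed
    ultimately have "norm (I (sk k) x - J x) <= 3 * b" unfolding I_def
     using norm_triangle_ineq4[of "J (P (sk k) x) + (c (sk k) x - 1) *\<^sub>R outer (J (P (sk k) x) *v n) n" "J x"]
      norm_triangle_ineq[of "J (P (sk k) x)" "(c (sk k) x - 1) *\<^sub>R outer (J (P (sk k) x) *v n) n"] by linarith
    hence "(norm (I (sk k) x - J x))^2 <= (3 * b)^2" by (intro power_mono) auto
    thus ?thesis using True by (simp add: ennreal_leI)
   qed simp
  qed
  show "(\<integral>\<^sup>+x. ennreal ((3 * b)^2) * indicator (ball x0 B) x \<partial>lborel) < \<infinity>"
   using emeasure_lborel_ball_finite[of x0 B] by (simp add: nn_integral_cmult_indicator ennreal_mult_less_top)
  show "AE x in lborel. (\<lambda>k. nsq (I (sk k) x - J x) * indicator ?\<Omega> x) \<longlonglongrightarrow> 0"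
  proof (intro AE_I2)
   fix x
   show "(\<lambda>k. nsq (I (sk k) x - J x) * indicator ?\<Omega> x) \<longlonglongrightarrow> 0"
   proof (cases "x \<in> ?\<Omega>")
    case True
    have t: "0 < ht n a x" using True by (simp add: halfspace_ht)
    have "(\<lambda>k. rt (sk k) x) \<longlonglongrightarrow> sqrt ((ht n a x)^2 + 0^2)" unfolding rt_def by (intro tendsto_intros skl)
    hence lr: "(\<lambda>k. rt (sk k) x) \<longlonglongrightarrow> ht n a x" using t by simp
    have "(\<lambda>k. P (sk k) x) \<longlonglongrightarrow> x - (ht n a x - ht n a x) *\<^sub>R n" unfolding P_def by (intro tendsto_intros lr)
    hence "(\<lambda>k. P (sk k) x) \<longlonglongrightarrow> x" by simp
    hence lJ: "(\<lambda>k. J (P (sk k) x)) \<longlonglongrightarrow> J x" by (rule continuous_on_tendsto_compose[OF cJ]) auto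
    have "(\<lambda>k. c (sk k) x) \<longlonglongrightarrow> ht n a x / ht n a x" unfolding c_def by (intro tendsto_intros lr) (use t in simp)
    hence lc: "(\<lambda>k. c (sk k) x) \<longlonglongrightarrow> 1" using t by simp
    have co: "continuous_on UNIV (\<lambda>Y::real^'d^'m. outer (Y *v n) n)" by (intro continuous_intros)
    have lo: "(\<lambda>k. outer (J (P (sk k) x) *v n) n) \<longlonglongrightarrow> outer (J x *v n) n"
     by (rule continuous_on_tendsto_compose[OF co lJ]) auto
    have "(\<lambda>k. I (sk k) x - J x) \<longlonglongrightarrow> (J x + (1 - 1) *\<^sub>R outer (J x *v n) n) - J x"
     unfolding I_def by (intro tendsto_intros lJ lc lo)
    hence "(\<lambda>k. I (sk k) x - J x) \<longlonglongrightarrow> 0" by simp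
    from tendsto_power[OF tendsto_norm[OF this], of 2] have "(\<lambda>k. nsq (I (sk k) x - J x)) \<longlonglongrightarrow> ennreal 0"
     by (intro tendsto_ennrealI) simp
    thus ?thesis using True by simp
   qed simp
  qed
 qed measurable
 hence "\<forall>\<^sub>F k in sequentially. (\<integral>\<^sup>+x. nsq (I (sk k) x - J x) * indicator ?\<Omega> x \<partial>lborel) < ennreal e"
  by (rule order_tendstoD(2)) (use e in simp)
 then obtain k where "(\<integral>\<^sup>+x. nsq (I (sk k) x - J x) * indicator ?\<Omega> x \<partial>lborel) < ennreal e"
  using eventually_happens'[OF sequentially_bot] by force
 hence "energy ?\<Omega> (\<lambda>x. I (sk k) x - J x) <= ennreal e" by (simp add: energy_def)
 thus ?thesis using CI[OF sk(1)[of k]] sym[OF sk(1)[of k]] by blast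
qed

section \<open>From the approximations back to the weak solution\<close>

lemma approx_weak:
 fixes u :: "real^'d::finite => real^'m::finite" and Du :: "real^'d => real^'d^'m"
 assumes n: "norm n = 1" and x0: "ht n a x0 = 0" and H: "H1_loc (halfspace n a) u Du" and L: "L2_loc_upto (halfspace n a) Du" and e: "0 < e"
 shows "\<exists>v J. C1 v J \<and> (\<forall>r T. energy (sslab n a x0 r T) J <= ennreal 2 * energy (slab n a x0 r T) J)
  \<and> energy (halfspace n a \<inter> ball x0 B) (\<lambda>x. J x - Du x) <= ennreal e"
proof -
 have e4: "0 < e/4" using e by simp
 obtain w I where w: "C1 w I" "energy (halfspace n a \<inter> ball x0 B) (\<lambda>x. I x - Du x) <= ennreal (e/4)"
  using approx_interior[OF n H L e4] by blast
 obtain v J where v: "C1 v J" "\<forall>r T. energy (sslab n a x0 r T) J <= ennreal 2 * energy (slab n a x0 r T) J"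
  "energy (halfspace n a \<inter> ball x0 B) (\<lambda>x. J x - I x) <= ennreal (e/4)"
  using approx_even[OF n x0 w(1) e4] by blast
 note [measurable] = C1_measurable_J[OF v(1)] C1_measurable_J[OF w(1)]
 have [measurable]: "Du \<in> borel_measurable borel" using L by (simp add: L2_loc_upto_def)
 have mb: "ball x0 B \<in> sets borel" by simp
 have mh: "halfspace n a \<in> sets borel" unfolding halfspace_ht by measurable
 have [measurable]: "halfspace n a \<inter> ball x0 B \<in> sets borel" by (rule sets.Int[OF mh mb])
 have "energy (halfspace n a \<inter> ball x0 B) (\<lambda>x. J x - Du x) <= 2 * energy (halfspace n a \<inter> ball x0 B) (\<lambda>x. J x - I x)
  + 2 * energy (halfspace n a \<inter> ball x0 B) (\<lambda>x. I x - Du x)"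
  by (rule energy_diff_le) measurable
 also have "... <= 2 * ennreal (e/4) + 2 * ennreal (e/4)" by (intro add_mono mult_left_mono w(2) v(3)) auto
 also have "... = ennreal (2 * (e/4) + 2 * (e/4))"
  using e by (simp only: ennreal_reals)
 also have "... = ennreal e" by simp
 finally show ?thesis using v by blast
qed

text \<open>The matrix obtained by applying \<open>A\<close> to \<open>\<xi>\<close>. With it the
  error from replacing \<open>Du\<close> by \<open>J\<close> is written as part of the right-hand
  side, so that \<open>J\<close> satisfies an equation of the same type exactly.\<close>

definition coef_mult :: "('d::finite, 'm::finite) coeff => real^'d => real^'d^'m => real^'d^'m" where
 "coef_mult A x \<xi> = (\<chi> \<alpha>. \<chi> i. \<Sum>j\<in>UNIV. \<Sum>\<beta>\<in>UNIV. A i j \<alpha> \<beta> x * \<xi> $ \<beta> $ j)"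

lemma coef_mult_inner: "coef_mult A x \<xi> \<bullet> \<eta> = bilin A x \<xi> \<eta>"
proof -
 have "coef_mult A x \<xi> \<bullet> \<eta> = (\<Sum>\<alpha>\<in>UNIV. \<Sum>i\<in>UNIV. (\<Sum>j\<in>UNIV. \<Sum>\<beta>\<in>UNIV. A i j \<alpha> \<beta> x * \<xi> $ \<beta> $ j) * \<eta> $ \<alpha> $ i)"
  by (simp add: inner_vec_def coef_mult_def)
 also have "... = (\<Sum>i\<in>UNIV. \<Sum>\<alpha>\<in>UNIV. (\<Sum>j\<in>UNIV. \<Sum>\<beta>\<in>UNIV. A i j \<alpha> \<beta> x * \<xi> $ \<beta> $ j) * \<eta> $ \<alpha> $ i)"
  by (rule sum.swap)
 also have "... = (\<Sum>i\<in>UNIV. \<Sum>\<alpha>\<in>UNIV. \<Sum>j\<in>UNIV. \<Sum>\<beta>\<in>UNIV. A i j \<alpha> \<beta> x * \<xi> $ \<beta> $ j * \<eta> $ \<alpha> $ i)"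
  by (simp add: sum_distrib_right)
 also have "... = bilin A x \<xi> \<eta>" unfolding bilin_def
  by (intro sum.cong refl sum.swap)
 finally show ?thesis .
qed

lemma norm_coef_mult_le:
 assumes "coefs \<mu> M A" shows "norm (coef_mult A x \<xi>) <= M * norm \<xi>"
proof (cases "coef_mult A x \<xi> = 0")
 case True
 have "\<bar>bilin A x \<xi> \<xi>\<bar> <= M * norm \<xi> * norm \<xi>" using assms unfolding coefs_def by blast
 hence "0 <= M * norm \<xi> * norm \<xi>" by linarith
 hence "0 <= M * norm \<xi>" by (cases "\<xi> = 0") (auto simp: zero_le_mult_iff)
 thus ?thesis using True by simp
next
 case False
 let ?c = "coef_mult A x \<xi>"
 have "norm ?c * norm ?c = bilin A x \<xi> ?c" by (simp add: coef_mult_inner[symmetric] power2_norm_eq_inner[symmetric] power2_eq_square[symmetric])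
 also have "... <= M * norm \<xi> * norm ?c" using assms unfolding coefs_def by (meson abs_le_D1)
 finally show ?thesis using False by simp
qed

lemma L2_loc_upto_mono:
 fixes h :: "real^'d::finite => 'b::euclidean_space" and f g :: "real^'d => 'c::euclidean_space"
 assumes O: "\<Omega> \<in> sets borel" and m: "h \<in> borel_measurable borel" and f: "L2_loc_upto \<Omega> f" and g: "L2_loc_upto \<Omega> g"
  and le: "\<And>x. norm (h x) <= norm (f x) + c * norm (g x)"
 shows "L2_loc_upto \<Omega> h"
 unfolding L2_loc_upto_def
proof (intro conjI allI impI)
 show "h \<in> borel_measurable lborel" using m by simp
 fix K :: "(real^'d) set" assume K: "compact K"
 note [measurable] = m O
 have [measurable]: "K \<in> sets borel" using K by (simp add: borel_closed compact_imp_closed)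
 have i: "set_integrable lborel (\<Omega> \<inter> K) (\<lambda>x. 2 * (norm (f x))^2 + (2 * c^2) * (norm (g x))^2)"
  by (intro set_integral_add set_integrable_mult_right) (use f g K in \<open>auto simp: L2_loc_upto_def\<close>)
 show "set_integrable lborel (\<Omega> \<inter> K) (\<lambda>x. (norm (h x))^2)"
 proof (rule set_integrable_bound[OF i])
  show "set_borel_measurable lborel (\<Omega> \<inter> K) (\<lambda>x. (norm (h x))^2)" unfolding set_borel_measurable_def by measurable
  show "AE x in lborel. x \<in> \<Omega> \<inter> K --> norm ((norm (h x))^2) <= norm (2 * (norm (f x))^2 + (2 * c^2) * (norm (g x))^2)"
  proof (intro AE_I2 impI)
   fix x
   have "(norm (h x))^2 <= (norm (f x) + c * norm (g x))^2" by (rule power_mono[OF le]) simp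
   also have "... <= 2 * (norm (f x))^2 + (2 * c^2) * (norm (g x))^2"
    using zero_le_power2[of "norm (f x) - c * norm (g x)"] by (simp add: power2_eq_square algebra_simps)
   finally show "norm ((norm (h x))^2) <= norm (2 * (norm (f x))^2 + (2 * c^2) * (norm (g x))^2)" by simp
  qed
 qed
qed

lemma energy_coef_mult_le:
 assumes A: "coefs \<mu> M A" and M: "0 <= M" and m: "h \<in> borel_measurable borel" and S: "S \<in> sets borel"
 shows "energy S (\<lambda>x. coef_mult A x (h x)) <= ennreal (M^2) * energy S h"
proof -
 note [measurable] = m S
 have mm: "(\<lambda>x. nsq (h x) * indicator S x) \<in> borel_measurable lborel" by measurable
 have "energy S (\<lambda>x. coef_mult A x (h x)) <= (\<integral>\<^sup>+x. ennreal (M^2) * (nsq (h x) * indicator S x) \<partial>lborel)"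
  unfolding energy_def
 proof (rule nn_integral_mono)
  fix x
  have "(norm (coef_mult A x (h x)))^2 <= (M * norm (h x))^2" by (rule power_mono[OF norm_coef_mult_le[OF A]]) simp
  hence "nsq (coef_mult A x (h x)) <= ennreal (M^2 * (norm (h x))^2)" by (intro ennreal_leI) (simp add: power_mult_distrib)
  thus "nsq (coef_mult A x (h x)) * indicator S x <= ennreal (M^2) * (nsq (h x) * indicator S x)"
   by (simp add: ennreal_mult split: split_indicator)
 qed
 also have "... = ennreal (M^2) * energy S h" unfolding energy_def by (rule nn_integral_cmult[OF mm])
 finally show ?thesis .
qed

lemma energy_le_diff:
 fixes f g :: "real^'d::finite => 'b::euclidean_space"
 assumes [measurable]: "f \<in> borel_measurable borel" "g \<in> borel_measurable borel" "S \<in> sets borel"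
  and e: "energy S (\<lambda>x. f x - g x) <= ennreal e"
 shows "energy S f <= 2 * energy S g + 2 * ennreal e" "energy S g <= 2 * energy S f + 2 * ennreal e"
proof -
 have "energy S (\<lambda>x. g x + (f x - g x)) <= 2 * energy S g + 2 * energy S (\<lambda>x. f x - g x)" by (rule energy_add_le) measurable
 also have "... <= 2 * energy S g + 2 * ennreal e" by (intro add_left_mono mult_left_mono e) simp
 finally show "energy S f <= 2 * energy S g + 2 * ennreal e" by simp
 have eq: "energy S (\<lambda>x. g x - f x) = energy S (\<lambda>x. f x - g x)" by (simp add: energy_def norm_minus_commute)
 have "energy S (\<lambda>x. f x + (g x - f x)) <= 2 * energy S f + 2 * energy S (\<lambda>x. g x - f x)" by (rule energy_add_le) measurable
 also have "... <= 2 * energy S f + 2 * ennreal e" unfolding eq by (intro add_left_mono mult_left_mono e) simp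
 finally show "energy S g <= 2 * energy S f + 2 * ennreal e" by simp
qed

text \<open>For each \<open>\<epsilon>\<close> an approximation satisfies the equation exactly, with
  a right-hand side changed by \<open>coef_mult A x (Du x - J x)\<close>, so
  \<open>decay_step\<close> applies with constants that do not depend on \<open>\<epsilon>\<close>.
  The energies move by multiples of \<open>\<epsilon>\<close>, which then tends to 0. Passing to the
  approximation and back doubles squares twice, which turns 1/16 into 1/4.\<close>

lemma decay_step_weak:
 assumes mu: "0 < \<mu>" and M: "0 <= M" and sig: "0 < \<sigma>"
 shows "\<exists>Cd K1. 0 < Cd \<and> 4 <= K1 \<and> (\<forall>\<theta>. 0 < \<theta> --> \<theta> <= 1/8 --> (\<exists>C2 r0 R0. 0 < C2 \<and> 0 < r0 \<and> 0 < R0 \<and>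
  (\<forall>(n::real^'d::finite) a x0 A (u::real^'d => real^'m::finite) Du f R T.
  norm n = 1 --> ht n a x0 = 0 --> coefs \<mu> M A --> hoelder_bilin \<sigma> M A --> periodic_coeff A -->
  H1_loc (halfspace n a) u Du --> L2_loc_upto (halfspace n a) Du --> L2_loc_upto (halfspace n a) f -->
  weak_neumann A (halfspace n a) Du f -->
  0 < R --> 0 <= T --> R <= r0 \<or> R0 <= R -->
  energy (slab n a x0 (\<theta>*R) T) Du <= ennreal (1/4) * energy (slab n a x0 (2*(\<theta>*R)) (T+R)) Du
   + ennreal (Cd * \<theta>) * energy (slab n a x0 R (T+K1*R)) Du
   + ennreal C2 * energy (slab n a x0 R (T+K1*R)) f)))"
 \<comment> \<open>The numeral instantiates \<open>C0\<close> with 2, the constant of the even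
   approximations.\<close>
 using decay_step[OF mu M sig zero_less_numeral[of "num.Bit0 num.One"], where 'd='d and 'm='m]
proof (elim exE conjE, goal_cases)
 case (1 Cd K1)
 note Cd = 1(1,2) and DS = 1(3)
 show ?thesis
 proof (rule exI[of _ "4 * Cd"], rule exI[of _ K1], intro conjI allI impI, goal_cases)
  case (3 \<theta>)
  note th = 3
  from DS[rule_format, OF th] show ?case
  proof (elim exE conjE, goal_cases)
  case (1 C2 r0 R0)
  note C2 = 1(1-3) and DE = 1(4)
  show ?case
  proof (rule exI[of _ "4 * C2"], rule exI[of _ r0], rule exI[of _ R0], intro conjI allI impI)
   show "0 < 4 * C2" "0 < r0" "0 < R0" using C2 by auto
   fix n :: "real^'d" and a :: real and x0 A and u :: "real^'d => real^'m" and Du f and R T :: real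
   assume n: "norm n = 1" and x0: "ht n a x0 = 0" and A: "coefs \<mu> M A" and Ho: "hoelder_bilin \<sigma> M A" and per: "periodic_coeff A"
    and H1: "H1_loc (halfspace n a) u Du" and L: "L2_loc_upto (halfspace n a) Du" and f: "L2_loc_upto (halfspace n a) f"
    and wk: "weak_neumann A (halfspace n a) Du f" and R: "0 < R" and T: "0 <= T" and reg: "R <= r0 \<or> R0 <= R"
   let ?\<Omega> = "halfspace n a"
   have mO: "?\<Omega> \<in> sets borel" unfolding halfspace_ht by measurable
   have mD[measurable]: "Du \<in> borel_measurable borel" and mf[measurable]: "f \<in> borel_measurable borel" using L f by (auto simp: L2_loc_upto_def)
   have wd: "weakeq A ?\<Omega> Du f" by (rule weak_neumann_C1[OF A M mO L f wk])
   let ?S0 = "slab n a x0 (\<theta>*R) T" and ?S1 = "slab n a x0 (2*(\<theta>*R)) (T+R)" and ?S2 = "slab n a x0 R (T+K1*R)"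
   have tR: "2 * (\<theta> * R) <= R" "\<theta> * R <= R" using th R mult_right_mono[OF th(2), of R] by auto
   have RK: "R <= K1 * R" using mult_right_mono[of 1 K1 R] Cd R by simp
   have sub: "?S0 \<subseteq> ?S2" "?S1 \<subseteq> ?S2" by (rule slab_mono; use tR RK R in linarith)+
   \<comment> \<open>The coefficients that \<open>\<epsilon>\<close> receives from the two energies
     of \<open>J\<close>, from \<open>g\<close>, and from the passage back to
     \<open>Du\<close>.\<close>
   define e where "e = 1/4 + 4 * Cd * \<theta> + 4 * C2 * M^2 + 2"
   have e0: "0 < e" using Cd th C2 by (simp add: e_def add_pos_pos add_pos_nonneg)
   have main: "energy ?S0 Du <= ennreal (1/4) * energy ?S1 Du + ennreal (4 * Cd * \<theta>) * energy ?S2 Du + ennreal (4 * C2) * energy ?S2 f + ennreal (e * \<epsilon>)"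
    if eps: "0 < \<epsilon>" for \<epsilon>
   proof -
    obtain v J where v: "C1 v J" "\<forall>r T. energy (sslab n a x0 r T) J <= ennreal 2 * energy (slab n a x0 r T) J"
     "energy (?\<Omega> \<inter> ball x0 (T+K1*R)) (\<lambda>x. J x - Du x) <= ennreal \<epsilon>"
     using approx_weak[OF n x0 H1 L eps] by blast
    have cJ: "continuous_on UNIV J" by (rule C1_continuous_J[OF v(1)])
    have mJ[measurable]: "J \<in> borel_measurable borel" by (rule borel_measurable_continuous_onI[OF cJ])
    have LJ: "L2_loc_upto ?\<Omega> J" by (rule C1_L2_loc[OF v(1) mO])
    have LD: "L2_loc_upto ?\<Omega> (\<lambda>x. Du x - J x)"
     by (rule L2_loc_upto_mono[OF mO _ L LJ, of _ 1]) (auto intro: norm_triangle_ineq4)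
    define q where "q x = coef_mult A x (Du x - J x)" for x
    define g where "g x = f x + q x" for x
    have mDJ: "(\<lambda>x. Du x - J x) \<in> borel_measurable borel" by measurable
    have mid: "(\<lambda>x. x) \<in> borel_measurable borel" by simp
    have mq[measurable]: "q \<in> borel_measurable borel"
     unfolding borel_measurable_euclidean_space[of q] q_def coef_mult_inner
     by (intro ballI bilin_measurable mDJ mid borel_measurable_const) (use A in \<open>simp add: coefs_def\<close>)
    have mg: "g \<in> borel_measurable borel" unfolding g_def[abs_def] by measurable
    have Lg: "L2_loc_upto ?\<Omega> g"
    proof (rule L2_loc_upto_mono[OF mO mg f LD, of M])
     fix x show "norm (g x) <= norm (f x) + M * norm (Du x - J x)"
      unfolding g_def q_def using norm_triangle_ineq[of "f x" "coef_mult A x (Du x - J x)"] norm_coef_mult_le[OF A, of x "Du x - J x"] by linarith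
    qed
    have wg: "weakeq A ?\<Omega> J g"
    proof -
     have "bilin A x (J x) \<eta> + g x \<bullet> \<eta> = bilin A x (Du x) \<eta> + f x \<bullet> \<eta>" for x \<eta>
      by (simp add: g_def q_def inner_add_left coef_mult_inner bilin_diff_left)
     thus ?thesis using wd unfolding weakeq_def by simp
    qed
    have ds: "energy ?S0 J <= ennreal (1/16) * energy ?S1 J + ennreal (Cd * \<theta>) * energy ?S2 J + ennreal C2 * energy ?S2 g"
     by (rule DE[rule_format, OF n A Ho per v(1) Lg wg _ R T reg]) (use v(2) in blast)
    have S2O: "?S2 \<subseteq> ?\<Omega> \<inter> ball x0 (T+K1*R)" by (auto simp: slab_def halfspace_ht dist_commute)
    have er: "energy S (\<lambda>x. J x - Du x) <= ennreal \<epsilon>" if "S \<subseteq> ?S2" for S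
     using energy_mono[OF order_trans[OF that S2O], of "\<lambda>x. J x - Du x"] v(3) by (rule order_trans)
    have J1: "energy ?S1 J <= 2 * energy ?S1 Du + 2 * ennreal \<epsilon>" by (rule energy_le_diff(1)[OF mJ mD slab_borel er[OF sub(2)]])
    have J2: "energy ?S2 J <= 2 * energy ?S2 Du + 2 * ennreal \<epsilon>" by (rule energy_le_diff(1)[OF mJ mD slab_borel er[OF order_refl]])
    have J0: "energy ?S0 Du <= 2 * energy ?S0 J + 2 * ennreal \<epsilon>" by (rule energy_le_diff(2)[OF mJ mD slab_borel er[OF sub(1)]])
    have G: "energy ?S2 g <= 2 * energy ?S2 f + 2 * (ennreal (M^2) * ennreal \<epsilon>)"
    proof -
     have "energy ?S2 g <= 2 * energy ?S2 f + 2 * energy ?S2 q" unfolding g_def by (rule energy_add_le) measurable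
     also have "energy ?S2 q <= ennreal (M^2) * energy ?S2 (\<lambda>x. Du x - J x)" unfolding q_def
      by (rule energy_coef_mult_le[OF A M]) measurable
     also have "energy ?S2 (\<lambda>x. Du x - J x) = energy ?S2 (\<lambda>x. J x - Du x)" by (simp add: energy_def norm_minus_commute)
     also have "... <= ennreal \<epsilon>" by (rule er[OF order_refl])
     finally show ?thesis by (simp add: add_left_mono mult_left_mono)
    qed
    have tot: "energy ?S0 Du <= 2 * (ennreal (1/16) * (2 * energy ?S1 Du + 2 * ennreal \<epsilon>) + ennreal (Cd * \<theta>) * (2 * energy ?S2 Du + 2 * ennreal \<epsilon>)
     + ennreal C2 * (2 * energy ?S2 f + 2 * (ennreal (M^2) * ennreal \<epsilon>))) + 2 * ennreal \<epsilon>"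
     by (rule order_trans[OF J0], rule add_right_mono, rule mult_left_mono, rule order_trans[OF ds])
      (auto intro!: add_mono mult_left_mono J1 J2 G)
    show ?thesis
    proof (cases "energy ?S2 Du = top \<or> energy ?S2 f = top")
     case True
     hence "ennreal (1/4) * energy ?S1 Du + ennreal (4 * Cd * \<theta>) * energy ?S2 Du + ennreal (4 * C2) * energy ?S2 f + ennreal (e * \<epsilon>) = top"
      using th Cd C2 by (auto simp: ennreal_mult_eq_top_iff)
     thus ?thesis by (simp only: top_greatest)
    next
     case False
     obtain y where y: "energy ?S2 Du = ennreal y" "0 <= y" using False by (cases "energy ?S2 Du") auto
     obtain z where z: "energy ?S2 f = ennreal z" "0 <= z" using False by (cases "energy ?S2 f") auto
     have "energy ?S1 Du <= ennreal y" unfolding y(1)[symmetric] by (rule energy_mono[OF sub(2)])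
     then obtain x where x: "energy ?S1 Du = ennreal x" "0 <= x" using le_ennrealD by blast
     have "energy ?S0 Du <= ennreal (2 * (1/16 * (2 * x + 2 * \<epsilon>) + Cd * \<theta> * (2 * y + 2 * \<epsilon>) + C2 * (2 * z + 2 * (M^2 * \<epsilon>))) + 2 * \<epsilon>)"
      using tot unfolding x y z using x y z eps th Cd C2
      by (simp only: ennreal_reals)
     also have "2 * (1/16 * (2 * x + 2 * \<epsilon>) + Cd * \<theta> * (2 * y + 2 * \<epsilon>) + C2 * (2 * z + 2 * (M^2 * \<epsilon>))) + 2 * \<epsilon> = 1/4 * x + 4 * Cd * \<theta> * y + 4 * C2 * z + e * \<epsilon>"
      by (simp add: e_def algebra_simps)
     also have "ennreal (1/4 * x + 4 * Cd * \<theta> * y + 4 * C2 * z + e * \<epsilon>) = ennreal (1/4) * ennreal x + ennreal (4 * Cd * \<theta>) * ennreal y + ennreal (4 * C2) * ennreal z + ennreal (e * \<epsilon>)"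
     proof -
      have "0 <= 4 * Cd * \<theta>" "0 <= 4 * C2" "0 <= e * \<epsilon>" "(0::real) <= 1/4" using th Cd C2 e0 eps by auto
      thus ?thesis using x y z by (simp only: ennreal_mult[symmetric] ennreal_plus[symmetric] mult_nonneg_nonneg add_nonneg_nonneg)
     qed
     finally show ?thesis unfolding x y z .
    qed
   qed
   show "energy ?S0 Du <= ennreal (1/4) * energy ?S1 Du + ennreal (4 * Cd * \<theta>) * energy ?S2 Du + ennreal (4 * C2) * energy ?S2 f"
   proof (rule ennreal_le_epsilon)
    fix \<epsilon> :: real assume "0 < \<epsilon>"
    thus "energy ?S0 Du <= ennreal (1/4) * energy ?S1 Du + ennreal (4 * Cd * \<theta>) * energy ?S2 Du + ennreal (4 * C2) * energy ?S2 f + ennreal \<epsilon>"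
     using main[of "\<epsilon> / e"] e0 by simp
   qed
  qed
  qed
 qed (use Cd in auto)
qed

section \<open>Consequences of the bound on the Hoelder norm\<close>

lemma quad_sum_prod:
 fixes f :: "'d::finite => 'd => 'm::finite => 'm => real"
 shows "(\<Sum>i\<in>UNIV. \<Sum>j\<in>UNIV. \<Sum>\<alpha>\<in>UNIV. \<Sum>\<beta>\<in>UNIV. f i j \<alpha> \<beta>) = (\<Sum>(i,j,\<alpha>,\<beta>)\<in>UNIV. f i j \<alpha> \<beta>)"
 by (simp add: sum.cartesian_product split_beta)

text \<open>The fourfold sum is a single sum over index quadruples, and the squares of the products
  of entries of \<open>\<xi>\<close> and \<open>\<eta>\<close> sum to the product of the squared
  norms.\<close>

lemma quad_cauchy_schwarz:
 fixes B :: "'d::finite => 'd => 'm::finite => 'm => real" and \<xi> \<eta> :: "real^'d^'m"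
 shows "\<bar>\<Sum>i\<in>UNIV. \<Sum>j\<in>UNIV. \<Sum>\<alpha>\<in>UNIV. \<Sum>\<beta>\<in>UNIV. B i j \<alpha> \<beta> * \<xi> $ \<beta> $ j * \<eta> $ \<alpha> $ i\<bar>
  <= sqrt (\<Sum>i\<in>UNIV. \<Sum>j\<in>UNIV. \<Sum>\<alpha>\<in>UNIV. \<Sum>\<beta>\<in>UNIV. (B i j \<alpha> \<beta>)^2) * norm \<xi> * norm \<eta>"
proof -
 have nn: "(norm \<zeta>)^2 = (\<Sum>\<beta>\<in>UNIV. \<Sum>i\<in>UNIV. (\<zeta> $ \<beta> $ i)^2)" for \<zeta> :: "real^'d^'m"
  unfolding power2_norm_eq_inner inner_vec_def by (simp add: power2_eq_square)
 have pe: "(\<Sum>i\<in>UNIV. \<Sum>j\<in>UNIV. \<Sum>\<alpha>\<in>UNIV. \<Sum>\<beta>\<in>UNIV. (\<xi> $ \<beta> $ j * \<eta> $ \<alpha> $ i)^2) = (norm \<xi>)^2 * (norm \<eta>)^2"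
 proof -
  have "(\<Sum>i\<in>UNIV. \<Sum>j\<in>UNIV. \<Sum>\<alpha>\<in>UNIV. \<Sum>\<beta>\<in>UNIV. (\<xi> $ \<beta> $ j * \<eta> $ \<alpha> $ i)^2)
   = (\<Sum>i\<in>UNIV. \<Sum>j\<in>UNIV. (\<Sum>\<alpha>\<in>UNIV. (\<eta> $ \<alpha> $ i)^2) * (\<Sum>\<beta>\<in>UNIV. (\<xi> $ \<beta> $ j)^2))"
   by (simp add: sum_product power_mult_distrib mult.commute)
  also have "... = (\<Sum>i\<in>UNIV. \<Sum>\<alpha>\<in>UNIV. (\<eta> $ \<alpha> $ i)^2) * (\<Sum>j\<in>UNIV. \<Sum>\<beta>\<in>UNIV. (\<xi> $ \<beta> $ j)^2)"
   by (simp add: sum_product)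
  also have "(\<Sum>i\<in>UNIV. \<Sum>\<alpha>\<in>UNIV. (\<eta> $ \<alpha> $ i)^2) = (norm \<eta>)^2" unfolding nn by (rule sum.swap)
  also have "(\<Sum>j\<in>UNIV. \<Sum>\<beta>\<in>UNIV. (\<xi> $ \<beta> $ j)^2) = (norm \<xi>)^2" unfolding nn by (rule sum.swap)
  finally show ?thesis by (simp add: mult.commute)
 qed
 let ?P = "UNIV :: ('d \<times> 'd \<times> 'm \<times> 'm) set"
 have "(\<Sum>p\<in>?P. (case p of (i,j,\<alpha>,\<beta>) => B i j \<alpha> \<beta>) * (case p of (i,j,\<alpha>,\<beta>) => \<xi> $ \<beta> $ j * \<eta> $ \<alpha> $ i))^2
  <= (\<Sum>p\<in>?P. (case p of (i,j,\<alpha>,\<beta>) => B i j \<alpha> \<beta>)^2) * (\<Sum>p\<in>?P. (case p of (i,j,\<alpha>,\<beta>) => \<xi> $ \<beta> $ j * \<eta> $ \<alpha> $ i)^2)"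
  by (rule Cauchy_Schwarz_ineq_sum)
 hence "(\<Sum>i\<in>UNIV. \<Sum>j\<in>UNIV. \<Sum>\<alpha>\<in>UNIV. \<Sum>\<beta>\<in>UNIV. B i j \<alpha> \<beta> * \<xi> $ \<beta> $ j * \<eta> $ \<alpha> $ i)^2
  <= (\<Sum>i\<in>UNIV. \<Sum>j\<in>UNIV. \<Sum>\<alpha>\<in>UNIV. \<Sum>\<beta>\<in>UNIV. (B i j \<alpha> \<beta>)^2) * ((norm \<xi>)^2 * (norm \<eta>)^2)"
  unfolding pe[symmetric] quad_sum_prod by (simp add: split_beta mult.assoc)
 from real_sqrt_le_mono[OF this] show ?thesis
  by (simp add: real_sqrt_mult mult.assoc)
qed

lemma abs_bilin_le: "\<bar>bilin A x \<xi> \<eta>\<bar> <= tnorm A x * norm \<xi> * norm \<eta>"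
 unfolding bilin_def tnorm_def by (rule quad_cauchy_schwarz)

lemma abs_bilin_diff_le: "\<bar>bilin A x \<xi> \<eta> - bilin A y \<xi> \<eta>\<bar> <= tnorm_diff A x y * norm \<xi> * norm \<eta>"
proof -
 have "bilin A x \<xi> \<eta> - bilin A y \<xi> \<eta> = (\<Sum>i\<in>UNIV. \<Sum>j\<in>UNIV. \<Sum>\<alpha>\<in>UNIV. \<Sum>\<beta>\<in>UNIV. (A i j \<alpha> \<beta> x - A i j \<alpha> \<beta> y) * \<xi> $ \<beta> $ j * \<eta> $ \<alpha> $ i)"
  by (simp add: bilin_def sum_subtractf left_diff_distrib)
 thus ?thesis unfolding tnorm_diff_def by (simp only: quad_cauchy_schwarz)
qed

lemma tnorm_nonneg: "0 <= tnorm A x" "0 <= tnorm_diff A x y"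
 unfolding tnorm_def tnorm_diff_def by (intro real_sqrt_ge_zero sum_nonneg zero_le_power2)+

lemma holder_norm_bounds:
 assumes "holder_norm \<sigma> A <= ereal M"
 shows "tnorm A x <= M" "tnorm_diff A x y <= M * dist x y powr \<sigma>" "0 <= M"
proof -
 let ?S1 = "SUP x. ereal (tnorm A x)"
 let ?S2 = "SUP p\<in>{(x, y). x \<noteq> y}. ereal (tnorm_diff A (fst p) (snd p) / (dist (fst p) (snd p) powr \<sigma>))"
 have le: "?S1 + ?S2 <= ereal M" using assms by (simp add: holder_norm_def)
 have s1: "ereal (tnorm A x) <= ?S1" for x by (rule SUP_upper) simp
 have s2: "ereal (tnorm_diff A x y / (dist x y powr \<sigma>)) <= ?S2" if "x \<noteq> y" for x y
  using that by (intro SUP_upper2[of "(x,y)"]) auto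
 have p1: "0 <= ?S1" by (rule order_trans[OF _ s1[of 0]]) (simp add: tnorm_nonneg)
 \<comment> \<open>A supremum of nonnegative terms is nonnegative once there is one term; the pair
   of a unit vector and 0 supplies it.\<close>
 have p2: "0 <= ?S2"
  by (rule order_trans[OF _ s2[of "axis undefined 1" 0]]) (auto simp: tnorm_nonneg axis_eq_0_iff)
 have "ereal (tnorm A x) <= ereal M" for x by (rule order_trans[OF s1 order_trans[OF _ le]]) (use p2 in \<open>simp add: add_increasing2\<close>)
 thus t: "tnorm A x <= M" for x by simp
 show "0 <= M" using order_trans[OF tnorm_nonneg(1) t] .
 show "tnorm_diff A x y <= M * dist x y powr \<sigma>"
 proof (cases "x = y")
  case True thus ?thesis by (simp add: tnorm_diff_def)
 next
  case False
  have "ereal (tnorm_diff A x y / (dist x y powr \<sigma>)) <= ereal M"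
   by (rule order_trans[OF s2[OF False] order_trans[OF _ le]]) (use p1 in \<open>simp add: add_increasing\<close>)
  thus ?thesis using False by (simp add: pos_divide_le_eq)
 qed
qed

lemma coefs_of_holder:
 assumes s: "0 < \<sigma>" and A: "elliptic \<mu> A" "holder_norm \<sigma> A <= ereal M"
 shows "coefs \<mu> M A" "hoelder_bilin \<sigma> M A"
proof -
 note b = holder_norm_bounds[OF A(2)]
 have c: "continuous_on UNIV (A i j \<alpha> \<beta>)" for i j \<alpha> \<beta>
 proof (rule continuous_onI)
  fix x :: "real^'a" and e :: real assume e: "0 < e"
  have le: "dist (A i j \<alpha> \<beta> y) (A i j \<alpha> \<beta> x) <= M * dist y x powr \<sigma>" for y
  proof -
   have "(A i j \<alpha> \<beta> y - A i j \<alpha> \<beta> x)^2 <= (\<Sum>\<beta>\<in>UNIV. (A i j \<alpha> \<beta> y - A i j \<alpha> \<beta> x)^2)"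
    by (rule member_le_sum) auto
   also have "... <= (\<Sum>\<alpha>\<in>UNIV. \<Sum>\<beta>\<in>UNIV. (A i j \<alpha> \<beta> y - A i j \<alpha> \<beta> x)^2)"
    by (rule member_le_sum) (auto intro: sum_nonneg)
   also have "... <= (\<Sum>j\<in>UNIV. \<Sum>\<alpha>\<in>UNIV. \<Sum>\<beta>\<in>UNIV. (A i j \<alpha> \<beta> y - A i j \<alpha> \<beta> x)^2)"
    by (rule member_le_sum) (auto intro!: sum_nonneg)
   also have "... <= (\<Sum>i\<in>UNIV. \<Sum>j\<in>UNIV. \<Sum>\<alpha>\<in>UNIV. \<Sum>\<beta>\<in>UNIV. (A i j \<alpha> \<beta> y - A i j \<alpha> \<beta> x)^2)"
    by (rule member_le_sum) (auto intro!: sum_nonneg)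
   finally have "\<bar>A i j \<alpha> \<beta> y - A i j \<alpha> \<beta> x\<bar> <= tnorm_diff A y x"
    unfolding tnorm_diff_def by (intro real_le_rsqrt) simp
   thus ?thesis using b(2)[of y x] by (simp add: dist_real_def)
  qed
  define d where "d = (e/(M+1)) powr (1/\<sigma>)"
  have d: "0 < d" using e b(3) by (simp add: d_def)
  have "dist (A i j \<alpha> \<beta> y) (A i j \<alpha> \<beta> x) <= e" if "dist y x < d" for y
  proof -
   have "dist y x powr \<sigma> <= d powr \<sigma>" using that s by (intro powr_mono2) auto
   also have "d powr \<sigma> = e/(M+1)" using s e b(3) by (simp add: d_def powr_powr)
   finally have "M * dist y x powr \<sigma> <= M * (e/(M+1))" using b(3) by (rule mult_left_mono)
   also have "... <= e" using b(3) e by (simp add: pos_divide_le_eq algebra_simps)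
   finally show ?thesis using le[of y] by linarith
  qed
  thus "\<exists>d>0. \<forall>x'\<in>UNIV. dist x' x < d --> dist (A i j \<alpha> \<beta> x') (A i j \<alpha> \<beta> x) <= e" using d by blast
 qed
 have bl: "\<bar>bilin A x \<xi> \<eta>\<bar> <= M * norm \<xi> * norm \<eta>" for x \<xi> \<eta>
  by (rule order_trans[OF abs_bilin_le]) (intro mult_right_mono b(1) norm_ge_zero)
 show "coefs \<mu> M A" unfolding coefs_def using A(1) bl c unfolding elliptic_def by blast
 have "\<bar>bilin A x \<xi> \<eta> - bilin A y \<xi> \<eta>\<bar> <= M * dist x y powr \<sigma> * norm \<xi> * norm \<eta>" for x y \<xi> \<eta>
  by (rule order_trans[OF abs_bilin_diff_le]) (intro mult_right_mono b(2) norm_ge_zero)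
 thus "hoelder_bilin \<sigma> M A" unfolding hoelder_bilin_def by blast
qed

section \<open>Summation over dyadic scales\<close>

lemma sum_shift_le:
 fixes g :: "nat => real"
 assumes "\<And>k. 0 <= g k" "B + q <= Q" "m <= m'"
 shows "(\<Sum>k=m'..<B. g (k + q)) <= (\<Sum>k=m..<Q. g k)"
proof -
 have "(\<Sum>k=m'..<B. g (k + q)) = (\<Sum>k=m'+q..<B+q. g k)" by (rule sum.shift_bounds_nat_ivl[symmetric])
 also have "... <= (\<Sum>k=m..<Q. g k)" using assms by (intro sum_mono2) auto
 finally show ?thesis .
qed

text \<open>Shifted sums exceed the unshifted one only by the top \<open>p\<close> scales. As 1/2 +
  1/4 = 3/4, the sum is absorbed: \<open>S <= 3/4 * (S + T) + P\<close> gives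
  \<open>S <= 3 * T + 4 * P\<close>.\<close>

lemma dyadic_sum:
 fixes g h :: "nat => real"
 assumes g: "\<And>k. 0 <= g k" and h: "\<And>k. 0 <= h k" and c: "0 <= c" and p: "1 <= p" and mN: "m <= N"
  and le: "\<And>k. m <= k ==> k < N ==> g k <= 1/2 * g (k + 1) + 1/4 * g (k + p) + c * h (k + p)"
 shows "(\<Sum>k=m..<N. g k) <= 3 * (\<Sum>k=N..<N+p. g k) + 4 * (c * (\<Sum>k<N+p. h k))"
proof -
 have "(\<Sum>k=m..<N. g k) <= (\<Sum>k=m..<N. 1/2 * g (k + 1) + 1/4 * g (k + p) + c * h (k + p))"
  by (intro sum_mono le) auto
 also have "... = 1/2 * (\<Sum>k=m..<N. g (k + 1)) + 1/4 * (\<Sum>k=m..<N. g (k + p)) + c * (\<Sum>k=m..<N. h (k + p))"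
  by (simp only: sum.distrib sum_distrib_left)
 also have "... <= 1/2 * (\<Sum>k=m..<N+p. g k) + 1/4 * (\<Sum>k=m..<N+p. g k) + c * (\<Sum>k=0..<N+p. h k)"
  by (intro add_mono mult_left_mono sum_shift_le g h) (use p c in auto)
 also have "(\<Sum>k=m..<N+p. g k) = (\<Sum>k=m..<N. g k) + (\<Sum>k=N..<N+p. g k)"
  using mN by (intro sum.atLeastLessThan_concat[symmetric]) auto
 finally have "(\<Sum>k=m..<N. g k) <= 1/2 * ((\<Sum>k=m..<N. g k) + (\<Sum>k=N..<N+p. g k)) + 1/4 * ((\<Sum>k=m..<N. g k) + (\<Sum>k=N..<N+p. g k)) + c * (\<Sum>k<N+p. h k)"
  unfolding atLeast0LessThan .
 moreover have "S <= 1/2 * (S + T) + 1/4 * (S + T) + P ==> S <= 3 * T + 4 * P" for S T P :: real by (simp add: field_simps)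
 ultimately show ?thesis by blast
qed

lemma dyadic_gap_sum:
 fixes g h :: "nat => real"
 assumes g: "\<And>k. 0 <= g k" and h: "\<And>k. 0 <= h k" and c: "0 <= c" and p: "1 <= p" and N: "n + w <= N"
  and le: "\<And>k. k < N ==> k < n \<or> n + w <= k ==> g k <= 1/2 * g (k + 1) + 1/4 * g (k + p) + c * h (k + p)"
  and mono: "\<And>k. g k <= 2 * g (k + 1)"
 shows "(\<Sum>k<N+p. g k) <= (20 * (real w * 2^w) + 24) * ((\<Sum>k=N..<N+p. g k) + c * (\<Sum>k<N+p. h k))"
proof -
 define T where "T = (\<Sum>k=N..<N+p. g k)"
 define H where "H = (\<Sum>k<N+p. h k)"
 define SL where "SL = (\<Sum>k=n+w..<N. g k)"
 define SM where "SM = (\<Sum>k=n..<n+w. g k)"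
 define SS where "SS = (\<Sum>k=0..<n. g k)"
 define X where "X = T + c * H"
 define W where "W = real w * 2^w"
 have nn: "0 <= T" "0 <= H" "0 <= SL" "0 <= SM" "0 <= SS" "0 <= W" using g h by (auto simp: T_def H_def SL_def SM_def SS_def W_def intro: sum_nonneg)
 have cH: "0 <= c * H" using c nn by simp
 have "SL <= 3 * T + 4 * (c * H)" unfolding SL_def T_def H_def
  by (rule dyadic_sum[OF g h c p N]) (use le in auto)
 hence L: "SL <= 4 * X" using nn cH by (simp add: X_def)
 have it: "g k <= 2^i * g (k + i)" for k i
 proof (induction i)
  case (Suc i)
  have "2^i * g (k + i) <= 2^i * (2 * g (k + i + 1))" by (intro mult_left_mono mono) auto
  with Suc have "g k <= 2^i * (2 * g (k + i + 1))" by (rule order_trans)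
  thus ?case by (simp add: mult.assoc mult.left_commute)
 qed simp
 \<comment> \<open>This also holds when the gap ends at \<open>N\<close>: the term then belongs to
   \<open>T\<close>, which is not an empty sum because \<open>1 <= p\<close>.\<close>
 have gw: "g (n + w) <= SL + T"
 proof -
  have "g (n + w) <= (\<Sum>k=n+w..<N+p. g k)" using N p g by (intro member_le_sum) auto
  also have "... = SL + T" unfolding SL_def T_def using N by (intro sum.atLeastLessThan_concat[symmetric]) auto
  finally show ?thesis .
 qed
 have "SM <= (\<Sum>k=n..<n+w. 2^w * (SL + T))" unfolding SM_def
 proof (rule sum_mono)
  fix k assume k: "k \<in> {n..<n+w}"
  have "g k <= 2^(n + w - k) * g (n + w)" using it[of k "n + w - k"] k by simp
  also have "... <= 2^w * (SL + T)" using k gw g by (intro mult_mono power_increasing) auto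
  finally show "g k <= 2^w * (SL + T)" .
 qed
 hence "SM <= W * (SL + T)" by (simp add: W_def mult_ac)
 also have "... <= W * (5 * X)" using L nn cH by (intro mult_left_mono) (auto simp: X_def)
 finally have M: "SM <= 5 * (W * X)" by simp
 have "SS <= 3 * (\<Sum>k=n..<n+p. g k) + 4 * (c * (\<Sum>k<n+p. h k))" unfolding SS_def
  by (rule dyadic_sum[OF g h c p]) (use le N in auto)
 also have "(\<Sum>k=n..<n+p. g k) <= (\<Sum>k=n..<N+p. g k)" using N g by (intro sum_mono2) auto
 also have "(\<Sum>k=n..<N+p. g k) = SM + SL + T"
 proof -
  have "(\<Sum>k=n..<N+p. g k) = (\<Sum>k=n..<N. g k) + T" unfolding T_def using N by (intro sum.atLeastLessThan_concat[symmetric]) auto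
  moreover have "(\<Sum>k=n..<N. g k) = SM + SL" unfolding SM_def SL_def using N by (intro sum.atLeastLessThan_concat[symmetric]) auto
  ultimately show ?thesis by simp
 qed
 also have "4 * (c * (\<Sum>k<n+p. h k)) <= 4 * (c * H)" unfolding H_def using N h c by (intro mult_left_mono sum_mono2) auto
 finally have S: "SS <= 3 * (SM + SL + T) + 4 * (c * H)" by simp
 have "(\<Sum>k<N+p. g k) = SS + (SM + SL + T)"
 proof -
  have "(\<Sum>k=0..<N+p. g k) = (\<Sum>k=0..<N. g k) + T" unfolding T_def by (intro sum.atLeastLessThan_concat[symmetric]) auto
  moreover have "(\<Sum>k=0..<N. g k) = SS + (\<Sum>k=n..<N. g k)" unfolding SS_def using N by (intro sum.atLeastLessThan_concat[symmetric]) auto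
  moreover have "(\<Sum>k=n..<N. g k) = SM + SL" unfolding SM_def SL_def using N by (intro sum.atLeastLessThan_concat[symmetric]) auto
  ultimately show ?thesis by (simp add: atLeast0LessThan)
 qed
 also have "... <= (20 * W + 24) * X"
 proof -
  \<comment> \<open>\<open>Y\<close> stands for \<open>W * X\<close>. The left-hand side is at most
    four times \<open>SM + SL + T + P\<close>, and this is at most 20 Y + 16 X + 4 X.\<close>
  have "SS + (SM + SL + T) <= 20 * Y + 24 * X"
   if "SS <= 3 * (SM + SL + T) + 4 * P" "SM <= 5 * Y" "SL <= 4 * X" "0 <= T" "0 <= P" "X = T + P" for SS SM SL T P X Y :: real
   using that unfolding distrib_left by linarith
  from this[OF S M L nn(1) cH X_def] have "SS + (SM + SL + T) <= 20 * (W * X) + 24 * X" .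
  thus ?thesis by (simp add: algebra_simps)
 qed
 finally show ?thesis by (simp add: W_def X_def T_def H_def)
qed

text \<open>Only scales above \<open>t\<close> contribute; as \<open>\<alpha> < 0\<close>, their
  weights form a geometric series of ratio \<open>2 powr \<alpha> < 1\<close> whose first term is at
  most \<open>t powr \<alpha>\<close>. This is how a power of the height arises from weighted
  energies of slabs.\<close>

lemma dyadic_weight_sum_le:
 fixes \<rho> \<alpha> t :: real
 assumes rho: "0 < \<rho>" and al: "\<alpha> < 0" and t: "0 < t"
 shows "(\<Sum>k<N. (\<rho> * 2^k) powr \<alpha> * (if t < \<rho> * 2^k then 1 else 0)) <= t powr \<alpha> / (1 - 2 powr \<alpha>)"
proof -
 define b where "b = 2 powr \<alpha>"
 have b: "0 < b" "b < 1" using al by (auto simp: b_def powr_less_one)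
 have w: "(\<rho> * 2^k) powr \<alpha> = \<rho> powr \<alpha> * b^k" for k
  using rho by (simp add: b_def powr_mult powr_power[symmetric] powr_realpow[symmetric] powr_powr mult.commute)
 show ?thesis
 proof (cases "\<exists>k. t < \<rho> * 2^k")
  case False
  thus ?thesis using t b(2) unfolding b_def by (simp add: divide_nonneg_pos)
 next
  case True
  define k0 where "k0 = (LEAST k. t < \<rho> * 2^k)"
  have k0: "t < \<rho> * 2^k0" unfolding k0_def using True by (rule LeastI_ex)
  have k0': "k0 <= k" if "t < \<rho> * 2^k" for k unfolding k0_def using that by (rule Least_le)
  have "(\<Sum>k<N. (\<rho> * 2^k) powr \<alpha> * (if t < \<rho> * 2^k then 1 else 0)) <= (\<Sum>k=k0..<N+k0. (\<rho> * 2^k) powr \<alpha>)"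
  proof -
   have "(\<Sum>k<N. (\<rho> * 2^k) powr \<alpha> * (if t < \<rho> * 2^k then 1 else 0)) <= (\<Sum>k<N. if k \<in> {k0..<N+k0} then (\<rho> * 2^k) powr \<alpha> else 0)"
    by (intro sum_mono) (use k0' in auto)
   also have "... = (\<Sum>k\<in>{..<N} \<inter> {k0..<N+k0}. (\<rho> * 2^k) powr \<alpha>)" by (simp add: sum.inter_restrict)
   also have "... <= (\<Sum>k=k0..<N+k0. (\<rho> * 2^k) powr \<alpha>)" by (intro sum_mono2) auto
   finally show ?thesis .
  qed
  also have "... = (\<Sum>k=0..<N. (\<rho> * 2^(k + k0)) powr \<alpha>)"
   using sum.shift_bounds_nat_ivl[of "\<lambda>k. (\<rho> * 2^k) powr \<alpha>" 0 k0 N] by simp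
  also have "... = (\<rho> * 2^k0) powr \<alpha> * (\<Sum>k<N. b^k)"
  proof -
   have "(\<rho> * 2^(k + k0)) powr \<alpha> = (\<rho> * 2^k0) powr \<alpha> * b^k" for k unfolding w by (simp add: power_add)
   thus ?thesis by (simp only: sum_distrib_left atLeast0LessThan)
  qed
  also have "... <= t powr \<alpha> * (1 / (1 - b))"
  proof (rule mult_mono)
   show "(\<rho> * 2^k0) powr \<alpha> <= t powr \<alpha>" using k0 t al by (intro powr_mono2') auto
   have "(\<Sum>k<N. b^k) = (1 - b^N) / (1 - b)" using b sum_gp_strict[of b N] by simp
   also have "... <= 1 / (1 - b)" using b by (intro divide_right_mono) auto
   finally show "(\<Sum>k<N. b^k) <= 1 / (1 - b)" .
  qed (use b in \<open>auto intro: sum_nonneg\<close>)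
  finally show ?thesis by (simp add: b_def)
 qed
qed

section \<open>Weighted integrals and energies of dyadic slabs\<close>

lemma energy_bounded_finite:
 assumes h: "L2_loc_upto \<Omega> h" and S: "S \<subseteq> \<Omega>" "bounded S"
 shows "energy S h < top"
proof -
 obtain R where "\<forall>y\<in>S. norm y <= R" using S(2) unfolding bounded_iff ..
 hence R: "S \<subseteq> cball 0 R" by auto
 have "set_integrable lborel (\<Omega> \<inter> cball 0 R) (\<lambda>x. (norm (h x))^2)" using h compact_cball unfolding L2_loc_upto_def by blast
 hence "(\<integral>\<^sup>+x. ennreal (norm (indicat_real (\<Omega> \<inter> cball 0 R) x *\<^sub>R (norm (h x))^2)) \<partial>lborel) < \<infinity>"
  unfolding set_integrable_def integrable_iff_bounded by blast
 moreover have "energy (\<Omega> \<inter> cball 0 R) h = (\<integral>\<^sup>+x. ennreal (norm (indicat_real (\<Omega> \<inter> cball 0 R) x *\<^sub>R (norm (h x))^2)) \<partial>lborel)"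
  unfolding energy_def by (intro nn_integral_cong) (auto split: split_indicator)
 moreover have "energy S h <= energy (\<Omega> \<inter> cball 0 R) h" by (rule energy_mono) (use S R in auto)
 ultimately show ?thesis by simp
qed

lemma slab_subset: "slab n a x0 r T \<subseteq> halfspace n a \<inter> ball x0 T"
 by (auto simp: slab_def halfspace_ht dist_commute)

lemma energy_slab_finite:
 assumes "L2_loc_upto (halfspace n a) h" shows "energy (slab n a x0 r T) h < top"
 by (rule energy_bounded_finite[OF assms]) (use slab_subset[of n a x0 r T] bounded_subset[OF bounded_ball] in auto)

text \<open>A point of height t is charged to the least \<open>k\<close> with
  \<open>t < \<rho> * 2^k\<close>. Its height is then at least half of that scale, which costs a
  factor \<open>2 powr (- \<alpha>)\<close>, at most 2 because \<open>-1 < \<alpha>\<close>. Heights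
  start at \<open>\<rho>\<close> so that \<open>k\<close> is positive and the preceding scale
  exists.\<close>

lemma layers_lower:
 fixes Du :: "real^'d::finite => 'b::euclidean_space"
 assumes al: "-1 < \<alpha>" "\<alpha> < 0" and rho: "0 < \<rho>" and p: "1 <= p" and K: "0 <= K" and mD: "Du \<in> borel_measurable borel"
 shows "(\<integral>\<^sup>+x\<in>{x. \<rho> <= ht n a x \<and> ht n a x < \<rho> * 2^N \<and> dist x x0 < L}. ennreal ((norm (Du x))^2 * ht n a x powr \<alpha>) \<partial>lborel)
  <= (\<Sum>k<N+p. ennreal (2 * (\<rho> * 2^k) powr \<alpha>) * energy (slab n a x0 (\<rho> * 2^k) (L + K * (\<rho> * 2^k))) Du)"
proof -
 note [measurable] = mD
 let ?S = "\<lambda>k. slab n a x0 (\<rho> * 2^k) (L + K * (\<rho> * 2^k))" and ?D = "{x. \<rho> <= ht n a x \<and> ht n a x < \<rho> * 2^N \<and> dist x x0 < L}"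
 have m: "(\<lambda>x. nsq (Du x) * indicator (?S k) x) \<in> borel_measurable lborel" for k by measurable
 have "(\<integral>\<^sup>+x\<in>?D. ennreal ((norm (Du x))^2 * ht n a x powr \<alpha>) \<partial>lborel)
  <= (\<integral>\<^sup>+x. (\<Sum>k<N+p. ennreal (2 * (\<rho> * 2^k) powr \<alpha>) * (nsq (Du x) * indicator (?S k) x)) \<partial>lborel)"
 proof (rule nn_integral_mono)
  fix x
  show "ennreal ((norm (Du x))^2 * ht n a x powr \<alpha>) * indicator ?D x <= (\<Sum>k<N+p. ennreal (2 * (\<rho> * 2^k) powr \<alpha>) * (nsq (Du x) * indicator (?S k) x))"
  proof (cases "x \<in> ?D")
   case True
   let ?t = "ht n a x"
   have t: "\<rho> <= ?t" "?t < \<rho> * 2^N" "dist x x0 < L" using True by auto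
   define k where "k = (LEAST k. ?t < \<rho> * 2^k)"
   have k: "?t < \<rho> * 2^k" unfolding k_def by (rule LeastI[where P="\<lambda>k. ht n a x < \<rho> * 2^k", OF t(2)])
   have kN: "k <= N" unfolding k_def by (rule Least_le[where P="\<lambda>k. ht n a x < \<rho> * 2^k", OF t(2)])
   have k0: "k \<noteq> 0" using k t(1) by (cases k) auto
   then obtain i where i: "k = Suc i" by (cases k) auto
   have "\<not> ?t < \<rho> * 2^i" using not_less_Least[of i "\<lambda>k. ?t < \<rho> * 2^k"] i unfolding k_def[symmetric] by simp
   hence ti: "\<rho> * 2^i <= ?t" by simp
   have "?t powr \<alpha> <= (\<rho> * 2^i) powr \<alpha>" using ti rho al by (intro powr_mono2') auto
   also have "... <= 2 * (\<rho> * 2^k) powr \<alpha>"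
   proof -
    have "(\<rho> * 2^k) powr \<alpha> = (2 * (\<rho> * 2^i)) powr \<alpha>" by (simp add: i mult_ac)
    also have "... = 2 powr \<alpha> * (\<rho> * 2^i) powr \<alpha>" by (rule powr_mult)
    finally have e: "(\<rho> * 2^k) powr \<alpha> = 2 powr \<alpha> * (\<rho> * 2^i) powr \<alpha>" .
    have "2 powr (-1) <= 2 powr \<alpha>" using al by (intro powr_mono) auto
    hence "1/2 <= 2 powr \<alpha>" by (simp add: powr_minus)
    hence "1/2 * (\<rho> * 2^i) powr \<alpha> <= 2 powr \<alpha> * (\<rho> * 2^i) powr \<alpha>" by (rule mult_right_mono) simp
    thus ?thesis unfolding e by simp
   qed
   finally have w: "?t powr \<alpha> <= 2 * (\<rho> * 2^k) powr \<alpha>" .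
   have "0 <= K * (\<rho> * 2^k)" using K rho by simp
   hence xS: "x \<in> ?S k" using t k rho by (auto simp: slab_def)
   have "(norm (Du x))^2 * ?t powr \<alpha> <= (2 * (\<rho> * 2^k) powr \<alpha>) * (norm (Du x))^2"
    using mult_right_mono[OF w, of "(norm (Du x))^2"] by (simp add: mult.commute)
   hence "ennreal ((norm (Du x))^2 * ?t powr \<alpha>) <= ennreal (2 * (\<rho> * 2^k) powr \<alpha>) * nsq (Du x)"
    by (simp add: ennreal_mult[symmetric] ennreal_leI)
   also have "... = ennreal (2 * (\<rho> * 2^k) powr \<alpha>) * (nsq (Du x) * indicator (?S k) x)" using xS by simp
   also have "... <= (\<Sum>k<N+p. ennreal (2 * (\<rho> * 2^k) powr \<alpha>) * (nsq (Du x) * indicator (?S k) x))"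
    by (rule member_le_sum[where f="\<lambda>k. ennreal (2 * (\<rho> * 2^k) powr \<alpha>) * (nsq (Du x) * indicator (?S k) x)"]) (use kN p in auto)
   finally show ?thesis using True by simp
  qed simp
 qed
 also have "... = (\<Sum>k<N+p. \<integral>\<^sup>+x. ennreal (2 * (\<rho> * 2^k) powr \<alpha>) * (nsq (Du x) * indicator (?S k) x) \<partial>lborel)"
  by (rule nn_integral_sum) (intro borel_measurable_times_ennreal borel_measurable_const m)
 also have "... = (\<Sum>k<N+p. ennreal (2 * (\<rho> * 2^k) powr \<alpha>) * energy (?S k) Du)"
  unfolding energy_def by (simp only: nn_integral_cmult m)
 finally show ?thesis .
qed

text \<open>Sum and integral are interchanged; for a fixed point the weights of the slabs that
  contain it are summed by \<open>dyadic_weight_sum_le\<close>, whatever the widths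
  \<open>T k\<close>.\<close>

lemma layers_upper:
 fixes f :: "real^'d::finite => 'b::euclidean_space"
 assumes al: "\<alpha> < 0" and rho: "0 < \<rho>" and mf: "f \<in> borel_measurable borel"
 shows "(\<Sum>k<N. ennreal ((\<rho> * 2^k) powr \<alpha>) * energy (slab n a x0 (\<rho> * 2^k) (T k)) f)
  <= ennreal (1 / (1 - 2 powr \<alpha>)) * (\<integral>\<^sup>+x\<in>halfspace n a. ennreal ((norm (f x))^2 * ht n a x powr \<alpha>) \<partial>lborel)"
proof -
 note [measurable] = mf
 let ?S = "\<lambda>k. slab n a x0 (\<rho> * 2^k) (T k)"
 have m: "(\<lambda>x. nsq (f x) * indicator (?S k) x) \<in> borel_measurable lborel" for k by measurable
 have hm[measurable]: "ht n a \<in> borel_measurable borel" unfolding ht_def[abs_def] by measurable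
 have mO[measurable]: "halfspace n a \<in> sets borel" unfolding halfspace_ht by measurable
 have m2: "(\<lambda>x. ennreal ((norm (f x))^2 * ht n a x powr \<alpha>) * indicator (halfspace n a) x) \<in> borel_measurable lborel" by measurable
 have b: "0 < 1 - 2 powr \<alpha>" using al by (simp add: powr_less_one)
 have "(\<Sum>k<N. ennreal ((\<rho> * 2^k) powr \<alpha>) * energy (?S k) f)
  = (\<Sum>k<N. \<integral>\<^sup>+x. ennreal ((\<rho> * 2^k) powr \<alpha>) * (nsq (f x) * indicator (?S k) x) \<partial>lborel)"
  unfolding energy_def by (simp only: nn_integral_cmult m)
 also have "... = (\<integral>\<^sup>+x. (\<Sum>k<N. ennreal ((\<rho> * 2^k) powr \<alpha>) * (nsq (f x) * indicator (?S k) x)) \<partial>lborel)"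
  by (rule nn_integral_sum[symmetric]) (intro borel_measurable_times_ennreal borel_measurable_const m)
 also have "... <= (\<integral>\<^sup>+x. ennreal (1 / (1 - 2 powr \<alpha>)) * (ennreal ((norm (f x))^2 * ht n a x powr \<alpha>) * indicator (halfspace n a) x) \<partial>lborel)"
 proof (rule nn_integral_mono)
  fix x
  show "(\<Sum>k<N. ennreal ((\<rho> * 2^k) powr \<alpha>) * (nsq (f x) * indicator (?S k) x))
   <= ennreal (1 / (1 - 2 powr \<alpha>)) * (ennreal ((norm (f x))^2 * ht n a x powr \<alpha>) * indicator (halfspace n a) x)"
  proof (cases "0 < ht n a x")
   case False
   thus ?thesis by (simp add: slab_def)
  next
   case True
   let ?w = "\<lambda>k. (\<rho> * 2^k) powr \<alpha> * (if ht n a x < \<rho> * 2^k then 1 else 0)"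
   have "(\<Sum>k<N. ennreal ((\<rho> * 2^k) powr \<alpha>) * (nsq (f x) * indicator (?S k) x)) <= (\<Sum>k<N. ennreal (?w k * (norm (f x))^2))"
    by (intro sum_mono) (auto simp: slab_def ennreal_mult split: split_indicator)
   also have "... = ennreal ((\<Sum>k<N. ?w k) * (norm (f x))^2)" by (simp add: sum_distrib_right)
   also have "... <= ennreal (ht n a x powr \<alpha> / (1 - 2 powr \<alpha>) * (norm (f x))^2)"
    by (intro ennreal_leI mult_right_mono dyadic_weight_sum_le rho al True) simp
   also have "... = ennreal (1 / (1 - 2 powr \<alpha>)) * (ennreal ((norm (f x))^2 * ht n a x powr \<alpha>))"
    using b by (simp add: ennreal_mult[symmetric] mult_ac)
   finally show ?thesis using True by (simp add: halfspace_ht)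
  qed
 qed
 also have "... = ennreal (1 / (1 - 2 powr \<alpha>)) * (\<integral>\<^sup>+x\<in>halfspace n a. ennreal ((norm (f x))^2 * ht n a x powr \<alpha>) \<partial>lborel)"
  by (rule nn_integral_cmult[OF m2])
 finally show ?thesis .
qed

text \<open>The scales reach from far below \<open>r0\<close> to far above \<open>R0\<close>, and
  \<open>g k\<close> is the weighted energy at scale \<open>r k\<close>. The decay inequality at
  \<open>R = r (k + p)\<close> becomes the recursion of \<open>dyadic_gap_sum\<close>; the growth
  hypothesis removes the top \<open>p\<close> scales as the range of scales grows, and monotone
  convergence exhausts the half-space.\<close>

lemma weighted_estimate:
 fixes Du f :: "real^'d::finite => real^'d^'m::finite"
 assumes al: "-1 < \<alpha>" "\<alpha> < 0" and L: "L2_loc_upto (halfspace n a) Du" and f: "L2_loc_upto (halfspace n a) f"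
  and p: "1 <= p" and Cd: "0 <= Cd" and C2: "0 <= C2" and K1: "0 <= K1" and r0: "0 < r0" and w: "R0 <= r0 * 2^w"
  and small: "Cd * (1/2^p) * (2^p) powr (- \<alpha>) <= 1/4"
  and dec: "\<And>R T. 0 < R ==> 0 <= T ==> R <= r0 \<or> R0 <= R ==>
   energy (slab n a x0 (1/2^p*R) T) Du <= ennreal (1/4) * energy (slab n a x0 (2*(1/2^p*R)) (T+R)) Du
   + ennreal (Cd * (1/2^p)) * energy (slab n a x0 R (T+K1*R)) Du + ennreal C2 * energy (slab n a x0 R (T+K1*R)) f"
  and growth: "((\<lambda>R. R powr \<alpha> * enn2real (energy (halfspace n a \<inter> ball x0 R) Du)) \<longlongrightarrow> 0) at_top"
 shows "(\<integral>\<^sup>+x\<in>halfspace n a. ennreal ((norm (Du x))^2 * ht n a x powr \<alpha>) \<partial>lborel)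
  <= ennreal (2 * (20 * (real w * 2^w) + 24) * (C2 * (2^p) powr (- \<alpha>)) / (1 - 2 powr \<alpha>))
   * (\<integral>\<^sup>+x\<in>halfspace n a. ennreal ((norm (f x))^2 * ht n a x powr \<alpha>) \<partial>lborel)"
proof -
 have mD[measurable]: "Du \<in> borel_measurable borel" and mf[measurable]: "f \<in> borel_measurable borel" using L f by (auto simp: L2_loc_upto_def)
 have hm[measurable]: "ht n a \<in> borel_measurable borel" unfolding ht_def[abs_def] by measurable
 let ?I = "\<integral>\<^sup>+x\<in>halfspace n a. ennreal ((norm (f x))^2 * ht n a x powr \<alpha>) \<partial>lborel"
 define W where "W = 20 * (real w * 2^w) + 24"
 define B where "B = (2^p :: real) powr (- \<alpha>)"
 define c where "c = C2 * B"
 define b where "b = 2 powr \<alpha>"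
 have b1: "0 < 1 - b" using al by (simp add: b_def powr_less_one)
 have W0: "0 <= W" and B0: "0 <= B" and c0: "0 <= c" using C2 by (auto simp: W_def B_def c_def)
 \<comment> \<open>Widths grow in proportion to the scale. The part \<open>2^p\<close> makes room
   for \<open>T + R\<close>, with \<open>R = 2^p * r k\<close>, at the next scale; the part
   \<open>2 * K1\<close> makes room for \<open>T + K1 * R\<close> at the scale \<open>p\<close>
   steps up.\<close>
 define K where "K = 2^p + 2 * K1"
 have K: "0 <= K" using K1 by (simp add: K_def)
 \<comment> \<open>At the top \<open>p\<close> scales the slabs have height at most
   \<open>2^p * L' J\<close>, hence width at most \<open>Q * L' J\<close>.\<close>
 define Q where "Q = 1 + K * 2^p"
 have Q: "1 <= Q" using K by (simp add: Q_def)
 \<comment> \<open>Normalised so that \<open>r (k + p) = r0 * (2^k / 2^J)\<close>: this is at most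
   \<open>r0\<close> for \<open>k < J\<close> and at least \<open>R0\<close> from
   \<open>k = J + w\<close> on, so exactly \<open>w\<close> indices form the gap.\<close>
 define \<rho> where "\<rho> J = r0 / 2^(p + J)" for J :: nat
 \<comment> \<open>With \<open>2 * J\<close> here, the top height \<open>L' J\<close> grows like
   \<open>2^J\<close> while \<open>\<rho> J\<close> decays like its reciprocal.\<close>
 define N where "N J = 2 * J + w" for J :: nat
 define L' where "L' J = \<rho> J * 2^(N J)" for J
 define \<Phi> where "\<Phi> R = R powr \<alpha> * enn2real (energy (halfspace n a \<inter> ball x0 R) Du)" for R
 define D where "D J = {x. \<rho> J <= ht n a x \<and> ht n a x < L' J \<and> dist x x0 < L' J}" for J
 have rho: "0 < \<rho> J" for J using r0 by (simp add: \<rho>_def)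
 have L'e: "L' J = (r0 * 2^w / 2^p) * 2^J" for J
  by (simp add: L'_def \<rho>_def N_def power_add mult_2)
 have bound: "(\<integral>\<^sup>+x\<in>D J. ennreal ((norm (Du x))^2 * ht n a x powr \<alpha>) \<partial>lborel)
  <= ennreal (2 * W * (real p * (Q powr (- \<alpha>) * \<Phi> (Q * L' J)))) + ennreal (2 * W * c / (1 - b)) * ?I" for J
 proof -
  define r where "r k = \<rho> J * 2^k" for k
  define T where "T k = L' J + K * r k" for k
  define e where "e k = enn2real (energy (slab n a x0 (r k) (T k)) Du)" for k
  define e' where "e' k = enn2real (energy (slab n a x0 (r k) (T k)) f)" for k
  define g where "g k = r k powr \<alpha> * e k" for k
  define h where "h k = r k powr \<alpha> * e' k" for k
  have r: "0 < r k" for k using rho by (simp add: r_def)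
  have LJ: "0 < L' J" using rho by (simp add: L'_def)
  have ee: "energy (slab n a x0 (r k) (T k)) Du = ennreal (e k)" for k
   using energy_slab_finite[OF L, of x0 "r k" "T k"] by (simp add: e_def)
  have ee': "energy (slab n a x0 (r k) (T k)) f = ennreal (e' k)" for k
   using energy_slab_finite[OF f, of x0 "r k" "T k"] by (simp add: e'_def)
  have e0: "0 <= e k" "0 <= e' k" for k by (auto simp: e_def e'_def)
  have g0: "0 <= g k" and h0: "0 <= h k" for k using e0 by (auto simp: g_def h_def)
  have r1: "r (k + 1) = 2 * r k" for k by (simp add: r_def)
  have rp: "r (k + p) = 2^p * r k" for k by (simp add: r_def power_add)
  have w1: "r k powr \<alpha> <= 2 * r (k + 1) powr \<alpha>" for k
  proof -
   have "r (k + 1) powr \<alpha> = 2 powr \<alpha> * r k powr \<alpha>" unfolding r1 by (rule powr_mult)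
   moreover have "2 powr (-1) <= 2 powr \<alpha>" using al by (intro powr_mono) auto
   hence "1/2 <= 2 powr \<alpha>" by (simp add: powr_minus)
   hence "1/2 * r k powr \<alpha> <= 2 powr \<alpha> * r k powr \<alpha>" by (rule mult_right_mono) simp
   ultimately show ?thesis by simp
  qed
  have wp: "r k powr \<alpha> = B * r (k + p) powr \<alpha>" for k
  proof -
   have "r (k + p) powr \<alpha> = (2^p) powr \<alpha> * r k powr \<alpha>" unfolding rp by (rule powr_mult)
   thus ?thesis by (simp add: B_def powr_minus)
  qed
  have em: "e k <= e (k + 1)" for k
  proof -
   have "r k <= r (k + 1)" unfolding r1 using r[of k] by simp
   hence "energy (slab n a x0 (r k) (T k)) Du <= energy (slab n a x0 (r (k+1)) (T (k+1))) Du"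
    using K by (intro energy_slab_mono) (auto simp: T_def mult_left_mono)
   thus ?thesis unfolding ee using e0 by simp
  qed
  have mono: "g k <= 2 * g (k + 1)" for k
   using mult_mono[OF w1[of k] em[of k]] e0 by (simp add: g_def mult.assoc)
  have step: "g k <= 1/2 * g (k + 1) + 1/4 * g (k + p) + c * h (k + p)" if k: "k < J \<or> J + w <= k" for k
  proof -
   have reg: "r (k + p) <= r0 \<or> R0 <= r (k + p)"
   proof -
    have e: "r (k + p) = r0 * (2^k / 2^J)" by (simp add: r_def \<rho>_def power_add)
    from k show ?thesis
    proof
     assume "k < J"
     hence "2^k / 2^J <= (1::real)" by simp
     hence "r0 * (2^k / 2^J) <= r0 * 1" using r0 by (intro mult_left_mono) auto
     thus ?thesis unfolding e by simp
    next
     assume "J + w <= k"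
     hence "(2::real)^(J + w) <= 2^k" by (intro power_increasing) auto
     hence "2^w <= 2^k / (2::real)^J" by (simp add: power_add pos_le_divide_eq mult.commute)
     hence "r0 * 2^w <= r0 * (2^k / 2^J)" using r0 by (intro mult_left_mono) auto
     thus ?thesis unfolding e using w by linarith
    qed
   qed
   have rk: "1/2^p * r (k + p) = r k" by (simp add: rp)
   have T0: "0 <= T k" using LJ K r[of k] by (simp add: T_def)
   have "energy (slab n a x0 (r k) (T k)) Du <= ennreal (1/4) * energy (slab n a x0 (2 * r k) (T k + r (k + p))) Du
   + ennreal (Cd * (1/2^p)) * energy (slab n a x0 (r (k + p)) (T k + K1 * r (k + p))) Du + ennreal C2 * energy (slab n a x0 (r (k + p)) (T k + K1 * r (k + p))) f"
    using dec[OF r T0 reg] unfolding rk .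
   also have "... <= ennreal (1/4) * ennreal (e (k + 1)) + ennreal (Cd * (1/2^p)) * ennreal (e (k + p)) + ennreal C2 * ennreal (e' (k + p))"
   proof -
    have t1: "T k + r (k + p) <= T (k + 1)" using K1 r[of k] unfolding T_def r1 rp K_def by (simp add: algebra_simps)
    have t2: "T k + K1 * r (k + p) <= T (k + p)"
    proof -
     have "(2::real) <= 2^p" using p power_increasing[of 1 p "2::real"] by simp
     hence "2 * K <= 2^p * K" using K by (rule mult_right_mono)
     hence "K + 2^p * K1 <= 2^p * K"
     proof -
      assume a: "2 * K <= 2^p * K"
      have "2^p * (2 * K1) <= 2^p * K" by (intro mult_left_mono) (auto simp: K_def)
      hence "2 * (2^p * K1) <= 2^p * K" by (simp only: mult.left_commute)
      with a show ?thesis by linarith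
     qed
     from mult_right_mono[OF this, of "r k"] show ?thesis using r[of k] unfolding T_def rp by (simp add: algebra_simps)
    qed
    show ?thesis unfolding ee[symmetric] ee'[symmetric] r1
     by (intro add_mono mult_left_mono energy_slab_mono order_refl) (use t1 t2 r1 in auto)
   qed
   also have "... = ennreal (1/4 * e (k + 1) + Cd * (1/2^p) * e (k + p) + C2 * e' (k + p))"
   proof -
    have "0 <= Cd * (1/2^p)" "(0::real) <= 1/4" using Cd by auto
    thus ?thesis using e0 C2 by (simp only: ennreal_mult[symmetric] ennreal_plus[symmetric] mult_nonneg_nonneg add_nonneg_nonneg)
   qed
   finally have "e k <= 1/4 * e (k + 1) + Cd * (1/2^p) * e (k + p) + C2 * e' (k + p)"
    unfolding ee using e0 Cd C2 by (subst (asm) ennreal_le_iff) auto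
   hence "g k <= r k powr \<alpha> * (1/4 * e (k + 1) + Cd * (1/2^p) * e (k + p) + C2 * e' (k + p))"
    unfolding g_def by (rule mult_left_mono) simp
   also have "... = 1/4 * (r k powr \<alpha> * e (k + 1)) + Cd * (1/2^p) * (r k powr \<alpha> * e (k + p)) + C2 * (r k powr \<alpha> * e' (k + p))"
    by (simp add: distrib_left)
   \<comment> \<open>The change of weight from \<open>r k\<close> to \<open>r (k + 1)\<close>
     doubles the first coefficient. In the second term the change of weight over \<open>p\<close>
     scales is the factor \<open>B\<close>, for which \<open>small\<close> compensates.\<close>
   also have "... <= 1/4 * (2 * g (k + 1)) + 1/4 * g (k + p) + c * h (k + p)"
   proof (intro add_mono)
    have "r k powr \<alpha> * e (k + 1) <= 2 * r (k + 1) powr \<alpha> * e (k + 1)" by (rule mult_right_mono[OF w1 e0(1)])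
    hence "r k powr \<alpha> * e (k + 1) <= 2 * g (k + 1)" by (simp only: g_def mult.assoc)
    thus "1/4 * (r k powr \<alpha> * e (k + 1)) <= 1/4 * (2 * g (k + 1))" by linarith
    have "Cd * (1/2^p) * (r k powr \<alpha> * e (k + p)) = (Cd * (1/2^p) * B) * g (k + p)" unfolding wp[of k] g_def by simp
    also have "... <= 1/4 * g (k + p)" using small g0 unfolding B_def by (intro mult_right_mono) auto
    finally show "Cd * (1/2^p) * (r k powr \<alpha> * e (k + p)) <= 1/4 * g (k + p)" .
    show "C2 * (r k powr \<alpha> * e' (k + p)) <= c * h (k + p)" unfolding wp[of k] h_def c_def by simp
   qed
   finally show ?thesis by simp
  qed
  have S: "(\<Sum>k<N J+p. g k) <= W * ((\<Sum>k=N J..<N J+p. g k) + c * (\<Sum>k<N J+p. h k))"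
   unfolding W_def by (rule dyadic_gap_sum[OF g0 h0 c0 p, of J w]) (use step mono in \<open>auto simp: N_def\<close>)
  have top: "(\<Sum>k=N J..<N J+p. g k) <= real p * (Q powr (- \<alpha>) * \<Phi> (Q * L' J))"
  proof -
   have "g k <= Q powr (- \<alpha>) * \<Phi> (Q * L' J)" if k: "k \<in> {N J..<N J+p}" for k
   proof -
    have "(2::real)^(N J) <= 2^k" using k by (intro power_increasing) auto
    hence Lr: "L' J <= r k" unfolding L'_def r_def using rho by (intro mult_left_mono) (auto simp: less_imp_le)
    have "(2::real)^k <= 2^(N J + p)" using k by (intro power_increasing) auto
    hence "r k <= \<rho> J * 2^(N J + p)" unfolding r_def using rho by (intro mult_left_mono) (auto simp: less_imp_le)
    hence rL: "r k <= L' J * 2^p" by (simp add: L'_def power_add mult.assoc)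
    have "T k <= L' J + K * (L' J * 2^p)" unfolding T_def using mult_left_mono[OF rL K] by simp
    hence TQ: "T k <= Q * L' J" by (simp add: Q_def algebra_simps)
    have "energy (slab n a x0 (r k) (T k)) Du <= energy (halfspace n a \<inter> ball x0 (Q * L' J)) Du"
     by (rule energy_mono) (use slab_subset[of n a x0 "r k" "T k"] TQ in auto)
    moreover have "energy (halfspace n a \<inter> ball x0 (Q * L' J)) Du < top"
     by (rule energy_bounded_finite[OF L]) (use bounded_subset[OF bounded_ball[of x0 "Q * L' J"]] in auto)
    ultimately have eI: "e k <= enn2real (energy (halfspace n a \<inter> ball x0 (Q * L' J)) Du)"
     unfolding e_def by (intro enn2real_mono) auto
    have "r k powr \<alpha> <= L' J powr \<alpha>" using Lr LJ al by (intro powr_mono2') auto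
    from mult_mono[OF this eI] have "g k <= L' J powr \<alpha> * enn2real (energy (halfspace n a \<inter> ball x0 (Q * L' J)) Du)"
     using e0 by (simp add: g_def)
    also have "L' J powr \<alpha> = Q powr (- \<alpha>) * (Q * L' J) powr \<alpha>"
    proof -
     have "(Q * L' J) powr \<alpha> = Q powr \<alpha> * L' J powr \<alpha>" by (rule powr_mult)
     moreover have "Q powr (- \<alpha>) * Q powr \<alpha> = 1" using Q by (simp add: powr_minus)
     ultimately show ?thesis by (metis mult.assoc mult_1)
    qed
    finally show ?thesis by (simp add: \<Phi>_def mult.assoc)
   qed
   hence "(\<Sum>k=N J..<N J+p. g k) <= (\<Sum>k=N J..<N J+p. Q powr (- \<alpha>) * \<Phi> (Q * L' J))" by (rule sum_mono)
   thus ?thesis by simp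
  qed
  have Ph: "0 <= \<Phi> (Q * L' J)" by (simp add: \<Phi>_def)
  have hsum: "ennreal (\<Sum>k<N J+p. h k) <= ennreal (1 / (1 - b)) * ?I"
  proof -
   have "ennreal (\<Sum>k<N J+p. h k) = (\<Sum>k<N J+p. ennreal (h k))" using h0 by (simp add: sum_ennreal)
   also have "... = (\<Sum>k<N J+p. ennreal ((\<rho> J * 2^k) powr \<alpha>) * energy (slab n a x0 (\<rho> J * 2^k) (T k)) f)"
    unfolding r_def[symmetric] ee' h_def using e0 by (simp add: ennreal_mult)
   also have "... <= ennreal (1 / (1 - b)) * ?I" unfolding b_def by (rule layers_upper[OF al(2) rho mf])
   finally show ?thesis .
  qed
  have "(\<integral>\<^sup>+x\<in>D J. ennreal ((norm (Du x))^2 * ht n a x powr \<alpha>) \<partial>lborel)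
   <= (\<Sum>k<N J+p. ennreal (2 * (\<rho> J * 2^k) powr \<alpha>) * energy (slab n a x0 (\<rho> J * 2^k) (L' J + K * (\<rho> J * 2^k))) Du)"
   unfolding D_def L'_def by (rule layers_lower[OF al rho p K mD])
  also have "... = (\<Sum>k<N J+p. ennreal (2 * g k))"
   unfolding r_def[symmetric] T_def[symmetric] ee g_def using e0 by (simp add: ennreal_mult[symmetric] mult.assoc)
  also have "... = ennreal (2 * (\<Sum>k<N J+p. g k))" using g0 by (simp add: sum_ennreal sum_distrib_left)
  also have "... <= ennreal (2 * W * (real p * (Q powr (- \<alpha>) * \<Phi> (Q * L' J))) + 2 * W * c * (\<Sum>k<N J+p. h k))"
  proof (rule ennreal_leI)
   have "2 * (\<Sum>k<N J+p. g k) <= 2 * (W * ((\<Sum>k=N J..<N J+p. g k) + c * (\<Sum>k<N J+p. h k)))" using S by simp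
   also have "... <= 2 * (W * (real p * (Q powr (- \<alpha>) * \<Phi> (Q * L' J)) + c * (\<Sum>k<N J+p. h k)))"
    using top W0 by (intro mult_left_mono add_right_mono) auto
   finally show "2 * (\<Sum>k<N J+p. g k) <= 2 * W * (real p * (Q powr (- \<alpha>) * \<Phi> (Q * L' J))) + 2 * W * c * (\<Sum>k<N J+p. h k)"
    by (simp add: algebra_simps)
  qed
  also have "... = ennreal (2 * W * (real p * (Q powr (- \<alpha>) * \<Phi> (Q * L' J)))) + ennreal (2 * W * c) * ennreal (\<Sum>k<N J+p. h k)"
  proof -
   have "0 <= 2 * W * (real p * (Q powr (- \<alpha>) * \<Phi> (Q * L' J)))" "0 <= 2 * W * c" "0 <= (\<Sum>k<N J+p. h k)"
    using W0 Ph c0 h0 by (auto intro: sum_nonneg)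
   thus ?thesis by (simp add: ennreal_plus ennreal_mult)
  qed
  also have "... <= ennreal (2 * W * (real p * (Q powr (- \<alpha>) * \<Phi> (Q * L' J)))) + ennreal (2 * W * c) * (ennreal (1 / (1 - b)) * ?I)"
   by (intro add_left_mono mult_left_mono hsum) simp
  also have "ennreal (2 * W * c) * (ennreal (1 / (1 - b)) * ?I) = ennreal (2 * W * c / (1 - b)) * ?I"
   using W0 c0 b1 by (simp add: mult.assoc[symmetric] ennreal_mult[symmetric])
  finally show ?thesis .
 qed
 have D_mono: "D J \<subseteq> D J'" if "J <= J'" for J J'
 proof -
  have p2: "(2::real)^J <= 2^J'" using that by (intro power_increasing) auto
  have "\<rho> J' <= \<rho> J" unfolding \<rho>_def power_add using r0 p2 by (intro divide_left_mono mult_left_mono) auto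
  moreover have "L' J <= L' J'" unfolding L'e using p2 r0 by (intro mult_left_mono) auto
  ultimately show ?thesis by (auto simp: D_def)
 qed
 have Linf: "filterlim (\<lambda>J. Q * L' J) at_top sequentially"
 proof -
  have "filterlim (\<lambda>J. (2::real)^J) at_top sequentially"
   by (rule filterlim_at_infinity_imp_filterlim_at_top[OF filterlim_realpow_sequentially_gt1]) auto
  moreover have "0 < Q * (r0 * 2^w / 2^p)" using Q r0 by simp
  ultimately have "filterlim (\<lambda>J. Q * (r0 * 2^w / 2^p) * 2^J) at_top sequentially"
   using filterlim_tendsto_pos_mult_at_top[OF tendsto_const] by blast
  thus ?thesis unfolding L'e by (simp add: mult.assoc)
 qed
 have Plim: "(\<lambda>J. \<Phi> (Q * L' J)) \<longlonglongrightarrow> 0"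
  using filterlim_compose[OF growth Linf] by (simp add: \<Phi>_def)
 \<comment> \<open>The region \<open>D J\<close> is kept fixed while the bound is taken at larger
   and larger \<open>J'\<close>; the growth term disappears in the limit.\<close>
 have DI: "(\<integral>\<^sup>+x\<in>D J. ennreal ((norm (Du x))^2 * ht n a x powr \<alpha>) \<partial>lborel) <= ennreal (2 * W * c / (1 - b)) * ?I" for J
 proof (rule LIMSEQ_le_const)
  have "(\<lambda>J. 2 * W * (real p * (Q powr (- \<alpha>) * \<Phi> (Q * L' J)))) \<longlonglongrightarrow> 2 * W * (real p * (Q powr (- \<alpha>) * 0))"
   by (intro tendsto_intros Plim)
  from tendsto_add[OF tendsto_ennrealI[OF this] tendsto_const[of "ennreal (2 * W * c / (1 - b)) * ?I"]]
  show "(\<lambda>J. ennreal (2 * W * (real p * (Q powr (- \<alpha>) * \<Phi> (Q * L' J)))) + ennreal (2 * W * c / (1 - b)) * ?I) \<longlonglongrightarrow> ennreal (2 * W * c / (1 - b)) * ?I"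
   by simp
  show "\<exists>N. \<forall>J'\<ge>N. (\<integral>\<^sup>+x\<in>D J. ennreal ((norm (Du x))^2 * ht n a x powr \<alpha>) \<partial>lborel) <= ennreal (2 * W * (real p * (Q powr (- \<alpha>) * \<Phi> (Q * L' J')))) + ennreal (2 * W * c / (1 - b)) * ?I"
  proof (intro exI[of _ J] allI impI)
   fix J' assume "J <= J'"
   hence "(\<integral>\<^sup>+x\<in>D J. ennreal ((norm (Du x))^2 * ht n a x powr \<alpha>) \<partial>lborel) <= (\<integral>\<^sup>+x\<in>D J'. ennreal ((norm (Du x))^2 * ht n a x powr \<alpha>) \<partial>lborel)"
    using D_mono by (intro nn_integral_mono) (auto split: split_indicator)
   also note bound[of J']
   finally show "(\<integral>\<^sup>+x\<in>D J. ennreal ((norm (Du x))^2 * ht n a x powr \<alpha>) \<partial>lborel) <= ennreal (2 * W * (real p * (Q powr (- \<alpha>) * \<Phi> (Q * L' J')))) + ennreal (2 * W * c / (1 - b)) * ?I" .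
  qed
 qed
 have mDJ: "(\<lambda>x. ennreal ((norm (Du x))^2 * ht n a x powr \<alpha>) * indicator (D J) x) \<in> borel_measurable lborel" for J
  unfolding D_def by measurable
 have pw: "ennreal ((norm (Du x))^2 * ht n a x powr \<alpha>) * indicator (halfspace n a) x <= (SUP J. ennreal ((norm (Du x))^2 * ht n a x powr \<alpha>) * indicator (D J) x)" for x
 proof (cases "0 < ht n a x")
  case True
  have pos: "0 < r0 * 2^w / 2^p" using r0 by simp
  obtain j1 where j1: "max (ht n a x) (dist x x0) / (r0 * 2^w / 2^p) < 2^j1" using real_arch_pow[of 2] by auto
  obtain j2 where j2: "r0 / (2^p * ht n a x) < 2^j2" using real_arch_pow[of 2] by auto
  define J where "J = max j1 j2"
  have "(2::real)^j1 <= 2^J" "(2::real)^j2 <= 2^J" by (auto simp: J_def intro: power_increasing)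
  hence "max (ht n a x) (dist x x0) / (r0 * 2^w / 2^p) < 2^J" "r0 / (2^p * ht n a x) <= 2^J" using j1 j2 by linarith+
  hence "max (ht n a x) (dist x x0) < 2^J * (r0 * 2^w / 2^p)" "r0 <= 2^J * (2^p * ht n a x)" using pos True
   by (simp_all only: pos_divide_less_eq pos_divide_le_eq mult_pos_pos zero_less_power zero_less_numeral)
  hence "max (ht n a x) (dist x x0) < L' J" "\<rho> J <= ht n a x" unfolding L'e \<rho>_def by (simp_all add: mult_ac pos_divide_le_eq power_add)
  hence "x \<in> D J" by (simp add: D_def)
  thus ?thesis by (intro SUP_upper2[of J]) (auto split: split_indicator)
 qed (simp add: halfspace_ht)
 have "(\<integral>\<^sup>+x\<in>halfspace n a. ennreal ((norm (Du x))^2 * ht n a x powr \<alpha>) \<partial>lborel)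
  <= (\<integral>\<^sup>+x. (SUP J. ennreal ((norm (Du x))^2 * ht n a x powr \<alpha>) * indicator (D J) x) \<partial>lborel)"
  by (rule nn_integral_mono) (rule pw)
 also have "... = (SUP J. \<integral>\<^sup>+x\<in>D J. ennreal ((norm (Du x))^2 * ht n a x powr \<alpha>) \<partial>lborel)"
 proof (rule nn_integral_monotone_convergence_SUP[OF _ mDJ])
  show "incseq (\<lambda>J x. ennreal ((norm (Du x))^2 * ht n a x powr \<alpha>) * indicator (D J) x)"
   by (intro incseq_SucI le_funI) (use D_mono[OF le_SucI[OF order_refl]] in \<open>auto split: split_indicator\<close>)
 qed
 also have "... <= ennreal (2 * W * c / (1 - b)) * ?I" by (rule SUP_least) (rule DI)
 finally show ?thesis unfolding W_def c_def B_def b_def .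
qed

section \<open>Choice of the ratio of scales and of the constant\<close>

theorem theorem4p7:
  fixes \<mu> \<alpha> \<sigma> M :: real
  assumes "0 < \<mu>" and "-1 < \<alpha>" and "\<alpha> < 0" and "0 < \<sigma>" and "\<sigma> < 1"
  shows "\<exists>C>0. \<forall>(A :: ('d::finite, 'm::finite) coeff) (a :: real) (n :: real^'d)
            (u :: real^'d \<Rightarrow> real^'m) (Du :: real^'d \<Rightarrow> real^'d^'m) (f :: real^'d \<Rightarrow> real^'d^'m) x0.
      elliptic \<mu> A \<and> periodic_coeff A \<and> holder_norm \<sigma> A \<le> ereal M \<and>
      norm n = 1 \<and> x0 \<in> frontier (halfspace n a) \<and>
      H1_loc (halfspace n a) u Du \<and> L2_loc_upto (halfspace n a) Du \<and> L2_loc_upto (halfspace n a) f \<and>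
      weak_neumann A (halfspace n a) Du f \<and>
      ((\<lambda>R. R powr \<alpha> * (LINT x:(ball x0 R \<inter> halfspace n a)|lborel. (norm (Du x))^2)) \<longlongrightarrow> 0) at_top
      \<longrightarrow>
      (\<integral>\<^sup>+ x\<in>halfspace n a. ennreal ((norm (Du x))^2 * \<bar>a + x \<bullet> n\<bar> powr \<alpha>) \<partial>lborel)
        \<le> ennreal C * (\<integral>\<^sup>+ x\<in>halfspace n a. ennreal ((norm (f x))^2 * \<bar>a + x \<bullet> n\<bar> powr \<alpha>) \<partial>lborel)"
proof (cases "0 <= M")
 case False
 \<comment> \<open>A Hoelder norm is never bounded by a negative number, so the claim is vacuous and
   any positive constant will do.\<close>
 hence "\<not> holder_norm \<sigma> A <= ereal M" for A :: "('d, 'm) coeff" using holder_norm_bounds(3) by blast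
 thus ?thesis by (intro exI[of _ 1]) simp
next
 case M: True
 from decay_step_weak[OF assms(1) M assms(4), where 'd='d and 'm='m] show ?thesis
 proof (elim exE conjE, goal_cases)
 case (1 Cd K1)
 note Cd = 1(1,2) and DS = 1(3)
 \<comment> \<open>With \<open>\<theta> = 1/2^p\<close>, the coefficient to be absorbed is
   \<open>Cd * \<theta> * \<theta> powr \<alpha>\<close>, that is, \<open>Cd * q^p\<close>;
   \<open>q < 1\<close> expresses \<open>\<alpha> > -1\<close>.\<close>
 define q where "q = 2 powr (- (1 + \<alpha>))"
 have q: "0 < q" "q < 1" using assms(2) by (auto simp: q_def powr_less_one)
 obtain k where k: "q^k < 1 / (4 * Cd)" using real_arch_pow_inv[of "1 / (4 * Cd)" q] q Cd by auto
 \<comment> \<open>The summand 3 ensures \<open>1/2^p <= 1/8\<close>, as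
   \<open>decay_step_weak\<close> requires of \<open>\<theta>\<close>.\<close>
 define p where "p = k + 3"
 have p: "1 <= p" by (simp add: p_def)
 have small: "Cd * (1/2^p) * (2^p) powr (- \<alpha>) <= 1/4"
 proof -
  have "(1/2^p) * (2^p) powr (- \<alpha>) = (2^p) powr (-1) * (2^p) powr (- \<alpha>)" by (simp add: powr_minus divide_inverse)
  also have "... = (2^p) powr (- (1 + \<alpha>))" unfolding powr_add[symmetric] by simp
  also have "... = q^p" by (simp add: q_def powr_realpow[symmetric] powr_powr mult.commute)
  also have "... <= q^k" using q by (intro power_decreasing) (auto simp: p_def)
  finally have "Cd * ((1/2^p) * (2^p) powr (- \<alpha>)) <= Cd * (1 / (4 * Cd))" using k Cd by (intro mult_left_mono) auto
  thus ?thesis using Cd by (simp only: mult.assoc) simp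
 qed
 have th: "0 < 1/(2::real)^p" "1/(2::real)^p <= 1/8"
  using power_increasing[of 3 p "2::real"] by (auto simp: p_def divide_left_mono)
 from DS[rule_format, OF th] show ?case
 proof (elim exE conjE, goal_cases)
 case (1 C2 r0 R0)
 note C2 = 1(1) and r0 = 1(2) and R0 = 1(3) and DE = 1(4)
 \<comment> \<open>The number of dyadic scales between \<open>r0\<close> and \<open>R0\<close>. It
   is fixed before the coefficients and the solution are introduced, and so is the constant built
   from it.\<close>
 obtain w where w: "R0 / r0 < 2^w" using real_arch_pow[of 2] by auto
 hence w': "R0 <= r0 * 2^w" using r0 by (simp add: pos_divide_less_eq mult.commute)
 define C where "C = 2 * (20 * (real w * 2^w) + 24) * (C2 * (2^p) powr (- \<alpha>)) / (1 - 2 powr \<alpha>)"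
 have C: "0 < C" using C2 assms(3) by (auto simp: C_def powr_less_one intro!: divide_pos_pos mult_pos_pos add_nonneg_pos)
 show ?thesis
 proof (rule exI[of _ C], intro conjI C allI impI)
  fix A :: "('d, 'm) coeff" and a :: real and n :: "real^'d" and u :: "real^'d => real^'m" and Du f :: "real^'d => real^'d^'m" and x0
  assume H: "elliptic \<mu> A \<and> periodic_coeff A \<and> holder_norm \<sigma> A <= ereal M \<and>
   norm n = 1 \<and> x0 \<in> frontier (halfspace n a) \<and>
   H1_loc (halfspace n a) u Du \<and> L2_loc_upto (halfspace n a) Du \<and> L2_loc_upto (halfspace n a) f \<and>
   weak_neumann A (halfspace n a) Du f \<and>
   ((\<lambda>R. R powr \<alpha> * (LINT x:(ball x0 R \<inter> halfspace n a)|lborel. (norm (Du x))^2)) \<longlongrightarrow> 0) at_top"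
  hence ell: "elliptic \<mu> A" and per: "periodic_coeff A" and hol: "holder_norm \<sigma> A <= ereal M" and n: "norm n = 1"
   and fr: "x0 \<in> frontier (halfspace n a)" and H1: "H1_loc (halfspace n a) u Du" and L: "L2_loc_upto (halfspace n a) Du"
   and f: "L2_loc_upto (halfspace n a) f" and wk: "weak_neumann A (halfspace n a) Du f"
   and gr: "((\<lambda>R. R powr \<alpha> * (LINT x:(ball x0 R \<inter> halfspace n a)|lborel. (norm (Du x))^2)) \<longlongrightarrow> 0) at_top"
   by - (elim conjE, assumption)+
  have h: "halfspace n a = {x. n \<bullet> x < - a}" by (simp add: halfspace_def inner_commute)
  have "n \<noteq> 0" using n by auto
  hence "n \<bullet> x0 = - a" using fr unfolding h by (simp add: frontier_halfspace_lt)
  hence x0: "ht n a x0 = 0" by (simp add: ht_def inner_commute)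
  have mD[measurable]: "Du \<in> borel_measurable borel" using L by (simp add: L2_loc_upto_def)
  have mO[measurable]: "halfspace n a \<in> sets borel" unfolding halfspace_ht by measurable
  have "(LINT x:(ball x0 R \<inter> halfspace n a)|lborel. (norm (Du x))^2) = enn2real (energy (halfspace n a \<inter> ball x0 R) Du)" for R
  proof -
   have mS[measurable]: "ball x0 R \<inter> halfspace n a \<in> sets borel" by (intro sets.Int mO) simp
   have "(LINT x:(ball x0 R \<inter> halfspace n a)|lborel. (norm (Du x))^2)
    = enn2real (\<integral>\<^sup>+x. ennreal (indicat_real (ball x0 R \<inter> halfspace n a) x *\<^sub>R (norm (Du x))^2) \<partial>lborel)"
    unfolding set_lebesgue_integral_def
   proof (rule integral_eq_nn_integral)
    show "(\<lambda>x. indicat_real (ball x0 R \<inter> halfspace n a) x *\<^sub>R (norm (Du x))^2) \<in> borel_measurable lborel" by measurable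
   qed simp
   also have "(\<integral>\<^sup>+x. ennreal (indicat_real (ball x0 R \<inter> halfspace n a) x *\<^sub>R (norm (Du x))^2) \<partial>lborel) = energy (halfspace n a \<inter> ball x0 R) Du"
    unfolding energy_def by (intro nn_integral_cong) (auto split: split_indicator)
   finally show ?thesis .
  qed
  with gr have growth: "((\<lambda>R. R powr \<alpha> * enn2real (energy (halfspace n a \<inter> ball x0 R) Du)) \<longlongrightarrow> 0) at_top" by simp
  have est: "(\<integral>\<^sup>+x\<in>halfspace n a. ennreal ((norm (Du x))^2 * ht n a x powr \<alpha>) \<partial>lborel)
   <= ennreal C * (\<integral>\<^sup>+x\<in>halfspace n a. ennreal ((norm (f x))^2 * ht n a x powr \<alpha>) \<partial>lborel)"
   unfolding C_def
  proof (rule weighted_estimate[OF assms(2,3) L f p _ _ _ r0 w' small _ growth])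
   show "0 <= Cd" "0 <= C2" "0 <= K1" using Cd C2 by auto
   fix R T :: real assume "0 < R" "0 <= T" "R <= r0 \<or> R0 <= R"
   thus "energy (slab n a x0 (1/2^p*R) T) Du <= ennreal (1/4) * energy (slab n a x0 (2*(1/2^p*R)) (T+R)) Du
   + ennreal (Cd * (1/2^p)) * energy (slab n a x0 R (T+K1*R)) Du + ennreal C2 * energy (slab n a x0 R (T+K1*R)) f"
    by (rule DE[rule_format, OF n x0 coefs_of_holder[OF assms(4) ell hol] per H1 L f wk])
  qed
  have d: "(\<integral>\<^sup>+x\<in>halfspace n a. ennreal ((norm (h x))^2 * \<bar>a + x \<bullet> n\<bar> powr \<alpha>) \<partial>lborel)
   = (\<integral>\<^sup>+x\<in>halfspace n a. ennreal ((norm (h x))^2 * ht n a x powr \<alpha>) \<partial>lborel)" for h :: "real^'d => real^'d^'m"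
  proof (rule nn_integral_cong)
   fix x
   have "\<bar>a + x \<bullet> n\<bar> = ht n a x" if "x \<in> halfspace n a" using that by (simp add: halfspace_def ht_def)
   thus "ennreal ((norm (h x))^2 * \<bar>a + x \<bullet> n\<bar> powr \<alpha>) * indicator (halfspace n a) x
    = ennreal ((norm (h x))^2 * ht n a x powr \<alpha>) * indicator (halfspace n a) x" by (auto split: split_indicator)
  qed
  show "(\<integral>\<^sup>+ x\<in>halfspace n a. ennreal ((norm (Du x))^2 * \<bar>a + x \<bullet> n\<bar> powr \<alpha>) \<partial>lborel)
    <= ennreal C * (\<integral>\<^sup>+ x\<in>halfspace n a. ennreal ((norm (f x))^2 * \<bar>a + x \<bullet> n\<bar> powr \<alpha>) \<partial>lborel)"
   unfolding d by (rule est)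
 qed
qed
qed
qed

end
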